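(* Let $A$ be a left finite $\mathbb{N}$-graded ring generated in degree $1$ with $A_0$ noetherian semiperfect, and let $J$ be its graded Jacobson radical. (1) Let $M$ be a left finite bounded below graded $A$-module. Then $M$ is quasi-Koszul if and only if, for every $n>0$, $$\underline{\mathrm{Ext}}_A^1(A/J,A/J)\cdot \underline{\mathrm{Ext}}_A^{n-1}(M,A/J)=\underline{\mathrm{Ext}}^n_A(M,A/J).$$ (2) $A$ is a quasi-Koszul ring if and only if the graded ring $\underline{\mathrm{Ext}}_A^{\bullet}(A/J,A/J)$ is generated by $\underline{\mathrm{Ext}}^1_A(A/J,A/J)$ over $\underline{\mathrm{Hom}}_A(A/J,A/J)$ (i.e. it is generated in degree $1$ for the homological grading).
   Context: Modules are left modules; "noetherian" means left noetherian. For an $\mathbb{N}$-graded ring $A=\bigoplus_{i\ge 0}A_i$: the graded Jacobson radical is $J=J(A_0)\oplus A_{\geqslant 1}$, where $J(A_0)$ is the Jacobson radical of $A_0$. $A$ is left finite if each $A_i$ is a finitely generated left $A_0$-module; a graded $A$-module $M$ is left finite if each $M_i$ is a finitely generated $A_0$-module, and bounded below if $M_i=0$ for $i\ll 0$. $A$ is generated in degree $1$ if $A_iA_j=A_{i+j}$ for all $i,j\ge 0$. A graded projective resolution $\cdots\to P_1\xrightarrow{d_1}P_0\xrightarrow{d_0}M\to 0$ is minimal if $\mathrm{Im}\, d_{i+1}\subseteq JP_i$ for all $i\ge 0$. (Under the hypotheses on $A$, every left finite bounded below graded module has one.) A graded $A$-module $M$ with a minimal graded projective resolution $P_\bullet\to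 M\to 0$ is quasi-Koszul if $J\,\mathrm{Ker}\, d_n=\mathrm{Ker}\, d_n\cap J^2P_n$ for all $n\geqslant 0$. The ring $A$ is quasi-Koszul if $A/J$ is quasi-Koszul as a graded $A$-module. For graded modules $X,Y$, $\underline{\mathrm{Hom}}_A(X,Y)=\bigoplus_{n\in\mathbb{Z}}\mathrm{Hom}_{\mathrm{Gr}}(X,Y(n))$, where $\mathrm{Hom}_{\mathrm{Gr}}$ denotes degree-preserving homomorphisms and $Y(n)_i=Y_{i+n}$; $\underline{\mathrm{Ext}}^i_A$ are its derived functors and $\underline{\mathrm{Ext}}^\bullet_A=\bigoplus_{i\ge0}\underline{\mathrm{Ext}}^i_A$. The dot is the Yoneda product $\underline{\mathrm{Ext}}^j_A(Y,Z)\times\underline{\mathrm{Ext}}^i_A(X,Y)\to\underline{\mathrm{Ext}}^{i+j}_A(X,Z)$; a product of two Ext groups means the set of finite sums of products of elements. *)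

theory Defs
  imports "HOL-Algebra.Generated_Rings" "HOL-Algebra.QuotRing" "HOL-Algebra.Module"
begin

section \<open>Finite sums, left modules, left ideals\<close>

definition finite_sums :: "('a, 'b) monoid_scheme \<Rightarrow> 'a set \<Rightarrow> 'a set"
  where "finite_sums G S =
    {x. \<exists>(n::nat) s. s \<in> {..<n} \<rightarrow> S \<and> x = finprod G s {..<n}}"

text \<open>The library locale \<^locale>\<open>module\<close> requires a commutative ring; its record type is
  reused here for left modules over an arbitrary ring. The fields \<open>mult\<close> and \<open>one\<close>
  that this record inherits from rings play no role for modules.\<close>

locale left_module = R?: ring R + M?: abelian_group M
  for R :: "('a, 'b) ring_scheme" (structure) and M :: "('a, 'm, 'c) module_scheme" (structure) +
  assumes smult_closed:
      "\<lbrakk>a \<in> carrier R; x \<in> carrier M\<rbrakk> \<Longrightarrow> a \<odot>\<^bsub>M\<^esub> x \<in> carrier M"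
    and smult_l_distr:
      "\<lbrakk>a \<in> carrier R; b \<in> carrier R; x \<in> carrier M\<rbrakk> \<Longrightarrow>
        (a \<oplus>\<^bsub>R\<^esub> b) \<odot>\<^bsub>M\<^esub> x = a \<odot>\<^bsub>M\<^esub> x \<oplus>\<^bsub>M\<^esub> b \<odot>\<^bsub>M\<^esub> x"
    and smult_r_distr:
      "\<lbrakk>a \<in> carrier R; x \<in> carrier M; y \<in> carrier M\<rbrakk> \<Longrightarrow>
        a \<odot>\<^bsub>M\<^esub> (x \<oplus>\<^bsub>M\<^esub> y) = a \<odot>\<^bsub>M\<^esub> x \<oplus>\<^bsub>M\<^esub> a \<odot>\<^bsub>M\<^esub> y"
    and smult_assoc:
      "\<lbrakk>a \<in> carrier R; b \<in> carrier R; x \<in> carrier M\<rbrakk> \<Longrightarrow>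
        (a \<otimes>\<^bsub>R\<^esub> b) \<odot>\<^bsub>M\<^esub> x = a \<odot>\<^bsub>M\<^esub> (b \<odot>\<^bsub>M\<^esub> x)"
    and smult_one: "x \<in> carrier M \<Longrightarrow> \<one>\<^bsub>R\<^esub> \<odot>\<^bsub>M\<^esub> x = x"

definition reg_module :: "('a, 'b) ring_scheme \<Rightarrow> ('a, 'a) module"
  where "reg_module R =
    \<lparr>carrier = carrier R, monoid.mult = monoid.mult R, one = one R, ring.zero = \<zero>\<^bsub>R\<^esub>, ring.add = ring.add R,
     module.smult = monoid.mult R\<rparr>"

abbreviation left_ideal :: "'a set \<Rightarrow> ('a, 'b) ring_scheme \<Rightarrow> bool"
  where "left_ideal I R \<equiv> submodule I R (reg_module R)"

definition fin_gen_submodule ::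
    "('a, 'b) ring_scheme \<Rightarrow> ('a, 'm, 'c) module_scheme \<Rightarrow> 'm set \<Rightarrow> bool"
  where "fin_gen_submodule R M N \<longleftrightarrow>
    (\<exists>S. finite S \<and> S \<subseteq> N \<and> N = \<Inter>{K. submodule K R M \<and> S \<subseteq> K})"

definition act_prod :: "('a, 'm, 'c) module_scheme \<Rightarrow> 'a set \<Rightarrow> 'm set \<Rightarrow> 'm set"
  where "act_prod M I N = finite_sums (add_monoid M) {a \<odot>\<^bsub>M\<^esub> x | a x. a \<in> I \<and> x \<in> N}"

definition set_prod :: "('a, 'b) ring_scheme \<Rightarrow> 'a set \<Rightarrow> 'a set \<Rightarrow> 'a set"
  where "set_prod R I K = finite_sums (add_monoid R) {a \<otimes>\<^bsub>R\<^esub> b | a b. a \<in> I \<and> b \<in> K}"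


section \<open>Noetherian and semiperfect rings\<close>

definition left_noetherian :: "('a, 'b) ring_scheme \<Rightarrow> bool"
  where "left_noetherian R \<longleftrightarrow>
    ring R \<and> (\<forall>I. left_ideal I R \<longrightarrow> fin_gen_submodule R (reg_module R) I)"

definition maximal_left_ideal :: "'a set \<Rightarrow> ('a, 'b) ring_scheme \<Rightarrow> bool"
  where "maximal_left_ideal I R \<longleftrightarrow>
    left_ideal I R \<and> I \<noteq> carrier R \<and>
    (\<forall>K. left_ideal K R \<and> I \<subseteq> K \<longrightarrow> K = I \<or> K = carrier R)"

definition jacobson_radical :: "('a, 'b) ring_scheme \<Rightarrow> 'a set"
  where "jacobson_radical R = carrier R \<inter> \<Inter>{I. maximal_left_ideal I R}"

definition semisimple_ring :: "('a, 'b) ring_scheme \<Rightarrow> bool"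
  where "semisimple_ring R \<longleftrightarrow>
    ring R \<and>
    (\<forall>I. left_ideal I R \<longrightarrow>
      (\<exists>K. left_ideal K R \<and> I \<inter> K = {\<zero>\<^bsub>R\<^esub>} \<and> I <+>\<^bsub>R\<^esub> K = carrier R))"

definition idempotents_lift :: "('a, 'b) ring_scheme \<Rightarrow> 'a set \<Rightarrow> bool"
  where "idempotents_lift R I \<longleftrightarrow>
    (\<forall>x\<in>carrier R. x \<otimes>\<^bsub>R\<^esub> x \<ominus>\<^bsub>R\<^esub> x \<in> I \<longrightarrow>
      (\<exists>e\<in>carrier R. e \<otimes>\<^bsub>R\<^esub> e = e \<and> e \<ominus>\<^bsub>R\<^esub> x \<in> I))"

definition semiperfect_ring :: "('a, 'b) ring_scheme \<Rightarrow> bool"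
  where "semiperfect_ring R \<longleftrightarrow>
    ring R \<and> semisimple_ring (R Quot jacobson_radical R) \<and>
    idempotents_lift R (jacobson_radical R)"


section \<open>Graded rings and graded modules\<close>

record 'a graded_ring = "'a ring" +
  rdeg :: "nat \<Rightarrow> 'a set"

record ('a, 'm) graded_module = "('a, 'm) module" +
  mdeg :: "int \<Rightarrow> 'm set"

definition internal_direct_sum :: "('a, 'b) ring_scheme \<Rightarrow> ('i \<Rightarrow> 'a set) \<Rightarrow> bool"
  where "internal_direct_sum G V \<longleftrightarrow>
    (\<forall>i. additive_subgroup (V i) G) \<and>
    (\<forall>x\<in>carrier G. \<exists>!c. (\<forall>i. c i \<in> V i) \<and> finite {i. c i \<noteq> \<zero>\<^bsub>G\<^esub>} \<and>
      x = (\<Oplus>\<^bsub>G\<^esub> i\<in>{i. c i \<noteq> \<zero>\<^bsub>G\<^esub>}. c i))"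

locale graded_ring = ring A for A :: "'a graded_ring" (structure) +
  assumes ring_direct_sum: "internal_direct_sum A (rdeg A)"
    and one_degree: "\<one> \<in> rdeg A 0"
    and mult_degree: "\<lbrakk>a \<in> rdeg A i; b \<in> rdeg A j\<rbrakk> \<Longrightarrow> a \<otimes> b \<in> rdeg A (i + j)"

locale graded_module = graded_ring A + left_module A M
  for A :: "'a graded_ring" (structure) and M :: "('a, 'm) graded_module" (structure) +
  assumes module_direct_sum: "internal_direct_sum M (mdeg M)"
    and smult_degree:
      "\<lbrakk>a \<in> rdeg A i; x \<in> mdeg M k\<rbrakk> \<Longrightarrow> a \<odot>\<^bsub>M\<^esub> x \<in> mdeg M (int i + k)"

definition degree_zero :: "'a graded_ring \<Rightarrow> 'a graded_ring"
  where "degree_zero A = A\<lparr>carrier := rdeg A 0\<rparr>"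

definition generated_in_degree_one :: "'a graded_ring \<Rightarrow> bool"
  where "generated_in_degree_one A \<longleftrightarrow>
    (\<forall>i j. set_prod A (rdeg A i) (rdeg A j) = rdeg A (i + j))"

definition left_finite_ring :: "'a graded_ring \<Rightarrow> bool"
  where "left_finite_ring A \<longleftrightarrow>
    (\<forall>i. fin_gen_submodule (degree_zero A) (reg_module A) (rdeg A i))"

definition left_finite :: "'a graded_ring \<Rightarrow> ('a, 'm) graded_module \<Rightarrow> bool"
  where "left_finite A M \<longleftrightarrow> (\<forall>i. fin_gen_submodule (degree_zero A) M (mdeg M i))"

definition bounded_below :: "('a, 'm) graded_module \<Rightarrow> bool"
  where "bounded_below M \<longleftrightarrow> (\<exists>b. \<forall>i<b. mdeg M i = {\<zero>\<^bsub>M\<^esub>})"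

definition positive_part :: "'a graded_ring \<Rightarrow> 'a set"
  where "positive_part A = finite_sums (add_monoid A) (\<Union>i\<in>{1..}. rdeg A i)"

definition graded_radical :: "'a graded_ring \<Rightarrow> 'a set"
  where "graded_radical A = jacobson_radical (degree_zero A) <+>\<^bsub>A\<^esub> positive_part A"

definition graded_reg_module :: "'a graded_ring \<Rightarrow> ('a, 'a) graded_module"
  where "graded_reg_module A =
    \<lparr>carrier = carrier A, monoid.mult = monoid.mult A, one = one A, ring.zero = \<zero>\<^bsub>A\<^esub>, ring.add = ring.add A,
     module.smult = monoid.mult A, mdeg = (\<lambda>i. if i < 0 then {\<zero>\<^bsub>A\<^esub>} else rdeg A (nat i))\<rparr>"

definition graded_quot ::
    "('a, 'm) graded_module \<Rightarrow> 'm set \<Rightarrow> ('a, 'm set) graded_module"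
  where "graded_quot M N =
    \<lparr>carrier = a_rcosets\<^bsub>M\<^esub> N, monoid.mult = undefined, one = undefined, ring.zero = N,
     ring.add = set_add M,
     module.smult = (\<lambda>a X. \<Union>x\<in>X. N +>\<^bsub>M\<^esub> (a \<odot>\<^bsub>M\<^esub> x)),
     mdeg = (\<lambda>i. (\<lambda>x. N +>\<^bsub>M\<^esub> x) ` mdeg M i)\<rparr>"

definition mod_radical :: "'a graded_ring \<Rightarrow> ('a, 'a set) graded_module"
  where "mod_radical A = graded_quot (graded_reg_module A) (graded_radical A)"


section \<open>Graded homomorphisms\<close>

text \<open>Homomorphisms are extensional functions, so that equality of homomorphisms is equality
  of functions.\<close>

definition Hom_Gr ::
    "'a graded_ring \<Rightarrow> ('a, 'm) graded_module \<Rightarrow> ('a, 'n) graded_module \<Rightarrow> ('m \<Rightarrow> 'n) set"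
  where "Hom_Gr A X Y =
    {f \<in> carrier X \<rightarrow>\<^sub>E carrier Y.
      (\<forall>x\<in>carrier X. \<forall>y\<in>carrier X. f (x \<oplus>\<^bsub>X\<^esub> y) = f x \<oplus>\<^bsub>Y\<^esub> f y) \<and>
      (\<forall>a\<in>carrier A. \<forall>x\<in>carrier X. f (a \<odot>\<^bsub>X\<^esub> x) = a \<odot>\<^bsub>Y\<^esub> f x) \<and>
      (\<forall>i. f ` mdeg X i \<subseteq> mdeg Y i)}"

definition shift :: "('a, 'm) graded_module \<Rightarrow> int \<Rightarrow> ('a, 'm) graded_module"
  where "shift Y n = Y\<lparr>mdeg := (\<lambda>i. mdeg Y (i + n))\<rparr>"

text \<open>The direct sum of the groups of homomorphisms \<open>X \<rightarrow> Y(n)\<close> is formed inside the group of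
  all \<open>A\<close>-linear maps \<open>X \<rightarrow> Y\<close>: maps of pairwise different degrees whose sum
  vanishes are all zero, so the canonical map from the external direct sum is injective.\<close>

definition uHom ::
    "'a graded_ring \<Rightarrow> ('a, 'm) graded_module \<Rightarrow> ('a, 'n) graded_module \<Rightarrow> ('m \<Rightarrow> 'n) set"
  where "uHom A X Y =
    {f. \<exists>D h. finite D \<and> (\<forall>n\<in>D. h n \<in> Hom_Gr A X (shift Y n)) \<and>
      f = (\<lambda>x\<in>carrier X. \<Oplus>\<^bsub>Y\<^esub> n\<in>D. h n x)}"

definition uHom_group ::
    "'a graded_ring \<Rightarrow> ('a, 'm) graded_module \<Rightarrow> ('a, 'n) graded_module \<Rightarrow> ('m \<Rightarrow> 'n) monoid"
  where "uHom_group A X Y =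
    \<lparr>carrier = uHom A X Y,
     monoid.mult = (\<lambda>f g. \<lambda>x\<in>carrier X. f x \<oplus>\<^bsub>Y\<^esub> g x),
     one = (\<lambda>x\<in>carrier X. \<zero>\<^bsub>Y\<^esub>)\<rparr>"


section \<open>Graded projective resolutions\<close>

text \<open>The lifting property in the category of graded modules. A definition cannot quantify over
  the types of \<open>X\<close> and \<open>Y\<close>; the types chosen lose nothing, because they allow
  \<open>X\<close> to be the graded free module on the nonzero homogeneous elements of \<open>P\<close> and
  \<open>Y = P\<close>, so that \<open>P\<close> is a graded direct summand of a graded free module and
  lifts along surjections between graded modules of any types.\<close>

definition graded_projective :: "'a graded_ring \<Rightarrow> ('a, 'p) graded_module \<Rightarrow> bool"
  where "graded_projective A P \<longleftrightarrow>
    graded_module A P \<and>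
    (\<forall>(X :: ('a, 'p \<Rightarrow> 'a) graded_module) (Y :: ('a, 'p) graded_module) g f.
      graded_module A X \<and> graded_module A Y \<and>
      g \<in> Hom_Gr A X Y \<and> g ` carrier X = carrier Y \<and> f \<in> Hom_Gr A P Y \<longrightarrow>
      (\<exists>h\<in>Hom_Gr A P X. \<forall>x\<in>carrier P. g (h x) = f x))"

text \<open>\<open>res_diff P n\<close> is the differential from degree \<open>n\<close> to degree \<open>n - 1\<close> and is
  only relevant for \<open>n > 0\<close>; the map called \<open>d\<^sub>0\<close> has a different target type and is
  \<open>res_aug P\<close>.\<close>

record ('a, 'm, 'p) resolution =
  res_mod :: "nat \<Rightarrow> ('a, 'p) graded_module"
  res_diff :: "nat \<Rightarrow> 'p \<Rightarrow> 'p"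
  res_aug :: "'p \<Rightarrow> 'm"

definition res_ker :: "('a, 'm) graded_module \<Rightarrow> ('a, 'm, 'p) resolution \<Rightarrow> nat \<Rightarrow> 'p set"
  where "res_ker M P n =
    (case n of
       0 \<Rightarrow> {x \<in> carrier (res_mod P 0). res_aug P x = \<zero>\<^bsub>M\<^esub>}
     | Suc k \<Rightarrow> {x \<in> carrier (res_mod P n). res_diff P n x = \<zero>\<^bsub>res_mod P k\<^esub>})"

definition res_im :: "('a, 'm, 'p) resolution \<Rightarrow> nat \<Rightarrow> 'p set"
  where "res_im P n = res_diff P n ` carrier (res_mod P n)"

definition graded_projective_resolution ::
    "'a graded_ring \<Rightarrow> ('a, 'm) graded_module \<Rightarrow> ('a, 'm, 'p) resolution \<Rightarrow> bool"
  where "graded_projective_resolution A M P \<longleftrightarrow>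
    (\<forall>n. graded_projective A (res_mod P n)) \<and>
    (\<forall>n. res_diff P (Suc n) \<in> Hom_Gr A (res_mod P (Suc n)) (res_mod P n)) \<and>
    res_aug P \<in> Hom_Gr A (res_mod P 0) M \<and>
    res_aug P ` carrier (res_mod P 0) = carrier M \<and>
    (\<forall>n. res_im P (Suc n) = res_ker M P n)"

definition minimal_resolution ::
    "'a graded_ring \<Rightarrow> ('a, 'm) graded_module \<Rightarrow> ('a, 'm, 'p) resolution \<Rightarrow> bool"
  where "minimal_resolution A M P \<longleftrightarrow>
    graded_projective_resolution A M P \<and>
    (\<forall>i. res_im P (Suc i) \<subseteq>
      act_prod (res_mod P i) (graded_radical A) (carrier (res_mod P i)))"

text \<open>Resolutions of modules over \<open>'m\<close> are taken with terms over the following type. It is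
  large enough for every graded module: the index type \<open>'m \<times> 'a \<times> nat\<close> is infinite and
  dominates \<open>'m\<close> and \<open>'a\<close> in cardinality, so a graded free module (of finitely supported
  functions) on at most that many generators has at most that many elements, hence so does the
  next kernel to be covered.\<close>

type_synonym ('a, 'm) res_elem = "'m \<times> 'a \<times> nat \<Rightarrow> 'a"

definition quasi_Koszul :: "'a graded_ring \<Rightarrow> ('a, 'm) graded_module \<Rightarrow> bool"
  where "quasi_Koszul A M \<longleftrightarrow>
    (\<exists>P :: ('a, 'm, ('a, 'm) res_elem) resolution.
      minimal_resolution A M P \<and>
      (\<forall>n. act_prod (res_mod P n) (graded_radical A) (res_ker M P n) =
        res_ker M P n \<inter>
        act_prod (res_mod P n) (set_prod A (graded_radical A) (graded_radical A))
          (carrier (res_mod P n))))"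

definition quasi_Koszul_ring :: "'a graded_ring \<Rightarrow> bool"
  where "quasi_Koszul_ring A \<longleftrightarrow> quasi_Koszul A (mod_radical A)"


section \<open>Ext groups\<close>

text \<open>As usual for derived functors, a projective resolution of every module is fixed once and
  for all.\<close>

definition proj_res ::
    "'a graded_ring \<Rightarrow> ('a, 'm) graded_module \<Rightarrow> ('a, 'm, ('a, 'm) res_elem) resolution"
  where "proj_res A X = (SOME P. graded_projective_resolution A X P)"

abbreviation res_term ::
    "'a graded_ring \<Rightarrow> ('a, 'm) graded_module \<Rightarrow> nat \<Rightarrow> ('a, ('a, 'm) res_elem) graded_module"
  where "res_term A X n \<equiv> res_mod (proj_res A X) n"

definition cochains ::
    "'a graded_ring \<Rightarrow> nat \<Rightarrow> ('a, 'm) graded_module \<Rightarrow> ('a, 'n) graded_module \<Rightarrow>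
      (('a, 'm) res_elem \<Rightarrow> 'n) monoid"
  where "cochains A n X Y = uHom_group A (res_term A X n) Y"

definition cocycles ::
    "'a graded_ring \<Rightarrow> nat \<Rightarrow> ('a, 'm) graded_module \<Rightarrow> ('a, 'n) graded_module \<Rightarrow>
      (('a, 'm) res_elem \<Rightarrow> 'n) set"
  where "cocycles A n X Y =
    {f \<in> carrier (cochains A n X Y).
      \<forall>x\<in>carrier (res_term A X (Suc n)). f (res_diff (proj_res A X) (Suc n) x) = \<zero>\<^bsub>Y\<^esub>}"

definition coboundaries ::
    "'a graded_ring \<Rightarrow> nat \<Rightarrow> ('a, 'm) graded_module \<Rightarrow> ('a, 'n) graded_module \<Rightarrow>
      (('a, 'm) res_elem \<Rightarrow> 'n) set"
  where "coboundaries A n X Y =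
    (case n of
       0 \<Rightarrow> {\<one>\<^bsub>cochains A 0 X Y\<^esub>}
     | Suc k \<Rightarrow> (\<lambda>g. compose (carrier (res_term A X n)) g (res_diff (proj_res A X) n)) `
         carrier (cochains A k X Y))"

text \<open>The group operation of Ext is written multiplicatively, as for all library groups.\<close>

definition Ext ::
    "'a graded_ring \<Rightarrow> nat \<Rightarrow> ('a, 'm) graded_module \<Rightarrow> ('a, 'n) graded_module \<Rightarrow>
      (('a, 'm) res_elem \<Rightarrow> 'n) set monoid"
  where "Ext A n X Y =
    (cochains A n X Y)\<lparr>carrier := cocycles A n X Y\<rparr> Mod coboundaries A n X Y"

definition ext_class ::
    "'a graded_ring \<Rightarrow> nat \<Rightarrow> ('a, 'm) graded_module \<Rightarrow> ('a, 'n) graded_module \<Rightarrow>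
      (('a, 'm) res_elem \<Rightarrow> 'n) \<Rightarrow> (('a, 'm) res_elem \<Rightarrow> 'n) set"
  where "ext_class A n X Y f = coboundaries A n X Y #>\<^bsub>cochains A n X Y\<^esub> f"


section \<open>Yoneda products\<close>

text \<open>\<open>chain_lifts A i X Y f\<close> consists of the chain maps, from the resolution of \<open>X\<close>
  truncated at \<open>i\<close> to the resolution of \<open>Y\<close>, that cover the cocycle \<open>f\<close>.\<close>

definition chain_lifts ::
    "'a graded_ring \<Rightarrow> nat \<Rightarrow> ('a, 'm) graded_module \<Rightarrow> ('a, 'n) graded_module \<Rightarrow>
      (('a, 'm) res_elem \<Rightarrow> 'n) \<Rightarrow> (nat \<Rightarrow> ('a, 'm) res_elem \<Rightarrow> ('a, 'n) res_elem) set"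
  where "chain_lifts A i X Y f =
    {\<phi>. (\<forall>k. \<phi> k \<in> uHom A (res_term A X (i + k)) (res_term A Y k)) \<and>
      (\<forall>x\<in>carrier (res_term A X i). res_aug (proj_res A Y) (\<phi> 0 x) = f x) \<and>
      (\<forall>k. \<forall>x\<in>carrier (res_term A X (i + Suc k)).
        res_diff (proj_res A Y) (Suc k) (\<phi> (Suc k) x) =
        \<phi> k (res_diff (proj_res A X) (i + Suc k) x))}"

text \<open>\<open>yoneda A j i X Y Z \<alpha> \<beta>\<close> is the product of \<open>\<alpha>\<close> in the \<open>j\<close>-th Ext group of
  \<open>(Y, Z)\<close> and \<open>\<beta>\<close> in the \<open>i\<close>-th Ext group of \<open>(X, Y)\<close>. As for
  \<^const>\<open>rcoset_mult\<close>, the class is written as a union over all representatives (and all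
  lifts), which all give the same class.\<close>

definition yoneda ::
    "'a graded_ring \<Rightarrow> nat \<Rightarrow> nat \<Rightarrow>
      ('a, 'm) graded_module \<Rightarrow> ('a, 'n) graded_module \<Rightarrow> ('a, 'l) graded_module \<Rightarrow>
      (('a, 'n) res_elem \<Rightarrow> 'l) set \<Rightarrow> (('a, 'm) res_elem \<Rightarrow> 'n) set \<Rightarrow>
      (('a, 'm) res_elem \<Rightarrow> 'l) set"
  where "yoneda A j i X Y Z \<alpha> \<beta> =
    (\<Union>g\<in>\<alpha>. \<Union>f\<in>\<beta>. \<Union>\<phi>\<in>chain_lifts A i X Y f.
      ext_class A (i + j) X Z (compose (carrier (res_term A X (i + j))) g (\<phi> j)))"

definition Ext_product ::
    "'a graded_ring \<Rightarrow> nat \<Rightarrow> nat \<Rightarrow>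
      ('a, 'm) graded_module \<Rightarrow> ('a, 'n) graded_module \<Rightarrow> ('a, 'l) graded_module \<Rightarrow>
      (('a, 'm) res_elem \<Rightarrow> 'l) set set"
  where "Ext_product A j i X Y Z =
    finite_sums (Ext A (i + j) X Z)
      {yoneda A j i X Y Z \<alpha> \<beta> | \<alpha> \<beta>.
        \<alpha> \<in> carrier (Ext A j Y Z) \<and> \<beta> \<in> carrier (Ext A i X Y)}"


section \<open>The Ext ring\<close>

definition Ext_ring ::
    "'a graded_ring \<Rightarrow> ('a, 'm) graded_module \<Rightarrow> (nat \<Rightarrow> (('a, 'm) res_elem \<Rightarrow> 'm) set) ring"
  where "Ext_ring A X =
    \<lparr>carrier = {u. (\<forall>n. u n \<in> carrier (Ext A n X X)) \<and>
       finite {n. u n \<noteq> \<one>\<^bsub>Ext A n X X\<^esub>}},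
     monoid.mult = (\<lambda>u v n. finprod (Ext A n X X)
       (\<lambda>j. yoneda A j (n - j) X X X (u j) (v (n - j))) {..n}),
     one = (\<lambda>n. if n = 0 then ext_class A 0 X X (res_aug (proj_res A X))
       else \<one>\<^bsub>Ext A n X X\<^esub>),
     ring.zero = (\<lambda>n. \<one>\<^bsub>Ext A n X X\<^esub>),
     ring.add = (\<lambda>u v n. u n \<otimes>\<^bsub>Ext A n X X\<^esub> v n)\<rparr>"

definition in_degree ::
    "'a graded_ring \<Rightarrow> ('a, 'm) graded_module \<Rightarrow> nat \<Rightarrow> (('a, 'm) res_elem \<Rightarrow> 'm) set \<Rightarrow>
      nat \<Rightarrow> (('a, 'm) res_elem \<Rightarrow> 'm) set"
  where "in_degree A X n \<alpha> = (\<lambda>m. if m = n then \<alpha> else \<one>\<^bsub>Ext A m X X\<^esub>)"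

text \<open>Endomorphisms of \<open>X\<close> are elements of the Ext ring through the canonical isomorphism onto
  the Ext group of degree \<open>0\<close>, composition with the augmentation.\<close>

definition hom_to_Ext ::
    "'a graded_ring \<Rightarrow> ('a, 'm) graded_module \<Rightarrow> ('m \<Rightarrow> 'm) \<Rightarrow>
      nat \<Rightarrow> (('a, 'm) res_elem \<Rightarrow> 'm) set"
  where "hom_to_Ext A X h =
    in_degree A X 0
      (ext_class A 0 X X (compose (carrier (res_term A X 0)) h (res_aug (proj_res A X))))"

definition Ext_generated_in_degree_one ::
    "'a graded_ring \<Rightarrow> ('a, 'm) graded_module \<Rightarrow> bool"
  where "Ext_generated_in_degree_one A X \<longleftrightarrow>
    generate_ring (Ext_ring A X)
      (hom_to_Ext A X ` uHom A X X \<union> in_degree A X 1 ` carrier (Ext A 1 X X)) =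
    carrier (Ext_ring A X)"

end

(* Write S = A/J, a module concentrated in degree 0 and killed by J. For a resolution P of M with
   kernels K_n consider the condition that K_n \<inter> J^2 P_n lies in J K_n for all n. Comparing two
   resolutions by chain maps shows that it does not depend on P. Take P minimal, with P_n a direct sum
   of modules A e_k with finitely many generators in each degree.
   If the condition holds, a homogeneous cocycle P_(n+1) \<rightarrow> S is a map on K_n that kills
   K_n \<inter> J^2 P_n; as S is semisimple, it extends to a map on J P_n, and its restrictions to the summands
   J e_k write the cocycle as a sum of products of classes of degree 1 with the coordinate classes of P_n.
   Conversely, a product of a class of degree 1 vanishes at each y with d y in J^2 P_n, because
   J^2 Q_0 lies in J ker for the resolution Q of S; an element of K_n \<inter> J^2 P_n outside J K_n is
   detected by a cocycle that does not vanish there. For M = S, associativity of the Yoneda product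
   turns the condition on products into generation of the Ext ring in degree 1. *)

theory Submission
  imports Defs "HOL-Library.Countable"
begin

text \<open>Ext is computed from \<open>proj_res\<close>, an arbitrary resolution, while
  \<open>quasi_Koszul\<close> speaks of some minimal one, so cocycles and kernels are carried
  between resolutions by chain maps. The condition survives this because a homotopy error d h x with
  x in J^2 P_n lies in J^2 K_n; the inclusion of J K_n in J^2 P_n follows from minimality alone.

  Maps into S are never extended over A. A graded map N -> S of degree -d is an A_0-linear map on
  N_d that kills (J N)_d, and S is semisimple over A_0. As A_0 is noetherian, N_d is finitely
  generated in all cases needed, and maps are extended one generator at a time, the new value coming
  from a retraction of A_0 onto a left ideal modulo J(A_0). The same retractions, made idempotent by
  lifting, produce the projective covers.

  A decomposition into products must be a finite sum of maps. It is one because a functional of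
  degree m on J P_n sees only the summands A e_k whose generator has degree at most -m, and these
  are finitely many.\<close>

section \<open>Finite sums and direct sums\<close>

context comm_monoid begin

lemma finite_sums_one: "\<one> \<in> finite_sums G S"
  unfolding finite_sums_def by (auto intro!: exI[of _ "0::nat"])

lemma finite_sums_step:
  assumes "S \<subseteq> carrier G" "s \<in> S" "x \<in> finite_sums G S"
  shows "s \<otimes> x \<in> finite_sums G S"
proof -
  obtain n :: nat and t where t: "t \<in> {..<n} \<rightarrow> S" "x = finprod G t {..<n}"
    using assms(3) unfolding finite_sums_def by blast
  let ?t = "t(n := s)"
  have "finprod G ?t {..<Suc n} = s \<otimes> finprod G ?t {..<n}"
    unfolding lessThan_Suc using assms t by (subst finprod_insert) auto
  also have "finprod G ?t {..<n} = x"
    unfolding t(2) using assms t by (intro finprod_cong') auto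
  finally have "s \<otimes> x = finprod G ?t {..<Suc n}" by (rule sym)
  moreover have "?t \<in> {..<Suc n} \<rightarrow> S" using t assms by (auto simp: less_Suc_eq)
  ultimately show ?thesis unfolding finite_sums_def by blast
qed

text \<open>Peels off the summands one at a time, so that later proofs never mention the indexing
  function; the sums in \<open>act_prod\<close> and \<open>Ext_product\<close> are always treated
  through this rule.\<close>

lemma finite_sums_induct [consumes 2, case_names one step]:
  assumes "x \<in> finite_sums G S" "S \<subseteq> carrier G"
    and one: "P \<one>"
    and step: "\<And>s x. \<lbrakk>s \<in> S; x \<in> finite_sums G S; x \<in> carrier G; P x\<rbrakk> \<Longrightarrow> P (s \<otimes> x)"
  shows "P x"
proof -
  obtain n :: nat and t where t: "t \<in> {..<n} \<rightarrow> S" "x = finprod G t {..<n}"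
    using assms(1) unfolding finite_sums_def by blast
  have "finprod G t {..<n} \<in> finite_sums G S \<and> finprod G t {..<n} \<in> carrier G \<and> P (finprod G t {..<n})"
    using t(1)
  proof (induction n)
    case 0
    thus ?case using one finite_sums_one by simp
  next
    case (Suc n)
    have eq: "finprod G t {..<Suc n} = t n \<otimes> finprod G t {..<n}"
      unfolding lessThan_Suc using assms(2) Suc.prems by (subst finprod_insert) (auto simp: lessThan_Suc)
    have "t n \<in> S" using Suc.prems by auto
    moreover have "t \<in> {..<n} \<rightarrow> S" using Suc.prems by auto
    ultimately show ?case using Suc.IH assms(2) step[of "t n"] finite_sums_step unfolding eq by blast
  qed
  thus ?thesis using t(2) by simp
qed

lemma finite_sums_closed:
  assumes "S \<subseteq> carrier G" shows "finite_sums G S \<subseteq> carrier G"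
proof
  fix x assume "x \<in> finite_sums G S"
  from this assms show "x \<in> carrier G"
    by (induction rule: finite_sums_induct) (use assms in auto)
qed

lemma finite_sums_incl:
  assumes "S \<subseteq> carrier G" "s \<in> S" shows "s \<in> finite_sums G S"
  using finite_sums_step[OF assms finite_sums_one] assms by auto

lemma finite_sums_mult:
  assumes "S \<subseteq> carrier G" "x \<in> finite_sums G S" "y \<in> finite_sums G S"
  shows "x \<otimes> y \<in> finite_sums G S"
  using assms(2,1)
proof (induction rule: finite_sums_induct)
  case one
  show ?case using assms(3) finite_sums_closed[OF assms(1)] by auto
next
  case (step s x)
  have "s \<in> carrier G" "y \<in> carrier G" using step assms finite_sums_closed by auto
  thus ?case using step finite_sums_step[OF assms(1) step(1) step(4)] by (simp add: m_assoc)
qed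

end

text \<open>The homogeneous component of \<open>x\<close> in \<open>V i\<close>, read off from the
  unique family in \<open>internal_direct_sum\<close>; as a definite description it says something
  only for \<open>x\<close> in the carrier.\<close>

definition hcomp :: "('a, 'b) ring_scheme \<Rightarrow> ('i \<Rightarrow> 'a set) \<Rightarrow> 'i \<Rightarrow> 'a \<Rightarrow> 'a"
  where "hcomp G V i x = (THE c. (\<forall>i. c i \<in> V i) \<and> finite {i. c i \<noteq> \<zero>\<^bsub>G\<^esub>} \<and>
      x = (\<Oplus>\<^bsub>G\<^esub> i\<in>{i. c i \<noteq> \<zero>\<^bsub>G\<^esub>}. c i)) i"

lemma (in abelian_group) finsum_support:
  assumes "finite D" "{i. c i \<noteq> \<zero>} \<subseteq> D" "\<And>i. c i \<in> carrier G"
  shows "finsum G c {i. c i \<noteq> \<zero>} = finsum G c D"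
  using assms by (intro add.finprod_mono_neutral_cong_left) auto

locale direct_sum = abelian_group G for G (structure) +
  fixes V :: "'i \<Rightarrow> 'a set"
  assumes ids: "internal_direct_sum G V"
begin

lemma V_sub: "additive_subgroup (V i) G"
  using ids unfolding internal_direct_sum_def by blast

lemma V_zero: "\<zero> \<in> V i"
  and V_closed: "x \<in> V i \<Longrightarrow> x \<in> carrier G"
  and V_add: "\<lbrakk>x \<in> V i; y \<in> V i\<rbrakk> \<Longrightarrow> x \<oplus> y \<in> V i"
  using V_sub additive_subgroup.zero_closed additive_subgroup.a_Hcarr additive_subgroup.a_closed
  by fastforce+

lemma V_neg: "x \<in> V i \<Longrightarrow> \<ominus> x \<in> V i"
  using V_sub[of i] unfolding additive_subgroup_def a_inv_def
  by (simp add: subgroup.m_inv_closed)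

lemma hcomp_spec:
  assumes "x \<in> carrier G"
  shows "hcomp G V i x \<in> V i" "finite {i. hcomp G V i x \<noteq> \<zero>}"
    "x = (\<Oplus>i\<in>{i. hcomp G V i x \<noteq> \<zero>}. hcomp G V i x)"
proof -
  have "\<exists>!c. (\<forall>i. c i \<in> V i) \<and> finite {i. c i \<noteq> \<zero>} \<and>
      x = (\<Oplus>i\<in>{i. c i \<noteq> \<zero>}. c i)"
    using ids assms unfolding internal_direct_sum_def by blast
  note * = theI'[OF this, folded hcomp_def]
  have eq: "(\<lambda>i. hcomp G V i x) = (THE c. (\<forall>i. c i \<in> V i) \<and> finite {i. c i \<noteq> \<zero>} \<and>
      x = (\<Oplus>i\<in>{i. c i \<noteq> \<zero>}. c i))"
    unfolding hcomp_def by simp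
  show "hcomp G V i x \<in> V i" "finite {i. hcomp G V i x \<noteq> \<zero>}"
    "x = (\<Oplus>i\<in>{i. hcomp G V i x \<noteq> \<zero>}. hcomp G V i x)"
    using * unfolding eq[symmetric] by simp_all
qed

text \<open>Any finite index set that contains the support will do; this spares computing the exact
  support of a sum of two families.\<close>

lemma hcomp_unique:
  assumes "\<And>i. c i \<in> V i" "finite D" "{i. c i \<noteq> \<zero>} \<subseteq> D" "x = (\<Oplus>i\<in>D. c i)"
  shows "hcomp G V i x = c i"
proof -
  have x: "x \<in> carrier G" using assms(1,4) V_closed by (auto intro!: finsum_closed)
  have "\<exists>!c. (\<forall>i. c i \<in> V i) \<and> finite {i. c i \<noteq> \<zero>} \<and>
      x = (\<Oplus>i\<in>{i. c i \<noteq> \<zero>}. c i)"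
    using ids x unfolding internal_direct_sum_def by blast
  moreover have "(\<forall>i. c i \<in> V i) \<and> finite {i. c i \<noteq> \<zero>} \<and> x = (\<Oplus>i\<in>{i. c i \<noteq> \<zero>}. c i)"
    using assms(1,4) finsum_support[OF assms(2,3)] V_closed finite_subset[OF assms(3,2)] by metis
  ultimately have "(THE c. (\<forall>i. c i \<in> V i) \<and> finite {i. c i \<noteq> \<zero>} \<and>
      x = (\<Oplus>i\<in>{i. c i \<noteq> \<zero>}. c i)) = c"
    by (rule the1_equality[of "\<lambda>c. (\<forall>i. c i \<in> V i) \<and> finite {i. c i \<noteq> \<zero>} \<and> x = (\<Oplus>i\<in>{i. c i \<noteq> \<zero>}. c i)"])
  thus ?thesis unfolding hcomp_def by simp
qed

lemma hcomp_closed: "x \<in> carrier G \<Longrightarrow> hcomp G V i x \<in> carrier G"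
  using hcomp_spec(1) V_closed by blast

lemma hcomp_sum:
  assumes "x \<in> carrier G" "finite D" "{i. hcomp G V i x \<noteq> \<zero>} \<subseteq> D"
  shows "x = (\<Oplus>i\<in>D. hcomp G V i x)"
  using assms hcomp_spec(3)[OF assms(1)] finsum_support[of D "\<lambda>i. hcomp G V i x"] hcomp_closed by auto

lemma hcomp_add:
  assumes "x \<in> carrier G" "y \<in> carrier G"
  shows "hcomp G V i (x \<oplus> y) = hcomp G V i x \<oplus> hcomp G V i y"
proof (rule hcomp_unique)
  let ?D = "{i. hcomp G V i x \<noteq> \<zero>} \<union> {i. hcomp G V i y \<noteq> \<zero>}"
  show "hcomp G V i x \<oplus> hcomp G V i y \<in> V i" for i using assms hcomp_spec(1) V_add by blast
  show fin: "finite ?D" using assms hcomp_spec(2) by blast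
  show "{i. hcomp G V i x \<oplus> hcomp G V i y \<noteq> \<zero>} \<subseteq> ?D" by auto
  have "(\<Oplus>i\<in>?D. hcomp G V i x \<oplus> hcomp G V i y)
    = (\<Oplus>i\<in>?D. hcomp G V i x) \<oplus> (\<Oplus>i\<in>?D. hcomp G V i y)"
    using assms hcomp_closed by (intro finsum_addf) auto
  also have "\<dots> = x \<oplus> y" using hcomp_sum[OF _ fin] assms by auto
  finally show "x \<oplus> y = (\<Oplus>i\<in>?D. hcomp G V i x \<oplus> hcomp G V i y)" by simp
qed

lemma hcomp_hom:
  assumes "x \<in> V i" shows "hcomp G V j x = (if j = i then x else \<zero>)"
proof (rule hcomp_unique[of _ "{i}"])
  show "x = (\<Oplus>j\<in>{i}. if j = i then x else \<zero>)"
    using finsum_insert[of "{}" i "\<lambda>j. if j = i then x else \<zero>"] assms V_closed by (auto simp: finsum_empty)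
qed (use assms V_zero in auto)

lemma hcomp_zero [simp]: "hcomp G V i \<zero> = \<zero>"
  using hcomp_hom[OF V_zero, of i] by auto

lemma hcomp_neg: "x \<in> carrier G \<Longrightarrow> hcomp G V i (\<ominus> x) = \<ominus> hcomp G V i x"
  using hcomp_add[of x "\<ominus> x" i] hcomp_closed by (auto simp: r_neg intro: minus_equality[symmetric] simp: add.m_comm)

lemma hcomp_eq_zero: "x \<in> carrier G \<Longrightarrow> (\<And>i. hcomp G V i x = \<zero>) \<Longrightarrow> x = \<zero>"
  using hcomp_sum[of x "{}"] by simp

text \<open>The premise \<open>h = hcomp G V i x\<close> records that the pieces are components of
  \<open>x\<close> itself. It transfers a property known for the components of \<open>x\<close> to
  \<open>h\<close> when membership in a graded ideal or submodule has to be propagated.\<close>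

lemma homogeneous_induct [consumes 1, case_names zero step]:
  assumes "x \<in> carrier G"
    and zero: "P \<zero>"
    and step: "\<And>i h y. \<lbrakk>h \<in> V i; h \<in> carrier G; y \<in> carrier G; h = hcomp G V i x; P y\<rbrakk> \<Longrightarrow> P (h \<oplus> y)"
  shows "P x"
proof -
  let ?c = "\<lambda>i. hcomp G V i x"
  have "P (finsum G ?c D) \<and> finsum G ?c D \<in> carrier G" if "finite D" for D
    using that
  proof (induction D)
    case empty
    thus ?case using zero by simp
  next
    case (insert i D)
    have "finsum G ?c (insert i D) = ?c i \<oplus> finsum G ?c D"
      using insert hcomp_closed[OF assms(1)] by (intro finsum_insert) auto
    thus ?case using insert step[of "?c i" i] hcomp_spec(1)[OF assms(1)] hcomp_closed[OF assms(1)] by auto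
  qed
  thus ?thesis using hcomp_spec(2,3)[OF assms(1)] by metis
qed

end

text \<open>Constructs a grading from candidate projections \<open>c i\<close>: additive, the
  identity or zero on each \<open>V j\<close>, finitely supported and jointly injective. The
  gradings constructed below all arise in this way, and the second conclusion identifies their
  components.\<close>

lemma (in abelian_group) internal_direct_sumI:
  fixes V :: "'i \<Rightarrow> 'a set" and c :: "'i \<Rightarrow> 'a \<Rightarrow> 'a"
  assumes sub: "\<And>i. additive_subgroup (V i) G"
    and c_in: "\<And>i x. x \<in> carrier G \<Longrightarrow> c i x \<in> V i"
    and c_add: "\<And>i x y. \<lbrakk>x \<in> carrier G; y \<in> carrier G\<rbrakk> \<Longrightarrow> c i (x \<oplus> y) = c i x \<oplus> c i y"
    and c_hom: "\<And>i j x. x \<in> V i \<Longrightarrow> c j x = (if j = i then x else \<zero>)"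
    and c_fin: "\<And>x. x \<in> carrier G \<Longrightarrow> finite {i. c i x \<noteq> \<zero>}"
    and c_sep: "\<And>x. x \<in> carrier G \<Longrightarrow> (\<And>i. c i x = \<zero>) \<Longrightarrow> x = \<zero>"
  shows "internal_direct_sum G V"
    and "x \<in> carrier G \<Longrightarrow> hcomp G V i x = c i x"
proof -
  have Vc: "x \<in> V i \<Longrightarrow> x \<in> carrier G" for x i using sub additive_subgroup.a_Hcarr by fastforce
  have V0: "\<zero> \<in> V i" for i using sub additive_subgroup.zero_closed by fastforce
  have c0: "c i \<zero> = \<zero>" for i using c_hom[OF V0, of i i] by simp
  have cc: "x \<in> carrier G \<Longrightarrow> c i x \<in> carrier G" for x i using c_in Vc by blast
  have cneg: "c i (\<ominus> x) = \<ominus> c i x" if "x \<in> carrier G" for i x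
    using c_add[of x "\<ominus> x" i] that cc c0 by (auto simp: r_neg add.m_comm intro: minus_equality[symmetric])
  have csum: "c j (finsum G f D) = (if j \<in> D then f j else \<zero>)" if "finite D" "\<And>i. f i \<in> V i" for f j D
    using that(1)
  proof (induction D)
    case empty
    thus ?case using c0 by simp
  next
    case (insert i D)
    have fc: "f \<in> D \<rightarrow> carrier G" "f i \<in> carrier G" "finsum G f D \<in> carrier G"
      using that(2) Vc by (auto intro!: finsum_closed)
    hence "finsum G f (insert i D) = f i \<oplus> finsum G f D"
      using insert by (intro finsum_insert) auto
    hence "c j (finsum G f (insert i D)) = c j (f i) \<oplus> c j (finsum G f D)"
      using fc c_add by simp
    thus ?case using insert c_hom[OF that(2)[of i], of j] fc that(2) Vc[OF that(2)] by (auto simp del: Pi_split_insert_domain)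
  qed
  show ids: "internal_direct_sum G V"
    unfolding internal_direct_sum_def
  proof (intro conjI allI ballI sub)
    fix x assume x: "x \<in> carrier G"
    let ?D = "{i. c i x \<noteq> \<zero>}"
    let ?s = "\<Oplus>i\<in>?D. c i x"
    have sc: "?s \<in> carrier G" using cc x by (auto intro!: finsum_closed)
    \<comment> \<open>Existence: the difference between \<open>x\<close> and the sum of its
      projections has no component left.\<close>
    have "c j (x \<oplus> \<ominus> ?s) = \<zero>" for j
      using c_add[of x "\<ominus> ?s" j] cneg[OF sc, of j] csum[OF c_fin[OF x], of "\<lambda>i. c i x" j] x sc cc c_in
      by (auto simp: r_neg)
    hence "x \<oplus> \<ominus> ?s = \<zero>" using c_sep x sc by simp
    hence xs: "x = ?s" using x sc by (metis r_neg a_inv_closed add.inv_unique' minus_minus minus_equality)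
    show "\<exists>!c. (\<forall>i. c i \<in> V i) \<and> finite {i. c i \<noteq> \<zero>} \<and> x = (\<Oplus>i\<in>{i. c i \<noteq> \<zero>}. c i)"
    proof (rule ex1I[of _ "\<lambda>i. c i x"])
      show "(\<forall>i. c i x \<in> V i) \<and> finite {i. c i x \<noteq> \<zero>} \<and> x = ?s"
        using xs c_in c_fin x by blast
      fix b assume b: "(\<forall>i. b i \<in> V i) \<and> finite {i. b i \<noteq> \<zero>} \<and> x = (\<Oplus>i\<in>{i. b i \<noteq> \<zero>}. b i)"
      hence "c j x = b j" for j
        using csum[of "{i. b i \<noteq> \<zero>}" b j] by auto
      thus "b = (\<lambda>i. c i x)" by auto
    qed
  qed
  show "hcomp G V i x = c i x" if x: "x \<in> carrier G"
  proof -
    interpret direct_sum G V by (unfold_locales) (rule ids)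
    have "c i x = c i (\<Oplus>i\<in>{i. hcomp G V i x \<noteq> \<zero>}. hcomp G V i x)"
      using hcomp_spec(3)[OF x] by simp
    also have "\<dots> = hcomp G V i x"
      using csum[OF hcomp_spec(2)[OF x], of "\<lambda>i. hcomp G V i x" i] hcomp_spec(1)[OF x] by auto
    finally show ?thesis by simp
  qed
qed

section \<open>Graded modules and graded homomorphisms\<close>

abbreviation cp :: "('a, 'm) graded_module \<Rightarrow> int \<Rightarrow> 'm \<Rightarrow> 'm"
  where "cp M i x \<equiv> hcomp M (mdeg M) i x"

lemma abelian_group_cong:
  fixes H (structure)
  assumes "abelian_group G" "carrier G = carrier H" "\<And>x y. x \<oplus>\<^bsub>G\<^esub> y = x \<oplus> y" "\<zero>\<^bsub>G\<^esub> = \<zero>"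
  shows "abelian_group H"
proof -
  interpret G: abelian_group G by fact
  note eq = assms(2-4)[symmetric]
  show ?thesis
  proof (rule abelian_groupI)
    show "\<exists>y\<in>carrier H. y \<oplus> x = \<zero>" if "x \<in> carrier H" for x
      using that G.l_neg[of x] G.a_inv_closed[of x] unfolding eq by blast
  qed (simp_all add: eq G.a_ac)
qed

lemma (in abelian_group) add_subgroupI:
  assumes "H \<subseteq> carrier G" "\<zero> \<in> H" "\<And>x. x \<in> H \<Longrightarrow> \<ominus> x \<in> H" "\<And>x y. \<lbrakk>x \<in> H; y \<in> H\<rbrakk> \<Longrightarrow> x \<oplus> y \<in> H"
  shows "additive_subgroup H G"
  unfolding additive_subgroup_def by (rule add.subgroupI) (use assms in auto)

sublocale graded_module \<subseteq> direct_sum M "mdeg M"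
  by unfold_locales (rule module_direct_sum)

section \<open>Left modules, the submodules I N and linear maps\<close>

context left_module begin

lemma smult_zero_left [simp]: "x \<in> carrier M \<Longrightarrow> \<zero>\<^bsub>R\<^esub> \<odot>\<^bsub>M\<^esub> x = \<zero>\<^bsub>M\<^esub>"
  using smult_l_distr[of "\<zero>\<^bsub>R\<^esub>" "\<zero>\<^bsub>R\<^esub>" x] smult_closed[of "\<zero>\<^bsub>R\<^esub>" x] by simp

lemma smult_zero_right [simp]: "a \<in> carrier R \<Longrightarrow> a \<odot>\<^bsub>M\<^esub> \<zero>\<^bsub>M\<^esub> = \<zero>\<^bsub>M\<^esub>"
  using smult_r_distr[of a "\<zero>\<^bsub>M\<^esub>" "\<zero>\<^bsub>M\<^esub>"] smult_closed[of a "\<zero>\<^bsub>M\<^esub>"] by simp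

lemma smult_neg_right: "\<lbrakk>a \<in> carrier R; x \<in> carrier M\<rbrakk> \<Longrightarrow> a \<odot>\<^bsub>M\<^esub> (\<ominus>\<^bsub>M\<^esub> x) = \<ominus>\<^bsub>M\<^esub> (a \<odot>\<^bsub>M\<^esub> x)"
  using smult_r_distr[of a "\<ominus>\<^bsub>M\<^esub> x" x] smult_closed[of a]
  by (metis M.a_inv_closed M.l_neg M.minus_equality smult_zero_right)

lemma smult_neg_left: "\<lbrakk>a \<in> carrier R; x \<in> carrier M\<rbrakk> \<Longrightarrow> (\<ominus>\<^bsub>R\<^esub> a) \<odot>\<^bsub>M\<^esub> x = \<ominus>\<^bsub>M\<^esub> (a \<odot>\<^bsub>M\<^esub> x)"
  using smult_l_distr[of "\<ominus>\<^bsub>R\<^esub> a" a x] smult_closed[of _ x]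
  by (metis R.a_inv_closed R.l_neg M.minus_equality smult_zero_left)

declare smult_closed [simp]

lemma prods_closed: "\<lbrakk>I \<subseteq> carrier R; N \<subseteq> carrier M\<rbrakk> \<Longrightarrow> {a \<odot>\<^bsub>M\<^esub> x |a x. a \<in> I \<and> x \<in> N} \<subseteq> carrier M"
  using smult_closed by blast

context
  fixes I N assumes I: "I \<subseteq> carrier R" and N: "N \<subseteq> carrier M"
begin

lemma act_prod_zero: "\<zero>\<^bsub>M\<^esub> \<in> act_prod M I N"
  using M.add.finite_sums_one unfolding act_prod_def by simp

lemma act_prod_closed: "act_prod M I N \<subseteq> carrier M"
  using M.add.finite_sums_closed[OF prods_closed[OF I N]] unfolding act_prod_def by simp

lemma act_prod_prod: "\<lbrakk>a \<in> I; x \<in> N\<rbrakk> \<Longrightarrow> a \<odot>\<^bsub>M\<^esub> x \<in> act_prod M I N"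
  unfolding act_prod_def by (rule M.add.finite_sums_incl[OF prods_closed[OF I N]]) auto

lemma act_prod_add: "\<lbrakk>x \<in> act_prod M I N; y \<in> act_prod M I N\<rbrakk> \<Longrightarrow> x \<oplus>\<^bsub>M\<^esub> y \<in> act_prod M I N"
  using M.add.finite_sums_mult[OF prods_closed[OF I N]] unfolding act_prod_def by simp

lemma act_prod_induct [consumes 1, case_names zero step]:
  assumes "x \<in> act_prod M I N" and "P \<zero>\<^bsub>M\<^esub>"
    and "\<And>a x y. \<lbrakk>a \<in> I; x \<in> N; a \<in> carrier R; x \<in> carrier M; y \<in> act_prod M I N; y \<in> carrier M; P y\<rbrakk> \<Longrightarrow> P (a \<odot>\<^bsub>M\<^esub> x \<oplus>\<^bsub>M\<^esub> y)"
  shows "P x"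
proof -
  have "x \<in> finite_sums (add_monoid M) {a \<odot>\<^bsub>M\<^esub> x |a x. a \<in> I \<and> x \<in> N}"
    using assms(1) unfolding act_prod_def .
  thus ?thesis
  proof (induction rule: M.add.finite_sums_induct[OF _ prods_closed[OF I N], consumes 1, case_names one step])
    case one
    thus ?case using assms by simp
  next
    case (step s y)
    obtain a z where "s = a \<odot>\<^bsub>M\<^esub> z" "a \<in> I" "z \<in> N" using step(1) by auto
    thus ?case using assms(3)[of a z y] step I N unfolding act_prod_def by auto
  qed
qed

lemma act_prod_smult:
  assumes "\<And>r a. \<lbrakk>r \<in> carrier R; a \<in> I\<rbrakk> \<Longrightarrow> r \<otimes>\<^bsub>R\<^esub> a \<in> I" "r \<in> carrier R" "x \<in> act_prod M I N"
  shows "r \<odot>\<^bsub>M\<^esub> x \<in> act_prod M I N"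
  using assms(3)
proof (induction rule: act_prod_induct)
  case zero
  thus ?case using act_prod_zero assms by simp
next
  case (step a x y)
  have "r \<odot>\<^bsub>M\<^esub> (a \<odot>\<^bsub>M\<^esub> x \<oplus>\<^bsub>M\<^esub> y) = (r \<otimes>\<^bsub>R\<^esub> a) \<odot>\<^bsub>M\<^esub> x \<oplus>\<^bsub>M\<^esub> r \<odot>\<^bsub>M\<^esub> y"
    using step assms by (simp add: smult_r_distr smult_assoc)
  moreover have "(r \<otimes>\<^bsub>R\<^esub> a) \<odot>\<^bsub>M\<^esub> x \<in> act_prod M I N"
    using step(1,2) assms(1,2) by (intro act_prod_prod)
  ultimately show ?case using step(7) act_prod_add by simp
qed

lemma act_prod_least:
  assumes "\<And>a x. \<lbrakk>a \<in> I; x \<in> N\<rbrakk> \<Longrightarrow> a \<odot>\<^bsub>M\<^esub> x \<in> T" "\<zero>\<^bsub>M\<^esub> \<in> T"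
    "\<And>x y. \<lbrakk>x \<in> T; y \<in> T\<rbrakk> \<Longrightarrow> x \<oplus>\<^bsub>M\<^esub> y \<in> T" "x \<in> act_prod M I N"
  shows "x \<in> T"
  using assms(4)
proof (induction rule: act_prod_induct)
  case zero
  show ?case by (rule assms(2))
next
  case (step a x y)
  show ?case by (rule assms(3)[OF assms(1)[OF step(1,2)] step(7)])
qed

end

lemma act_prod_mono:
  assumes "I \<subseteq> I'" "N \<subseteq> N'" "I' \<subseteq> carrier R" "N' \<subseteq> carrier M"
  shows "act_prod M I N \<subseteq> act_prod M I' N'"
proof
  fix x assume x: "x \<in> act_prod M I N"
  show "x \<in> act_prod M I' N'"
  proof (rule act_prod_least[OF _ _ _ _ _ x])
    fix a y assume "a \<in> I" "y \<in> N"
    thus "a \<odot>\<^bsub>M\<^esub> y \<in> act_prod M I' N'" using assms by (intro act_prod_prod) auto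
  next
    show "I \<subseteq> carrier R" "N \<subseteq> carrier M" using assms by auto
    show "\<zero>\<^bsub>M\<^esub> \<in> act_prod M I' N'" by (rule act_prod_zero[OF assms(3,4)])
    show "x \<oplus>\<^bsub>M\<^esub> y \<in> act_prod M I' N'" if "x \<in> act_prod M I' N'" "y \<in> act_prod M I' N'" for x y
      by (rule act_prod_add[OF assms(3,4) that])
  qed
qed

end

text \<open>The scalars enter only through the carrier of \<open>R\<close>. So
  \<open>degree_zero A\<close> gives A_0-linear maps and \<open>A\<close> with empty carrier gives
  additive maps, and one set of lemmas serves all three cases. Extensionality is left out here and
  added separately for \<open>Hom_Gr\<close>.\<close>

definition lin :: "('a, 'b) ring_scheme \<Rightarrow> ('a, 'm, 'c) module_scheme \<Rightarrow> ('a, 'n, 'd) module_scheme \<Rightarrow> ('m \<Rightarrow> 'n) \<Rightarrow> bool"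
  where "lin R X Y f \<longleftrightarrow> f \<in> carrier X \<rightarrow> carrier Y \<and>
      (\<forall>x\<in>carrier X. \<forall>y\<in>carrier X. f (x \<oplus>\<^bsub>X\<^esub> y) = f x \<oplus>\<^bsub>Y\<^esub> f y) \<and>
      (\<forall>a\<in>carrier R. \<forall>x\<in>carrier X. f (a \<odot>\<^bsub>X\<^esub> x) = a \<odot>\<^bsub>Y\<^esub> f x)"

lemma linI:
  assumes "\<And>x. x \<in> carrier X \<Longrightarrow> f x \<in> carrier Y"
    "\<And>x y. \<lbrakk>x \<in> carrier X; y \<in> carrier X\<rbrakk> \<Longrightarrow> f (x \<oplus>\<^bsub>X\<^esub> y) = f x \<oplus>\<^bsub>Y\<^esub> f y"
    "\<And>a x. \<lbrakk>a \<in> carrier R; x \<in> carrier X\<rbrakk> \<Longrightarrow> f (a \<odot>\<^bsub>X\<^esub> x) = a \<odot>\<^bsub>Y\<^esub> f x"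
  shows "lin R X Y f"
  using assms unfolding lin_def by auto

lemma lin_closed: "lin R X Y f \<Longrightarrow> x \<in> carrier X \<Longrightarrow> f x \<in> carrier Y"
  and lin_add: "\<lbrakk>lin R X Y f; x \<in> carrier X; y \<in> carrier X\<rbrakk> \<Longrightarrow> f (x \<oplus>\<^bsub>X\<^esub> y) = f x \<oplus>\<^bsub>Y\<^esub> f y"
  and lin_smult: "\<lbrakk>lin R X Y f; a \<in> carrier R; x \<in> carrier X\<rbrakk> \<Longrightarrow> f (a \<odot>\<^bsub>X\<^esub> x) = a \<odot>\<^bsub>Y\<^esub> f x"
  unfolding lin_def by auto

lemma lin_zero:
  assumes "lin R X Y f" "abelian_group X" "abelian_group Y"
  shows "f \<zero>\<^bsub>X\<^esub> = \<zero>\<^bsub>Y\<^esub>"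
proof -
  interpret X: abelian_group X by fact
  interpret Y: abelian_group Y by fact
  show ?thesis using lin_add[OF assms(1), of "\<zero>\<^bsub>X\<^esub>" "\<zero>\<^bsub>X\<^esub>"] lin_closed[OF assms(1), of "\<zero>\<^bsub>X\<^esub>"] by simp
qed

lemma lin_neg:
  assumes "lin R X Y f" "abelian_group X" "abelian_group Y" "x \<in> carrier X"
  shows "f (\<ominus>\<^bsub>X\<^esub> x) = \<ominus>\<^bsub>Y\<^esub> f x"
proof -
  interpret X: abelian_group X by fact
  interpret Y: abelian_group Y by fact
  show ?thesis using lin_add[OF assms(1), of "\<ominus>\<^bsub>X\<^esub> x" x] lin_closed[OF assms(1)] lin_zero[OF assms(1-3)] assms(4)
    by (simp add: X.l_neg Y.minus_equality)
qed

lemma lin_finsum: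
  assumes "lin R X Y f" "abelian_group X" "abelian_group Y" "finite D" "\<And>i. i \<in> D \<Longrightarrow> g i \<in> carrier X"
  shows "f (finsum X g D) = (\<Oplus>\<^bsub>Y\<^esub>i\<in>D. f (g i))"
proof -
  interpret X: abelian_group X by fact
  interpret Y: abelian_group Y by fact
  show ?thesis using assms(4,5)
  proof (induction D)
    case empty
    thus ?case using lin_zero[OF assms(1-3)] by simp
  next
    case (insert i D)
    have "f (finsum X g (insert i D)) = f (g i \<oplus>\<^bsub>X\<^esub> finsum X g D)"
      using insert by (subst X.finsum_insert) auto
    also have "\<dots> = f (g i) \<oplus>\<^bsub>Y\<^esub> f (finsum X g D)"
      using insert by (intro lin_add[OF assms(1)]) (auto intro!: X.finsum_closed)
    also have "\<dots> = (\<Oplus>\<^bsub>Y\<^esub>i\<in>insert i D. f (g i))"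
      using insert lin_closed[OF assms(1)] by (subst Y.finsum_insert) auto
    finally show ?case .
  qed
qed

lemma lin_comp: "\<lbrakk>lin R X Y f; lin R Y Z g\<rbrakk> \<Longrightarrow> lin R X Z (\<lambda>x. g (f x))"
  by (rule linI) (auto simp: lin_add lin_smult lin_closed)

lemma lin_cong: "\<lbrakk>lin R X Y f; \<And>x. x \<in> carrier X \<Longrightarrow> f x = g x; left_module R X\<rbrakk> \<Longrightarrow> lin R X Y g"
  unfolding lin_def Pi_def
  by (auto simp: abelian_group.axioms abelian_monoid.a_closed left_module.smult_closed left_module.axioms(2))

lemma lin_act_prod:
  assumes "lin R X Y f" "left_module R X" "left_module R Y" "I \<subseteq> carrier R" "N \<subseteq> carrier X"
    "x \<in> act_prod X I N" "f ` N \<subseteq> N'" "N' \<subseteq> carrier Y"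
  shows "f x \<in> act_prod Y I N'"
proof -
  interpret X: left_module R X by fact
  interpret Y: left_module R Y by fact
  show ?thesis using assms(6)
  proof (induction rule: X.act_prod_induct[OF assms(4,5), consumes 1, case_names zero step])
    case zero
    thus ?case using lin_zero[OF assms(1)] Y.act_prod_zero X.M.abelian_group_axioms Y.M.abelian_group_axioms assms(4,8)
      by simp
  next
    case (step a x y)
    have "f (a \<odot>\<^bsub>X\<^esub> x \<oplus>\<^bsub>X\<^esub> y) = a \<odot>\<^bsub>Y\<^esub> f x \<oplus>\<^bsub>Y\<^esub> f y"
      using step lin_add[OF assms(1)] lin_smult[OF assms(1)] by simp
    moreover have "a \<odot>\<^bsub>Y\<^esub> f x \<in> act_prod Y I N'"
      using step assms by (intro Y.act_prod_prod) auto
    ultimately show ?case using step assms Y.act_prod_add by simp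
  qed
qed

section \<open>The graded ring as a graded module over itself\<close>

context graded_ring begin

abbreviation "gm \<equiv> graded_module A"
abbreviation "RA \<equiv> graded_reg_module A"

lemma RA_simps [simp]: "carrier RA = carrier A" "\<zero>\<^bsub>RA\<^esub> = \<zero>" "x \<oplus>\<^bsub>RA\<^esub> y = x \<oplus> y" "a \<odot>\<^bsub>RA\<^esub> x = a \<otimes> x"
  unfolding graded_reg_module_def by auto

lemma RA_inv [simp]: "\<ominus>\<^bsub>RA\<^esub> x = \<ominus> x" unfolding a_inv_def m_inv_def by simp

lemma RA_mdeg: "mdeg RA i = (if i < 0 then {\<zero>} else rdeg A (nat i))"
  unfolding graded_reg_module_def by simp

lemma graded_direct_sum: "direct_sum A (rdeg A)" by unfold_locales (rule ring_direct_sum)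

lemma rdeg_closed: "a \<in> rdeg A i \<Longrightarrow> a \<in> carrier A"
  by (rule direct_sum.V_closed[OF graded_direct_sum])

lemma RA_group: "abelian_group RA" using is_abelian_group by (rule abelian_group_cong) auto

lemma RA_left_module: "left_module A RA"
proof -
  interpret RA: abelian_group RA by (rule RA_group)
  show ?thesis by unfold_locales (auto simp: l_distr r_distr m_assoc)
qed

text \<open>The ring is graded by naturals, modules by integers. From here on ring degrees are
  mostly taken in \<open>RA\<close>, where negative degrees are zero, so that differences of degrees
  make sense.\<close>

lemma RA_hcomp: "x \<in> carrier A \<Longrightarrow> cp RA i x = (if i < 0 then \<zero> else hcomp A (rdeg A) (nat i) x)"
  and RA_direct_sum: "internal_direct_sum RA (mdeg RA)"
proof -
  interpret A: direct_sum A "rdeg A" by (rule graded_direct_sum)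
  interpret RA: abelian_group RA by (rule RA_group)
  let ?c = "\<lambda>i x. if i < 0 then \<zero> else hcomp A (rdeg A) (nat i) x"
  have sub: "additive_subgroup (mdeg RA i) RA" for i
  proof (rule RA.add_subgroupI)
    show "a \<oplus>\<^bsub>RA\<^esub> b \<in> mdeg RA i" if "a \<in> mdeg RA i" "b \<in> mdeg RA i" for a b
      using that A.V_add[of a "nat i" b] by (simp add: RA_mdeg split: if_splits)
    show "\<ominus>\<^bsub>RA\<^esub> a \<in> mdeg RA i" if "a \<in> mdeg RA i" for a
      using that A.V_neg[of a "nat i"] by (simp add: RA_mdeg split: if_splits)
    show "\<zero>\<^bsub>RA\<^esub> \<in> mdeg RA i" using A.V_zero by (simp add: RA_mdeg)
    show "mdeg RA i \<subseteq> carrier RA" using A.V_closed by (auto simp: RA_mdeg)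
  qed
  have cin: "?c i x \<in> mdeg RA i" if "x \<in> carrier RA" for i x
    using that A.hcomp_spec(1)[of x "nat i"] by (simp add: RA_mdeg)
  have cadd: "?c i (x \<oplus>\<^bsub>RA\<^esub> y) = ?c i x \<oplus>\<^bsub>RA\<^esub> ?c i y" if "x \<in> carrier RA" "y \<in> carrier RA" for i x y
    using that A.hcomp_add[of x y "nat i"] by simp
  have chom: "?c j x = (if j = i then x else \<zero>\<^bsub>RA\<^esub>)" if "x \<in> mdeg RA i" for i j x
    using that A.hcomp_hom[of x "nat i" "nat j"] by (cases "i < 0") (auto simp: RA_mdeg eq_nat_nat_iff)
  have fin: "finite {i. ?c i x \<noteq> \<zero>\<^bsub>RA\<^esub>}" if "x \<in> carrier RA" for x
  proof -
    have "{i. ?c i x \<noteq> \<zero>} \<subseteq> int ` {i. hcomp A (rdeg A) i x \<noteq> \<zero>}"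
      by (auto split: if_splits intro!: image_eqI[of _ int "nat _"])
    hence "finite {i. ?c i x \<noteq> \<zero>}" using A.hcomp_spec(2)[of x] that by (simp only: RA_simps) (erule finite_subset, blast)
    thus ?thesis by (simp only: RA_simps)
  qed
  have sep: "x = \<zero>\<^bsub>RA\<^esub>" if "x \<in> carrier RA" "\<And>i. ?c i x = \<zero>\<^bsub>RA\<^esub>" for x
    using A.hcomp_eq_zero[of x] that(1) that(2)[of "int _"] by simp
  show "internal_direct_sum RA (mdeg RA)"
    by (rule RA.internal_direct_sumI(1)[of "mdeg RA" ?c]) (fact sub cin cadd chom fin sep)+
  show "cp RA i x = ?c i x" if "x \<in> carrier A"
    by (rule RA.internal_direct_sumI(2)[of "mdeg RA" ?c]) (fact sub cin cadd chom fin sep that[folded RA_simps(1)])+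
qed

lemma RA_gm: "gm RA"
proof -
  interpret RA: left_module A RA by (rule RA_left_module)
  show ?thesis
  proof unfold_locales
    show "internal_direct_sum RA (mdeg RA)" by (rule RA_direct_sum)
    fix a i x k assume a: "a \<in> rdeg A i" "x \<in> mdeg RA k"
    show "a \<odot>\<^bsub>RA\<^esub> x \<in> mdeg RA (int i + k)"
    proof (cases "k < 0")
      case True
      hence "x = \<zero>" using a by (simp add: RA_mdeg)
      moreover have "\<zero> \<in> mdeg RA j" for j
        using RA_direct_sum RA.abelian_group_axioms direct_sum.V_zero[of RA "mdeg RA" j] unfolding direct_sum_def direct_sum_axioms_def by simp
      ultimately show ?thesis using rdeg_closed[OF a(1)] by simp
    next
      case False
      hence "nat (int i + k) = i + nat k" by auto
      thus ?thesis using mult_degree[OF a(1), of x "nat k"] a False by (simp add: RA_mdeg)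
    qed
  qed
qed

end

sublocale graded_ring \<subseteq> RA: graded_module A RA by (rule RA_gm)

context graded_ring begin

lemma smult_degree': "\<lbrakk>gm M; a \<in> mdeg RA i; x \<in> mdeg M k\<rbrakk> \<Longrightarrow> a \<odot>\<^bsub>M\<^esub> x \<in> mdeg M (i + k)"
proof -
  assume M: "gm M" and a: "a \<in> mdeg RA i" "x \<in> mdeg M k"
  interpret M: graded_module A M by (rule M)
  show ?thesis
  proof (cases "i < 0")
    case True
    hence "a = \<zero>" using a by (simp add: RA_mdeg)
    thus ?thesis using M.V_closed[OF a(2)] M.V_zero by simp
  next
    case False
    thus ?thesis using M.smult_degree[of a "nat i" x k] a by (simp add: RA_mdeg)
  qed
qed

lemma cp_smult:
  assumes M: "gm M" and a: "a \<in> mdeg RA i" "x \<in> carrier M"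
  shows "cp M k (a \<odot>\<^bsub>M\<^esub> x) = a \<odot>\<^bsub>M\<^esub> cp M (k - i) x"
proof -
  interpret M: graded_module A M by (rule M)
  have ac: "a \<in> carrier A" using RA.V_closed[OF a(1)] by simp
  show ?thesis using a(2)
  proof (induction rule: M.homogeneous_induct)
    case zero
    thus ?case using ac by simp
  next
    case (step j h y)
    have "cp M k (a \<odot>\<^bsub>M\<^esub> h) = a \<odot>\<^bsub>M\<^esub> cp M (k - i) h"
    proof (cases "k = i + j")
      case True
      thus ?thesis
        unfolding M.hcomp_hom[OF smult_degree'[OF M a(1) step(1)]] M.hcomp_hom[OF step(1)] by simp
    next
      case False
      hence "k - i \<noteq> j" by auto
      thus ?thesis
        unfolding M.hcomp_hom[OF smult_degree'[OF M a(1) step(1)]] M.hcomp_hom[OF step(1)] using False ac by simp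
    qed
    thus ?case using step(2,3,5) ac by (simp add: M.smult_r_distr M.hcomp_add M.hcomp_closed)
  qed
qed

text \<open>The criterion \<open>internal_direct_sumI\<close> with an integer-graded ring action
  added; submodules, sums of modules A e_k and A/J are all graded by naming their component
  maps.\<close>

lemma graded_moduleI:
  fixes M :: "('a, 'm) graded_module" and c
  assumes "left_module A M"
    and sub: "\<And>i. additive_subgroup (mdeg M i) M"
    and c_in: "\<And>i x. x \<in> carrier M \<Longrightarrow> c i x \<in> mdeg M i"
    and c_add: "\<And>i x y. \<lbrakk>x \<in> carrier M; y \<in> carrier M\<rbrakk> \<Longrightarrow> c i (x \<oplus>\<^bsub>M\<^esub> y) = c i x \<oplus>\<^bsub>M\<^esub> c i y"
    and c_hom: "\<And>i j x. x \<in> mdeg M i \<Longrightarrow> c j x = (if j = i then x else \<zero>\<^bsub>M\<^esub>)"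
    and c_fin: "\<And>x. x \<in> carrier M \<Longrightarrow> finite {i. c i x \<noteq> \<zero>\<^bsub>M\<^esub>}"
    and c_sep: "\<And>x. x \<in> carrier M \<Longrightarrow> (\<And>i. c i x = \<zero>\<^bsub>M\<^esub>) \<Longrightarrow> x = \<zero>\<^bsub>M\<^esub>"
    and deg: "\<And>a i x k. \<lbrakk>a \<in> mdeg RA i; x \<in> mdeg M k\<rbrakk> \<Longrightarrow> a \<odot>\<^bsub>M\<^esub> x \<in> mdeg M (i + k)"
  shows "gm M" "x \<in> carrier M \<Longrightarrow> cp M i x = c i x"
proof -
  interpret M: left_module A M by fact
  show "gm M"
  proof unfold_locales
    show "internal_direct_sum M (mdeg M)"
      by (rule M.M.internal_direct_sumI(1)[of "mdeg M" c]) (fact sub c_in c_add c_hom c_fin c_sep)+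
    show "a \<odot>\<^bsub>M\<^esub> x \<in> mdeg M (int i + k)" if "a \<in> rdeg A i" "x \<in> mdeg M k" for a i x k
      using that deg[of a "int i" x k] by (simp add: RA_mdeg)
  qed
  show "cp M i x = c i x" if "x \<in> carrier M"
    by (rule M.M.internal_direct_sumI(2)[of "mdeg M" c]) (fact sub c_in c_add c_hom c_fin c_sep that)+
qed

text \<open>Graded submodules. Closure under negation comes from the action of -1, and closure under
  components is what makes \<open>hsub X N\<close> a graded module.\<close>

definition gsub :: "('a, 'm) graded_module \<Rightarrow> 'm set \<Rightarrow> bool"
  where "gsub X N \<longleftrightarrow> N \<subseteq> carrier X \<and> \<zero>\<^bsub>X\<^esub> \<in> N \<and> (\<forall>x\<in>N. \<forall>y\<in>N. x \<oplus>\<^bsub>X\<^esub> y \<in> N) \<and>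
    (\<forall>a\<in>carrier A. \<forall>x\<in>N. a \<odot>\<^bsub>X\<^esub> x \<in> N) \<and> (\<forall>x\<in>N. \<forall>i. cp X i x \<in> N)"

lemma gsub_carrier: "gm X \<Longrightarrow> gsub X (carrier X)"
proof -
  assume "gm X"
  then interpret X: graded_module A X .
  show ?thesis unfolding gsub_def using X.hcomp_closed by auto
qed

lemma gsub_neg: "gm X \<Longrightarrow> gsub X N \<Longrightarrow> x \<in> N \<Longrightarrow> \<ominus>\<^bsub>X\<^esub> x \<in> N"
proof -
  assume X: "gm X" and N: "gsub X N" and x: "x \<in> N"
  interpret X: graded_module A X by (rule X)
  have "x \<in> carrier X" using N x unfolding gsub_def by blast
  hence "\<ominus>\<^bsub>X\<^esub> x = (\<ominus> \<one>) \<odot>\<^bsub>X\<^esub> x"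
    using X.smult_neg_left[of \<one> x] X.smult_one by simp
  thus ?thesis using N x unfolding gsub_def by simp
qed

text \<open>A submodule keeps the element type and the operations of \<open>X\<close>, so maps and
  finite sums need no conversion when kernels and radicals are treated as modules.\<close>

definition hsub :: "('a, 'm) graded_module \<Rightarrow> 'm set \<Rightarrow> ('a, 'm) graded_module"
  where "hsub X N = X\<lparr>carrier := N, mdeg := (\<lambda>i. mdeg X i \<inter> N)\<rparr>"

lemma hsub_simps [simp]: "carrier (hsub X N) = N" "\<zero>\<^bsub>hsub X N\<^esub> = \<zero>\<^bsub>X\<^esub>" "x \<oplus>\<^bsub>hsub X N\<^esub> y = x \<oplus>\<^bsub>X\<^esub> y"
  "a \<odot>\<^bsub>hsub X N\<^esub> x = a \<odot>\<^bsub>X\<^esub> x" "mdeg (hsub X N) i = mdeg X i \<inter> N"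
  unfolding hsub_def by auto

lemma hsub_gm:
  assumes X: "gm X" and N: "gsub X N"
  shows "gm (hsub X N)" "x \<in> N \<Longrightarrow> cp (hsub X N) i x = cp X i x"
proof -
  interpret X: graded_module A X by (rule X)
  note n = N[unfolded gsub_def]
  have Nc: "x \<in> N \<Longrightarrow> x \<in> carrier X" for x using n by blast
  have n': "\<zero>\<^bsub>X\<^esub> \<in> N" "\<And>x y. \<lbrakk>x \<in> N; y \<in> N\<rbrakk> \<Longrightarrow> x \<oplus>\<^bsub>X\<^esub> y \<in> N" "\<And>a x. \<lbrakk>a \<in> carrier A; x \<in> N\<rbrakk> \<Longrightarrow> a \<odot>\<^bsub>X\<^esub> x \<in> N"
    "\<And>i x. x \<in> N \<Longrightarrow> cp X i x \<in> N" using n by blast+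
  have grp: "abelian_group (hsub X N)"
  proof (rule abelian_groupI)
    show "\<exists>y\<in>carrier (hsub X N). y \<oplus>\<^bsub>hsub X N\<^esub> x = \<zero>\<^bsub>hsub X N\<^esub>" if "x \<in> carrier (hsub X N)" for x
      using that gsub_neg[OF X N, of x] X.l_neg[of x] Nc by auto
  qed (simp_all add: n'(1,2) Nc X.a_ac)
  then interpret H: abelian_group "hsub X N" .
  have lm: "left_module A (hsub X N)"
    by unfold_locales (simp_all add: n'(3) Nc X.smult_l_distr X.smult_r_distr X.smult_assoc X.smult_one)
  have neg: "\<ominus>\<^bsub>hsub X N\<^esub> x = \<ominus>\<^bsub>X\<^esub> x" if "x \<in> N" for x
    using that gsub_neg[OF X N that] X.l_neg[of x] Nc by (intro H.minus_equality) auto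
  have sub: "additive_subgroup (mdeg (hsub X N) i) (hsub X N)" for i
  proof (rule H.add_subgroupI)
    show "\<ominus>\<^bsub>hsub X N\<^esub> x \<in> mdeg (hsub X N) i" if "x \<in> mdeg (hsub X N) i" for x
      using that neg X.V_neg gsub_neg[OF X N] by simp
    show "mdeg (hsub X N) i \<subseteq> carrier (hsub X N)" by simp
    show "\<zero>\<^bsub>hsub X N\<^esub> \<in> mdeg (hsub X N) i" using X.V_zero n'(1) by simp
    show "x \<oplus>\<^bsub>hsub X N\<^esub> y \<in> mdeg (hsub X N) i" if "x \<in> mdeg (hsub X N) i" "y \<in> mdeg (hsub X N) i" for x y
      using that X.V_add n'(2) by simp
  qed
  have deg: "a \<odot>\<^bsub>hsub X N\<^esub> x \<in> mdeg (hsub X N) (i + k)" if "a \<in> mdeg RA i" "x \<in> mdeg (hsub X N) k" for a i x k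
    using that smult_degree'[OF X that(1), of x k] n'(3)[of a x] RA.V_closed[OF that(1)] by simp
  have sep: "x = \<zero>\<^bsub>hsub X N\<^esub>" if "x \<in> carrier (hsub X N)" "\<And>i. cp X i x = \<zero>\<^bsub>hsub X N\<^esub>" for x
    using that Nc X.hcomp_eq_zero by simp
  have cin: "cp X i x \<in> mdeg (hsub X N) i" if "x \<in> carrier (hsub X N)" for i x
    using that Nc n' X.hcomp_spec(1) by simp
  have fin: "finite {i. cp X i x \<noteq> \<zero>\<^bsub>hsub X N\<^esub>}" if "x \<in> carrier (hsub X N)" for x
    using that Nc X.hcomp_spec(2) by simp
  have add: "cp X i (x \<oplus>\<^bsub>hsub X N\<^esub> y) = cp X i x \<oplus>\<^bsub>hsub X N\<^esub> cp X i y"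
    if "x \<in> carrier (hsub X N)" "y \<in> carrier (hsub X N)" for i x y
    using that Nc X.hcomp_add by simp
  have hom: "cp X j x = (if j = i then x else \<zero>\<^bsub>hsub X N\<^esub>)" if "x \<in> mdeg (hsub X N) i" for i j x
    using that X.hcomp_hom[of x i j] by simp
  show "gm (hsub X N)"
    by (rule graded_moduleI(1)[of _ "\<lambda>i x. cp X i x", OF lm sub], erule cin, erule (1) add, erule hom, erule fin,
      rule sep, assumption, assumption, erule (1) deg)
  show "cp (hsub X N) i x = cp X i x" if "x \<in> N"
    by (rule graded_moduleI(2)[of _ "\<lambda>i x. cp X i x", OF lm sub], erule cin, erule (1) add, erule hom, erule fin,
      rule sep, assumption, assumption, erule (1) deg, simp add: that)
qed

end

lemma (in direct_sum) V_finsum: "\<lbrakk>finite D; \<And>k. k \<in> D \<Longrightarrow> f k \<in> V i\<rbrakk> \<Longrightarrow> finsum G f D \<in> V i"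
proof (induction D rule: finite_induct)
  case empty
  thus ?case using V_zero by simp
next
  case (insert k D)
  have "f \<in> D \<rightarrow> carrier G" "f k \<in> carrier G" using insert V_closed by auto
  hence "finsum G f (insert k D) = f k \<oplus> finsum G f D" using insert by (intro finsum_insert) auto
  thus ?case using insert V_add by simp
qed

lemma (in direct_sum) hcomp_finsum:
  "\<lbrakk>finite D; \<And>k. k \<in> D \<Longrightarrow> f k \<in> carrier G\<rbrakk> \<Longrightarrow> hcomp G V i (finsum G f D) = (\<Oplus>k\<in>D. hcomp G V i (f k))"
proof (induction D rule: finite_induct)
  case empty
  thus ?case by simp
next
  case (insert k D)
  have *: "f \<in> D \<rightarrow> carrier G" "f k \<in> carrier G" "(\<lambda>k. hcomp G V i (f k)) \<in> D \<rightarrow> carrier G"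
    using insert hcomp_closed by auto
  have "finsum G f (insert k D) = f k \<oplus> finsum G f D" using insert * by (intro finsum_insert) auto
  moreover have "(\<Oplus>k\<in>insert k D. hcomp G V i (f k)) = hcomp G V i (f k) \<oplus> (\<Oplus>k\<in>D. hcomp G V i (f k))"
    using insert * hcomp_closed by (intro finsum_insert) auto
  ultimately show ?case using insert * hcomp_add finsum_closed by simp
qed

lemma shift_simps [simp]:
  "carrier (shift Y n) = carrier Y" "\<zero>\<^bsub>shift Y n\<^esub> = \<zero>\<^bsub>Y\<^esub>" "x \<oplus>\<^bsub>shift Y n\<^esub> y = x \<oplus>\<^bsub>Y\<^esub> y"
  "a \<odot>\<^bsub>shift Y n\<^esub> x = a \<odot>\<^bsub>Y\<^esub> x" "mdeg (shift Y n) i = mdeg Y (i + n)"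
  unfolding shift_def by auto

lemma Hom_Gr_iff:
  "f \<in> Hom_Gr A X Y \<longleftrightarrow> f \<in> extensional (carrier X) \<and> lin A X Y f \<and> (\<forall>i. \<forall>x\<in>mdeg X i. f x \<in> mdeg Y i)"
  unfolding Hom_Gr_def lin_def PiE_def image_subset_iff by blast

lemma Hom_shift_iff:
  "f \<in> Hom_Gr A X (shift Y n) \<longleftrightarrow> f \<in> extensional (carrier X) \<and> lin A X Y f \<and> (\<forall>i. \<forall>x\<in>mdeg X i. f x \<in> mdeg Y (i + n))"
  unfolding Hom_Gr_iff by (simp add: lin_def)

lemma Hom_shift_zero: "Hom_Gr A X (shift Y 0) = Hom_Gr A X Y"
  unfolding set_eq_iff Hom_shift_iff Hom_Gr_iff by (simp add: lin_def)

lemma lin_restrict: "left_module R X \<Longrightarrow> lin R X Y f \<Longrightarrow> lin R X Y (restrict f (carrier X))"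
  by (rule lin_cong[of R X Y f]) auto

lemma lin_padd:
  assumes "left_module R Y" "lin R X Y f" "lin R X Y g"
  shows "lin R X Y (\<lambda>x. f x \<oplus>\<^bsub>Y\<^esub> g x)"
proof -
  interpret Y: left_module R Y by fact
  show ?thesis
    by (rule linI) (simp_all add: lin_closed[OF assms(2)] lin_closed[OF assms(3)] lin_add[OF assms(2)] lin_add[OF assms(3)]
      lin_smult[OF assms(2)] lin_smult[OF assms(3)] Y.smult_r_distr Y.M.a_ac)
qed

lemma lin_pneg:
  assumes "left_module R Y" "lin R X Y f"
  shows "lin R X Y (\<lambda>x. \<ominus>\<^bsub>Y\<^esub> f x)"
proof -
  interpret Y: left_module R Y by fact
  show ?thesis
    by (rule linI) (simp_all add: lin_closed[OF assms(2)] lin_add[OF assms(2)]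
      lin_smult[OF assms(2)] Y.smult_neg_right Y.M.minus_add)
qed

lemma lin_pzero:
  assumes "left_module R Y" shows "lin R X Y (\<lambda>x. \<zero>\<^bsub>Y\<^esub>)"
proof -
  interpret Y: left_module R Y by fact
  show ?thesis by (rule linI) simp_all
qed

section \<open>Homomorphisms of a fixed degree and finite sums of them\<close>

context graded_ring begin

abbreviation homd :: "('a, 'm) graded_module \<Rightarrow> ('a, 'n) graded_module \<Rightarrow> int \<Rightarrow> ('m \<Rightarrow> 'n) set"
  where "homd X Y n \<equiv> Hom_Gr A X (shift Y n)"

lemma gm_left_module: "gm X \<Longrightarrow> left_module A X"
  by (rule graded_module.axioms)

lemma gm_group: "gm X \<Longrightarrow> abelian_group X"
  by (rule left_module.axioms(2)[OF gm_left_module])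

lemma homd_lin: "f \<in> homd X Y n \<Longrightarrow> lin A X Y f"
  and homd_ext: "f \<in> homd X Y n \<Longrightarrow> f \<in> extensional (carrier X)"
  and homd_deg: "f \<in> homd X Y n \<Longrightarrow> x \<in> mdeg X i \<Longrightarrow> f x \<in> mdeg Y (i + n)"
  unfolding Hom_shift_iff by blast+

lemma Hom_lin: "f \<in> Hom_Gr A X Y \<Longrightarrow> lin A X Y f"
  and Hom_deg: "f \<in> Hom_Gr A X Y \<Longrightarrow> x \<in> mdeg X i \<Longrightarrow> f x \<in> mdeg Y i"
  unfolding Hom_Gr_iff by blast+

lemma homdI:
  assumes "gm X" "lin A X Y f" "\<And>i x. x \<in> mdeg X i \<Longrightarrow> f x \<in> mdeg Y (i + n)"
  shows "(\<lambda>x\<in>carrier X. f x) \<in> homd X Y n"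
proof -
  interpret X: graded_module A X by fact
  show ?thesis
    unfolding Hom_shift_iff using assms(3) lin_restrict[OF gm_left_module[OF assms(1)] assms(2)] X.V_closed by simp
qed

lemma HomI:
  assumes "gm X" "lin A X Y f" "\<And>i x. x \<in> mdeg X i \<Longrightarrow> f x \<in> mdeg Y i"
  shows "(\<lambda>x\<in>carrier X. f x) \<in> Hom_Gr A X Y"
  using homdI[of X Y f 0] assms unfolding Hom_shift_zero by simp

lemma homd_cp:
  assumes X: "gm X" and Y: "gm Y" and f: "f \<in> homd X Y n" and x: "x \<in> carrier X"
  shows "cp Y k (f x) = f (cp X (k - n) x)"
proof -
  interpret X: graded_module A X by (rule X)
  interpret Y: graded_module A Y by (rule Y)
  note l = homd_lin[OF f]
  show ?thesis using x
  proof (induction rule: X.homogeneous_induct)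
    case zero
    thus ?case using lin_zero[OF l gm_group[OF X] gm_group[OF Y]] by simp
  next
    case (step j h y)
    have "cp Y k (f h) = f (cp X (k - n) h)"
    proof (cases "k = j + n")
      case True
      thus ?thesis
        unfolding Y.hcomp_hom[OF homd_deg[OF f step(1)]] X.hcomp_hom[OF step(1)] by simp
    next
      case False
      hence "k - n \<noteq> j" by auto
      thus ?thesis
        unfolding Y.hcomp_hom[OF homd_deg[OF f step(1)]] X.hcomp_hom[OF step(1)]
        using False lin_zero[OF l gm_group[OF X] gm_group[OF Y]] by simp
    qed
    thus ?case using step(2,3,5)
      by (simp add: lin_add[OF l] lin_closed[OF l] Y.hcomp_add X.hcomp_add X.hcomp_closed)
  qed
qed

lemma Hom_cp:
  assumes "gm X" "gm Y" "f \<in> Hom_Gr A X Y" "x \<in> carrier X"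
  shows "cp Y k (f x) = f (cp X k x)"
  using homd_cp[of X Y f 0 x k] assms unfolding Hom_shift_zero by simp

lemma homd_add:
  assumes X: "gm X" and Y: "gm Y" and "f \<in> homd X Y n" "g \<in> homd X Y n"
  shows "(\<lambda>x\<in>carrier X. f x \<oplus>\<^bsub>Y\<^esub> g x) \<in> homd X Y n"
proof (rule homdI[OF X])
  interpret Y: graded_module A Y by (rule Y)
  show "lin A X Y (\<lambda>x. f x \<oplus>\<^bsub>Y\<^esub> g x)"
    using assms homd_lin by (intro lin_padd gm_left_module)
  show "f x \<oplus>\<^bsub>Y\<^esub> g x \<in> mdeg Y (i + n)" if "x \<in> mdeg X i" for i x
    using homd_deg[OF assms(3) that] homd_deg[OF assms(4) that] by (rule Y.V_add)
qed

lemma homd_neg: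
  assumes X: "gm X" and Y: "gm Y" and "f \<in> homd X Y n"
  shows "(\<lambda>x\<in>carrier X. \<ominus>\<^bsub>Y\<^esub> f x) \<in> homd X Y n"
proof (rule homdI[OF X])
  interpret Y: graded_module A Y by (rule Y)
  show "lin A X Y (\<lambda>x. \<ominus>\<^bsub>Y\<^esub> f x)"
    using assms homd_lin by (intro lin_pneg gm_left_module)
  show "\<ominus>\<^bsub>Y\<^esub> f x \<in> mdeg Y (i + n)" if "x \<in> mdeg X i" for i x
    using homd_deg[OF assms(3) that] by (rule Y.V_neg)
qed

lemma uHom_zero:
  assumes "gm Y" shows "(\<lambda>x\<in>carrier X. \<zero>\<^bsub>Y\<^esub>) \<in> uHom A X Y"
proof -
  interpret Y: graded_module A Y by fact
  show ?thesis unfolding uHom_def by (auto intro!: exI[of _ "{}::int set"])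
qed

text \<open>\<open>uHom\<close> admits one summand per degree, so a further map of degree
  \<open>n\<close> has to be merged with the summand of that degree if there is one.\<close>

lemma uHom_step:
  assumes X: "gm X" and Y: "gm Y" and h: "h \<in> homd X Y n" and g: "g \<in> uHom A X Y"
  shows "(\<lambda>x\<in>carrier X. h x \<oplus>\<^bsub>Y\<^esub> g x) \<in> uHom A X Y"
proof -
  interpret X: graded_module A X by (rule X)
  interpret Y: graded_module A Y by (rule Y)
  obtain D k where D: "finite D" "\<And>m. m \<in> D \<Longrightarrow> k m \<in> homd X Y m" "g = (\<lambda>x\<in>carrier X. \<Oplus>\<^bsub>Y\<^esub> m\<in>D. k m x)"
    using g unfolding uHom_def by blast
  \<comment> \<open>Padding by zero maps provides a summand of degree \<open>n\<close> in either
    case.\<close>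
  define k' where "k' m = (if m \<in> D then k m else (\<lambda>x\<in>carrier X. \<zero>\<^bsub>Y\<^esub>))" for m
  have z: "(\<lambda>x\<in>carrier X. \<zero>\<^bsub>Y\<^esub>) \<in> homd X Y m" for m
    by (rule homdI[OF X lin_pzero[OF gm_left_module[OF Y]]]) (rule Y.V_zero)
  have k': "k' m \<in> homd X Y m" for m using D(2) z unfolding k'_def by simp
  have kc: "k' m x \<in> carrier Y" "h x \<in> carrier Y" if "x \<in> carrier X" for m x
    using lin_closed[OF homd_lin[OF k'] that] lin_closed[OF homd_lin[OF h] that] .
  let ?h = "\<lambda>x\<in>carrier X. h x \<oplus>\<^bsub>Y\<^esub> k' n x" and ?D = "D - {n}"
  have "h x \<oplus>\<^bsub>Y\<^esub> g x = (\<Oplus>\<^bsub>Y\<^esub> m\<in>insert n ?D. (k'(n := ?h)) m x)" if x: "x \<in> carrier X" for x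
  proof -
    have "(\<Oplus>\<^bsub>Y\<^esub> m\<in>D. k m x) = (\<Oplus>\<^bsub>Y\<^esub> m\<in>insert n ?D. k' m x)"
      by (rule Y.M.add.finprod_mono_neutral_cong_left) (use D(1) kc x in \<open>auto simp: k'_def\<close>)
    also have "\<dots> = k' n x \<oplus>\<^bsub>Y\<^esub> (\<Oplus>\<^bsub>Y\<^esub> m\<in>?D. k' m x)"
      by (rule Y.M.finsum_insert) (use D(1) kc x in auto)
    finally have "g x = k' n x \<oplus>\<^bsub>Y\<^esub> (\<Oplus>\<^bsub>Y\<^esub> m\<in>?D. k' m x)" unfolding D(3) using x by simp
    moreover have "(\<Oplus>\<^bsub>Y\<^esub> m\<in>insert n ?D. (k'(n := ?h)) m x) = ?h x \<oplus>\<^bsub>Y\<^esub> (\<Oplus>\<^bsub>Y\<^esub> m\<in>?D. (k'(n := ?h)) m x)"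
      by (subst Y.M.finsum_insert) (use D(1) kc x in auto)
    moreover have "(\<Oplus>\<^bsub>Y\<^esub> m\<in>?D. (k'(n := ?h)) m x) = (\<Oplus>\<^bsub>Y\<^esub> m\<in>?D. k' m x)"
      by (rule Y.M.finsum_cong') (use kc x in auto)
    moreover have "(\<Oplus>\<^bsub>Y\<^esub> m\<in>?D. k' m x) \<in> carrier Y" by (rule Y.M.finsum_closed) (use kc x in auto)
    ultimately show ?thesis using x kc[OF x] by (simp add: Y.M.a_assoc)
  qed
  hence "(\<lambda>x\<in>carrier X. h x \<oplus>\<^bsub>Y\<^esub> g x) = (\<lambda>x\<in>carrier X. \<Oplus>\<^bsub>Y\<^esub> m\<in>insert n ?D. (k'(n := ?h)) m x)"
    by (rule restrict_ext)
  moreover have "(k'(n := ?h)) m \<in> homd X Y m" for m using k' homd_add[OF X Y h k'] by simp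
  moreover have "finite (insert n ?D)" using D(1) by simp
  ultimately show ?thesis unfolding uHom_def by blast
qed

lemma homd_uHom:
  assumes X: "gm X" and Y: "gm Y" and h: "h \<in> homd X Y n"
  shows "h \<in> uHom A X Y"
proof -
  interpret Y: graded_module A Y by (rule Y)
  have "(\<lambda>x\<in>carrier X. h x \<oplus>\<^bsub>Y\<^esub> (\<lambda>x\<in>carrier X. \<zero>\<^bsub>Y\<^esub>) x) \<in> uHom A X Y"
    by (rule uHom_step[OF X Y h uHom_zero[OF Y]])
  moreover have "(\<lambda>x\<in>carrier X. h x \<oplus>\<^bsub>Y\<^esub> (\<lambda>x\<in>carrier X. \<zero>\<^bsub>Y\<^esub>) x) = h"
    using homd_ext[OF h] lin_closed[OF homd_lin[OF h]] by (auto simp: fun_eq_iff extensional_def)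
  ultimately show ?thesis by simp
qed

lemma Hom_uHom: "\<lbrakk>gm X; gm Y; h \<in> Hom_Gr A X Y\<rbrakk> \<Longrightarrow> h \<in> uHom A X Y"
  using homd_uHom[of X Y h 0] unfolding Hom_shift_zero by simp

text \<open>Closure of \<open>uHom\<close> under sums, negatives and composition is proved with this
  rule, one homogeneous map at a time.\<close>

lemma uHom_induct [consumes 3, case_names zero step]:
  assumes X: "gm X" and Y: "gm Y" and f: "f \<in> uHom A X Y"
    and zero: "P (\<lambda>x\<in>carrier X. \<zero>\<^bsub>Y\<^esub>)"
    and step: "\<And>n h g. \<lbrakk>h \<in> homd X Y n; g \<in> uHom A X Y; P g\<rbrakk> \<Longrightarrow> P (\<lambda>x\<in>carrier X. h x \<oplus>\<^bsub>Y\<^esub> g x)"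
  shows "P f"
proof -
  interpret X: graded_module A X by (rule X)
  interpret Y: graded_module A Y by (rule Y)
  obtain D k where D: "finite D" "\<And>m. m \<in> D \<Longrightarrow> k m \<in> homd X Y m" "f = (\<lambda>x\<in>carrier X. \<Oplus>\<^bsub>Y\<^esub> m\<in>D. k m x)"
    using f unfolding uHom_def by blast
  let ?f = "\<lambda>D. \<lambda>x\<in>carrier X. \<Oplus>\<^bsub>Y\<^esub> m\<in>D. k m x"
  have "?f D \<in> uHom A X Y \<and> P (?f D)" using D(1,2)
  proof (induction D)
    case empty
    have "?f {} = (\<lambda>x\<in>carrier X. \<zero>\<^bsub>Y\<^esub>)" by (rule restrict_ext) simp
    thus ?case using zero uHom_zero[OF Y] by (simp only: simp_thms)
  next
    case (insert n D)
    have kn: "k n \<in> homd X Y n" using insert by simp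
    have kc: "k m x \<in> carrier Y" if "m \<in> insert n D" "x \<in> carrier X" for m x
      using lin_closed[OF homd_lin[OF insert(4)[OF that(1)]] that(2)] .
    have IH: "?f D \<in> uHom A X Y" "P (?f D)" using insert(3,4) by blast+
    have "?f (insert n D) = (\<lambda>x\<in>carrier X. k n x \<oplus>\<^bsub>Y\<^esub> ?f D x)"
    proof (rule restrict_ext)
      fix x assume x: "x \<in> carrier X"
      have "(\<Oplus>\<^bsub>Y\<^esub> m\<in>insert n D. k m x) = k n x \<oplus>\<^bsub>Y\<^esub> (\<Oplus>\<^bsub>Y\<^esub> m\<in>D. k m x)"
        by (rule Y.finsum_insert) (use insert(1,2) kc x in auto)
      thus "(\<Oplus>\<^bsub>Y\<^esub> m\<in>insert n D. k m x) = k n x \<oplus>\<^bsub>Y\<^esub> ?f D x" using x by simp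
    qed
    thus ?case using step[OF kn IH] uHom_step[OF X Y kn IH(1)] by (simp only: simp_thms)
  qed
  thus ?thesis using D(3) by simp
qed

lemma uHom_lin_ext:
  assumes X: "gm X" and Y: "gm Y" and f: "f \<in> uHom A X Y"
  shows "lin A X Y f \<and> f \<in> extensional (carrier X)"
  using X Y f
proof (induction rule: uHom_induct)
  case zero
  show ?case using lin_restrict[OF gm_left_module[OF X] lin_pzero[OF gm_left_module[OF Y]]] restrict_extensional by blast
next
  case (step n h g)
  show ?case
    using lin_restrict[OF gm_left_module[OF X] lin_padd[OF gm_left_module[OF Y] homd_lin[OF step(1)] conjunct1[OF step(3)]]]
      restrict_extensional by blast
qed

lemmas uHom_lin = conjunct1[OF uHom_lin_ext]
lemmas uHom_ext = conjunct2[OF uHom_lin_ext]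
lemmas uHom_closed = lin_closed[OF uHom_lin]

lemma uHom_0: "\<lbrakk>gm X; gm Y; f \<in> uHom A X Y\<rbrakk> \<Longrightarrow> f \<zero>\<^bsub>X\<^esub> = \<zero>\<^bsub>Y\<^esub>"
  by (rule lin_zero[OF uHom_lin gm_group gm_group])

lemma uHom_eqI:
  assumes "gm X" "gm Y" "f \<in> uHom A X Y" "g \<in> uHom A X Y" "\<And>x. x \<in> carrier X \<Longrightarrow> f x = g x"
  shows "f = g"
  using uHom_ext[OF assms(1,2,3)] uHom_ext[OF assms(1,2,4)] assms(5) by (rule extensionalityI)

lemma uHom_add:
  assumes X: "gm X" and Y: "gm Y" and f: "f \<in> uHom A X Y" and g: "g \<in> uHom A X Y"
  shows "(\<lambda>x\<in>carrier X. f x \<oplus>\<^bsub>Y\<^esub> g x) \<in> uHom A X Y"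
  using X Y f
proof (induction rule: uHom_induct)
  interpret Y: graded_module A Y by (rule Y)
  {
    case zero
    have "(\<lambda>x\<in>carrier X. (\<lambda>x\<in>carrier X. \<zero>\<^bsub>Y\<^esub>) x \<oplus>\<^bsub>Y\<^esub> g x) = g"
      using uHom_ext[OF X Y g] uHom_closed[OF X Y g] by (auto simp: fun_eq_iff extensional_def)
    thus ?case using g by (simp only:)
  next
    case (step n h k)
    have "(\<lambda>x\<in>carrier X. (\<lambda>x\<in>carrier X. h x \<oplus>\<^bsub>Y\<^esub> k x) x \<oplus>\<^bsub>Y\<^esub> g x) = (\<lambda>x\<in>carrier X. h x \<oplus>\<^bsub>Y\<^esub> (\<lambda>x\<in>carrier X. k x \<oplus>\<^bsub>Y\<^esub> g x) x)"
      by (rule restrict_ext) (simp add: Y.M.a_assoc lin_closed[OF homd_lin[OF step(1)]] uHom_closed[OF X Y g] uHom_closed[OF X Y step(2)])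
    thus ?case using uHom_step[OF X Y step(1,3)] by (simp only:)
  }
qed

lemma uHom_neg:
  assumes X: "gm X" and Y: "gm Y" and f: "f \<in> uHom A X Y"
  shows "(\<lambda>x\<in>carrier X. \<ominus>\<^bsub>Y\<^esub> f x) \<in> uHom A X Y"
  using X Y f
proof (induction rule: uHom_induct)
  interpret Y: graded_module A Y by (rule Y)
  {
    case zero
    have "\<ominus>\<^bsub>Y\<^esub> \<zero>\<^bsub>Y\<^esub> = \<zero>\<^bsub>Y\<^esub>" by (metis Y.M.add.inv_one a_inv_def)
    hence "(\<lambda>x\<in>carrier X. \<ominus>\<^bsub>Y\<^esub> (\<lambda>x\<in>carrier X. \<zero>\<^bsub>Y\<^esub>) x) = (\<lambda>x\<in>carrier X. \<zero>\<^bsub>Y\<^esub>)"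
      by (intro restrict_ext) simp
    thus ?case using uHom_zero[OF Y] by metis
  next
    case (step n h k)
    have "(\<lambda>x\<in>carrier X. \<ominus>\<^bsub>Y\<^esub> (\<lambda>x\<in>carrier X. h x \<oplus>\<^bsub>Y\<^esub> k x) x) = (\<lambda>x\<in>carrier X. (\<lambda>x\<in>carrier X. \<ominus>\<^bsub>Y\<^esub> h x) x \<oplus>\<^bsub>Y\<^esub> (\<lambda>x\<in>carrier X. \<ominus>\<^bsub>Y\<^esub> k x) x)"
      by (rule restrict_ext) (simp add: Y.M.minus_add lin_closed[OF homd_lin[OF step(1)]] uHom_closed[OF X Y step(2)])
    thus ?case using uHom_step[OF X Y homd_neg[OF X Y step(1)] step(3)] by (simp only:)
  }
qed

lemma homd_comp:
  assumes X: "gm X" and "h \<in> homd X Y n" "g \<in> homd Y Z m"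
  shows "(\<lambda>x\<in>carrier X. g (h x)) \<in> homd X Z (n + m)"
proof (rule homdI[OF X])
  show "lin A X Z (\<lambda>x. g (h x))" by (rule lin_comp[OF homd_lin[OF assms(2)] homd_lin[OF assms(3)]])
  show "g (h x) \<in> mdeg Z (i + (n + m))" if "x \<in> mdeg X i" for i x
    using homd_deg[OF assms(3) homd_deg[OF assms(2) that]] by (simp add: add.assoc)
qed

lemma uHom_comp:
  assumes X: "gm X" and Y: "gm Y" and Z: "gm Z"
    and f: "f \<in> uHom A X Y" and g: "g \<in> uHom A Y Z"
  shows "(\<lambda>x\<in>carrier X. g (f x)) \<in> uHom A X Z"
  using X Y f
proof (induction rule: uHom_induct)
  interpret Z: graded_module A Z by (rule Z)
  interpret Y: graded_module A Y by (rule Y)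
  {
    case zero
    have "(\<lambda>x\<in>carrier X. g ((\<lambda>x\<in>carrier X. \<zero>\<^bsub>Y\<^esub>) x)) = (\<lambda>x\<in>carrier X. \<zero>\<^bsub>Z\<^esub>)"
      by (rule restrict_ext) (simp add: lin_zero[OF uHom_lin[OF Y Z g] gm_group[OF Y] gm_group[OF Z]])
    thus ?case using uHom_zero[OF Z] by metis
  next
    case (step n h k)
    have hc: "h x \<in> carrier Y" if "x \<in> carrier X" for x using lin_closed[OF homd_lin[OF step(1)] that] .
    \<comment> \<open>With \<open>h\<close> homogeneous, a second induction splits \<open>g\<close>;
      composites of homogeneous maps are homogeneous.\<close>
    have "(\<lambda>x\<in>carrier X. g (h x)) \<in> uHom A X Z" using Y Z g
    proof (induction rule: uHom_induct)
      case zero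
      have "(\<lambda>x\<in>carrier X. (\<lambda>x\<in>carrier Y. \<zero>\<^bsub>Z\<^esub>) (h x)) = (\<lambda>x\<in>carrier X. \<zero>\<^bsub>Z\<^esub>)"
        by (rule restrict_ext) (simp add: hc)
      thus ?case using uHom_zero[OF Z] by metis
    next
      case (step m h' k')
      have "(\<lambda>x\<in>carrier X. (\<lambda>x\<in>carrier Y. h' x \<oplus>\<^bsub>Z\<^esub> k' x) (h x)) = (\<lambda>x\<in>carrier X. (\<lambda>x\<in>carrier X. h' (h x)) x \<oplus>\<^bsub>Z\<^esub> (\<lambda>x\<in>carrier X. k' (h x)) x)"
        by (rule restrict_ext) (simp add: hc)
      thus ?case using uHom_step[OF X Z homd_comp[OF X \<open>h \<in> homd X Y n\<close> step(1)] step(3)] by (simp only:)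
    qed
    note 1 = uHom_add[OF X Z this step(3)]
    have "(\<lambda>x\<in>carrier X. g ((\<lambda>x\<in>carrier X. h x \<oplus>\<^bsub>Y\<^esub> k x) x)) = (\<lambda>x\<in>carrier X. (\<lambda>x\<in>carrier X. g (h x)) x \<oplus>\<^bsub>Z\<^esub> (\<lambda>x\<in>carrier X. g (k x)) x)"
      by (rule restrict_ext) (simp add: hc uHom_closed[OF X Y step(2)] lin_add[OF uHom_lin[OF Y Z g]])
    thus ?case using 1 by (simp only:)
  }
qed

text \<open>On homogeneous arguments the summands are components of \<open>f x\<close>. Hence what
  \<open>f\<close> satisfies with respect to graded submodules (values, vanishing, liftability)
  holds for each summand, and questions about \<open>uHom\<close> reduce to maps of one
  degree.\<close>

lemma uHom_decomp:
  assumes X: "gm X" and Y: "gm Y" and f: "f \<in> uHom A X Y"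
  obtains D h where "finite D" "\<And>n. n \<in> D \<Longrightarrow> h n \<in> homd X Y n" "f = (\<lambda>x\<in>carrier X. \<Oplus>\<^bsub>Y\<^esub> n\<in>D. h n x)"
    "\<And>n i x. \<lbrakk>n \<in> D; x \<in> mdeg X i\<rbrakk> \<Longrightarrow> h n x = cp Y (i + n) (f x)"
proof -
  interpret X: graded_module A X by (rule X)
  interpret Y: graded_module A Y by (rule Y)
  obtain D k where D: "finite D" "\<And>m. m \<in> D \<Longrightarrow> k m \<in> homd X Y m" "f = (\<lambda>x\<in>carrier X. \<Oplus>\<^bsub>Y\<^esub> m\<in>D. k m x)"
    using f unfolding uHom_def by blast
  have "k n x = cp Y (i + n) (f x)" if n: "n \<in> D" and x: "x \<in> mdeg X i" for n i x
  proof -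
    have xc: "x \<in> carrier X" by (rule X.V_closed[OF x])
    have kc: "k m x \<in> carrier Y" if "m \<in> D" for m
      using lin_closed[OF homd_lin[OF D(2)[OF that]] xc] .
    have "cp Y (i + n) (f x) = (\<Oplus>\<^bsub>Y\<^esub> m\<in>D. cp Y (i + n) (k m x))"
      unfolding D(3) using xc Y.hcomp_finsum[OF D(1) kc] by simp
    also have "\<dots> = (\<Oplus>\<^bsub>Y\<^esub> m\<in>D. if n = m then k m x else \<zero>\<^bsub>Y\<^esub>)"
    proof (rule Y.finsum_cong')
      show "cp Y (i + n) (k m x) = (if n = m then k m x else \<zero>\<^bsub>Y\<^esub>)" if "m \<in> D" for m
        using Y.hcomp_hom[OF homd_deg[OF D(2)[OF that] x], of "i + n"] by auto
    qed (use kc in auto)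
    also have "\<dots> = k n x"
      by (rule Y.finsum_singleton[OF n D(1)]) (use kc in auto)
    finally show ?thesis by simp
  qed
  with D that show ?thesis by blast
qed

end

section \<open>Graded projective modules\<close>

definition single :: "('a, 'b) ring_scheme \<Rightarrow> 'k \<Rightarrow> 'a \<Rightarrow> 'k \<Rightarrow> 'a"
  where "single R k a = (\<lambda>j. if j = k then a else \<zero>\<^bsub>R\<^esub>)"

text \<open>The image of \<open>f\<close> under the map that sends the k-th generator to
  \<open>w k\<close>; summing over the support keeps the expression independent of the index
  set.\<close>

definition lincomb :: "('a, 'b) ring_scheme \<Rightarrow> ('a, 'm) graded_module \<Rightarrow> ('k \<Rightarrow> 'm) \<Rightarrow> ('k \<Rightarrow> 'a) \<Rightarrow> 'm"
  where "lincomb R X w f = (\<Oplus>\<^bsub>X\<^esub>k\<in>{k. f k \<noteq> \<zero>\<^bsub>R\<^esub>}. f k \<odot>\<^bsub>X\<^esub> w k)"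

text \<open>The direct sum of the modules \<open>A e\<^sub>k\<close>, with \<open>e\<^sub>k\<close> in degree \<open>d\<^sub>k\<close>.\<close>

definition fmod :: "'a graded_ring \<Rightarrow> 'k set \<Rightarrow> ('k \<Rightarrow> 'a) \<Rightarrow> ('k \<Rightarrow> int) \<Rightarrow> ('a, 'k \<Rightarrow> 'a) graded_module"
  where "fmod A K e d =
    (let C = {f. (\<forall>k. f k \<in> carrier A) \<and> finite {k. f k \<noteq> \<zero>\<^bsub>A\<^esub>} \<and> (\<forall>k. k \<notin> K \<longrightarrow> f k = \<zero>\<^bsub>A\<^esub>) \<and>
        (\<forall>k\<in>K. f k \<otimes>\<^bsub>A\<^esub> e k = f k)}
     in \<lparr>carrier = C, monoid.mult = undefined, one = undefined, ring.zero = (\<lambda>_. \<zero>\<^bsub>A\<^esub>),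
       ring.add = (\<lambda>f g k. f k \<oplus>\<^bsub>A\<^esub> g k), module.smult = (\<lambda>a f k. a \<otimes>\<^bsub>A\<^esub> f k),
       mdeg = (\<lambda>i. {f \<in> C. \<forall>k. f k \<in> mdeg (graded_reg_module A) (i - d k)})\<rparr>)"

context graded_ring begin

lemma RA_one: "\<one> \<in> mdeg RA 0"
  using one_degree by (simp add: RA_mdeg)

lemma RA_mult: "\<lbrakk>a \<in> mdeg RA i; b \<in> mdeg RA j\<rbrakk> \<Longrightarrow> a \<otimes> b \<in> mdeg RA (i + j)"
  using smult_degree'[OF RA_gm, of a i b j] by simp

lemma RA_closed: "a \<in> mdeg RA i \<Longrightarrow> a \<in> carrier A"
  using RA.V_closed by simp

lemma cp_RA_closed [simp]: "x \<in> carrier A \<Longrightarrow> cp RA i x \<in> carrier A"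
  using RA.hcomp_closed by simp

lemma cp_RA_in: "x \<in> carrier A \<Longrightarrow> cp RA i x \<in> mdeg RA i"
  using RA.hcomp_spec(1) by simp

lemma cp_RA_zero [simp]: "cp RA i \<zero> = \<zero>"
  using RA.hcomp_zero by simp

text \<open>Right multiplication by \<open>e\<close> is an endomorphism of degree \<open>l\<close>
  of the left module \<open>RA\<close>, so this is an instance of \<open>homd_cp\<close>.\<close>

lemma cp_mult_right:
  assumes "e \<in> mdeg RA l" "x \<in> carrier A"
  shows "cp RA k (x \<otimes> e) = cp RA (k - l) x \<otimes> e"
proof -
  have "(\<lambda>x\<in>carrier A. x \<otimes> e) \<in> homd RA RA l"
    using homdI[OF RA_gm, of RA "\<lambda>x. x \<otimes> e" l] RA_mult[OF _ assms(1)] RA_closed[OF assms(1)]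
    by (simp add: lin_def l_distr m_assoc)
  from homd_cp[OF RA_gm RA_gm this, of x k] show ?thesis using assms by simp
qed

lemma cp_mult_left:
  assumes "a \<in> mdeg RA i" "x \<in> carrier A"
  shows "cp RA k (a \<otimes> x) = a \<otimes> cp RA (k - i) x"
  using cp_smult[OF RA_gm assms(1), of x k] assms by simp

context
  fixes K :: "'k set" and e :: "'k \<Rightarrow> 'a" and d :: "'k \<Rightarrow> int"
  assumes e: "\<And>k. k \<in> K \<Longrightarrow> e k \<in> mdeg RA 0"
begin

abbreviation "F \<equiv> fmod A K e d"

lemma fmod_simps [simp]: "\<zero>\<^bsub>F\<^esub> = (\<lambda>_. \<zero>)" "x \<oplus>\<^bsub>F\<^esub> y = (\<lambda>k. x k \<oplus> y k)" "a \<odot>\<^bsub>F\<^esub> x = (\<lambda>k. a \<otimes> x k)"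
  unfolding fmod_def Let_def by auto

lemma fmod_carrier: "f \<in> carrier F \<longleftrightarrow> (\<forall>k. f k \<in> carrier A) \<and> finite {k. f k \<noteq> \<zero>} \<and> (\<forall>k. k \<notin> K \<longrightarrow> f k = \<zero>) \<and>
        (\<forall>k\<in>K. f k \<otimes> e k = f k)"
  unfolding fmod_def Let_def by auto

lemma fmod_mdeg: "f \<in> mdeg F i \<longleftrightarrow> f \<in> carrier F \<and> (\<forall>k. f k \<in> mdeg RA (i - d k))"
  unfolding fmod_def Let_def by auto

lemma fmodD: "f \<in> carrier F \<Longrightarrow> f k \<in> carrier A"
  and fmod_fin: "f \<in> carrier F \<Longrightarrow> finite {k. f k \<noteq> \<zero>}"
  and fmod_out: "f \<in> carrier F \<Longrightarrow> k \<notin> K \<Longrightarrow> f k = \<zero>"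
  and fmod_e: "f \<in> carrier F \<Longrightarrow> k \<in> K \<Longrightarrow> f k \<otimes> e k = f k"
  unfolding fmod_carrier by blast+

lemma e_closed: "k \<in> K \<Longrightarrow> e k \<in> carrier A"
  using e RA_closed by blast

lemma fmod_add: "\<lbrakk>f \<in> carrier F; g \<in> carrier F\<rbrakk> \<Longrightarrow> (\<lambda>k. f k \<oplus> g k) \<in> carrier F"
  unfolding fmod_carrier
proof (intro conjI allI ballI impI; elim conjE)
  assume "finite {k. f k \<noteq> \<zero>}" "finite {k. g k \<noteq> \<zero>}"
  moreover have "{k. f k \<oplus> g k \<noteq> \<zero>} \<subseteq> {k. f k \<noteq> \<zero>} \<union> {k. g k \<noteq> \<zero>}" by auto
  ultimately show "finite {k. f k \<oplus> g k \<noteq> \<zero>}" by (meson finite_UnI finite_subset)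
qed (simp_all add: l_distr e_closed)

lemma fmod_smult: "\<lbrakk>a \<in> carrier A; f \<in> carrier F\<rbrakk> \<Longrightarrow> (\<lambda>k. a \<otimes> f k) \<in> carrier F"
  unfolding fmod_carrier
proof (intro conjI allI ballI impI; elim conjE)
  assume "finite {k. f k \<noteq> \<zero>}" and a: "a \<in> carrier A"
  moreover have "{k. a \<otimes> f k \<noteq> \<zero>} \<subseteq> {k. f k \<noteq> \<zero>}" using a by auto
  ultimately show "finite {k. a \<otimes> f k \<noteq> \<zero>}" by (meson finite_subset)
qed (simp_all add: m_assoc e_closed)

lemma fmod_neg: "f \<in> carrier F \<Longrightarrow> (\<lambda>k. \<ominus> f k) \<in> carrier F"
  unfolding fmod_carrier
proof (intro conjI allI ballI impI; elim conjE)
  assume "finite {k. f k \<noteq> \<zero>}"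
  moreover have "{k. \<ominus> f k \<noteq> \<zero>} \<subseteq> {k. f k \<noteq> \<zero>}" by auto
  ultimately show "finite {k. \<ominus> f k \<noteq> \<zero>}" by (meson finite_subset)
qed (simp_all add: l_minus e_closed)

lemma fmod_group: "abelian_group F"
proof (rule abelian_groupI)
  show "\<exists>y\<in>carrier F. y \<oplus>\<^bsub>F\<^esub> x = \<zero>\<^bsub>F\<^esub>" if "x \<in> carrier F" for x
    using fmod_neg[OF that] fmodD[OF that] by (intro bexI[of _ "\<lambda>k. \<ominus> x k"]) (simp_all add: l_neg)
  show "\<zero>\<^bsub>F\<^esub> \<in> carrier F" unfolding fmod_carrier by (simp add: e_closed)
qed (simp_all add: fmod_add fmodD a_ac)

lemma fmod_left_module: "left_module A F"
proof -
  interpret F: abelian_group F by (rule fmod_group)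
  show ?thesis
    by unfold_locales (simp_all add: fmod_smult fmodD l_distr r_distr m_assoc)
qed

lemma fmod_a_inv: "f \<in> carrier F \<Longrightarrow> \<ominus>\<^bsub>F\<^esub> f = (\<lambda>k. \<ominus> f k)"
proof -
  interpret F: abelian_group F by (rule fmod_group)
  assume f: "f \<in> carrier F"
  show ?thesis
    by (rule F.minus_equality) (simp_all add: f fmod_neg fmodD[OF f] l_neg)
qed

lemma fmod_cp_in: "f \<in> carrier F \<Longrightarrow> (\<lambda>k. cp RA (i - d k) (f k)) \<in> mdeg F i"
  unfolding fmod_mdeg fmod_carrier
proof (intro conjI allI ballI impI; elim conjE)
  assume "finite {k. f k \<noteq> \<zero>}"
  moreover have "{k. cp RA (i - d k) (f k) \<noteq> \<zero>} \<subseteq> {k. f k \<noteq> \<zero>}" by auto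
  ultimately show "finite {k. cp RA (i - d k) (f k) \<noteq> \<zero>}" by (meson finite_subset)
next
  fix k assume k: "k \<in> K" and "\<forall>k. f k \<in> carrier A" "\<forall>k\<in>K. f k \<otimes> e k = f k"
  hence "cp RA (i - d k) (f k) = cp RA (i - d k) (f k \<otimes> e k)" "f k \<in> carrier A" by auto
  thus "cp RA (i - d k) (f k) \<otimes> e k = cp RA (i - d k) (f k)"
    using cp_mult_right[OF e[OF k]] by simp
qed (simp_all add: cp_RA_in)

lemma fmod_gm_cp: "gm F" "f \<in> carrier F \<Longrightarrow> cp F i f = (\<lambda>k. cp RA (i - d k) (f k))"
proof -
  interpret F: left_module A F by (rule fmod_left_module)
  let ?c = "\<lambda>i f. (\<lambda>k. cp RA (i - d k) (f k))"
  have sub: "additive_subgroup (mdeg F i) F" for i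
  proof (rule F.M.add_subgroupI)
    show "mdeg F i \<subseteq> carrier F" using fmod_mdeg by blast
    show "\<zero>\<^bsub>F\<^esub> \<in> mdeg F i" unfolding fmod_mdeg using F.M.zero_closed RA.V_zero by simp
    show "\<ominus>\<^bsub>F\<^esub> x \<in> mdeg F i" if x: "x \<in> mdeg F i" for x
    proof -
      have "x \<in> carrier F" using x fmod_mdeg by blast
      thus ?thesis using x fmod_neg[of x] RA.V_neg unfolding fmod_mdeg by (simp add: fmod_a_inv)
    qed
    show "x \<oplus>\<^bsub>F\<^esub> y \<in> mdeg F i" if "x \<in> mdeg F i" "y \<in> mdeg F i" for x y
      using that fmod_add[of x y] RA.V_add unfolding fmod_mdeg by simp
  qed
  have add: "?c i (f \<oplus>\<^bsub>F\<^esub> g) = ?c i f \<oplus>\<^bsub>F\<^esub> ?c i g" if "f \<in> carrier F" "g \<in> carrier F" for i f g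
    using RA.hcomp_add[simplified] fmodD[OF that(1)] fmodD[OF that(2)] by simp
  have hom: "?c j f = (if j = i then f else \<zero>\<^bsub>F\<^esub>)" if f: "f \<in> mdeg F i" for i j f
  proof -
    have "cp RA (j - d k) (f k) = (if j = i then f k else \<zero>)" for k
    proof -
      have "f k \<in> mdeg RA (i - d k)" using f fmod_mdeg by blast
      from RA.hcomp_hom[OF this, of "j - d k"] show ?thesis by simp
    qed
    thus ?thesis by auto
  qed
  have fin: "finite {i. ?c i f \<noteq> \<zero>\<^bsub>F\<^esub>}" if f: "f \<in> carrier F" for f
  proof -
    have "{i. ?c i f \<noteq> \<zero>\<^bsub>F\<^esub>} \<subseteq> (\<Union>k\<in>{k. f k \<noteq> \<zero>}. (\<lambda>j. j + d k) ` {j. cp RA j (f k) \<noteq> \<zero>})"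
    proof
      fix i assume "i \<in> {i. ?c i f \<noteq> \<zero>\<^bsub>F\<^esub>}"
      then obtain k where k: "cp RA (i - d k) (f k) \<noteq> \<zero>" by (auto simp: fun_eq_iff)
      hence "f k \<noteq> \<zero>" by auto
      moreover have "i \<in> (\<lambda>j. j + d k) ` {j. cp RA j (f k) \<noteq> \<zero>}" using k by (intro image_eqI[of _ _ "i - d k"]) auto
      ultimately show "i \<in> (\<Union>k\<in>{k. f k \<noteq> \<zero>}. (\<lambda>j. j + d k) ` {j. cp RA j (f k) \<noteq> \<zero>})" by blast
    qed
    moreover have "finite {j. cp RA j (f k) \<noteq> \<zero>}" for k
      using RA.hcomp_spec(2)[of "f k"] fmodD[OF f] by simp
    ultimately show ?thesis using fmod_fin[OF f] by (meson finite_UN_I finite_imageI finite_subset)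
  qed
  have sep: "f = \<zero>\<^bsub>F\<^esub>" if f: "f \<in> carrier F" and "\<And>i. ?c i f = \<zero>\<^bsub>F\<^esub>" for f
  proof -
    have "cp RA j (f k) = \<zero>" for k j
      using fun_cong[OF that(2)[of "j + d k"], of k] by simp
    hence "f k = \<zero>" for k
      using RA.hcomp_eq_zero[of "f k"] fmodD[OF f] by simp
    thus ?thesis by auto
  qed
  have deg: "a \<odot>\<^bsub>F\<^esub> x \<in> mdeg F (i + k)" if "a \<in> mdeg RA i" "x \<in> mdeg F k" for a i x k
  proof -
    have "a \<otimes> x j \<in> mdeg RA (i + k - d j)" for j
      using that fmod_mdeg RA_mult[OF that(1), of "x j" "k - d j"] by (simp add: add_diff_eq)
    thus ?thesis using that fmod_mdeg fmod_smult[OF RA_closed[OF that(1)]] by simp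
  qed
  note gm = graded_moduleI[of F ?c, OF fmod_left_module sub]
  show "gm F"
    by (rule gm(1), erule fmod_cp_in, erule (1) add, erule hom, erule fin, rule sep, assumption, assumption, erule (1) deg)
  show "cp F i f = (\<lambda>k. cp RA (i - d k) (f k))" if "f \<in> carrier F"
    by (rule gm(2), erule fmod_cp_in, erule (1) add, erule hom, erule fin, rule sep, assumption, assumption, erule (1) deg, rule that)
qed

lemma fmod_eval_lin: "lin A F RA (\<lambda>f. f k)"
  by (rule linI) (simp_all add: fmodD)

lemma single_in: "\<lbrakk>k \<in> K; a \<in> carrier A; a \<otimes> e k = a\<rbrakk> \<Longrightarrow> single A k a \<in> carrier F"
  unfolding fmod_carrier single_def by (auto intro: finite_subset[of _ "{k}"] simp: e_closed)

lemma single_deg: "\<lbrakk>k \<in> K; a \<in> mdeg RA i; a \<otimes> e k = a\<rbrakk> \<Longrightarrow> single A k a \<in> mdeg F (i + d k)"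
  using single_in[OF _ RA_closed] RA.V_zero unfolding fmod_mdeg by (simp add: single_def)

context
  fixes X :: "('a, 'm) graded_module" and w :: "'k \<Rightarrow> 'm"
  assumes X: "gm X" and w: "\<And>k. k \<in> K \<Longrightarrow> w k \<in> carrier X"
begin

lemma lincomb_superset:
  assumes f: "f \<in> carrier F" and D: "finite D" "{k. f k \<noteq> \<zero>} \<subseteq> D" "D \<subseteq> K"
  shows "lincomb A X w f = (\<Oplus>\<^bsub>X\<^esub>k\<in>D. f k \<odot>\<^bsub>X\<^esub> w k)"
proof -
  interpret X: graded_module A X by (rule X)
  have "w k \<in> carrier X" if "k \<in> D" for k using that D(3) w by blast
  thus ?thesis
    unfolding lincomb_def
    by (intro X.M.add.finprod_mono_neutral_cong_left) (use D fmodD[OF f] in auto)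
qed

lemma lincomb_lin: "lin A F X (lincomb A X w)"
proof -
  interpret X: graded_module A X by (rule X)
  have sK: "{k. f k \<noteq> \<zero>} \<subseteq> K" if "f \<in> carrier F" for f using fmod_out[OF that] by blast
  have cl: "f k \<odot>\<^bsub>X\<^esub> w k \<in> carrier X" if "f \<in> carrier F" "k \<in> K" for f k
    using fmodD[OF that(1)] w[OF that(2)] by simp
  show ?thesis
  proof (rule linI)
    show "lincomb A X w f \<in> carrier X" if f: "f \<in> carrier F" for f
      unfolding lincomb_def by (rule X.M.finsum_closed) (use sK[OF f] cl[OF f] in blast)
    fix f g assume f: "f \<in> carrier F" and g: "g \<in> carrier F"
    let ?D = "{k. f k \<noteq> \<zero>} \<union> {k. g k \<noteq> \<zero>}"
    have D: "finite ?D" "?D \<subseteq> K" using fmod_fin[OF f] fmod_fin[OF g] sK[OF f] sK[OF g] by auto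
    have DK: "k \<in> K" if "k \<in> ?D" for k using that D(2) by blast
    have "lincomb A X w (f \<oplus>\<^bsub>F\<^esub> g) = (\<Oplus>\<^bsub>X\<^esub>k\<in>?D. (f \<oplus>\<^bsub>F\<^esub> g) k \<odot>\<^bsub>X\<^esub> w k)"
      by (rule lincomb_superset[OF _ D(1) _ D(2)]) (use fmod_add[OF f g] in auto)
    also have "\<dots> = (\<Oplus>\<^bsub>X\<^esub>k\<in>?D. f k \<odot>\<^bsub>X\<^esub> w k \<oplus>\<^bsub>X\<^esub> g k \<odot>\<^bsub>X\<^esub> w k)"
    proof (rule X.M.finsum_cong')
      show "(\<lambda>k. f k \<odot>\<^bsub>X\<^esub> w k \<oplus>\<^bsub>X\<^esub> g k \<odot>\<^bsub>X\<^esub> w k) \<in> ?D \<rightarrow> carrier X"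
        using cl[OF f DK] cl[OF g DK] by blast
      show "(f \<oplus>\<^bsub>F\<^esub> g) k \<odot>\<^bsub>X\<^esub> w k = f k \<odot>\<^bsub>X\<^esub> w k \<oplus>\<^bsub>X\<^esub> g k \<odot>\<^bsub>X\<^esub> w k" if "k \<in> ?D" for k
        using X.smult_l_distr[OF fmodD[OF f] fmodD[OF g] w[OF DK[OF that]]] by simp
    qed simp
    also have "\<dots> = (\<Oplus>\<^bsub>X\<^esub>k\<in>?D. f k \<odot>\<^bsub>X\<^esub> w k) \<oplus>\<^bsub>X\<^esub> (\<Oplus>\<^bsub>X\<^esub>k\<in>?D. g k \<odot>\<^bsub>X\<^esub> w k)"
      by (rule X.M.finsum_addf) (use cl[OF f DK] cl[OF g DK] in blast)+
    also have "(\<Oplus>\<^bsub>X\<^esub>k\<in>?D. f k \<odot>\<^bsub>X\<^esub> w k) = lincomb A X w f"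
      by (rule lincomb_superset[OF f D(1) _ D(2), symmetric]) blast
    also have "(\<Oplus>\<^bsub>X\<^esub>k\<in>?D. g k \<odot>\<^bsub>X\<^esub> w k) = lincomb A X w g"
      by (rule lincomb_superset[OF g D(1) _ D(2), symmetric]) blast
    finally show "lincomb A X w (f \<oplus>\<^bsub>F\<^esub> g) = lincomb A X w f \<oplus>\<^bsub>X\<^esub> lincomb A X w g" .
  next
    fix a f assume a: "a \<in> carrier A" and f: "f \<in> carrier F"
    let ?D = "{k. f k \<noteq> \<zero>}"
    have DK: "k \<in> K" if "k \<in> ?D" for k using that sK[OF f] by blast
    have "lincomb A X w (a \<odot>\<^bsub>F\<^esub> f) = (\<Oplus>\<^bsub>X\<^esub>k\<in>?D. (a \<odot>\<^bsub>F\<^esub> f) k \<odot>\<^bsub>X\<^esub> w k)"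
      by (rule lincomb_superset[OF _ fmod_fin[OF f] _ sK[OF f]]) (use fmod_smult[OF a f] a in auto)
    also have "\<dots> = (\<Oplus>\<^bsub>X\<^esub>k\<in>?D. a \<odot>\<^bsub>X\<^esub> (f k \<odot>\<^bsub>X\<^esub> w k))"
    proof (rule X.M.finsum_cong')
      show "(\<lambda>k. a \<odot>\<^bsub>X\<^esub> (f k \<odot>\<^bsub>X\<^esub> w k)) \<in> ?D \<rightarrow> carrier X"
        using X.smult_closed[OF a cl[OF f DK]] by blast
      show "(a \<odot>\<^bsub>F\<^esub> f) k \<odot>\<^bsub>X\<^esub> w k = a \<odot>\<^bsub>X\<^esub> (f k \<odot>\<^bsub>X\<^esub> w k)" if "k \<in> ?D" for k
        using X.smult_assoc[OF a fmodD[OF f] w[OF DK[OF that]]] by simp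
    qed simp
    \<comment> \<open>Multiplication by \<open>a\<close> is additive but in general not A-linear,
      hence the empty scalar set.\<close>
    also have "\<dots> = a \<odot>\<^bsub>X\<^esub> (\<Oplus>\<^bsub>X\<^esub>k\<in>?D. f k \<odot>\<^bsub>X\<^esub> w k)"
      by (rule lin_finsum[symmetric, of "A\<lparr>carrier := {}\<rparr>" X X "\<lambda>x. a \<odot>\<^bsub>X\<^esub> x"])
        (use a cl[OF f DK] fmod_fin[OF f] gm_group[OF X] X.smult_r_distr in \<open>auto simp: lin_def\<close>)
    finally show "lincomb A X w (a \<odot>\<^bsub>F\<^esub> f) = a \<odot>\<^bsub>X\<^esub> lincomb A X w f" unfolding lincomb_def .
  qed
qed

lemma lincomb_single:
  assumes "k \<in> K" "a \<in> carrier A" shows "lincomb A X w (single A k a) = a \<odot>\<^bsub>X\<^esub> w k"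
proof (cases "a = \<zero>")
  interpret X: graded_module A X by (rule X)
  case True
  hence "{j. single A k a j \<noteq> \<zero>} = {}" by (auto simp: single_def)
  thus ?thesis unfolding lincomb_def using True w[OF assms(1)] by simp
next
  interpret X: graded_module A X by (rule X)
  case False
  hence "{j. single A k a j \<noteq> \<zero>} = {k}" by (auto simp: single_def)
  thus ?thesis unfolding lincomb_def using assms w[OF assms(1)]
    by (simp add: X.M.finsum_insert single_def)
qed

lemma lincomb_deg:
  assumes "\<And>k. k \<in> K \<Longrightarrow> w k \<in> mdeg X (d k + n)" "f \<in> mdeg F i"
  shows "lincomb A X w f \<in> mdeg X (i + n)"
proof -
  interpret X: graded_module A X by (rule X)
  have f: "f \<in> carrier F" "\<And>k. f k \<in> mdeg RA (i - d k)" using assms(2) fmod_mdeg by blast+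
  show ?thesis
    unfolding lincomb_def
  proof (rule X.V_finsum[OF fmod_fin[OF f(1)]])
    fix k assume "k \<in> {k. f k \<noteq> \<zero>}"
    hence "k \<in> K" using fmod_out[OF f(1)] by blast
    from smult_degree'[OF X f(2)[of k] assms(1)[OF this]]
    show "f k \<odot>\<^bsub>X\<^esub> w k \<in> mdeg X (i + n)" by simp
  qed
qed

lemma lin_lincomb:
  assumes Y: "gm Y" and g: "lin A X Y g" and f: "f \<in> carrier F"
    and w': "\<And>k. k \<in> K \<Longrightarrow> g (w k) = w' k"
  shows "g (lincomb A X w f) = lincomb A Y w' f"
proof -
  interpret X: graded_module A X by (rule X)
  interpret Y: graded_module A Y by (rule Y)
  have sK: "k \<in> K" if "f k \<noteq> \<zero>" for k using that fmod_out[OF f] by blast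
  have "g (lincomb A X w f) = (\<Oplus>\<^bsub>Y\<^esub>k\<in>{k. f k \<noteq> \<zero>}. g (f k \<odot>\<^bsub>X\<^esub> w k))"
    unfolding lincomb_def
    by (rule lin_finsum[OF g gm_group[OF X] gm_group[OF Y] fmod_fin[OF f]]) (use sK w fmodD[OF f] in auto)
  also have "\<dots> = (\<Oplus>\<^bsub>Y\<^esub>k\<in>{k. f k \<noteq> \<zero>}. f k \<odot>\<^bsub>Y\<^esub> w' k)"
  proof (rule Y.M.finsum_cong')
    fix k assume "k \<in> {k. f k \<noteq> \<zero>}"
    hence k: "k \<in> K" using sK by blast
    show "g (f k \<odot>\<^bsub>X\<^esub> w k) = f k \<odot>\<^bsub>Y\<^esub> w' k"
      using lin_smult[OF g fmodD[OF f] w[OF k]] w'[OF k] by simp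
  next
    show "(\<lambda>k. f k \<odot>\<^bsub>Y\<^esub> w' k) \<in> {k. f k \<noteq> \<zero>} \<rightarrow> carrier Y"
      using sK w' lin_closed[OF g w] fmodD[OF f] by (auto simp flip: w')
  qed simp
  finally show ?thesis unfolding lincomb_def .
qed

end

text \<open>Checked one coordinate at a time: evaluation at \<open>k\<close> is linear, and only the
  k-th generator contributes, through \<open>f k \<otimes> e k = f k\<close>.\<close>

lemma lincomb_basis:
  assumes idem: "\<And>k. k \<in> K \<Longrightarrow> e k \<otimes> e k = e k" and f: "f \<in> carrier F"
  shows "lincomb A F (\<lambda>k. single A k (e k)) f = f"
proof
  fix k
  have s: "single A j (e j) \<in> carrier F" if "j \<in> K" for j using single_in[OF that e_closed[OF that] idem[OF that]] .
  have "(lincomb A F (\<lambda>j. single A j (e j)) f) k = lincomb A RA (\<lambda>j. single A j (e j) k) f"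
    by (rule lin_lincomb[OF fmod_gm_cp(1) _ RA_gm fmod_eval_lin f refl]) (rule s)
  also have "\<dots> = f k"
  proof (cases "k \<in> K")
    case True
    have "lincomb A RA (\<lambda>j. single A j (e j) k) f = (\<Oplus>\<^bsub>RA\<^esub>j\<in>insert k {k. f k \<noteq> \<zero>}. f j \<odot>\<^bsub>RA\<^esub> single A j (e j) k)"
    proof (rule lincomb_superset[OF RA_gm _ f])
      show "insert k {k. f k \<noteq> \<zero>} \<subseteq> K" using True fmod_out[OF f] by blast
    qed (use fmodD[OF s] fmod_fin[OF f] in auto)
    also have "\<dots> = (\<Oplus>\<^bsub>RA\<^esub>j\<in>insert k {k. f k \<noteq> \<zero>}. if k = j then f j else \<zero>\<^bsub>RA\<^esub>)"
      by (rule RA.M.finsum_cong') (use fmodD[OF f] fmod_e[OF f True] in \<open>auto simp: single_def\<close>)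
    also have "\<dots> = f k"
      by (rule RA.M.finsum_singleton) (use fmod_fin[OF f] fmodD[OF f] in auto)
    finally show ?thesis .
  next
    case False
    have "lincomb A RA (\<lambda>j. single A j (e j) k) f = (\<Oplus>\<^bsub>RA\<^esub>j\<in>{k. f k \<noteq> \<zero>}. \<zero>\<^bsub>RA\<^esub>)"
      unfolding lincomb_def
      by (rule RA.M.finsum_cong') (use fmodD[OF f] fmod_out[OF f False] in \<open>auto simp: single_def\<close>)
    thus ?thesis using fmod_out[OF f False] RA.M.finsum_zero by simp
  qed
  finally show "lincomb A F (\<lambda>j. single A j (e j)) f k = f k" .
qed

end

end

text \<open>\<open>s\<close> and \<open>p\<close> form a dual basis that exhibits \<open>P\<close>
  as a direct summand of a sum of modules A e_k. It suffices to lift the values at the generators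
  \<open>p k\<close>, in the right degree, and to extend along the coordinates
  \<open>s\<close>.\<close>

lemma (in graded_ring) lift_along:
  fixes P :: "('a, 'p) graded_module" and X :: "('a, 'm) graded_module" and Y :: "('a, 'n) graded_module"
    and K :: "'k set"
  assumes e: "\<And>k. k \<in> K \<Longrightarrow> e k \<in> mdeg RA 0"
    and P: "graded_module A P" and X: "graded_module A X" and Y: "graded_module A Y"
    and s: "s \<in> Hom_Gr A P (fmod A K e d)" and p: "\<And>k. k \<in> K \<Longrightarrow> p k \<in> mdeg P (d k)"
    and sec: "\<And>x. x \<in> carrier P \<Longrightarrow> lincomb A P p (s x) = x"
    and g: "g \<in> Hom_Gr A X Y" and f: "f \<in> homd P Y n"
    and im: "\<And>k. k \<in> K \<Longrightarrow> f (p k) \<in> g ` carrier X"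
  shows "\<exists>h\<in>homd P X n. \<forall>x\<in>carrier P. g (h x) = f x"
proof -
  interpret P: graded_module A P by (rule P)
  interpret X: graded_module A X by (rule X)
  interpret Y: graded_module A Y by (rule Y)
  have "\<forall>k\<in>K. \<exists>x. x \<in> mdeg X (d k + n) \<and> g x = f (p k)"
  proof
    fix k assume k: "k \<in> K"
    then obtain y where y: "y \<in> carrier X" "f (p k) = g y" using im by blast
    \<comment> \<open>A preimage is made homogeneous by passing to its component in the degree of
      \<open>f (p k)\<close>.\<close>
    have "g (cp X (d k + n) y) = cp Y (d k + n) (f (p k))"
      using Hom_cp[OF X Y g y(1)] y(2) by simp
    also have "\<dots> = f (p k)" using Y.hcomp_hom[OF homd_deg[OF f p[OF k]], of "d k + n"] by simp
    finally show "\<exists>x. x \<in> mdeg X (d k + n) \<and> g x = f (p k)" using X.hcomp_spec(1)[OF y(1)] by blast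
  qed
  from bchoice[OF this] obtain w where w: "\<And>k. k \<in> K \<Longrightarrow> w k \<in> mdeg X (d k + n)" "\<And>k. k \<in> K \<Longrightarrow> g (w k) = f (p k)"
    by blast
  have wc: "k \<in> K \<Longrightarrow> w k \<in> carrier X" and pc: "k \<in> K \<Longrightarrow> p k \<in> carrier P" for k
    using w(1) X.V_closed p P.V_closed by blast+
  note sc = lin_closed[OF Hom_lin[OF s]]
  note ll = lincomb_lin[of K e X w d, OF e X wc]
  show ?thesis
  proof (rule bexI[of _ "\<lambda>x\<in>carrier P. lincomb A X w (s x)"])
    show "(\<lambda>x\<in>carrier P. lincomb A X w (s x)) \<in> homd P X n"
    proof (rule homdI[OF P])
      show "lin A P X (\<lambda>x. lincomb A X w (s x))"
        by (rule lin_comp[OF Hom_lin[OF s] ll])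
      show "lincomb A X w (s x) \<in> mdeg X (i + n)" if "x \<in> mdeg P i" for i x
        by (rule lincomb_deg[OF e X wc w(1) Hom_deg[OF s that]])
    qed
    show "\<forall>x\<in>carrier P. g ((\<lambda>x\<in>carrier P. lincomb A X w (s x)) x) = f x"
    proof
      fix x assume x: "x \<in> carrier P"
      have "g (lincomb A X w (s x)) = lincomb A Y (\<lambda>k. f (p k)) (s x)"
        by (rule lin_lincomb[of K e X w Y g _ d, OF e X wc Y Hom_lin[OF g] sc[OF x] w(2)])
      also have "\<dots> = f (lincomb A P p (s x))"
        by (rule lin_lincomb[of K e P p Y f _ d, OF e P pc Y homd_lin[OF f] sc[OF x] refl, symmetric])
      finally show "g ((\<lambda>x\<in>carrier P. lincomb A X w (s x)) x) = f x" using sec[OF x] x by simp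
    qed
  qed
qed

context graded_ring begin

text \<open>The coordinates of an element together with the generators
  \<open>single A k (e k)\<close> are already a dual basis, so \<open>lift_along\<close> applies
  with the identity as coordinate map.\<close>

lemma fmod_projective:
  fixes K :: "'k set"
  assumes e: "\<And>k. k \<in> K \<Longrightarrow> e k \<in> mdeg RA 0" and idem: "\<And>k. k \<in> K \<Longrightarrow> e k \<otimes> e k = e k"
  shows "graded_projective A (fmod A K e d)"
proof -
  let ?F = "fmod A K e d"
  have F: "gm ?F" by (rule fmod_gm_cp(1)[OF e])
  show ?thesis
    unfolding graded_projective_def
  proof (rule conjI[OF F], intro allI impI, elim conjE)
    fix X :: "('a, ('k \<Rightarrow> 'a) \<Rightarrow> 'a) graded_module" and Y :: "('a, 'k \<Rightarrow> 'a) graded_module" and g f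
    assume X: "gm X" and Y: "gm Y" and g: "g \<in> Hom_Gr A X Y"
      and sur: "g ` carrier X = carrier Y" and f: "f \<in> Hom_Gr A ?F Y"
    have id: "(\<lambda>x\<in>carrier ?F. x) \<in> Hom_Gr A ?F ?F"
      by (rule HomI[OF F]) (simp_all add: lin_def)
    have "\<exists>h\<in>homd ?F X 0. \<forall>x\<in>carrier ?F. g (h x) = f x"
    proof (rule lift_along[of K e, OF e F X Y id _ _ g])
      show "single A k (e k) \<in> mdeg ?F (d k)" if "k \<in> K" for k
        using single_deg[of K e k "e k" 0 d, OF e that e[OF that] idem[OF that]] by simp
      show "lincomb A ?F (\<lambda>k. single A k (e k)) ((\<lambda>x\<in>carrier ?F. x) x) = x" if "x \<in> carrier ?F" for x
        using lincomb_basis[of K e _ d, OF e idem that] that by simp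
      show "f \<in> homd ?F Y 0" using f by (simp add: Hom_shift_zero)
      show "f (single A k (e k)) \<in> g ` carrier X" if "k \<in> K" for k
        unfolding sur
        by (rule lin_closed[OF Hom_lin[OF f]])
          (rule single_in[of K e k "e k" d, OF e that RA_closed[OF e[OF that]] idem[OF that]])
    qed
    thus "\<exists>h\<in>Hom_Gr A ?F X. \<forall>x\<in>carrier ?F. g (h x) = f x" by (simp add: Hom_shift_zero)
  qed
qed

definition homog :: "('a, 'm) graded_module \<Rightarrow> 'm set"
  where "homog P = {p. \<exists>i. p \<in> mdeg P i}"

text \<open>Splits the cover of \<open>P\<close> by the free module on its homogeneous elements, the
  test for which the types in \<open>graded_projective\<close> were chosen. Together with
  \<open>lift_along\<close> it frees the lifting property from those types.\<close>

lemma projective_section: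
  assumes "graded_projective A P"
  obtains d s where "s \<in> Hom_Gr A P (fmod A (homog P) (\<lambda>_. \<one>) d)" "\<And>p. p \<in> homog P \<Longrightarrow> p \<in> mdeg P (d p)"
    "\<And>x. x \<in> carrier P \<Longrightarrow> lincomb A P (\<lambda>p. p) (s x) = x"
proof -
  have P: "gm P" using assms unfolding graded_projective_def by blast
  interpret P: graded_module A P by (rule P)
  \<comment> \<open>Zero is homogeneous of every degree, so a degree has to be chosen.\<close>
  define d where "d = (\<lambda>p. SOME i. p \<in> mdeg P i)"
  have d: "p \<in> mdeg P (d p)" if "p \<in> homog P" for p
    using that unfolding homog_def d_def by (auto intro: someI)
  let ?F = "fmod A (homog P) (\<lambda>_. \<one>) d" and ?L = "\<lambda>f. lincomb A P (\<lambda>p. p) f"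
  have F: "gm ?F" by (rule fmod_gm_cp(1)) (rule RA_one)
  have pc: "p \<in> carrier P" if "p \<in> homog P" for p using d[OF that] P.V_closed by blast
  have Ll: "lin A ?F P ?L" by (rule lincomb_lin[OF RA_one P pc])
  have L: "(\<lambda>f\<in>carrier ?F. ?L f) \<in> Hom_Gr A ?F P"
  proof (rule HomI[OF F Ll])
    show "?L f \<in> mdeg P i" if f: "f \<in> mdeg ?F i" for f i
      using lincomb_deg[of "homog P" "\<lambda>_. \<one>" P "\<lambda>p. p" d 0, OF RA_one P pc _ f] d by simp
  qed
  have sur: "(\<lambda>f\<in>carrier ?F. ?L f) ` carrier ?F = carrier P"
  proof
    show "(\<lambda>f\<in>carrier ?F. ?L f) ` carrier ?F \<subseteq> carrier P" using lin_closed[OF Ll] by auto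
    show "carrier P \<subseteq> (\<lambda>f\<in>carrier ?F. ?L f) ` carrier ?F"
    proof
      fix x assume "x \<in> carrier P"
      hence "\<exists>f\<in>carrier ?F. ?L f = x"
      proof (induction rule: P.homogeneous_induct)
        case zero
        show ?case using lin_zero[OF Ll gm_group[OF F] gm_group[OF P]] abelian_monoid.zero_closed[OF abelian_group.axioms(1)[OF gm_group[OF F]]]
          by blast
      next
        case (step i h y)
        obtain f where f: "f \<in> carrier ?F" "?L f = y" using step(5) by blast
        have h: "h \<in> homog P" using step(1) unfolding homog_def by blast
        let ?h = "single A h \<one>"
        have sh: "?h \<in> carrier ?F" by (rule single_in[OF RA_one h]) simp_all
        have "?L ?h = h" using lincomb_single[of "homog P" "\<lambda>_. \<one>" P "\<lambda>p. p", OF RA_one P pc h, of \<one>] step(2) P.smult_one by simp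
        hence "?L (?h \<oplus>\<^bsub>?F\<^esub> f) = h \<oplus>\<^bsub>P\<^esub> y" using lin_add[OF Ll sh f(1)] f(2) by simp
        moreover have "?h \<oplus>\<^bsub>?F\<^esub> f \<in> carrier ?F"
          by (rule abelian_monoid.a_closed[OF abelian_group.axioms(1)[OF gm_group[OF F]] sh f(1)])
        ultimately show ?case by blast
      qed
      thus "x \<in> (\<lambda>f\<in>carrier ?F. ?L f) ` carrier ?F" by (auto intro!: image_eqI)
    qed
  qed
  have id: "(\<lambda>x\<in>carrier P. x) \<in> Hom_Gr A P P"
    by (rule HomI[OF P]) (simp_all add: lin_def)
  obtain s where s: "s \<in> Hom_Gr A P ?F" "\<forall>x\<in>carrier P. (\<lambda>f\<in>carrier ?F. ?L f) (s x) = (\<lambda>x\<in>carrier P. x) x"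
    using assms F P L sur id unfolding graded_projective_def by blast
  have "?L (s x) = x" if "x \<in> carrier P" for x
    using s(2) that lin_closed[OF Hom_lin[OF s(1)] that] by force
  with s(1) d that show ?thesis by blast
qed

lemma projective_gm: "graded_projective A P \<Longrightarrow> gm P"
  unfolding graded_projective_def by blast

text \<open>Each homogeneous summand of \<open>f\<close> still sends homogeneous elements into the
  image of \<open>g\<close>, because that image is closed under components; the summands are lifted
  separately and added.\<close>

lemma uHom_lift:
  assumes proj: "graded_projective A P" and X: "gm X" and Y: "gm Y"
    and g: "g \<in> Hom_Gr A X Y" and f: "f \<in> uHom A P Y" and im: "\<And>x. x \<in> carrier P \<Longrightarrow> f x \<in> g ` carrier X"
  shows "\<exists>h\<in>uHom A P X. \<forall>x\<in>carrier P. g (h x) = f x"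
proof -
  note P = projective_gm[OF proj]
  interpret P: graded_module A P by (rule P)
  interpret X: graded_module A X by (rule X)
  interpret Y: graded_module A Y by (rule Y)
  obtain d s where s: "s \<in> Hom_Gr A P (fmod A (homog P) (\<lambda>_. \<one>) d)" "\<And>p. p \<in> homog P \<Longrightarrow> p \<in> mdeg P (d p)"
    "\<And>x. x \<in> carrier P \<Longrightarrow> lincomb A P (\<lambda>p. p) (s x) = x"
    by (rule projective_section[OF proj]) (rule that)
  obtain D h where D: "finite D" "\<And>n. n \<in> D \<Longrightarrow> h n \<in> homd P Y n" "f = (\<lambda>x\<in>carrier P. \<Oplus>\<^bsub>Y\<^esub> n\<in>D. h n x)"
    "\<And>n i x. \<lbrakk>n \<in> D; x \<in> mdeg P i\<rbrakk> \<Longrightarrow> h n x = cp Y (i + n) (f x)"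
    by (rule uHom_decomp[OF P Y f]) (rule that)
  have "\<forall>n\<in>D. \<exists>k. k \<in> homd P X n \<and> (\<forall>x\<in>carrier P. g (k x) = h n x)"
  proof
    fix n assume n: "n \<in> D"
    have "\<exists>k\<in>homd P X n. \<forall>x\<in>carrier P. g (k x) = h n x"
    proof (rule lift_along[OF RA_one P X Y s(1,2) s(3) g D(2)[OF n]])
      fix p assume p: "p \<in> homog P"
      note dp = s(2)[OF p]
      from im[OF P.V_closed[OF dp]] obtain y where y: "f p = g y" "y \<in> carrier X" by (rule imageE)
      have "h n p = g (cp X (d p + n) y)"
        unfolding D(4)[OF n dp] y(1) by (rule Hom_cp[OF X Y g y(2)])
      thus "h n p \<in> g ` carrier X" using X.hcomp_closed[OF y(2)] by (rule image_eqI)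
    qed
    thus "\<exists>k. k \<in> homd P X n \<and> (\<forall>x\<in>carrier P. g (k x) = h n x)" by blast
  qed
  from bchoice[OF this] obtain k where k: "\<And>n. n \<in> D \<Longrightarrow> k n \<in> homd P X n"
    "\<And>n x. n \<in> D \<Longrightarrow> x \<in> carrier P \<Longrightarrow> g (k n x) = h n x" by blast
  show ?thesis
  proof (rule bexI[of _ "\<lambda>x\<in>carrier P. \<Oplus>\<^bsub>X\<^esub> n\<in>D. k n x"])
    show "(\<lambda>x\<in>carrier P. \<Oplus>\<^bsub>X\<^esub> n\<in>D. k n x) \<in> uHom A P X"
      unfolding uHom_def using D(1) k(1) by blast
    show "\<forall>x\<in>carrier P. g ((\<lambda>x\<in>carrier P. \<Oplus>\<^bsub>X\<^esub> n\<in>D. k n x) x) = f x"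
    proof
      fix x assume x: "x \<in> carrier P"
      have kc: "k n x \<in> carrier X" if "n \<in> D" for n using lin_closed[OF homd_lin[OF k(1)[OF that]] x] .
      have "g (\<Oplus>\<^bsub>X\<^esub> n\<in>D. k n x) = (\<Oplus>\<^bsub>Y\<^esub> n\<in>D. g (k n x))"
        by (rule lin_finsum[OF Hom_lin[OF g] gm_group[OF X] gm_group[OF Y] D(1) kc])
      also have "\<dots> = (\<Oplus>\<^bsub>Y\<^esub> n\<in>D. h n x)"
      proof (rule Y.M.finsum_cong')
        show "(\<lambda>n. h n x) \<in> D \<rightarrow> carrier Y" using lin_closed[OF homd_lin[OF D(2)] x] by blast
      qed (use k(2)[OF _ x] in simp_all)
      finally show "g ((\<lambda>x\<in>carrier P. \<Oplus>\<^bsub>X\<^esub> n\<in>D. k n x) x) = f x" using x unfolding D(3) by simp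
    qed
  qed
qed

end

section \<open>Comparison of resolutions\<close>

lemma res_ker_0: "res_ker M P 0 = {x \<in> carrier (res_mod P 0). res_aug P x = \<zero>\<^bsub>M\<^esub>}"
  and res_ker_Suc: "res_ker M P (Suc k) = {x \<in> carrier (res_mod P (Suc k)). res_diff P (Suc k) x = \<zero>\<^bsub>res_mod P k\<^esub>}"
  unfolding res_ker_def by auto

lemma res_ker_sub: "res_ker M P n \<subseteq> carrier (res_mod P n)"
  unfolding res_ker_def by (auto split: nat.splits)

locale gp_resolution = graded_ring A for A :: "'a graded_ring" (structure) +
  fixes M :: "('a, 'm) graded_module" and P :: "('a, 'm, 'p) resolution"
  assumes M: "graded_module A M" and res: "graded_projective_resolution A M P"
begin

abbreviation "T \<equiv> res_mod P"
abbreviation "dif \<equiv> res_diff P"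
abbreviation "aug \<equiv> res_aug P"

lemmas res_unfolded = res[unfolded graded_projective_resolution_def res_im_def]

lemma T_proj: "graded_projective A (T n)"
  by (rule spec[OF conjunct1[OF res_unfolded]])

lemma d_Hom: "dif (Suc n) \<in> Hom_Gr A (T (Suc n)) (T n)"
  by (rule spec[OF conjunct1[OF conjunct2[OF res_unfolded]]])

lemma aug_Hom: "aug \<in> Hom_Gr A (T 0) M"
  by (rule conjunct1[OF conjunct2[OF conjunct2[OF res_unfolded]]])

lemma aug_sur: "aug ` carrier (T 0) = carrier M"
  by (rule conjunct1[OF conjunct2[OF conjunct2[OF conjunct2[OF res_unfolded]]]])

lemma im_ker: "dif (Suc n) ` carrier (T (Suc n)) = res_ker M P n"
  by (rule spec[OF conjunct2[OF conjunct2[OF conjunct2[OF conjunct2[OF res_unfolded]]]]])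

lemma T_gm: "graded_module A (T n)"
  by (rule projective_gm[OF T_proj])

lemmas T_group = gm_group[OF T_gm]

lemma d_closed [simp]: "x \<in> carrier (T (Suc n)) \<Longrightarrow> dif (Suc n) x \<in> carrier (T n)"
  by (rule lin_closed[OF Hom_lin[OF d_Hom]])

lemma aug_closed [simp]: "x \<in> carrier (T 0) \<Longrightarrow> aug x \<in> carrier M"
  by (rule lin_closed[OF Hom_lin[OF aug_Hom]])

lemma d_ker: "x \<in> carrier (T (Suc n)) \<Longrightarrow> dif (Suc n) x \<in> res_ker M P n"
  using im_ker by blast

lemma ker_d: "x \<in> res_ker M P n \<Longrightarrow> \<exists>y\<in>carrier (T (Suc n)). dif (Suc n) y = x"
  unfolding im_ker[symmetric] by blast

lemma dd [simp]: "x \<in> carrier (T (Suc (Suc n))) \<Longrightarrow> dif (Suc n) (dif (Suc (Suc n)) x) = \<zero>\<^bsub>T n\<^esub>"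
  using d_ker[of x "Suc n"] unfolding res_ker_Suc by blast

lemma aug_d [simp]: "x \<in> carrier (T (Suc 0)) \<Longrightarrow> aug (dif (Suc 0) x) = \<zero>\<^bsub>M\<^esub>"
  using d_ker[of x 0] unfolding res_ker_0 by blast

lemma d_uHom: "dif (Suc n) \<in> uHom A (T (Suc n)) (T n)"
  by (rule Hom_uHom[OF T_gm T_gm d_Hom])

lemma aug_uHom: "aug \<in> uHom A (T 0) M"
  by (rule Hom_uHom[OF T_gm M aug_Hom])

lemma lift_step:
  assumes "graded_projective A X" "f \<in> uHom A X (T n)" "\<And>x. x \<in> carrier X \<Longrightarrow> f x \<in> res_ker M P n"
  shows "\<exists>h\<in>uHom A X (T (Suc n)). \<forall>x\<in>carrier X. dif (Suc n) (h x) = f x"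
  by (rule uHom_lift[OF assms(1) T_gm T_gm d_Hom assms(2)]) (simp add: im_ker assms(3))

lemma lift_aug:
  assumes "graded_projective A X" "f \<in> uHom A X M"
  shows "\<exists>h\<in>uHom A X (T 0). \<forall>x\<in>carrier X. aug (h x) = f x"
  by (rule uHom_lift[OF assms(1) T_gm M aug_Hom assms(2)])
    (simp add: aug_sur uHom_closed[OF projective_gm[OF assms(1)] M assms(2)])

end

text \<open>\<open>chain_lifts\<close> for two arbitrary resolutions, with \<open>Suc\<close>
  outermost in the indices so that the facts about differentials rewrite directly.\<close>

definition lifts ::
    "'a graded_ring \<Rightarrow> ('a, 'm, 'p) resolution \<Rightarrow> ('a, 'n, 'q) resolution \<Rightarrow> nat \<Rightarrow>
      ('p \<Rightarrow> 'n) \<Rightarrow> (nat \<Rightarrow> 'p \<Rightarrow> 'q) \<Rightarrow> bool"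
  where "lifts A P Q i f \<phi> \<longleftrightarrow>
    (\<forall>k. \<phi> k \<in> uHom A (res_mod P (i + k)) (res_mod Q k)) \<and>
    (\<forall>x\<in>carrier (res_mod P i). res_aug Q (\<phi> 0 x) = f x) \<and>
    (\<forall>k. \<forall>x\<in>carrier (res_mod P (Suc (i + k))).
        res_diff Q (Suc k) (\<phi> (Suc k) x) = \<phi> k (res_diff P (Suc (i + k)) x))"

lemma (in gp_resolution) lifts_id: "lifts A P P 0 aug (\<lambda>k. \<lambda>x\<in>carrier (T k). x)"
  unfolding lifts_def
proof (intro conjI allI ballI)
  have "(\<lambda>x\<in>carrier (T k). x) \<in> Hom_Gr A (T k) (T k)" for k
    by (rule HomI[OF T_gm]) (simp_all add: lin_def)
  thus "(\<lambda>x\<in>carrier (T k). x) \<in> uHom A (T (0 + k)) (T k)" for k using Hom_uHom[OF T_gm T_gm] by (simp only: add_0)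
qed simp_all

locale two_resolutions = graded_ring A + P: gp_resolution A X P + Q: gp_resolution A Y Q
  for A :: "'a graded_ring" (structure) and X :: "('a, 'm) graded_module" and P :: "('a, 'm, 'p) resolution"
    and Y :: "('a, 'n) graded_module" and Q :: "('a, 'n, 'q) resolution"
begin

text \<open>The comparison theorem. The maps are chosen recursively; carried along is that the map
  chosen last sends boundaries into the kernel, which is what the next lift requires.\<close>

lemma lifts_exist:
  assumes f: "f \<in> uHom A (P.T i) Y" and fd: "\<And>x. x \<in> carrier (P.T (Suc i)) \<Longrightarrow> f (P.dif (Suc i) x) = \<zero>\<^bsub>Y\<^esub>"
  shows "\<exists>\<phi>. lifts A P Q i f \<phi>"
proof -
  obtain \<phi>0 where \<phi>0: "\<phi>0 \<in> uHom A (P.T i) (Q.T 0)" "\<And>x. x \<in> carrier (P.T i) \<Longrightarrow> Q.aug (\<phi>0 x) = f x"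
    using Q.lift_aug[OF P.T_proj f] by blast
  \<comment> \<open>The last clause pins the start of the recursion, so that the augmentation
    condition is still known after the choice.\<close>
  let ?I = "\<lambda>k \<phi>. \<phi> \<in> uHom A (P.T (i + k)) (Q.T k) \<and> (\<forall>x\<in>carrier (P.T (Suc (i + k))). \<phi> (P.dif (Suc (i + k)) x) \<in> res_ker Y Q k)
      \<and> (k = 0 \<longrightarrow> \<phi> = \<phi>0)"
  let ?S = "\<lambda>k \<phi> \<phi>'. \<forall>x\<in>carrier (P.T (Suc (i + k))). Q.dif (Suc k) (\<phi>' x) = \<phi> (P.dif (Suc (i + k)) x)"
  have "\<exists>\<phi>. \<forall>k. ?I k (\<phi> k) \<and> ?S k (\<phi> k) (\<phi> (Suc k))"
  proof (rule dependent_nat_choice)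
    have "?I 0 \<phi>0"
      using \<phi>0 fd by (simp add: res_ker_0 uHom_closed[OF P.T_gm Q.T_gm \<phi>0(1)])
    thus "\<exists>\<phi>. ?I 0 \<phi>" by blast
  next
    fix \<phi> k assume I: "?I k \<phi>"
    have \<phi>: "\<phi> \<in> uHom A (P.T (i + k)) (Q.T k)" using I by blast
    let ?\<phi>d = "\<lambda>x\<in>carrier (P.T (Suc (i + k))). \<phi> (P.dif (Suc (i + k)) x)"
    have "\<exists>h\<in>uHom A (P.T (Suc (i + k))) (Q.T (Suc k)). \<forall>x\<in>carrier (P.T (Suc (i + k))). Q.dif (Suc k) (h x) = ?\<phi>d x"
    proof (rule Q.lift_step[OF P.T_proj uHom_comp[OF P.T_gm P.T_gm Q.T_gm P.d_uHom \<phi>]])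
      show "?\<phi>d x \<in> res_ker Y Q k" if "x \<in> carrier (P.T (Suc (i + k)))" for x
        using I that by simp
    qed
    then obtain \<phi>' where \<phi>': "\<phi>' \<in> uHom A (P.T (Suc (i + k))) (Q.T (Suc k))"
      "\<And>x. x \<in> carrier (P.T (Suc (i + k))) \<Longrightarrow> Q.dif (Suc k) (\<phi>' x) = \<phi> (P.dif (Suc (i + k)) x)"
      by (metis (no_types, lifting) restrict_apply')
    have "\<phi>' (P.dif (Suc (Suc (i + k))) x) \<in> res_ker Y Q (Suc k)" if x: "x \<in> carrier (P.T (Suc (Suc (i + k))))" for x
      using \<phi>'(2) x uHom_closed[OF P.T_gm Q.T_gm \<phi>'(1)]
        uHom_0[OF P.T_gm Q.T_gm \<phi>]
      by (simp add: res_ker_Suc)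
    hence "?I (Suc k) \<phi>'" using \<phi>'(1) by simp
    moreover have "?S k \<phi> \<phi>'" using \<phi>'(2) by blast
    ultimately show "\<exists>\<phi>'. ?I (Suc k) \<phi>' \<and> ?S k \<phi> \<phi>'" by blast
  qed
  then obtain \<phi> where \<phi>\<phi>: "\<forall>k. ?I k (\<phi> k) \<and> ?S k (\<phi> k) (\<phi> (Suc k))" by (rule exE)
  have \<phi>: "?I k (\<phi> k)" "?S k (\<phi> k) (\<phi> (Suc k))" for k
    using spec[OF \<phi>\<phi>, of k] by (rule conjunct1, rule conjunct2)
  have "\<phi> 0 = \<phi>0" using \<phi>(1)[of 0] by simp
  hence "lifts A P Q i f \<phi>" unfolding lifts_def using \<phi>0(2) \<phi> by simp
  thus ?thesis by blast
qed

text \<open>A chain homotopy between two lifts of the same cocycle. At the bottom both maps cover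
  \<open>f\<close>, so their difference takes values in the kernel of the augmentation and only the
  term d h appears; above, h d joins it.\<close>

lemma lifts_homotopy:
  assumes \<phi>: "lifts A P Q i f \<phi>" and \<psi>: "lifts A P Q i f \<psi>"
  obtains h where "\<And>k. h k \<in> uHom A (P.T (i + k)) (Q.T (Suc k))"
    "\<And>x. x \<in> carrier (P.T i) \<Longrightarrow> \<phi> 0 x = \<psi> 0 x \<oplus>\<^bsub>Q.T 0\<^esub> Q.dif (Suc 0) (h 0 x)"
    "\<And>k x. x \<in> carrier (P.T (Suc (i + k))) \<Longrightarrow>
      \<phi> (Suc k) x = \<psi> (Suc k) x \<oplus>\<^bsub>Q.T (Suc k)\<^esub> (Q.dif (Suc (Suc k)) (h (Suc k) x) \<oplus>\<^bsub>Q.T (Suc k)\<^esub> h k (P.dif (Suc (i + k)) x))"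
proof -
  let ?U = "\<lambda>k. carrier (P.T (Suc (i + k)))" and ?d = "\<lambda>k. P.dif (Suc (i + k))" and ?e = "\<lambda>k. Q.dif (Suc k)"
  have u: "\<phi> k \<in> uHom A (P.T (i + k)) (Q.T k)" "\<psi> k \<in> uHom A (P.T (i + k)) (Q.T k)" for k
    using \<phi> \<psi> unfolding lifts_def by blast+
  define \<delta> where "\<delta> = (\<lambda>k. \<lambda>x\<in>carrier (P.T (i + k)). \<phi> k x \<oplus>\<^bsub>Q.T k\<^esub> (\<lambda>x\<in>carrier (P.T (i + k)). \<ominus>\<^bsub>Q.T k\<^esub> \<psi> k x) x)"
  have \<delta>: "\<delta> k \<in> uHom A (P.T (i + k)) (Q.T k)" for k
    unfolding \<delta>_def by (rule uHom_add[OF P.T_gm Q.T_gm u(1) uHom_neg[OF P.T_gm Q.T_gm u(2)]])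
  have \<delta>x: "\<delta> k x = \<phi> k x \<oplus>\<^bsub>Q.T k\<^esub> \<ominus>\<^bsub>Q.T k\<^esub> \<psi> k x" if "x \<in> carrier (P.T (i + k))" for k x
    unfolding \<delta>_def using that by simp
  note uc = uHom_closed[OF P.T_gm Q.T_gm u(1)] uHom_closed[OF P.T_gm Q.T_gm u(2)]
  have \<delta>d: "?e k (\<delta> (Suc k) x) = \<delta> k (?d k x)" if x: "x \<in> ?U k" for k x
  proof -
    have "?e k (\<phi> (Suc k) x) = \<phi> k (?d k x)" "?e k (\<psi> (Suc k) x) = \<psi> k (?d k x)"
      using \<phi> \<psi> x unfolding lifts_def by blast+
    moreover have c: "\<phi> (Suc k) x \<in> carrier (Q.T (Suc k))" "\<psi> (Suc k) x \<in> carrier (Q.T (Suc k))"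
      using uc[of _ "Suc k"] x by simp_all
    moreover note abelian_group.a_inv_closed[OF Q.T_group c(2)]
    ultimately show ?thesis using x
      by (simp add: \<delta>x lin_add[OF Hom_lin[OF Q.d_Hom]] lin_neg[OF Hom_lin[OF Q.d_Hom] Q.T_group Q.T_group])
  qed
  have \<delta>0: "\<delta> 0 x \<in> res_ker Y Q 0" if x: "x \<in> carrier (P.T i)" for x
  proof -
    interpret Y: graded_module A Y by (rule Q.M)
    have 1: "Q.aug (\<phi> 0 x) = f x" "Q.aug (\<psi> 0 x) = f x" using \<phi> \<psi> x unfolding lifts_def by blast+
    have c: "\<phi> 0 x \<in> carrier (Q.T 0)" "\<psi> 0 x \<in> carrier (Q.T 0)"
      using uc[of _ 0] x by simp_all
    have "f x \<in> carrier Y" using Q.aug_closed[OF c(1)] 1 by simp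
    hence "Q.aug (\<delta> 0 x) = \<zero>\<^bsub>Y\<^esub>" using x 1 c abelian_group.a_inv_closed[OF Q.T_group c(2)]
      by (simp add: \<delta>x lin_add[OF Hom_lin[OF Q.aug_Hom]] lin_neg[OF Hom_lin[OF Q.aug_Hom] Q.T_group gm_group[OF Q.M]] Y.M.r_neg)
    thus ?thesis unfolding res_ker_0 using uHom_closed[OF P.T_gm Q.T_gm \<delta>[of 0]] x by simp
  qed
  \<comment> \<open>The second clause, d h d = \<delta> d, makes \<delta> - h d a cycle at the next
    step; the third fixes the start.\<close>
  let ?I = "\<lambda>k h. h \<in> uHom A (P.T (i + k)) (Q.T (Suc k)) \<and>
      (\<forall>x\<in>?U k. ?e k (h (?d k x)) = \<delta> k (?d k x))
      \<and> (k = 0 \<longrightarrow> (\<forall>x\<in>carrier (P.T i). Q.dif (Suc 0) (h x) = \<delta> 0 x))"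
  let ?S = "\<lambda>k h h'. \<forall>x\<in>?U k. \<delta> (Suc k) x = Q.dif (Suc (Suc k)) (h' x) \<oplus>\<^bsub>Q.T (Suc k)\<^esub> h (?d k x)"
  have "\<exists>h. \<forall>k. ?I k (h k) \<and> ?S k (h k) (h (Suc k))"
  proof (rule dependent_nat_choice)
    have "\<delta> 0 \<in> uHom A (P.T i) (Q.T 0)" using \<delta>[of 0] by simp
    from Q.lift_step[OF P.T_proj[of i] this \<delta>0]
    obtain h where "h \<in> uHom A (P.T i) (Q.T (Suc 0))" "\<forall>x\<in>carrier (P.T i). Q.dif (Suc 0) (h x) = \<delta> 0 x"
      by blast
    hence "?I 0 h" by simp
    thus "\<exists>h. ?I 0 h" by blast
  next
    fix h k assume I: "?I k h"
    interpret Q1: graded_module A "Q.T (Suc k)" by (rule Q.T_gm)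
    interpret Q0: graded_module A "Q.T k" by (rule Q.T_gm)
    have h: "h \<in> uHom A (P.T (i + k)) (Q.T (Suc k))" using I by blast
    let ?hd = "\<lambda>x\<in>?U k. h (?d k x)"
    have hd: "?hd \<in> uHom A (P.T (Suc (i + k))) (Q.T (Suc k))"
      by (rule uHom_comp[OF P.T_gm P.T_gm Q.T_gm P.d_uHom h])
    define \<epsilon> where "\<epsilon> = (\<lambda>x\<in>?U k. \<delta> (Suc k) x \<oplus>\<^bsub>Q.T (Suc k)\<^esub> (\<lambda>x\<in>?U k. \<ominus>\<^bsub>Q.T (Suc k)\<^esub> ?hd x) x)"
    have \<delta>': "\<delta> (Suc k) \<in> uHom A (P.T (Suc (i + k))) (Q.T (Suc k))" using \<delta>[of "Suc k"] by simp
    have \<epsilon>: "\<epsilon> \<in> uHom A (P.T (Suc (i + k))) (Q.T (Suc k))"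
      unfolding \<epsilon>_def by (rule uHom_add[OF P.T_gm Q.T_gm \<delta>' uHom_neg[OF P.T_gm Q.T_gm hd]])
    have hc: "h (?d k x) \<in> carrier (Q.T (Suc k))" if "x \<in> ?U k" for x
      using uHom_closed[OF P.T_gm Q.T_gm h] that by simp
    have \<delta>c: "\<delta> (Suc k) x \<in> carrier (Q.T (Suc k))" if "x \<in> ?U k" for x
      using uHom_closed[OF P.T_gm Q.T_gm \<delta>'] that by simp
    have \<epsilon>x: "\<epsilon> x = \<delta> (Suc k) x \<oplus>\<^bsub>Q.T (Suc k)\<^esub> \<ominus>\<^bsub>Q.T (Suc k)\<^esub> h (?d k x)" if "x \<in> ?U k" for x
      unfolding \<epsilon>_def using that by simp
    have "\<epsilon> x \<in> res_ker Y Q (Suc k)" if x: "x \<in> ?U k" for x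
    proof -
      have "?e k (\<epsilon> x) = ?e k (\<delta> (Suc k) x) \<oplus>\<^bsub>Q.T k\<^esub> \<ominus>\<^bsub>Q.T k\<^esub> ?e k (h (?d k x))"
        using x by (simp add: \<epsilon>x hc \<delta>c lin_add[OF Hom_lin[OF Q.d_Hom]] lin_neg[OF Hom_lin[OF Q.d_Hom] Q.T_group Q.T_group])
      also have "\<dots> = \<zero>\<^bsub>Q.T k\<^esub>"
        using I \<delta>d[OF x] x uHom_closed[OF P.T_gm Q.T_gm \<delta>[of k], of "?d k x"] by (simp add: Q0.M.r_neg)
      finally show ?thesis using uHom_closed[OF P.T_gm Q.T_gm \<epsilon> x] by (simp add: res_ker_Suc)
    qed
    then obtain h' where h': "h' \<in> uHom A (P.T (Suc (i + k))) (Q.T (Suc (Suc k)))"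
      "\<forall>x\<in>?U k. Q.dif (Suc (Suc k)) (h' x) = \<epsilon> x"
      using Q.lift_step[OF P.T_proj \<epsilon>] by blast
    have S: "?S k h h'"
    proof
      fix x assume x: "x \<in> ?U k"
      show "\<delta> (Suc k) x = Q.dif (Suc (Suc k)) (h' x) \<oplus>\<^bsub>Q.T (Suc k)\<^esub> h (?d k x)"
        using h'(2) x hc[OF x] \<delta>c[OF x] by (simp add: \<epsilon>x Q1.M.a_assoc Q1.M.l_neg)
    qed
    have "Q.dif (Suc (Suc k)) (h' (P.dif (Suc (Suc (i + k))) x)) = \<delta> (Suc k) (P.dif (Suc (Suc (i + k))) x)"
      if x: "x \<in> carrier (P.T (Suc (Suc (i + k))))" for x
    proof -
      have "h (?d k (P.dif (Suc (Suc (i + k))) x)) = \<zero>\<^bsub>Q.T (Suc k)\<^esub>"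
        using x uHom_0[OF P.T_gm Q.T_gm h] by simp
      moreover have "h' (P.dif (Suc (Suc (i + k))) x) \<in> carrier (Q.T (Suc (Suc k)))"
        using uHom_closed[OF P.T_gm Q.T_gm h'(1)] x by simp
      ultimately show ?thesis using S x by simp
    qed
    hence "?I (Suc k) h'" using h'(1) by simp
    thus "\<exists>h'. ?I (Suc k) h' \<and> ?S k h h'" using S by blast
  qed
  then obtain h where hh: "\<forall>k. ?I k (h k) \<and> ?S k (h k) (h (Suc k))" by (rule exE)
  have h: "?I k (h k)" "?S k (h k) (h (Suc k))" for k
    using spec[OF hh, of k] by (rule conjunct1, rule conjunct2)
  have hu: "h k \<in> uHom A (P.T (i + k)) (Q.T (Suc k))" for k using h(1) by blast
  have eq: "\<phi> k x = \<psi> k x \<oplus>\<^bsub>Q.T k\<^esub> \<delta> k x" if x: "x \<in> carrier (P.T (i + k))" for k x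
  proof -
    interpret Q0: graded_module A "Q.T k" by (rule Q.T_gm)
    have "\<psi> k x \<oplus>\<^bsub>Q.T k\<^esub> (\<phi> k x \<oplus>\<^bsub>Q.T k\<^esub> \<ominus>\<^bsub>Q.T k\<^esub> \<psi> k x) = \<phi> k x"
      using uc[OF x] Q0.M.a_lcomm[of "\<psi> k x" "\<phi> k x" "\<ominus>\<^bsub>Q.T k\<^esub> \<psi> k x"] by (simp add: Q0.M.r_neg)
    thus ?thesis using \<delta>x[OF x] by simp
  qed
  show ?thesis
  proof (rule that[of h, OF hu])
    show "\<phi> 0 x = \<psi> 0 x \<oplus>\<^bsub>Q.T 0\<^esub> Q.dif (Suc 0) (h 0 x)" if "x \<in> carrier (P.T i)" for x
      using eq[of x 0] h(1)[of 0] that by simp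
    show "\<phi> (Suc k) x = \<psi> (Suc k) x \<oplus>\<^bsub>Q.T (Suc k)\<^esub> (Q.dif (Suc (Suc k)) (h (Suc k) x) \<oplus>\<^bsub>Q.T (Suc k)\<^esub> h k (?d k x))"
      if "x \<in> ?U k" for k x
      using eq[of x "Suc k"] h(2)[of k] that by simp
  qed
qed

end

section \<open>Ext groups and Yoneda products\<close>

locale ext_source = gp_resolution A X "proj_res A X" for A :: "'a graded_ring" (structure) and X :: "('a, 'm) graded_module"

locale ext_pair = ext_source A X for A :: "'a graded_ring" (structure) and X :: "('a, 'm) graded_module" +
  fixes Y :: "('a, 'n) graded_module"
  assumes Y: "graded_module A Y"
begin

abbreviation "E n \<equiv> Ext A n X Y"
abbreviation "Z n \<equiv> cocycles A n X Y"
abbreviation "B n \<equiv> coboundaries A n X Y"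
abbreviation "cl n \<equiv> ext_class A n X Y"
abbreviation plus where "plus n f g \<equiv> (\<lambda>x\<in>carrier (T n). f x \<oplus>\<^bsub>Y\<^esub> g x)"
abbreviation neg where "neg n f \<equiv> (\<lambda>x\<in>carrier (T n). \<ominus>\<^bsub>Y\<^esub> f x)"
abbreviation nul where "nul n \<equiv> (\<lambda>x\<in>carrier (T n). \<zero>\<^bsub>Y\<^esub>)"

lemma uHom_group_simps: "carrier (uHom_group A V Y) = uHom A V Y"
  "f \<otimes>\<^bsub>uHom_group A V Y\<^esub> g = (\<lambda>x\<in>carrier V. f x \<oplus>\<^bsub>Y\<^esub> g x)"
  "\<one>\<^bsub>uHom_group A V Y\<^esub> = (\<lambda>x\<in>carrier V. \<zero>\<^bsub>Y\<^esub>)"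
  unfolding uHom_group_def by simp_all

lemma Z_iff: "f \<in> Z n \<longleftrightarrow> f \<in> uHom A (T n) Y \<and> (\<forall>x\<in>carrier (T (Suc n)). f (dif (Suc n) x) = \<zero>\<^bsub>Y\<^esub>)"
  unfolding cocycles_def cochains_def uHom_group_simps by blast

lemma Z_uHom: "f \<in> Z n \<Longrightarrow> f \<in> uHom A (T n) Y"
  and Z_d: "f \<in> Z n \<Longrightarrow> x \<in> carrier (T (Suc n)) \<Longrightarrow> f (dif (Suc n) x) = \<zero>\<^bsub>Y\<^esub>"
  unfolding Z_iff by blast+

lemma uHom_Y_closed: "\<lbrakk>f \<in> uHom A (T n) Y; x \<in> carrier (T n)\<rbrakk> \<Longrightarrow> f x \<in> carrier Y"
  by (rule uHom_closed[OF T_gm Y])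

lemma Z_closed: "\<lbrakk>f \<in> Z n; x \<in> carrier (T n)\<rbrakk> \<Longrightarrow> f x \<in> carrier Y"
  by (rule uHom_Y_closed[OF Z_uHom])

lemma B_0: "B 0 = {nul 0}"
  unfolding coboundaries_def cochains_def uHom_group_simps by simp

lemma B_Suc: "B (Suc k) = (\<lambda>g. \<lambda>x\<in>carrier (T (Suc k)). g (dif (Suc k) x)) ` uHom A (T k) Y"
  unfolding coboundaries_def cochains_def uHom_group_simps compose_def by simp

lemma Z_eqI: "\<lbrakk>f \<in> uHom A (T n) Y; g \<in> uHom A (T n) Y; \<And>x. x \<in> carrier (T n) \<Longrightarrow> f x = g x\<rbrakk> \<Longrightarrow> f = g"
  by (rule uHom_eqI[OF T_gm Y])

lemma nul_Z: "nul n \<in> Z n"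
  unfolding Z_iff using uHom_zero[OF Y] by simp

lemma plus_Z: assumes "f \<in> Z n" "g \<in> Z n" shows "plus n f g \<in> Z n"
proof -
  interpret Y: graded_module A Y by (rule Y)
  show ?thesis
    unfolding Z_iff using uHom_add[OF T_gm Y Z_uHom[OF assms(1)] Z_uHom[OF assms(2)]] Z_d[OF assms(1)] Z_d[OF assms(2)] by simp
qed

lemma neg_Z: assumes "f \<in> Z n" shows "neg n f \<in> Z n"
proof -
  interpret Y: graded_module A Y by (rule Y)
  have "\<ominus>\<^bsub>Y\<^esub> \<zero>\<^bsub>Y\<^esub> = \<zero>\<^bsub>Y\<^esub>" by (metis Y.M.add.inv_one a_inv_def)
  thus ?thesis
    unfolding Z_iff using uHom_neg[OF T_gm Y Z_uHom[OF assms(1)]] Z_d[OF assms(1)] by simp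
qed

lemma B_Z: "b \<in> B n \<Longrightarrow> b \<in> Z n"
proof (cases n)
  case 0
  thus "b \<in> B n \<Longrightarrow> b \<in> Z n" using B_0 nul_Z by simp
next
  case (Suc k)
  assume "b \<in> B n"
  then obtain g where g: "b = (\<lambda>x\<in>carrier (T (Suc k)). g (dif (Suc k) x))" "g \<in> uHom A (T k) Y"
    unfolding Suc B_Suc by (rule imageE)
  have "b \<in> uHom A (T (Suc k)) Y"
    unfolding g(1) by (rule uHom_comp[OF T_gm T_gm Y d_uHom g(2)])
  moreover have "b (dif (Suc (Suc k)) x) = \<zero>\<^bsub>Y\<^esub>" if "x \<in> carrier (T (Suc (Suc k)))" for x
    unfolding g(1) using that lin_zero[OF uHom_lin[OF T_gm Y g(2)] gm_group[OF T_gm] gm_group[OF Y]] by simp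
  ultimately show ?thesis unfolding Suc Z_iff by blast
qed

abbreviation "ZG n \<equiv> (uHom_group A (T n) Y)\<lparr>carrier := Z n\<rparr>"

lemma ZG_simps: "carrier (ZG n) = Z n" "f \<otimes>\<^bsub>ZG n\<^esub> g = plus n f g" "\<one>\<^bsub>ZG n\<^esub> = nul n"
  by (simp_all add: uHom_group_simps)

lemma ZG_group: "comm_group (ZG n)"
proof -
  interpret Y: graded_module A Y by (rule Y)
  show ?thesis
  proof (rule comm_groupI, unfold ZG_simps)
    fix f g h assume f: "f \<in> Z n" and g: "g \<in> Z n" and h: "h \<in> Z n"
    note c = Z_closed[OF f] Z_closed[OF g] Z_closed[OF h]
    show "plus n f g \<in> Z n" by (rule plus_Z[OF f g])
    show "plus n (plus n f g) h = plus n f (plus n g h)"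
      by (rule restrict_ext) (simp add: c Y.M.a_assoc)
    show "plus n f g = plus n g f"
      by (rule restrict_ext) (simp add: c Y.M.a_comm)
  next
    fix f assume f: "f \<in> Z n"
    note c = Z_closed[OF f]
    show "plus n (nul n) f = f"
      by (rule Z_eqI[OF Z_uHom[OF plus_Z[OF nul_Z f]] Z_uHom[OF f]]) (simp add: c)
    have "plus n (neg n f) f = nul n"
      by (rule restrict_ext) (simp add: c Y.M.l_neg)
    thus "\<exists>g\<in>Z n. plus n g f = nul n" using neg_Z[OF f] by blast
  qed (rule nul_Z)
qed

lemma ZG_inv: assumes f: "f \<in> Z n" shows "inv\<^bsub>ZG n\<^esub> f = neg n f"
proof -
  interpret Y: graded_module A Y by (rule Y)
  interpret G: comm_group "ZG n" by (rule ZG_group)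
  have "plus n (neg n f) f = nul n"
    by (rule restrict_ext) (simp add: Z_closed[OF f] Y.M.l_neg)
  thus ?thesis
    using f neg_Z[OF f] by (intro G.inv_equality) (simp_all only: ZG_simps)
qed

lemma B_subgroup: "subgroup (B n) (ZG n)"
proof -
  interpret Y: graded_module A Y by (rule Y)
  interpret G: comm_group "ZG n" by (rule ZG_group)
  have [simp]: "\<ominus>\<^bsub>Y\<^esub> \<zero>\<^bsub>Y\<^esub> = \<zero>\<^bsub>Y\<^esub>" by (metis Y.M.add.inv_one a_inv_def)
  show ?thesis
  proof (rule G.subgroupI, unfold ZG_simps)
    show "B n \<subseteq> Z n" using B_Z by blast
    show "B n \<noteq> {}" using uHom_zero[OF Y] by (cases n) (auto simp: B_0 B_Suc)
  next
    fix b assume b: "b \<in> B n"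
    have "neg n b \<in> B n"
    proof (cases n)
      case 0
      hence "b = nul 0" using b B_0 by simp
      hence "neg n b = nul 0" unfolding 0 by (intro restrict_ext) simp
      thus ?thesis unfolding 0 B_0 by (simp only: singletonI)
    next
      case (Suc k)
      obtain g where g: "b = (\<lambda>x\<in>carrier (T (Suc k)). g (dif (Suc k) x))" "g \<in> uHom A (T k) Y"
        using b unfolding Suc B_Suc by (rule imageE)
      have "neg n b = (\<lambda>x\<in>carrier (T (Suc k)). (neg k g) (dif (Suc k) x))"
        unfolding Suc g(1) by (rule restrict_ext) simp
      thus ?thesis unfolding Suc B_Suc using uHom_neg[OF T_gm Y g(2)] by (rule image_eqI)
    qed
    thus "inv\<^bsub>ZG n\<^esub> b \<in> B n" using ZG_inv[OF B_Z[OF b]] by (simp only:)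
    fix c assume c: "c \<in> B n"
    show "plus n b c \<in> B n"
    proof (cases n)
      case 0
      hence "b = nul 0" "c = nul 0" using b c B_0 by simp_all
      hence "plus n b c = nul 0" unfolding 0 by (intro restrict_ext) simp
      thus ?thesis unfolding 0 B_0 by (simp only: singletonI)
    next
      case (Suc k)
      obtain g where g: "b = (\<lambda>x\<in>carrier (T (Suc k)). g (dif (Suc k) x))" "g \<in> uHom A (T k) Y"
        using b unfolding Suc B_Suc by (rule imageE)
      obtain h where h: "c = (\<lambda>x\<in>carrier (T (Suc k)). h (dif (Suc k) x))" "h \<in> uHom A (T k) Y"
        using c unfolding Suc B_Suc by (rule imageE)
      have "plus n b c = (\<lambda>x\<in>carrier (T (Suc k)). (plus k g h) (dif (Suc k) x))"
        unfolding Suc g(1) h(1) by (rule restrict_ext) simp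
      thus ?thesis unfolding Suc B_Suc using uHom_add[OF T_gm Y g(2) h(2)] by (rule image_eqI)
    qed
  qed
qed

lemma cl_def': "cl n f = B n #>\<^bsub>ZG n\<^esub> f"
  unfolding ext_class_def cochains_def r_coset_def by simp

lemma E_def': "E n = ZG n Mod B n"
  unfolding Ext_def cochains_def ..

lemma E_group: "comm_group (E n)"
  unfolding E_def' by (rule comm_group.abelian_FactGroup[OF ZG_group B_subgroup])

lemma B_normal: "B n \<lhd> ZG n"
  by (rule comm_group.subgroup_imp_normal[OF ZG_group B_subgroup])

lemma E_carrier: "carrier (E n) = cl n ` Z n"
  unfolding E_def' carrier_FactGroup ZG_simps(1) cl_def' ..

lemma cl_closed: "f \<in> Z n \<Longrightarrow> cl n f \<in> carrier (E n)"
  unfolding E_carrier by (rule imageI)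

lemma E_cases: "\<alpha> \<in> carrier (E n) \<Longrightarrow> (\<And>f. f \<in> Z n \<Longrightarrow> \<alpha> = cl n f \<Longrightarrow> thesis) \<Longrightarrow> thesis"
  unfolding E_carrier by (erule imageE) blast

lemma cl_plus: "\<lbrakk>f \<in> Z n; g \<in> Z n\<rbrakk> \<Longrightarrow> cl n f \<otimes>\<^bsub>E n\<^esub> cl n g = cl n (plus n f g)"
  unfolding E_def' cl_def' mult_FactGroup
  using normal.rcos_sum[OF B_normal, of f n g] by (simp only: ZG_simps)

lemma cl_iff: "g \<in> cl n f \<longleftrightarrow> (\<exists>b\<in>B n. g = plus n b f)"
  unfolding cl_def' r_coset_def ZG_simps by blast

lemma cl_self: assumes f: "f \<in> Z n" shows "f \<in> cl n f"
proof -
  interpret G: comm_group "ZG n" by (rule ZG_group)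
  show ?thesis unfolding cl_def' using G.rcos_self[OF _ B_subgroup] f by (simp only: ZG_simps)
qed

lemma cl_Z: assumes "f \<in> Z n" "g \<in> cl n f" shows "g \<in> Z n"
proof -
  obtain b where "b \<in> B n" "g = plus n b f" using assms(2) unfolding cl_iff by blast
  thus ?thesis using plus_Z[OF B_Z assms(1)] by simp
qed

lemma cl_eqI: assumes f: "f \<in> Z n" and g: "g \<in> Z n" and b: "b \<in> B n" and eq: "\<And>x. x \<in> carrier (T n) \<Longrightarrow> g x = b x \<oplus>\<^bsub>Y\<^esub> f x"
  shows "cl n g = cl n f"
proof -
  interpret G: comm_group "ZG n" by (rule ZG_group)
  have "g = plus n b f"
    by (rule Z_eqI[OF Z_uHom[OF g] Z_uHom[OF plus_Z[OF B_Z[OF b] f]]]) (simp add: eq)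
  hence "g \<in> B n #>\<^bsub>ZG n\<^esub> f" using b cl_iff unfolding cl_def' by blast
  thus ?thesis
    unfolding cl_def' using G.repr_independence[OF _ _ B_subgroup] f by (simp only: ZG_simps)
qed

lemma cl_eqI0: assumes f: "f \<in> Z n" and g: "g \<in> Z n" and eq: "\<And>x. x \<in> carrier (T n) \<Longrightarrow> g x = f x"
  shows "cl n g = cl n f"
  using Z_eqI[OF Z_uHom[OF g] Z_uHom[OF f] eq] by simp

lemma cl_eqI1:
  assumes f: "f \<in> Z (Suc n)" and g: "g \<in> Z (Suc n)" and b: "b \<in> uHom A (T n) Y"
    and eq: "\<And>x. x \<in> carrier (T (Suc n)) \<Longrightarrow> g x = b (dif (Suc n) x) \<oplus>\<^bsub>Y\<^esub> f x"
  shows "cl (Suc n) g = cl (Suc n) f"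
proof (rule cl_eqI[OF f g])
  show "(\<lambda>x\<in>carrier (T (Suc n)). b (dif (Suc n) x)) \<in> B (Suc n)" unfolding B_Suc using b by blast
qed (simp add: eq)

lemma cl_eqD: assumes f: "f \<in> Z n" and g: "g \<in> Z n" and eq: "cl n g = cl n f"
  obtains b where "b \<in> B n" "\<And>x. x \<in> carrier (T n) \<Longrightarrow> g x = b x \<oplus>\<^bsub>Y\<^esub> f x"
proof -
  have "g \<in> cl n f" using cl_self[OF g] eq by simp
  then obtain b where "b \<in> B n" "g = plus n b f" unfolding cl_iff by blast
  thus ?thesis using that by simp
qed

lemma cl_eqD1: assumes f: "f \<in> Z (Suc n)" and g: "g \<in> Z (Suc n)" and eq: "cl (Suc n) g = cl (Suc n) f"
  obtains b where "b \<in> uHom A (T n) Y" "\<And>x. x \<in> carrier (T (Suc n)) \<Longrightarrow> g x = b (dif (Suc n) x) \<oplus>\<^bsub>Y\<^esub> f x"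
proof -
  obtain b where b: "b \<in> B (Suc n)" "\<And>x. x \<in> carrier (T (Suc n)) \<Longrightarrow> g x = b x \<oplus>\<^bsub>Y\<^esub> f x"
    by (rule cl_eqD[OF f g eq]) (rule that)
  obtain c where c: "b = (\<lambda>x\<in>carrier (T (Suc n)). c (dif (Suc n) x))" "c \<in> uHom A (T n) Y"
    using b(1) unfolding B_Suc by (rule imageE)
  show ?thesis by (rule that[OF c(2)]) (simp add: b(2) c(1))
qed

end

locale yon = graded_ring A + X: ext_source A X + Y: ext_source A Y
  for A :: "'a graded_ring" (structure) and X :: "('a, 'm) graded_module" and Y :: "('a, 'n) graded_module" +
  fixes Z :: "('a, 'l) graded_module"
  assumes Z: "graded_module A Z"

lemma ext_pairI: "ext_source A X \<Longrightarrow> graded_module A Y \<Longrightarrow> ext_pair A X Y"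
  by (intro ext_pair.intro ext_pair_axioms.intro)

lemma yonI: "ext_source A X \<Longrightarrow> ext_source A Y \<Longrightarrow> graded_module A Z \<Longrightarrow> yon A X Y Z"
  by (intro yon.intro yon_axioms.intro) (rule gp_resolution.axioms(1)[OF ext_source.axioms])

sublocale yon \<subseteq> XY: ext_pair A X Y by (rule ext_pairI[OF X.ext_source_axioms Y.M])
sublocale yon \<subseteq> YZ: ext_pair A Y Z by (rule ext_pairI[OF Y.ext_source_axioms Z])
sublocale yon \<subseteq> XZ: ext_pair A X Z by (rule ext_pairI[OF X.ext_source_axioms Z])
sublocale yon \<subseteq> R: two_resolutions A X "proj_res A X" Y "proj_res A Y"
  by (rule two_resolutions.intro[OF graded_ring_axioms X.gp_resolution_axioms Y.gp_resolution_axioms])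

lemma chain_lifts_iff: "\<phi> \<in> chain_lifts A i X Y f \<longleftrightarrow> lifts A (proj_res A X) (proj_res A Y) i f \<phi>"
  unfolding chain_lifts_def lifts_def by simp

section \<open>Well-definedness and additivity of Yoneda products\<close>

context yon begin

abbreviation comp where "comp i j g \<phi> \<equiv> (\<lambda>x\<in>carrier (X.T (i + j)). g (\<phi> j x))"
abbreviation "lft \<equiv> lifts A (proj_res A X) (proj_res A Y)"
abbreviation "yo j i \<equiv> yoneda A j i X Y Z"

lemma lift_cocycle: "f \<in> XY.Z i \<Longrightarrow> \<exists>\<phi>. lft i f \<phi>"
  by (rule R.lifts_exist[OF XY.Z_uHom XY.Z_d])

lemma liftsD:
  assumes "lft i f \<phi>"
  shows "\<phi> k \<in> uHom A (X.T (i + k)) (Y.T k)"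
    "x \<in> carrier (X.T i) \<Longrightarrow> Y.aug (\<phi> 0 x) = f x"
    "x \<in> carrier (X.T (Suc (i + k))) \<Longrightarrow> Y.dif (Suc k) (\<phi> (Suc k) x) = \<phi> k (X.dif (Suc (i + k)) x)"
    "x \<in> carrier (X.T (i + k)) \<Longrightarrow> \<phi> k x \<in> carrier (Y.T k)"
proof -
  show 1: "\<phi> k \<in> uHom A (X.T (i + k)) (Y.T k)" using assms unfolding lifts_def by blast
  show "x \<in> carrier (X.T (i + k)) \<Longrightarrow> \<phi> k x \<in> carrier (Y.T k)" by (rule uHom_closed[OF X.T_gm Y.T_gm 1])
qed (use assms in \<open>unfold lifts_def, blast+\<close>)

lemma comp_uHom:
  assumes "lft i f \<phi>" "g \<in> uHom A (Y.T j) Z"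
  shows "comp i j g \<phi> \<in> uHom A (X.T (i + j)) Z"
  by (rule uHom_comp[OF X.T_gm Y.T_gm Z liftsD(1)[OF assms(1)] assms(2)])

lemma comp_Z:
  assumes \<phi>: "lft i f \<phi>" and g: "g \<in> YZ.Z j"
  shows "comp i j g \<phi> \<in> XZ.Z (i + j)"
proof -
  have "comp i j g \<phi> (X.dif (Suc (i + j)) x) = \<zero>\<^bsub>Z\<^esub>" if x: "x \<in> carrier (X.T (Suc (i + j)))" for x
  proof -
    have "\<phi> (Suc j) x \<in> carrier (Y.T (Suc j))" using liftsD(4)[OF \<phi>, of x "Suc j"] x by simp
    thus ?thesis using YZ.Z_d[OF g] liftsD(3)[OF \<phi> x] x by (simp flip: liftsD(3)[OF \<phi> x])
  qed
  thus ?thesis unfolding XZ.Z_iff using comp_uHom[OF \<phi> YZ.Z_uHom[OF g]] by blast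
qed

text \<open>With \<phi> = \<psi> + d h + h d, the cocycle \<open>g\<close> kills d h, and g h d is a
  coboundary. For \<open>j = 0\<close> the term h d is absent and the composites agree.\<close>

lemma comp_homotopy:
  assumes \<phi>: "lft i f \<phi>" and \<psi>: "lft i f \<psi>"
    and g: "g \<in> YZ.Z j"
  shows "XZ.cl (i + j) (comp i j g \<phi>) = XZ.cl (i + j) (comp i j g \<psi>)"
proof -
  interpret Z: graded_module A Z by (rule Z)
  note gu = YZ.Z_uHom[OF g]
  note gl = uHom_lin[OF Y.T_gm Z gu]
  obtain h where h: "\<And>k. h k \<in> uHom A (X.T (i + k)) (Y.T (Suc k))"
    "\<And>x. x \<in> carrier (X.T i) \<Longrightarrow> \<phi> 0 x = \<psi> 0 x \<oplus>\<^bsub>Y.T 0\<^esub> Y.dif (Suc 0) (h 0 x)"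
    "\<And>k x. x \<in> carrier (X.T (Suc (i + k))) \<Longrightarrow>
      \<phi> (Suc k) x = \<psi> (Suc k) x \<oplus>\<^bsub>Y.T (Suc k)\<^esub> (Y.dif (Suc (Suc k)) (h (Suc k) x) \<oplus>\<^bsub>Y.T (Suc k)\<^esub> h k (X.dif (Suc (i + k)) x))"
    by (rule R.lifts_homotopy[OF \<phi> \<psi>]) (rule that)
  note hc = uHom_closed[OF X.T_gm Y.T_gm h(1)]
  show ?thesis
  proof (cases j)
    case 0
    show ?thesis
    proof (rule XZ.cl_eqI0[OF comp_Z[OF \<psi> g] comp_Z[OF \<phi> g]])
      fix x assume "x \<in> carrier (X.T (i + j))"
      hence x: "x \<in> carrier (X.T i)" unfolding 0 by simp
      have c: "\<psi> 0 x \<in> carrier (Y.T 0)" "h 0 x \<in> carrier (Y.T (Suc 0))"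
        using liftsD(4)[OF \<psi>, of x 0] hc[of x 0] x by simp_all
      show "comp i j g \<phi> x = comp i j g \<psi> x"
        using x c h(2)[OF x] YZ.Z_d[OF g, of "h 0 x"] lin_add[OF gl, of "\<psi> 0 x" "Y.dif (Suc 0) (h 0 x)"]
          YZ.Z_closed[OF g, of "\<psi> 0 x"] unfolding 0 by simp
    qed
  next
    case (Suc l)
    have cZ: "comp i (Suc l) g \<phi> \<in> XZ.Z (Suc (i + l))" "comp i (Suc l) g \<psi> \<in> XZ.Z (Suc (i + l))"
      using comp_Z[OF \<phi> g] comp_Z[OF \<psi> g] unfolding Suc by simp_all
    have "XZ.cl (Suc (i + l)) (comp i (Suc l) g \<phi>) = XZ.cl (Suc (i + l)) (comp i (Suc l) g \<psi>)"
    proof (rule XZ.cl_eqI1[OF cZ(2,1)])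
      show "(\<lambda>x\<in>carrier (X.T (i + l)). g (h l x)) \<in> uHom A (X.T (i + l)) Z"
        using uHom_comp[OF X.T_gm Y.T_gm Z h(1) gu[unfolded Suc]] .
      fix x assume x: "x \<in> carrier (X.T (Suc (i + l)))"
      have c: "\<psi> (Suc l) x \<in> carrier (Y.T (Suc l))" "h (Suc l) x \<in> carrier (Y.T (Suc (Suc l)))" "h l (X.dif (Suc (i + l)) x) \<in> carrier (Y.T (Suc l))"
        using liftsD(4)[OF \<psi>, of x "Suc l"] hc[of x "Suc l"] hc[of "X.dif (Suc (i + l)) x" l] x by simp_all
      interpret Y1: graded_module A "Y.T (Suc l)" by (rule Y.T_gm)
      have "g (\<phi> (Suc l) x) = g (\<psi> (Suc l) x) \<oplus>\<^bsub>Z\<^esub> (g (Y.dif (Suc (Suc l)) (h (Suc l) x)) \<oplus>\<^bsub>Z\<^esub> g (h l (X.dif (Suc (i + l)) x)))"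
        using h(3)[OF x] c by (simp add: lin_add[OF gl[unfolded Suc]])
      also have "g (Y.dif (Suc (Suc l)) (h (Suc l) x)) = \<zero>\<^bsub>Z\<^esub>"
        using YZ.Z_d[OF g[unfolded Suc] c(2)] .
      finally show "comp i (Suc l) g \<phi> x = (\<lambda>x\<in>carrier (X.T (i + l)). g (h l x)) (X.dif (Suc (i + l)) x) \<oplus>\<^bsub>Z\<^esub> comp i (Suc l) g \<psi> x"
        using x YZ.Z_closed[OF g[unfolded Suc] c(1)] YZ.Z_closed[OF g[unfolded Suc] c(3)] by (simp add: Z.M.a_comm)
    qed
    thus ?thesis unfolding Suc by simp
  qed
qed

text \<open>If \<open>g'\<close> and \<open>g\<close> differ by b d, the composites differ by b
  \<phi> d, since \<phi> commutes with the differentials; in degree 0 the only coboundary is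
  zero.\<close>

lemma comp_left_cob:
  assumes \<phi>: "lft i f \<phi>" and g: "g \<in> YZ.Z j" and g': "g' \<in> YZ.cl j g"
  shows "XZ.cl (i + j) (comp i j g' \<phi>) = XZ.cl (i + j) (comp i j g \<phi>)"
proof -
  interpret Z: graded_module A Z by (rule Z)
  obtain c where c: "c \<in> YZ.B j" "g' = YZ.plus j c g" using g' unfolding YZ.cl_iff by blast
  have g'Z: "g' \<in> YZ.Z j" by (rule YZ.cl_Z[OF g g'])
  show ?thesis
  proof (cases j)
    case 0
    hence c0: "c = YZ.nul 0" using c(1) YZ.B_0 by simp
    show ?thesis
    proof (rule XZ.cl_eqI0[OF comp_Z[OF \<phi> g] comp_Z[OF \<phi> g'Z]])
      fix x assume x: "x \<in> carrier (X.T (i + j))"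
      note p = liftsD(4)[OF \<phi> x]
      show "comp i j g' \<phi> x = comp i j g \<phi> x"
        using x p YZ.Z_closed[OF g p] unfolding c(2) c0 0 by simp
    qed
  next
    case (Suc l)
    obtain b where b: "c = (\<lambda>x\<in>carrier (Y.T (Suc l)). b (Y.dif (Suc l) x))" "b \<in> uHom A (Y.T l) Z"
      using c(1) unfolding Suc YZ.B_Suc by (rule imageE)
    have cZ: "comp i (Suc l) g' \<phi> \<in> XZ.Z (Suc (i + l))" "comp i (Suc l) g \<phi> \<in> XZ.Z (Suc (i + l))"
      using comp_Z[OF \<phi> g] comp_Z[OF \<phi> g'Z] unfolding Suc by simp_all
    have "XZ.cl (Suc (i + l)) (comp i (Suc l) g' \<phi>) = XZ.cl (Suc (i + l)) (comp i (Suc l) g \<phi>)"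
    proof (rule XZ.cl_eqI1[OF cZ(2,1)])
      show "comp i l b \<phi> \<in> uHom A (X.T (i + l)) Z" by (rule comp_uHom[OF \<phi> b(2)])
      fix x assume x: "x \<in> carrier (X.T (Suc (i + l)))"
      have "\<phi> (Suc l) x \<in> carrier (Y.T (Suc l))" using liftsD(4)[OF \<phi>, of x "Suc l"] x by simp
      thus "comp i (Suc l) g' \<phi> x = comp i l b \<phi> (X.dif (Suc (i + l)) x) \<oplus>\<^bsub>Z\<^esub> comp i (Suc l) g \<phi> x"
        using x liftsD(3)[OF \<phi> x] unfolding c(2) b(1) Suc by simp
    qed
    thus ?thesis unfolding Suc by simp
  qed
qed

text \<open>If \<open>f'\<close> and \<open>f\<close> differ by b d, a lift b' of b through the
  augmentation turns \<phi> into a lift of \<open>f'\<close>: add b' d to \<phi>_0 and keep all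
  higher terms, which is possible as d d = 0. Only for \<open>j = 0\<close> does the composite
  change, by the coboundary g b' d.\<close>

lemma comp_right_cob:
  assumes f: "f \<in> XY.Z i" and f': "f' \<in> XY.cl i f" and \<phi>: "lft i f \<phi>"
    and g: "g \<in> YZ.Z j"
  shows "\<exists>\<psi>. lft i f' \<psi> \<and> XZ.cl (i + j) (comp i j g \<psi>) = XZ.cl (i + j) (comp i j g \<phi>)"
proof -
  interpret Z: graded_module A Z by (rule Z)
  interpret Y: graded_module A Y by (rule Y.M)
  obtain c where c: "c \<in> XY.B i" "f' = XY.plus i c f" using f' unfolding XY.cl_iff by blast
  show ?thesis
  proof (cases i)
    case 0
    hence "c = XY.nul 0" using c(1) XY.B_0 by simp
    hence c0: "c = XY.nul i" unfolding 0 by (simp only:)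
    have "f' = f"
    proof (rule XY.Z_eqI[OF XY.Z_uHom[OF XY.cl_Z[OF f f']] XY.Z_uHom[OF f]])
      show "f' x = f x" if "x \<in> carrier (X.T i)" for x
        using that XY.Z_closed[OF f that] unfolding c(2) c0 by simp
    qed
    thus ?thesis using \<phi> by blast
  next
    case (Suc m)
    obtain b where b: "c = (\<lambda>x\<in>carrier (X.T (Suc m)). b (X.dif (Suc m) x))" "b \<in> uHom A (X.T m) Y"
      using c(1) unfolding Suc XY.B_Suc by (rule imageE)
    obtain b' where b': "b' \<in> uHom A (X.T m) (Y.T 0)" "\<And>x. x \<in> carrier (X.T m) \<Longrightarrow> Y.aug (b' x) = b x"
      using Y.lift_aug[OF X.T_proj b(2)] by blast
    interpret Y0: graded_module A "Y.T 0" by (rule Y.T_gm)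
    let ?b = "\<lambda>x\<in>carrier (X.T (Suc m)). b' (X.dif (Suc m) x)"
    define \<psi> where "\<psi> = \<phi>(0 := \<lambda>x\<in>carrier (X.T (Suc m)). ?b x \<oplus>\<^bsub>Y.T 0\<^esub> \<phi> 0 x)"
    have bu: "?b \<in> uHom A (X.T (Suc m)) (Y.T 0)" by (rule uHom_comp[OF X.T_gm X.T_gm Y.T_gm X.d_uHom b'(1)])
    have \<phi>0: "\<phi> 0 \<in> uHom A (X.T (Suc m)) (Y.T 0)" using liftsD(1)[OF \<phi>, of 0] unfolding Suc by simp
    note bc = uHom_closed[OF X.T_gm Y.T_gm b'(1)]
    note \<phi>0c = uHom_closed[OF X.T_gm Y.T_gm \<phi>0]
    have \<psi>: "lft i f' \<psi>"
      unfolding lifts_def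
    proof (intro conjI allI ballI)
      show "\<psi> k \<in> uHom A (X.T (i + k)) (Y.T k)" for k
        using uHom_add[OF X.T_gm Y.T_gm bu \<phi>0] liftsD(1)[OF \<phi>, of k] unfolding \<psi>_def Suc by simp
      show "Y.aug (\<psi> 0 x) = f' x" if x: "x \<in> carrier (X.T i)" for x
        using x bc \<phi>0c liftsD(2)[OF \<phi> x] b'(2) unfolding \<psi>_def c(2) b(1) Suc
        by (simp add: lin_add[OF Hom_lin[OF Y.aug_Hom]])
      show "Y.dif (Suc k) (\<psi> (Suc k) x) = \<psi> k (X.dif (Suc (i + k)) x)" if x: "x \<in> carrier (X.T (Suc (i + k)))" for k x
      proof (cases k)
        case 0
        have xx: "x \<in> carrier (X.T (Suc (Suc m)))" using x unfolding 0 Suc by simp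
        have "b' (X.dif (Suc m) (X.dif (Suc (Suc m)) x)) = \<zero>\<^bsub>Y.T 0\<^esub>"
          using xx uHom_0[OF X.T_gm Y.T_gm b'(1)] by simp
        thus ?thesis using liftsD(3)[OF \<phi>, of x 0] xx \<phi>0c[of "X.dif (Suc (Suc m)) x"] unfolding 0 Suc \<psi>_def by simp
      next
        case (Suc l)
        thus ?thesis using liftsD(3)[OF \<phi> x] unfolding \<psi>_def by simp
      qed
    qed
    have "XZ.cl (i + j) (comp i j g \<psi>) = XZ.cl (i + j) (comp i j g \<phi>)"
    proof (cases j)
      case 0
      note gu = YZ.Z_uHom[OF g[unfolded 0]]
      have cZ: "comp i 0 g \<psi> \<in> XZ.Z (Suc m)" "comp i 0 g \<phi> \<in> XZ.Z (Suc m)"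
        using comp_Z[OF \<phi> g] comp_Z[OF \<psi> g] unfolding Suc 0 by simp_all
      have "XZ.cl (Suc m) (comp i 0 g \<psi>) = XZ.cl (Suc m) (comp i 0 g \<phi>)"
      proof (rule XZ.cl_eqI1[OF cZ(2,1)])
        show "(\<lambda>x\<in>carrier (X.T m). g (b' x)) \<in> uHom A (X.T m) Z" by (rule uHom_comp[OF X.T_gm Y.T_gm Z b'(1) gu])
        fix x assume x: "x \<in> carrier (X.T (Suc m))"
        show "comp i 0 g \<psi> x = (\<lambda>x\<in>carrier (X.T m). g (b' x)) (X.dif (Suc m) x) \<oplus>\<^bsub>Z\<^esub> comp i 0 g \<phi> x"
          using x bc \<phi>0c unfolding Suc \<psi>_def by (simp add: lin_add[OF uHom_lin[OF Y.T_gm Z gu]])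
      qed
      thus ?thesis unfolding Suc 0 by simp
    next
      case (Suc l)
      have "\<psi> j = \<phi> j" unfolding \<psi>_def Suc by simp
      thus ?thesis by (simp only:)
    qed
    with \<psi> show ?thesis by blast
  qed
qed

text \<open>Collapses the union over all representatives and lifts to a single class; afterwards
  products are computed with one representative of each factor and one lift.\<close>

lemma yoneda_cl:
  assumes f: "f \<in> XY.Z i" and g: "g \<in> YZ.Z j" and \<phi>: "lft i f \<phi>"
  shows "yo j i (YZ.cl j g) (XY.cl i f) = XZ.cl (i + j) (comp i j g \<phi>)"
proof -
  have eq: "XZ.cl (i + j) (comp i j g' \<phi>') = XZ.cl (i + j) (comp i j g \<phi>)"
    if g': "g' \<in> YZ.cl j g" and f': "f' \<in> XY.cl i f" and \<phi>': "lft i f' \<phi>'" for g' f' \<phi>'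
  proof -
    obtain \<psi> where \<psi>: "lft i f' \<psi>"
      "XZ.cl (i + j) (comp i j g \<psi>) = XZ.cl (i + j) (comp i j g \<phi>)"
      using comp_right_cob[OF f f' \<phi> g] by blast
    show ?thesis
      using comp_left_cob[OF \<phi>' g g'] comp_homotopy[OF \<phi>' \<psi>(1) g] \<psi>(2) by simp
  qed
  show ?thesis
    unfolding yoneda_def compose_def chain_lifts_iff
  proof (rule antisym)
    show "(\<Union>g'\<in>YZ.cl j g. \<Union>f'\<in>XY.cl i f. \<Union>\<phi>\<in>chain_lifts A i X Y f'. XZ.cl (i + j) (comp i j g' \<phi>)) \<subseteq> XZ.cl (i + j) (comp i j g \<phi>)"
      by (intro UN_least equalityD1 eq) (simp_all only: chain_lifts_iff)
    have "\<phi> \<in> chain_lifts A i X Y f" using \<phi> chain_lifts_iff by blast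
    thus "XZ.cl (i + j) (comp i j g \<phi>) \<subseteq> (\<Union>g'\<in>YZ.cl j g. \<Union>f'\<in>XY.cl i f. \<Union>\<phi>\<in>chain_lifts A i X Y f'. XZ.cl (i + j) (comp i j g' \<phi>))"
      using YZ.cl_self[OF g] XY.cl_self[OF f] by blast
  qed
qed

lemma yoneda_closed:
  assumes "\<alpha> \<in> carrier (YZ.E j)" "\<beta> \<in> carrier (XY.E i)"
  shows "yo j i \<alpha> \<beta> \<in> carrier (XZ.E (i + j))"
proof -
  obtain g f where g: "g \<in> YZ.Z j" "\<alpha> = YZ.cl j g" and f: "f \<in> XY.Z i" "\<beta> = XY.cl i f"
    using YZ.E_cases[OF assms(1)] XY.E_cases[OF assms(2)] by metis
  obtain \<phi> where \<phi>: "lft i f \<phi>" using lift_cocycle[OF f(1)] by blast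
  show ?thesis unfolding g(2) f(2) yoneda_cl[OF f(1) g(1) \<phi>] by (rule XZ.cl_closed[OF comp_Z[OF \<phi> g(1)]])
qed

lemma yoneda_add_left:
  assumes "\<alpha> \<in> carrier (YZ.E j)" "\<alpha>' \<in> carrier (YZ.E j)" "\<beta> \<in> carrier (XY.E i)"
  shows "yo j i (\<alpha> \<otimes>\<^bsub>YZ.E j\<^esub> \<alpha>') \<beta> = yo j i \<alpha> \<beta> \<otimes>\<^bsub>XZ.E (i + j)\<^esub> yo j i \<alpha>' \<beta>"
proof -
  obtain g where g: "g \<in> YZ.Z j" "\<alpha> = YZ.cl j g" using assms(1) by (rule YZ.E_cases)
  obtain h where h: "h \<in> YZ.Z j" "\<alpha>' = YZ.cl j h" using assms(2) by (rule YZ.E_cases)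
  obtain f where f: "f \<in> XY.Z i" "\<beta> = XY.cl i f" using assms(3) by (rule XY.E_cases)
  obtain \<phi> where \<phi>: "lft i f \<phi>" using lift_cocycle[OF f(1)] by blast
  have "comp i j (YZ.plus j g h) \<phi> = XZ.plus (i + j) (comp i j g \<phi>) (comp i j h \<phi>)"
    by (rule restrict_ext) (simp add: liftsD(4)[OF \<phi>])
  thus ?thesis
    unfolding g(2) h(2) f(2) YZ.cl_plus[OF g(1) h(1)] yoneda_cl[OF f(1) g(1) \<phi>] yoneda_cl[OF f(1) h(1) \<phi>]
      yoneda_cl[OF f(1) YZ.plus_Z[OF g(1) h(1)] \<phi>] XZ.cl_plus[OF comp_Z[OF \<phi> g(1)] comp_Z[OF \<phi> h(1)]]
    by (simp only:)
qed

lemma yoneda_add_right: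
  assumes "\<alpha> \<in> carrier (YZ.E j)" "\<beta> \<in> carrier (XY.E i)" "\<beta>' \<in> carrier (XY.E i)"
  shows "yo j i \<alpha> (\<beta> \<otimes>\<^bsub>XY.E i\<^esub> \<beta>') = yo j i \<alpha> \<beta> \<otimes>\<^bsub>XZ.E (i + j)\<^esub> yo j i \<alpha> \<beta>'"
proof -
  obtain g where g: "g \<in> YZ.Z j" "\<alpha> = YZ.cl j g" using assms(1) by (rule YZ.E_cases)
  obtain f where f: "f \<in> XY.Z i" "\<beta> = XY.cl i f" using assms(2) by (rule XY.E_cases)
  obtain f' where f': "f' \<in> XY.Z i" "\<beta>' = XY.cl i f'" using assms(3) by (rule XY.E_cases)
  obtain \<phi> where \<phi>: "lft i f \<phi>" using lift_cocycle[OF f(1)] by blast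
  obtain \<psi> where \<psi>: "lft i f' \<psi>" using lift_cocycle[OF f'(1)] by blast
  let ?\<chi> = "\<lambda>k. \<lambda>x\<in>carrier (X.T (i + k)). \<phi> k x \<oplus>\<^bsub>Y.T k\<^esub> \<psi> k x"
  note c = liftsD(4)[OF \<phi>] liftsD(4)[OF \<psi>]
  have \<chi>: "lft i (XY.plus i f f') ?\<chi>"
    unfolding lifts_def
  proof (intro conjI allI ballI)
    show "?\<chi> k \<in> uHom A (X.T (i + k)) (Y.T k)" for k
      by (rule uHom_add[OF X.T_gm Y.T_gm liftsD(1)[OF \<phi>] liftsD(1)[OF \<psi>]])
    show "Y.aug (?\<chi> 0 x) = XY.plus i f f' x" if x: "x \<in> carrier (X.T i)" for x
      using x c[of x 0] liftsD(2)[OF \<phi> x] liftsD(2)[OF \<psi> x] by (simp add: lin_add[OF Hom_lin[OF Y.aug_Hom]])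
    show "Y.dif (Suc k) (?\<chi> (Suc k) x) = ?\<chi> k (X.dif (Suc (i + k)) x)" if x: "x \<in> carrier (X.T (Suc (i + k)))" for k x
      using x c[of x "Suc k"] liftsD(3)[OF \<phi> x] liftsD(3)[OF \<psi> x] by (simp add: lin_add[OF Hom_lin[OF Y.d_Hom]])
  qed
  have "comp i j g ?\<chi> = XZ.plus (i + j) (comp i j g \<phi>) (comp i j g \<psi>)"
    by (rule restrict_ext) (simp add: c lin_add[OF uHom_lin[OF Y.T_gm Z YZ.Z_uHom[OF g(1)]]])
  thus ?thesis
    unfolding g(2) f'(2) f(2) XY.cl_plus[OF f(1) f'(1)] yoneda_cl[OF f(1) g(1) \<phi>] yoneda_cl[OF f'(1) g(1) \<psi>]
      yoneda_cl[OF XY.plus_Z[OF f(1) f'(1)] g(1) \<chi>] XZ.cl_plus[OF comp_Z[OF \<phi> g(1)] comp_Z[OF \<psi> g(1)]]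
    by (simp only:)
qed

lemma yoneda_zero_left:
  assumes "\<beta> \<in> carrier (XY.E i)" shows "yo j i \<one>\<^bsub>YZ.E j\<^esub> \<beta> = \<one>\<^bsub>XZ.E (i + j)\<^esub>"
proof -
  interpret G: comm_group "YZ.E j" by (rule YZ.E_group)
  interpret H: comm_group "XZ.E (i + j)" by (rule XZ.E_group)
  have "yo j i \<one>\<^bsub>YZ.E j\<^esub> \<beta> \<otimes>\<^bsub>XZ.E (i + j)\<^esub> yo j i \<one>\<^bsub>YZ.E j\<^esub> \<beta> = yo j i \<one>\<^bsub>YZ.E j\<^esub> \<beta>"
    using yoneda_add_left[OF G.one_closed G.one_closed assms] by simp
  thus ?thesis using yoneda_closed[OF G.one_closed assms] H.l_cancel_one by blast
qed

lemma yoneda_zero_right: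
  assumes "\<alpha> \<in> carrier (YZ.E j)" shows "yo j i \<alpha> \<one>\<^bsub>XY.E i\<^esub> = \<one>\<^bsub>XZ.E (i + j)\<^esub>"
proof -
  interpret G: comm_group "XY.E i" by (rule XY.E_group)
  interpret H: comm_group "XZ.E (i + j)" by (rule XZ.E_group)
  have "yo j i \<alpha> \<one>\<^bsub>XY.E i\<^esub> \<otimes>\<^bsub>XZ.E (i + j)\<^esub> yo j i \<alpha> \<one>\<^bsub>XY.E i\<^esub> = yo j i \<alpha> \<one>\<^bsub>XY.E i\<^esub>"
    using yoneda_add_right[OF assms G.one_closed G.one_closed] by simp
  thus ?thesis using yoneda_closed[OF assms G.one_closed] H.l_cancel_one by blast
qed

end

text \<open>The composites \<chi>_l \<phi>_(j+l) form a lift of the cocycle g \<phi>_j. With this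
  lift both sides are represented by the same cocycle.\<close>

lemma yoneda_assoc:
  assumes "ext_source A X" "ext_source A Y" "ext_source A Z" "graded_module A W"
    and "\<gamma> \<in> carrier (Ext A k Z W)" "\<beta> \<in> carrier (Ext A j Y Z)" "\<alpha> \<in> carrier (Ext A i X Y)"
  shows "yoneda A k (i + j) X Z W \<gamma> (yoneda A j i X Y Z \<beta> \<alpha>) = yoneda A (j + k) i X Y W (yoneda A k j Y Z W \<gamma> \<beta>) \<alpha>"
proof -
  interpret X: ext_source A X by fact
  interpret Y: ext_source A Y by fact
  interpret Z: ext_source A Z by fact
  interpret YZ: yon A X Y Z by (rule yonI[OF assms(1,2) Z.M])
  interpret YW: yon A X Y W by (rule yonI[OF assms(1,2,4)])
  interpret ZW: yon A X Z W by (rule yonI[OF assms(1,3,4)])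
  interpret YZW: yon A Y Z W by (rule yonI[OF assms(2,3,4)])
  obtain h where h: "h \<in> cocycles A k Z W" "\<gamma> = ext_class A k Z W h" using assms(5) by (rule ZW.YZ.E_cases)
  obtain g where g: "g \<in> cocycles A j Y Z" "\<beta> = ext_class A j Y Z g" using assms(6) by (rule YZ.YZ.E_cases)
  obtain f where f: "f \<in> cocycles A i X Y" "\<alpha> = ext_class A i X Y f" using assms(7) by (rule YZ.XY.E_cases)
  obtain \<phi> where \<phi>: "lifts A (proj_res A X) (proj_res A Y) i f \<phi>" using YZ.lift_cocycle[OF f(1)] by blast
  obtain \<chi> where \<chi>: "lifts A (proj_res A Y) (proj_res A Z) j g \<chi>" using YZW.lift_cocycle[OF g(1)] by blast
  let ?\<psi> = "\<lambda>l. \<lambda>x\<in>carrier (X.T (i + (j + l))). \<chi> l (\<phi> (j + l) x)"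
  have c: "\<phi> (j + l) x \<in> carrier (Y.T (j + l))" if "x \<in> carrier (X.T (i + (j + l)))" for l x
    using YZ.liftsD(4)[OF \<phi> that] .
  have \<psi>: "lifts A (proj_res A X) (proj_res A Z) (i + j) (YZ.comp i j g \<phi>) ?\<psi>"
    unfolding lifts_def
  proof (intro conjI allI ballI)
    show "?\<psi> l \<in> uHom A (X.T (i + j + l)) (Z.T l)" for l
      using X.uHom_comp[OF X.T_gm Y.T_gm Z.T_gm YZ.liftsD(1)[OF \<phi>, of "j + l"] YZW.liftsD(1)[OF \<chi>, of l]]
      by (simp only: add.assoc)
    show "Z.aug (?\<psi> 0 x) = YZ.comp i j g \<phi> x" if x: "x \<in> carrier (X.T (i + j))" for x
      using YZW.liftsD(2)[OF \<chi>, of "\<phi> j x"] YZ.liftsD(4)[OF \<phi> x] x by simp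
    show "Z.dif (Suc l) (?\<psi> (Suc l) x) = ?\<psi> l (X.dif (Suc (i + j + l)) x)" if x: "x \<in> carrier (X.T (Suc (i + j + l)))" for l x
    proof -
      have x': "x \<in> carrier (X.T (Suc (i + (j + l))))" using x by (simp add: add.assoc)
      have 1: "Y.dif (Suc (j + l)) (\<phi> (Suc (j + l)) x) = \<phi> (j + l) (X.dif (Suc (i + (j + l))) x)"
        by (rule YZ.liftsD(3)[OF \<phi> x'])
      have 2: "\<phi> (Suc (j + l)) x \<in> carrier (Y.T (Suc (j + l)))" using YZ.liftsD(4)[OF \<phi>, of x "Suc (j + l)"] x' by simp
      show ?thesis using YZW.liftsD(3)[OF \<chi> 2] 1 x' X.d_closed[OF x'] by (simp add: add.assoc)
    qed
  qed
  note gf = YZ.comp_Z[OF \<phi> g(1)]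
  note hg = YZW.comp_Z[OF \<chi> h(1)]
  have "yoneda A k (i + j) X Z W \<gamma> (yoneda A j i X Y Z \<beta> \<alpha>) = ext_class A (i + j + k) X W (ZW.comp (i + j) k h ?\<psi>)"
    unfolding h(2) g(2) f(2) YZ.yoneda_cl[OF f(1) g(1) \<phi>] by (rule ZW.yoneda_cl[OF gf h(1) \<psi>])
  also have "ZW.comp (i + j) k h ?\<psi> = YW.comp i (j + k) (YZW.comp j k h \<chi>) \<phi>"
    unfolding add.assoc by (rule restrict_ext) (simp add: c)
  also have "ext_class A (i + j + k) X W \<dots> = yoneda A (j + k) i X Y W (yoneda A k j Y Z W \<gamma> \<beta>) \<alpha>"
    unfolding h(2) g(2) f(2) YZW.yoneda_cl[OF g(1) h(1) \<chi>] YW.yoneda_cl[OF f(1) hg \<phi>] add.assoc ..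
  finally show ?thesis .
qed

lemma (in ext_source) aug_cocycle: "aug \<in> cocycles A 0 X X"
proof -
  interpret ext_pair A X X by (rule ext_pairI[OF ext_source_axioms M])
  show ?thesis unfolding Z_iff using aug_uHom by simp
qed

text \<open>The identity maps lift the augmentation, so composing with this lift changes
  nothing.\<close>

lemma yoneda_one_right:
  assumes "ext_source A X" "graded_module A Z" and "\<alpha> \<in> carrier (Ext A j X Z)"
  shows "yoneda A j 0 X X Z \<alpha> (ext_class A 0 X X (res_aug (proj_res A X))) = \<alpha>"
proof -
  interpret X: ext_source A X by fact
  interpret yon A X X Z by (rule yonI[OF assms(1,1,2)])
  obtain g where g: "g \<in> YZ.Z j" "\<alpha> = YZ.cl j g" using assms(3) by (rule YZ.E_cases)
  let ?\<phi> = "\<lambda>k. \<lambda>x\<in>carrier (X.T k). x"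
  have \<phi>: "lifts A (proj_res A X) (proj_res A X) 0 X.aug ?\<phi>" by (rule X.lifts_id)
  have "comp 0 j g ?\<phi> = g"
    using X.uHom_ext[OF X.T_gm assms(2) YZ.Z_uHom[OF g(1)]] by (auto simp: fun_eq_iff extensional_def)
  thus ?thesis
    unfolding g(2) yoneda_cl[OF X.aug_cocycle g(1) \<phi>] by simp
qed

section \<open>Left ideals and the Jacobson radical\<close>

context ring begin

lemma left_ideal_iff:
  "left_ideal I R \<longleftrightarrow> I \<subseteq> carrier R \<and> \<zero> \<in> I \<and> (\<forall>x\<in>I. \<forall>y\<in>I. x \<oplus> y \<in> I) \<and> (\<forall>r\<in>carrier R. \<forall>x\<in>I. r \<otimes> x \<in> I)"
proof
  assume I: "left_ideal I R"
  interpret I: submodule I R "reg_module R" by (rule I)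
  show "I \<subseteq> carrier R \<and> \<zero> \<in> I \<and> (\<forall>x\<in>I. \<forall>y\<in>I. x \<oplus> y \<in> I) \<and> (\<forall>r\<in>carrier R. \<forall>x\<in>I. r \<otimes> x \<in> I)"
  proof (intro conjI ballI)
    show "I \<subseteq> carrier R" using I.subset by (simp add: reg_module_def)
    show "\<zero> \<in> I" using I.one_closed by (simp add: reg_module_def)
    show "x \<oplus> y \<in> I" if "x \<in> I" "y \<in> I" for x y using I.m_closed[OF that] by (simp add: reg_module_def)
    show "r \<otimes> x \<in> I" if "r \<in> carrier R" "x \<in> I" for r x using I.smult_closed[of r x] that by (simp add: reg_module_def)
  qed
next
  assume I: "I \<subseteq> carrier R \<and> \<zero> \<in> I \<and> (\<forall>x\<in>I. \<forall>y\<in>I. x \<oplus> y \<in> I) \<and> (\<forall>r\<in>carrier R. \<forall>x\<in>I. r \<otimes> x \<in> I)"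
  have inv: "\<ominus> x \<in> I" if x: "x \<in> I" for x
  proof -
    have "x \<in> carrier R" using x I by blast
    hence "\<ominus> x = (\<ominus> \<one>) \<otimes> x" by (simp add: l_minus)
    thus ?thesis using x I by simp
  qed
  have minv: "inv\<^bsub>add_monoid (reg_module R)\<^esub> x = \<ominus> x" for x
    unfolding a_inv_def m_inv_def reg_module_def by simp
  show "left_ideal I R"
  proof (intro submodule.intro subgroup.intro submodule_axioms.intro)
    show "inv\<^bsub>add_monoid (reg_module R)\<^esub> x \<in> I" if "x \<in> I" for x unfolding minv by (rule inv[OF that])
  qed (use I in \<open>auto simp: reg_module_def\<close>)
qed

lemma left_ideal_neg: assumes "left_ideal I R" "x \<in> I" shows "\<ominus> x \<in> I"
proof -
  have *: "x \<in> carrier R" "\<forall>r\<in>carrier R. \<forall>x\<in>I. r \<otimes> x \<in> I" using assms unfolding left_ideal_iff by blast+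
  hence "\<ominus> x = (\<ominus> \<one>) \<otimes> x" by (simp add: l_minus)
  thus ?thesis using * assms(2) by simp
qed

lemma left_ideal_whole: assumes "left_ideal I R" "\<one> \<in> I" shows "I = carrier R"
proof -
  have "x \<in> I" if "x \<in> carrier R" for x
    using assms that unfolding left_ideal_iff by (metis r_one)
  thus ?thesis using assms unfolding left_ideal_iff by blast
qed

lemma maximal_left_ideal_exists:
  assumes L: "left_ideal L R" and one: "\<one> \<notin> L"
  obtains I where "maximal_left_ideal I R" "L \<subseteq> I" "\<one> \<notin> I"
proof -
  let ?A = "{I. left_ideal I R \<and> L \<subseteq> I \<and> \<one> \<notin> I}"
  have "\<exists>M\<in>?A. \<forall>X\<in>?A. M \<subseteq> X \<longrightarrow> X = M"
  proof (rule subset_Zorn_nonempty)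
    show "?A \<noteq> {}" using assms by blast
    fix C assume C: "C \<noteq> {}" "subset.chain ?A C"
    have CA: "left_ideal I R" "L \<subseteq> I" "\<one> \<notin> I" if "I \<in> C" for I using that C(2) unfolding subset.chain_def by blast+
    have tot: "I \<subseteq> K \<or> K \<subseteq> I" if "I \<in> C" "K \<in> C" for I K using that C(2) unfolding subset.chain_def by blast
    have "left_ideal (\<Union>C) R"
      unfolding left_ideal_iff
    proof (intro conjI ballI)
      show "\<Union>C \<subseteq> carrier R" using CA(1) unfolding left_ideal_iff by blast
      show "\<zero> \<in> \<Union>C" using CA(1) C(1) unfolding left_ideal_iff by blast
    next
      fix x y assume "x \<in> \<Union>C" "y \<in> \<Union>C"
      then obtain I K where IK: "I \<in> C" "x \<in> I" "K \<in> C" "y \<in> K" by blast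
      then obtain T where "T \<in> C" "x \<in> T" "y \<in> T" using tot[OF IK(1,3)] by blast
      thus "x \<oplus> y \<in> \<Union>C" using CA(1) unfolding left_ideal_iff by blast
    next
      fix r x assume "r \<in> carrier R" "x \<in> \<Union>C"
      thus "r \<otimes> x \<in> \<Union>C" using CA(1) unfolding left_ideal_iff by blast
    qed
    moreover have "L \<subseteq> \<Union>C" using CA(2) C(1) by blast
    moreover have "\<one> \<notin> \<Union>C" using CA(3) by blast
    ultimately show "\<Union>C \<in> ?A" by simp
  qed
  then obtain M where M0: "M \<in> ?A" and max: "\<forall>X\<in>?A. M \<subseteq> X \<longrightarrow> X = M" by (rule bexE)
  have M: "left_ideal M R" "L \<subseteq> M" "\<one> \<notin> M" using M0 by simp_all
  have "maximal_left_ideal M R"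
    unfolding maximal_left_ideal_def
  proof (intro conjI allI impI M(1))
    show "M \<noteq> carrier R" using M(3) by auto
    fix K assume K: "left_ideal K R \<and> M \<subseteq> K"
    show "K = M \<or> K = carrier R"
    proof (cases "\<one> \<in> K")
      case True
      thus ?thesis using left_ideal_whole K by blast
    next
      case False
      hence "K \<in> ?A" using K M(2) by auto
      thus ?thesis using max K by simp
    qed
  qed
  thus ?thesis using that M by blast
qed

abbreviation "JR \<equiv> jacobson_radical R"

lemma jacobson_left_ideal: "left_ideal JR R"
proof -
  have "left_ideal I R" if "maximal_left_ideal I R" for I using that unfolding maximal_left_ideal_def by blast
  thus ?thesis unfolding left_ideal_iff jacobson_radical_def by blast
qed

text \<open>Otherwise the left ideal generated by \<open>\<one> \<ominus> a\<close> would lie in a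
  maximal left ideal, which contains \<open>a\<close> as well and hence 1.\<close>

lemma jacobson_unit:
  assumes a: "a \<in> JR" obtains u where "u \<in> carrier R" "u \<otimes> (\<one> \<ominus> a) = \<one>"
proof (rule ccontr)
  assume "\<not> thesis"
  with that have no: "u \<otimes> (\<one> \<ominus> a) \<noteq> \<one>" if "u \<in> carrier R" for u
    using \<open>u \<in> carrier R\<close> by blast
  have ac: "a \<in> carrier R" using a unfolding jacobson_radical_def by blast
  let ?L = "(\<lambda>u. u \<otimes> (\<one> \<ominus> a)) ` carrier R"
  have L: "left_ideal ?L R"
    unfolding left_ideal_iff
  proof (intro conjI ballI)
    show "?L \<subseteq> carrier R" using ac by auto
    show "\<zero> \<in> ?L" using ac by (intro image_eqI[of _ _ \<zero>]) auto
  next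
    fix x y assume "x \<in> ?L" "y \<in> ?L"
    then obtain u v where "x = u \<otimes> (\<one> \<ominus> a)" "y = v \<otimes> (\<one> \<ominus> a)" "u \<in> carrier R" "v \<in> carrier R" by blast
    thus "x \<oplus> y \<in> ?L" using ac by (intro image_eqI[of _ _ "u \<oplus> v"]) (auto simp: l_distr)
  next
    fix r x assume "r \<in> carrier R" "x \<in> ?L"
    then obtain u where "x = u \<otimes> (\<one> \<ominus> a)" "u \<in> carrier R" by blast
    thus "r \<otimes> x \<in> ?L" using ac \<open>r \<in> carrier R\<close> by (intro image_eqI[of _ _ "r \<otimes> u"]) (auto simp: m_assoc)
  qed
  have "\<one> \<notin> ?L"
  proof
    assume "\<one> \<in> ?L"
    then obtain u where "\<one> = u \<otimes> (\<one> \<ominus> a)" "u \<in> carrier R" by (rule imageE)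
    with no[of u] show False by simp
  qed
  obtain I where I: "maximal_left_ideal I R" "?L \<subseteq> I" "\<one> \<notin> I"
    by (rule maximal_left_ideal_exists[OF L \<open>\<one> \<notin> ?L\<close>]) (rule that)
  have "a \<in> I" using a I(1) unfolding jacobson_radical_def by simp
  moreover have "\<one> \<ominus> a \<in> I"
    using subsetD[OF I(2) imageI[OF one_closed]] ac by simp
  moreover have "left_ideal I R" using I(1) unfolding maximal_left_ideal_def by simp
  ultimately have "(\<one> \<ominus> a) \<oplus> a \<in> I" unfolding left_ideal_iff by simp
  moreover have "(\<one> \<ominus> a) \<oplus> a = \<one>" using ac by (simp add: a_minus_def a_assoc l_neg)
  ultimately show False using I(3) by simp
qed

lemma left_ideal_adjoin:
  assumes I: "left_ideal I R" and c: "c \<in> carrier R"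
  shows "left_ideal {i \<oplus> r \<otimes> c | i r. i \<in> I \<and> r \<in> carrier R} R" (is "left_ideal ?L R")
  unfolding left_ideal_iff
proof (intro conjI ballI)
  note il = I[unfolded left_ideal_iff]
  have ic: "i \<in> I \<Longrightarrow> i \<in> carrier R" for i using il by blast
  show "?L \<subseteq> carrier R" using ic c by auto
  show "\<zero> \<in> ?L" using il c by (intro CollectI exI[of _ \<zero>]) simp
  show "x \<oplus> y \<in> ?L" if x: "x \<in> ?L" and y: "y \<in> ?L" for x y
  proof -
    obtain i r i' r' where *: "x = i \<oplus> r \<otimes> c" "i \<in> I" "r \<in> carrier R" "y = i' \<oplus> r' \<otimes> c" "i' \<in> I" "r' \<in> carrier R" using x y by blast
    have "x \<oplus> y = (i \<oplus> i') \<oplus> (r \<oplus> r') \<otimes> c" using * ic c by (simp add: l_distr a_ac)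
    thus ?thesis using * il by blast
  qed
  show "s \<otimes> x \<in> ?L" if s: "s \<in> carrier R" and x: "x \<in> ?L" for s x
  proof -
    obtain i r where *: "x = i \<oplus> r \<otimes> c" "i \<in> I" "r \<in> carrier R" using x by blast
    have "s \<otimes> x = s \<otimes> i \<oplus> (s \<otimes> r) \<otimes> c" using * ic c s by (simp add: r_distr m_assoc)
    thus ?thesis using * il s by blast
  qed
qed

text \<open>For a maximal left ideal \<open>I\<close> without \<open>c\<close>, maximality gives 1 =
  i + r c, and a left inverse of 1 - r c = i forces 1 into \<open>I\<close>.\<close>

lemma jacobsonI:
  assumes c: "c \<in> carrier R" and u: "\<And>r. r \<in> carrier R \<Longrightarrow> \<exists>u\<in>carrier R. u \<otimes> (\<one> \<ominus> r \<otimes> c) = \<one>"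
  shows "c \<in> JR"
proof -
  have "c \<in> I" if max: "maximal_left_ideal I R" for I
  proof (rule ccontr)
    assume "c \<notin> I"
    have I: "left_ideal I R" and Im: "\<And>K. left_ideal K R \<Longrightarrow> I \<subseteq> K \<Longrightarrow> K = I \<or> K = carrier R" and ne: "I \<noteq> carrier R"
      using max unfolding maximal_left_ideal_def by simp_all
    note il = I[unfolded left_ideal_iff]
    have ic: "i \<in> I \<Longrightarrow> i \<in> carrier R" for i using il by blast
    let ?L = "{i \<oplus> r \<otimes> c | i r. i \<in> I \<and> r \<in> carrier R}"
    have "i \<in> ?L" if "i \<in> I" for i using that ic[OF that] c by (intro CollectI exI[of _ i] exI[of _ \<zero>]) simp
    moreover have "c \<in> ?L" using il c by (intro CollectI exI[of _ \<zero>] exI[of _ \<one>]) simp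
    ultimately have "?L = carrier R" using Im[OF left_ideal_adjoin[OF I c]] \<open>c \<notin> I\<close> by blast
    then obtain i r where ir: "\<one> = i \<oplus> r \<otimes> c" "i \<in> I" "r \<in> carrier R" using one_closed by blast
    have "i \<oplus> r \<otimes> c \<ominus> r \<otimes> c = i" using ir(2,3) ic c by (simp add: a_minus_def a_assoc r_neg)
    hence e: "\<one> \<ominus> r \<otimes> c = i" using ir(1) by simp
    obtain u where "u \<in> carrier R" "u \<otimes> i = \<one>" using u[OF ir(3)] unfolding e by blast
    hence "\<one> \<in> I" using il ir(2) by metis
    thus False using left_ideal_whole[OF I] ne by blast
  qed
  thus ?thesis using c unfolding jacobson_radical_def by blast
qed

text \<open>The radical is defined through maximal left ideals, so closure under right
  multiplication needs an argument: left invertibility passes from 1 - b r a to 1 - r a b.\<close>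

lemma jacobson_right:
  assumes a: "a \<in> JR" and b: "b \<in> carrier R" shows "a \<otimes> b \<in> JR"
proof (rule jacobsonI)
  have ac: "a \<in> carrier R" using a unfolding jacobson_radical_def by blast
  show "a \<otimes> b \<in> carrier R" using ac b by simp
  fix r assume r: "r \<in> carrier R"
  have "b \<otimes> r \<otimes> a \<in> JR" using jacobson_left_ideal[unfolded left_ideal_iff] a b r by blast
  then obtain u where u: "u \<in> carrier R" "u \<otimes> (\<one> \<ominus> b \<otimes> r \<otimes> a) = \<one>" by (rule jacobson_unit)
  \<comment> \<open>If u (1 - b c) = 1, then 1 + c u b is a left inverse of 1 - c b.\<close>
  let ?c = "r \<otimes> a" and ?v = "\<one> \<oplus> r \<otimes> a \<otimes> u \<otimes> b"
  have "?v \<otimes> (\<one> \<ominus> ?c \<otimes> b) = \<one> \<ominus> ?c \<otimes> b \<oplus> ?c \<otimes> (u \<otimes> (\<one> \<ominus> b \<otimes> r \<otimes> a)) \<otimes> b"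
    using ac b r u(1) by (simp add: a_minus_def l_distr r_distr l_minus r_minus m_assoc minus_add a_ac)
  also have "\<dots> = \<one>" unfolding u(2) using ac b r by (simp add: a_minus_def a_assoc l_neg)
  finally show "\<exists>u\<in>carrier R. u \<otimes> (\<one> \<ominus> r \<otimes> (a \<otimes> b)) = \<one>" using ac b r u(1) by (intro bexI[of _ ?v]) (simp_all add: m_assoc)
qed

lemma jacobson_ideal: "ideal JR R"
proof (rule idealI[OF ring_axioms])
  note l = jacobson_left_ideal[unfolded left_ideal_iff]
  show "subgroup JR (add_monoid R)"
    by (rule add.subgroupI) (use l left_ideal_neg[OF jacobson_left_ideal] in blast)+
  show "x \<otimes> a \<in> JR" if "a \<in> JR" "x \<in> carrier R" for a x using l that by blast
  show "a \<otimes> x \<in> JR" if "a \<in> JR" "x \<in> carrier R" for a x using jacobson_right that by blast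
qed

end

lemma (in abelian_subgroup) coset_eq_iff:
  assumes "x \<in> carrier G" "y \<in> carrier G" shows "H +> x = H +> y \<longleftrightarrow> x \<ominus> y \<in> H"
proof
  assume "H +> x = H +> y"
  hence "x \<in> H +> y" using a_rcos_self[OF assms(1)] by simp
  then obtain h where "h \<in> H" "x = h \<oplus> y" unfolding a_r_coset_def r_coset_def by auto
  thus "x \<ominus> y \<in> H" using assms a_subset by (auto simp: a_minus_def a_assoc r_neg)
next
  assume h: "x \<ominus> y \<in> H"
  have "(x \<ominus> y) \<oplus> y = x" using assms by (simp add: a_minus_def a_assoc l_neg)
  hence "x \<in> H +> y" using a_rcosI[OF h a_subset assms(2)] by simp
  thus "H +> x = H +> y" using a_repr_independence'[OF _ assms(2)] by blast
qed

text \<open>Modulo \<open>I\<close>, right multiplication by \<open>i\<close> is a projection onto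
  \<open>L\<close>. Let K be a complement of the image of \<open>L\<close> and split 1 = i + y
  accordingly; for a in \<open>L\<close>, the elements a - a i and a y are congruent, and their
  class lies both in the image of \<open>L\<close> and in K. Semisimplicity enters the later proofs
  only through this retraction.\<close>

lemma (in ideal) semisimple_retract:
  assumes ss: "semisimple_ring (R Quot I)" and L: "left_ideal L R" and IL: "I \<subseteq> L"
  shows "\<exists>i\<in>L. \<forall>a\<in>L. a \<ominus> a \<otimes> i \<in> I"
proof -
  interpret Q: ring "R Quot I" by (rule quotient_is_ring)
  note l = L[unfolded left_ideal_iff]
  have Qs: "carrier (R Quot I) = (\<lambda>a. I +> a) ` carrier R" "\<zero>\<^bsub>R Quot I\<^esub> = I"
    unfolding FactRing_def A_RCOSETS_def' by auto
  have Qa: "(I +> x) \<oplus>\<^bsub>R Quot I\<^esub> (I +> y) = I +> (x \<oplus> y)" if "x \<in> carrier R" "y \<in> carrier R" for x y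
    using a_rcos_sum[OF that] unfolding FactRing_def by simp
  have Qm: "(I +> x) \<otimes>\<^bsub>R Quot I\<^esub> (I +> y) = I +> (x \<otimes> y)" if "x \<in> carrier R" "y \<in> carrier R" for x y
    using rcoset_mult_add[OF that] unfolding FactRing_def by simp
  let ?L = "(\<lambda>a. I +> a) ` L"
  have lc: "x \<in> L \<Longrightarrow> x \<in> carrier R" for x using l by blast
  have "left_ideal ?L (R Quot I)"
    unfolding Q.left_ideal_iff
  proof (intro conjI ballI)
    show "?L \<subseteq> carrier (R Quot I)" unfolding Qs using lc by blast
    show "\<zero>\<^bsub>R Quot I\<^esub> \<in> ?L" unfolding Qs using l a_rcos_const[of \<zero>] additive_subgroup.zero_closed[OF is_additive_subgroup]
      by (intro image_eqI[of _ _ \<zero>]) auto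
  next
    fix x y assume "x \<in> ?L" "y \<in> ?L"
    then obtain a b where "x = I +> a" "y = I +> b" "a \<in> L" "b \<in> L" by blast
    thus "x \<oplus>\<^bsub>R Quot I\<^esub> y \<in> ?L" using Qa lc l by auto
  next
    fix r x assume "r \<in> carrier (R Quot I)" "x \<in> ?L"
    then obtain a b where "r = I +> a" "x = I +> b" "a \<in> carrier R" "b \<in> L" unfolding Qs by blast
    thus "r \<otimes>\<^bsub>R Quot I\<^esub> x \<in> ?L" using Qm lc l by auto
  qed
  then obtain K where K: "left_ideal K (R Quot I)" "?L \<inter> K = {\<zero>\<^bsub>R Quot I\<^esub>}" "?L <+>\<^bsub>R Quot I\<^esub> K = carrier (R Quot I)"
    using ss unfolding semisimple_ring_def by blast
  note kl = K(1)[unfolded Q.left_ideal_iff]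
  have "I +> \<one> \<in> ?L <+>\<^bsub>R Quot I\<^esub> K" unfolding K(3) Qs by blast
  then obtain X Y where XY: "X \<in> ?L" "Y \<in> K" "I +> \<one> = X \<oplus>\<^bsub>R Quot I\<^esub> Y" unfolding set_add_def' by auto
  obtain i where i: "X = I +> i" "i \<in> L" using XY(1) by blast
  have "Y \<in> carrier (R Quot I)" using XY(2) kl by blast
  then obtain y where y: "Y = I +> y" "y \<in> carrier R" unfolding Qs by blast
  have ic: "i \<in> carrier R" by (rule lc[OF i(2)])
  have "I +> \<one> = I +> (i \<oplus> y)" using XY(3) Qa ic y i by simp
  hence d: "\<one> \<ominus> (i \<oplus> y) \<in> I" using coset_eq_iff ic y by simp
  have "a \<ominus> a \<otimes> i \<in> I" if a: "a \<in> L" for a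
  proof -
    have ac: "a \<in> carrier R" by (rule lc[OF a])
    have "a \<otimes> (\<one> \<ominus> (i \<oplus> y)) \<in> I" using I_l_closed[OF d ac] .
    moreover have "a \<otimes> (\<one> \<ominus> (i \<oplus> y)) = (a \<ominus> a \<otimes> i) \<ominus> a \<otimes> y"
      using ac ic y by (simp add: a_minus_def r_distr r_minus minus_add a_ac)
    ultimately have e: "(a \<ominus> a \<otimes> i) \<ominus> a \<otimes> y \<in> I" by simp
    have aiL: "a \<ominus> a \<otimes> i \<in> L"
      unfolding a_minus_def using l a left_ideal_neg[OF L] ac i by blast
    have eq: "I +> (a \<ominus> a \<otimes> i) = I +> (a \<otimes> y)" using coset_eq_iff e ac ic y by simp
    have "I +> (a \<otimes> y) = (I +> a) \<otimes>\<^bsub>R Quot I\<^esub> Y" using Qm ac y by simp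
    also have "\<dots> \<in> K" using kl XY(2) ac Qs by blast
    finally have "I +> (a \<ominus> a \<otimes> i) \<in> ?L \<inter> K" using eq aiL by auto
    hence "I +> (a \<ominus> a \<otimes> i) \<in> {\<zero>\<^bsub>R Quot I\<^esub>}" unfolding K(2) .
    hence "I +> (a \<ominus> a \<otimes> i) = I" unfolding Qs(2) by (rule singletonD)
    moreover have "a \<ominus> a \<otimes> i \<in> I +> (a \<ominus> a \<otimes> i)" by (rule a_rcos_self) (use ac ic in simp)
    ultimately show ?thesis by simp
  qed
  with i(2) show ?thesis by (intro bexI[of _ i] ballI)
qed

section \<open>The graded radical and the semisimple quotient\<close>

locale gsp = graded_ring A for A :: "'a graded_ring" (structure) +
  assumes noeth: "left_noetherian (degree_zero A)"
    and semi: "semiperfect_ring (degree_zero A)"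
    and lfin: "left_finite_ring A"
begin

abbreviation "R0 \<equiv> degree_zero A"
abbreviation "A0 \<equiv> mdeg RA 0"
abbreviation "J0 \<equiv> jacobson_radical R0"
abbreviation "Jr \<equiv> graded_radical A"

lemma R0_simps [simp]: "carrier R0 = A0" "\<zero>\<^bsub>R0\<^esub> = \<zero>" "\<one>\<^bsub>R0\<^esub> = \<one>" "x \<otimes>\<^bsub>R0\<^esub> y = x \<otimes> y" "x \<oplus>\<^bsub>R0\<^esub> y = x \<oplus> y"
  unfolding degree_zero_def by (simp_all add: RA_mdeg)

lemma R0_ring: "ring R0" using noeth unfolding left_noetherian_def by simp

lemma A0_closed: "a \<in> A0 \<Longrightarrow> a \<in> carrier A" by (rule RA_closed)

lemma A0_mult: "\<lbrakk>a \<in> A0; b \<in> A0\<rbrakk> \<Longrightarrow> a \<otimes> b \<in> A0" using RA_mult[of a 0 b 0] by simp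

lemma A0_add: "\<lbrakk>a \<in> A0; b \<in> A0\<rbrakk> \<Longrightarrow> a \<oplus> b \<in> A0" using RA.V_add[of a 0 b] by simp

lemma A0_neg: "a \<in> A0 \<Longrightarrow> \<ominus> a \<in> A0" using RA.V_neg[of a 0] by simp

lemma A0_minus: "\<lbrakk>a \<in> A0; b \<in> A0\<rbrakk> \<Longrightarrow> a \<ominus> b \<in> A0" unfolding a_minus_def by (intro A0_add A0_neg)

lemma A0_zero: "\<zero> \<in> A0" using RA.V_zero by simp

lemma A0_one: "\<one> \<in> A0" by (rule RA_one)

lemma R0_neg: "a \<in> A0 \<Longrightarrow> \<ominus>\<^bsub>R0\<^esub> a = \<ominus> a"
proof -
  interpret R0: ring R0 by (rule R0_ring)
  assume a: "a \<in> A0"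
  show ?thesis
    by (rule R0.minus_equality) (use a A0_neg[OF a] A0_closed[OF a] in \<open>simp_all add: l_neg\<close>)
qed

lemma R0_minus: "b \<in> A0 \<Longrightarrow> a \<ominus>\<^bsub>R0\<^esub> b = a \<ominus> b"
  unfolding a_minus_def by (simp add: R0_neg)

lemma J0_ideal: "ideal J0 R0" by (rule ring.jacobson_ideal[OF R0_ring])

lemma J0_A0: "a \<in> J0 \<Longrightarrow> a \<in> A0"
  unfolding jacobson_radical_def by simp

lemma J0_closed: "a \<in> J0 \<Longrightarrow> a \<in> carrier A" using J0_A0 A0_closed by blast

lemma J0_left: "\<lbrakk>r \<in> A0; a \<in> J0\<rbrakk> \<Longrightarrow> r \<otimes> a \<in> J0"
  using ideal.I_l_closed[OF J0_ideal, of a r] by simp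

lemma J0_right: "\<lbrakk>r \<in> A0; a \<in> J0\<rbrakk> \<Longrightarrow> a \<otimes> r \<in> J0"
  using ideal.I_r_closed[OF J0_ideal, of a r] by simp

lemma J0_add: "\<lbrakk>a \<in> J0; b \<in> J0\<rbrakk> \<Longrightarrow> a \<oplus> b \<in> J0"
  using additive_subgroup.a_closed[OF ideal.axioms(1)[OF J0_ideal], of a b] by simp

lemma J0_zero: "\<zero> \<in> J0"
  using additive_subgroup.zero_closed[OF ideal.axioms(1)[OF J0_ideal]] by simp

lemma J0_neg: "a \<in> J0 \<Longrightarrow> \<ominus> a \<in> J0"
  using J0_left[of "\<ominus> \<one>" a] A0_neg[OF A0_one] J0_closed[of a] by (simp add: l_minus)

lemma J0_unit:
  assumes "a \<in> J0" obtains u where "u \<in> A0" "u \<otimes> (\<one> \<ominus> a) = \<one>"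
  by (rule ring.jacobson_unit[OF R0_ring assms]) (use that J0_A0[OF assms] in \<open>simp add: R0_minus\<close>)

text \<open>\<open>semisimple_retract\<close> for A_0 and its radical, phrased with the operations
  of A.\<close>

lemma retract0:
  assumes "L \<subseteq> A0" "J0 \<subseteq> L" "\<And>x y. \<lbrakk>x \<in> L; y \<in> L\<rbrakk> \<Longrightarrow> x \<oplus> y \<in> L" "\<And>r x. \<lbrakk>r \<in> A0; x \<in> L\<rbrakk> \<Longrightarrow> r \<otimes> x \<in> L"
  obtains i where "i \<in> L" "\<And>a. a \<in> L \<Longrightarrow> a \<ominus> a \<otimes> i \<in> J0"
proof -
  have "left_ideal L R0"
    unfolding ring.left_ideal_iff[OF R0_ring] using assms J0_zero by (intro conjI ballI) auto
  moreover have "semisimple_ring (R0 Quot J0)" using semi unfolding semiperfect_ring_def by simp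
  ultimately have "\<exists>i\<in>L. \<forall>a\<in>L. a \<ominus>\<^bsub>R0\<^esub> a \<otimes>\<^bsub>R0\<^esub> i \<in> J0"
    using ideal.semisimple_retract[OF J0_ideal] assms(2) by blast
  then obtain i where i: "i \<in> L" "\<And>a. a \<in> L \<Longrightarrow> a \<ominus>\<^bsub>R0\<^esub> a \<otimes>\<^bsub>R0\<^esub> i \<in> J0" by blast
  have "a \<ominus> a \<otimes> i \<in> J0" if "a \<in> L" for a
    using i(2)[OF that] A0_mult[of a i] subsetD[OF assms(1) that] subsetD[OF assms(1) i(1)] by (simp add: R0_minus)
  with i(1) show ?thesis by (rule that)
qed

text \<open>The map from A_0 e to A_0/L is onto, since 1 - e is in \<open>L\<close>, and its kernel
  lies in the radical: a projective cover of a cyclic module. The retraction \<open>i\<close> onto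
  \<open>L\<close> is idempotent modulo the radical; it lifts to an idempotent f, and e = 1 -
  f.\<close>

lemma idempotent0:
  assumes L: "L \<subseteq> A0" "J0 \<subseteq> L" "\<And>x y. \<lbrakk>x \<in> L; y \<in> L\<rbrakk> \<Longrightarrow> x \<oplus> y \<in> L" "\<And>r x. \<lbrakk>r \<in> A0; x \<in> L\<rbrakk> \<Longrightarrow> r \<otimes> x \<in> L"
  obtains e where "e \<in> A0" "e \<otimes> e = e" "\<one> \<ominus> e \<in> L" "\<And>a. \<lbrakk>a \<in> A0; a \<otimes> e \<in> L\<rbrakk> \<Longrightarrow> a \<otimes> e \<in> J0"
proof -
  obtain i where i: "i \<in> L" "\<And>a. a \<in> L \<Longrightarrow> a \<ominus> a \<otimes> i \<in> J0" by (rule retract0[OF L(1,2)], erule (1) L(3), erule (1) L(4), rule that)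
  have iA: "i \<in> A0" using i(1) L(1) by blast
  note ic = A0_closed[OF iA]
  have "\<ominus> (i \<ominus> i \<otimes> i) \<in> J0" using J0_neg[OF i(2)[OF i(1)]] .
  hence "i \<otimes> i \<ominus> i \<in> J0" using ic by (simp add: a_minus_def minus_add a_comm)
  then obtain f where f: "f \<in> A0" "f \<otimes> f = f" "f \<ominus> i \<in> J0"
    using semi iA unfolding semiperfect_ring_def idempotents_lift_def by (auto simp: R0_minus)
  note fc = A0_closed[OF f(1)]
  let ?e = "\<one> \<ominus> f"
  have e: "?e \<in> A0" by (rule A0_minus[OF A0_one f(1)])
  have ef: "?e \<otimes> f = \<zero>" using fc f(2) by (simp add: a_minus_def l_distr l_minus r_neg)
  have ee: "?e \<otimes> ?e = ?e"
  proof -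
    have "?e \<otimes> ?e = ?e \<otimes> \<one> \<ominus> ?e \<otimes> f" using fc by (simp add: a_minus_def r_distr r_minus)
    thus ?thesis using ef fc by (simp add: a_minus_def)
  qed
  have "f = (f \<ominus> i) \<oplus> i" using fc ic by (simp add: a_minus_def a_assoc l_neg)
  also have "\<dots> \<in> L" using L(3)[OF subsetD[OF L(2) f(3)] i(1)] .
  finally have "f \<in> L" .
  moreover have "\<one> \<ominus> ?e = f" using fc by (simp add: a_minus_def minus_add a_assoc[symmetric] r_neg)
  ultimately have 1: "\<one> \<ominus> ?e \<in> L" by simp
  have "a \<otimes> ?e \<in> J0" if a: "a \<in> A0" and ae: "a \<otimes> ?e \<in> L" for a
  proof -
    note ac = A0_closed[OF a]
    have x: "a \<otimes> ?e \<in> A0" by (rule A0_mult[OF a e])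
    have xc: "a \<otimes> ?e \<in> carrier A" by (rule A0_closed[OF x])
    have "a \<otimes> ?e \<otimes> f = \<zero>" using ef ac fc by (simp add: m_assoc)
    \<comment> \<open>As e f = 0, the product a e i equals -a e (f - i), where f - i is in the
      radical; and a e is congruent to a e i.\<close>
    hence "a \<otimes> ?e \<otimes> i = \<ominus> (a \<otimes> ?e \<otimes> (f \<ominus> i))"
      using xc fc ic by (simp add: a_minus_def r_distr r_minus)
    also have "\<dots> \<in> J0" by (rule J0_neg[OF J0_left[OF x f(3)]])
    finally have "(a \<otimes> ?e \<ominus> a \<otimes> ?e \<otimes> i) \<oplus> a \<otimes> ?e \<otimes> i \<in> J0" using i(2)[OF ae] J0_add by blast
    moreover have "(a \<otimes> ?e \<ominus> a \<otimes> ?e \<otimes> i) \<oplus> a \<otimes> ?e \<otimes> i = a \<otimes> ?e" using xc ic by (simp add: a_minus_def a_assoc l_neg)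
    ultimately show ?thesis by simp
  qed
  from that[OF e ee 1 this] show ?thesis by blast
qed

text \<open>Taking the degree 0 component is multiplicative because there are no negative
  degrees.\<close>

lemma cp0_mult:
  assumes "a \<in> carrier A" "b \<in> carrier A" shows "cp RA 0 (a \<otimes> b) = cp RA 0 a \<otimes> cp RA 0 b"
proof -
  have neg: "cp RA i b = \<zero>" if "i < 0" for i using that assms by (simp add: RA_hcomp)
  have "a \<in> carrier RA" using assms by simp
  thus ?thesis
  proof (induction rule: RA.homogeneous_induct)
    case zero
    thus ?case using assms by simp
  next
    case (step i h y)
    have h: "h \<in> carrier A" "y \<in> carrier A" using step by simp_all
    have "cp RA 0 (h \<otimes> b) = cp RA 0 h \<otimes> cp RA 0 b"
    proof -
      have e: "cp RA 0 h = (if 0 = i then h else \<zero>)" using RA.hcomp_hom[OF step(1), of 0] by simp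
      consider "i = 0" | "i > 0" | "i < 0" by linarith
      thus ?thesis
      proof cases
        case 3
        hence "h = \<zero>" using step(1) by (simp add: RA_mdeg)
        thus ?thesis using assms by simp
      qed (use e cp_mult_left[OF step(1) assms(2), of 0] neg[of "- i"] h assms in simp_all)
    qed
    thus ?case using h step(5) assms RA.hcomp_add[simplified] by (simp add: l_distr)
  qed
qed

lemma positive_part_closed: "positive_part A \<subseteq> carrier A"
proof -
  have "(\<Union>i\<in>{1..}. rdeg A i) \<subseteq> carrier (add_monoid A)" using rdeg_closed by auto
  from add.finite_sums_closed[OF this[simplified]] show ?thesis unfolding positive_part_def by simp
qed

text \<open>Membership in the graded radical is decided by the degree 0 component; with
  \<open>cp0_mult\<close> this reduces the ideal properties of \<open>Jr\<close> to those of the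
  radical of A_0.\<close>

lemma Jr_iff: "x \<in> Jr \<longleftrightarrow> x \<in> carrier A \<and> cp RA 0 x \<in> J0"
proof -
  have sub: "(\<Union>i\<in>{1..}. rdeg A i) \<subseteq> carrier A" using rdeg_closed by auto
  have P0: "cp RA 0 p = \<zero>" if "p \<in> positive_part A" for p
  proof -
    have "p \<in> finite_sums (add_monoid A) (\<Union>i\<in>{1..}. rdeg A i)" using that unfolding positive_part_def .
    thus ?thesis
    proof (induction rule: add.finite_sums_induct[OF _ sub, consumes 1, case_names one step])
      case one
      thus ?case by simp
    next
      case (step s x)
      obtain i :: nat where i: "i \<ge> 1" "s \<in> rdeg A i" using step(1) by auto
      hence "s \<in> mdeg RA (int i)" by (simp add: RA_mdeg)
      from RA.hcomp_hom[OF this, of 0] have "cp RA 0 s = \<zero>" using i by simp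
      thus ?case using step(3,4) rdeg_closed[OF i(2)] RA.hcomp_add[of s x 0] by simp
    qed
  qed
  have Pz: "\<zero> \<in> positive_part A" using add.finite_sums_one unfolding positive_part_def by simp
  have dec: "x \<ominus> cp RA 0 x \<in> positive_part A" if "x \<in> carrier RA" for x
    using that
  proof (induction rule: RA.homogeneous_induct)
    case zero
    thus ?case using Pz by (simp add: a_minus_def)
  next
    case (step i h y)
    have h: "h \<in> carrier A" "y \<in> carrier A" using step by simp_all
    have e: "cp RA 0 h = (if 0 = i then h else \<zero>)" using RA.hcomp_hom[OF step(1), of 0] by simp
    have a: "cp RA 0 (h \<oplus> y) = cp RA 0 h \<oplus> cp RA 0 y" using RA.hcomp_add[of h y 0] h by simp
    show ?case
    proof (cases "i = 0 \<or> h = \<zero>")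
      case True
      hence "cp RA 0 h = h" using e by auto
      hence "h \<oplus>\<^bsub>RA\<^esub> y \<ominus> cp RA 0 (h \<oplus>\<^bsub>RA\<^esub> y) = y \<ominus> cp RA 0 y"
      proof -
        have "h \<oplus> y \<oplus> (\<ominus> h \<oplus> \<ominus> cp RA 0 y) = (h \<oplus> \<ominus> h) \<oplus> (y \<oplus> \<ominus> cp RA 0 y)"
          using h by (simp add: a_ac)
        thus ?thesis using a h \<open>cp RA 0 h = h\<close> by (simp add: a_minus_def minus_add r_neg)
      qed
      thus ?thesis using step(5) by simp
    next
      case False
      hence i: "i > 0" using step(1) by (auto simp: RA_mdeg split: if_splits)
      hence hs: "h \<in> (\<Union>i\<in>{1..}. rdeg A i)" using step(1) by (auto simp: RA_mdeg intro!: bexI[of _ "nat i"])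
      have "h \<oplus>\<^bsub>RA\<^esub> y \<ominus> cp RA 0 (h \<oplus>\<^bsub>RA\<^esub> y) = h \<oplus> (y \<ominus> cp RA 0 y)"
        using a e False h by (simp add: a_minus_def a_assoc)
      thus ?thesis
        using add.finite_sums_step[OF sub hs, of "y \<ominus> cp RA 0 y"] step(5) unfolding positive_part_def by simp
    qed
  qed
  show ?thesis
  proof
    assume "x \<in> Jr"
    then obtain j p where jp: "x = j \<oplus> p" "j \<in> J0" "p \<in> positive_part A"
      unfolding graded_radical_def set_add_def' by auto
    have pc: "p \<in> carrier A" using jp(3) positive_part_closed by blast
    have jc: "j \<in> carrier A" by (rule J0_closed[OF jp(2)])
    have "cp RA 0 j = j" using RA.hcomp_hom[OF J0_A0[OF jp(2)], of 0] by simp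
    hence "cp RA 0 x = j" using RA.hcomp_add[of j p 0] jc pc P0[OF jp(3)] jp(1) by simp
    thus "x \<in> carrier A \<and> cp RA 0 x \<in> J0" using jp(1,2) jc pc by simp
  next
    assume x: "x \<in> carrier A \<and> cp RA 0 x \<in> J0"
    hence "x = cp RA 0 x \<oplus> (x \<ominus> cp RA 0 x)" by (simp add: a_minus_def a_lcomm r_neg)
    moreover have "x \<ominus> cp RA 0 x \<in> positive_part A" using dec x by simp
    ultimately show "x \<in> Jr" unfolding graded_radical_def set_add_def' using x by auto
  qed
qed

lemma Jr_closed: "x \<in> Jr \<Longrightarrow> x \<in> carrier A"
  unfolding Jr_iff by simp

lemma Jr_sub: "Jr \<subseteq> carrier A"
  using Jr_closed by blast

lemma Jr_zero: "\<zero> \<in> Jr"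
  unfolding Jr_iff using J0_zero by simp

lemma Jr_add: "\<lbrakk>x \<in> Jr; y \<in> Jr\<rbrakk> \<Longrightarrow> x \<oplus> y \<in> Jr"
  unfolding Jr_iff using RA.hcomp_add[of x y 0] J0_add by simp

lemma Jr_left: "\<lbrakk>a \<in> carrier A; x \<in> Jr\<rbrakk> \<Longrightarrow> a \<otimes> x \<in> Jr"
  unfolding Jr_iff using J0_left[OF cp_RA_in[of a 0]] by (simp add: cp0_mult)

lemma Jr_right: "\<lbrakk>a \<in> carrier A; x \<in> Jr\<rbrakk> \<Longrightarrow> x \<otimes> a \<in> Jr"
  unfolding Jr_iff using J0_right[OF cp_RA_in[of a 0]] by (simp add: cp0_mult)

lemma Jr_neg: "x \<in> Jr \<Longrightarrow> \<ominus> x \<in> Jr"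
  using Jr_left[of "\<ominus> \<one>" x] Jr_closed[of x] by (simp add: l_minus)

lemma Jr_cp: "x \<in> Jr \<Longrightarrow> cp RA i x \<in> Jr"
  unfolding Jr_iff using RA.hcomp_hom[OF cp_RA_in[of x i], of 0] J0_zero by simp

lemma Jr_pos: "x \<in> mdeg RA i \<Longrightarrow> i \<noteq> 0 \<Longrightarrow> x \<in> Jr"
  unfolding Jr_iff using RA.hcomp_hom[of x i 0] RA_closed[of x i] J0_zero by simp

lemma Jr_A0: "x \<in> A0 \<Longrightarrow> x \<in> Jr \<longleftrightarrow> x \<in> J0"
  unfolding Jr_iff using RA.hcomp_hom[of x 0 0] A0_closed[of x] by simp

lemma Jr_gsub: "gsub RA Jr"
  unfolding gsub_def using Jr_sub Jr_zero Jr_add Jr_left Jr_cp by simp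

lemma Jr_ideal: "ideal Jr A"
proof (rule idealI[OF ring_axioms])
  show "subgroup Jr (add_monoid A)"
    by (rule add.subgroupI) (use Jr_sub Jr_zero Jr_neg Jr_add in auto)
qed (simp_all add: Jr_left Jr_right)

section \<open>The graded module A/J\<close>

abbreviation "SS \<equiv> mod_radical A"
abbreviation zero_SS ("\<zero>\<^sub>S") where "\<zero>\<^sub>S \<equiv> \<zero>\<^bsub>SS\<^esub>"

definition cls :: "'a \<Rightarrow> 'a set" where "cls a = Jr +>\<^bsub>A\<^esub> a"

lemma RA_coset: "Jr +>\<^bsub>RA\<^esub> a = cls a"
  unfolding cls_def a_r_coset_def r_coset_def by simp

lemma SS_simps: "carrier SS = cls ` carrier A" "\<zero>\<^sub>S = Jr" "ring.add SS = set_add A"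
  "mdeg SS i = cls ` mdeg RA i" "a \<odot>\<^bsub>SS\<^esub> X = (\<Union>x\<in>X. cls (a \<otimes> x))"
  unfolding mod_radical_def graded_quot_def
  by (auto simp: A_RCOSETS_def' RA_coset set_add_def' fun_eq_iff)

lemma cls_eq_iff: "\<lbrakk>a \<in> carrier A; b \<in> carrier A\<rbrakk> \<Longrightarrow> cls a = cls b \<longleftrightarrow> a \<ominus> b \<in> Jr"
  unfolding cls_def
  by (rule abelian_subgroup.coset_eq_iff[OF abelian_subgroupI3[OF ideal.axioms(1)[OF Jr_ideal] is_abelian_group]])

lemma cls_zero_iff: "a \<in> carrier A \<Longrightarrow> cls a = Jr \<longleftrightarrow> a \<in> Jr"
proof -
  assume a: "a \<in> carrier A"
  have "cls \<zero> = Jr" unfolding cls_def a_r_coset_def r_coset_def using Jr_closed by force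
  thus ?thesis using cls_eq_iff[OF a zero_closed] a by (simp add: a_minus_def)
qed

lemma cls_self: "a \<in> carrier A \<Longrightarrow> a \<in> cls a"
  unfolding cls_def a_r_coset_def r_coset_def using Jr_zero by (auto intro!: bexI[of _ \<zero>])

lemma cls_add: "\<lbrakk>a \<in> carrier A; b \<in> carrier A\<rbrakk> \<Longrightarrow> cls a \<oplus>\<^bsub>SS\<^esub> cls b = cls (a \<oplus> b)"
  unfolding SS_simps cls_def
  by (rule abelian_subgroup.a_rcos_sum[OF abelian_subgroupI3[OF ideal.axioms(1)[OF Jr_ideal] is_abelian_group]])

lemma cls_smult: assumes "a \<in> carrier A" "b \<in> carrier A" shows "a \<odot>\<^bsub>SS\<^esub> cls b = cls (a \<otimes> b)"
proof -
  have "cls (a \<otimes> x) = cls (a \<otimes> b)" if x: "x \<in> cls b" for x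
  proof -
    obtain j where j: "j \<in> Jr" "x = j \<oplus> b" using x unfolding cls_def a_r_coset_def r_coset_def by auto
    note jc = Jr_closed[OF j(1)]
    have "a \<otimes> x \<ominus> a \<otimes> b = a \<otimes> j" using assms jc j(2) by (simp add: r_distr a_minus_def a_assoc r_neg)
    thus ?thesis using cls_eq_iff[of "a \<otimes> x" "a \<otimes> b"] assms jc j(2) Jr_left[OF assms(1) j(1)] by simp
  qed
  thus ?thesis unfolding SS_simps using cls_self[OF assms(2)] by blast
qed

lemma SS_cases: "s \<in> carrier SS \<Longrightarrow> (\<And>a. a \<in> carrier A \<Longrightarrow> s = cls a \<Longrightarrow> thesis) \<Longrightarrow> thesis"
  unfolding SS_simps by (erule imageE) blast

lemma cls_closed: "a \<in> carrier A \<Longrightarrow> cls a \<in> carrier SS"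
  unfolding SS_simps by (rule imageI)

lemma cls_lin: "lin A RA SS cls"
  by (rule linI) (simp_all add: cls_closed cls_add cls_smult)

lemma SS_group: "abelian_group SS"
proof (rule abelian_groupI)
  show "\<zero>\<^sub>S \<in> carrier SS" using cls_closed[of \<zero>] cls_zero_iff[of \<zero>] Jr_zero SS_simps(2) by simp
  have z: "\<zero>\<^sub>S = cls \<zero>" using cls_zero_iff[of \<zero>] Jr_zero SS_simps(2) by simp
  fix x assume "x \<in> carrier SS"
  then obtain a where a: "a \<in> carrier A" "x = cls a" by (rule SS_cases)
  show "\<zero>\<^sub>S \<oplus>\<^bsub>SS\<^esub> x = x" unfolding z a(2) using a(1) by (simp add: cls_add)
  have "cls (\<ominus> a) \<oplus>\<^bsub>SS\<^esub> x = \<zero>\<^sub>S" unfolding z a(2) using a(1) by (simp add: cls_add l_neg)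
  thus "\<exists>y\<in>carrier SS. y \<oplus>\<^bsub>SS\<^esub> x = \<zero>\<^sub>S" using cls_closed[of "\<ominus> a"] a(1) by blast
  fix y assume "y \<in> carrier SS"
  then obtain b where b: "b \<in> carrier A" "y = cls b" by (rule SS_cases)
  show "x \<oplus>\<^bsub>SS\<^esub> y \<in> carrier SS" unfolding a(2) b(2) using a(1) b(1) by (simp add: cls_add cls_closed)
  show "x \<oplus>\<^bsub>SS\<^esub> y = y \<oplus>\<^bsub>SS\<^esub> x" unfolding a(2) b(2) using a(1) b(1) by (simp add: cls_add a_comm)
  fix w assume "w \<in> carrier SS"
  then obtain c where c: "c \<in> carrier A" "w = cls c" by (rule SS_cases)
  show "x \<oplus>\<^bsub>SS\<^esub> y \<oplus>\<^bsub>SS\<^esub> w = x \<oplus>\<^bsub>SS\<^esub> (y \<oplus>\<^bsub>SS\<^esub> w)"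
    unfolding a(2) b(2) c(2) using a(1) b(1) c(1) by (simp add: cls_add a_assoc)
qed

lemma SS_left_module: "left_module A SS"
proof -
  interpret SS: abelian_group SS by (rule SS_group)
  show ?thesis
  proof (intro left_module.intro ring_axioms SS_group left_module_axioms.intro)
    fix a b x assume ab: "a \<in> carrier A" "b \<in> carrier A" and "x \<in> carrier SS"
    then obtain c where c: "c \<in> carrier A" "x = cls c" using SS_cases by blast
    show "(a \<oplus> b) \<odot>\<^bsub>SS\<^esub> x = a \<odot>\<^bsub>SS\<^esub> x \<oplus>\<^bsub>SS\<^esub> b \<odot>\<^bsub>SS\<^esub> x" "(a \<otimes> b) \<odot>\<^bsub>SS\<^esub> x = a \<odot>\<^bsub>SS\<^esub> (b \<odot>\<^bsub>SS\<^esub> x)"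
      unfolding c(2) using ab c(1) by (simp_all add: cls_add cls_smult l_distr m_assoc)
  next
    fix a x y assume a: "a \<in> carrier A" and xy: "x \<in> carrier SS" "y \<in> carrier SS"
    obtain b where b: "b \<in> carrier A" "x = cls b" using xy(1) by (rule SS_cases)
    obtain c where c: "c \<in> carrier A" "y = cls c" using xy(2) by (rule SS_cases)
    show "a \<odot>\<^bsub>SS\<^esub> (x \<oplus>\<^bsub>SS\<^esub> y) = a \<odot>\<^bsub>SS\<^esub> x \<oplus>\<^bsub>SS\<^esub> a \<odot>\<^bsub>SS\<^esub> y"
      unfolding b(2) c(2) using a b(1) c(1) by (simp add: cls_add cls_smult r_distr)
  next
    fix a x assume a: "a \<in> carrier A" and x: "x \<in> carrier SS"
    obtain b where b: "b \<in> carrier A" "x = cls b" using x by (rule SS_cases)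
    show "a \<odot>\<^bsub>SS\<^esub> x \<in> carrier SS" unfolding b(2) using a b(1) by (simp add: cls_smult cls_closed)
  next
    fix x assume "x \<in> carrier SS"
    then obtain b where b: "b \<in> carrier A" "x = cls b" by (rule SS_cases)
    show "\<one> \<odot>\<^bsub>SS\<^esub> x = x" unfolding b(2) using b(1) by (simp add: cls_smult)
  qed
qed

text \<open>Every element is congruent to its degree 0 component, because elements of nonzero degree
  lie in \<open>Jr\<close>.\<close>

lemma SS_deg: "mdeg SS i = (if i = 0 then carrier SS else {\<zero>\<^sub>S})"
proof (cases "i = 0")
  case True
  have "cls x \<in> cls ` A0" if x: "x \<in> carrier A" for x
  proof -
    have "cp RA 0 (x \<ominus> cp RA 0 x) = \<zero>"
      using x RA.hcomp_add[of x "\<ominus> cp RA 0 x" 0] RA.hcomp_neg[of "cp RA 0 x" 0] RA.hcomp_hom[OF cp_RA_in[OF x], of 0 0]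
      by (simp add: a_minus_def r_neg)
    hence "x \<ominus> cp RA 0 x \<in> Jr" using x J0_zero by (simp add: Jr_iff)
    hence "cls x = cls (cp RA 0 x)" using cls_eq_iff[of x "cp RA 0 x"] x by simp
    thus ?thesis using cp_RA_in[OF x] by (rule image_eqI)
  qed
  thus ?thesis using True A0_closed unfolding SS_simps by auto
next
  case False
  have "cls x = Jr" if "x \<in> mdeg RA i" for x
    using cls_zero_iff[OF RA_closed[OF that]] Jr_pos[OF that False] by simp
  moreover have "\<zero> \<in> mdeg RA i" using RA.V_zero by simp
  ultimately have "cls ` mdeg RA i = {Jr}" by force
  thus ?thesis using False unfolding SS_simps by simp
qed

lemma SS_gm: "graded_module A SS"
proof -
  interpret SS: left_module A SS by (rule SS_left_module)
  let ?c = "\<lambda>i x. if i = (0::int) then x else \<zero>\<^sub>S"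
  have sub: "additive_subgroup (mdeg SS i) SS" for i
    unfolding SS_deg using SS.M.add.triv_subgroup SS.M.add.subgroup_self by (simp add: additive_subgroup_def)
  have deg: "a \<odot>\<^bsub>SS\<^esub> x \<in> mdeg SS (i + k)" if ax: "a \<in> mdeg RA i" "x \<in> mdeg SS k" for a i x k
  proof -
    obtain b where b: "x = cls b" "b \<in> mdeg RA k" using ax(2) unfolding SS_simps by (rule imageE)
    show ?thesis unfolding b(1) SS_simps(4) cls_smult[OF RA_closed[OF ax(1)] RA_closed[OF b(2)]]
      by (rule imageI[OF RA_mult[OF ax(1) b(2)]])
  qed
  show ?thesis
  proof (rule graded_moduleI(1)[of SS ?c, OF SS_left_module sub _ _ _ _ _ deg])
    fix x assume "\<And>i. ?c i x = \<zero>\<^sub>S"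
    from this[of 0] show "x = \<zero>\<^sub>S" by simp
  qed (auto simp: SS_deg split: if_splits intro: finite_subset[of _ "{0}"])
qed

lemma cls_Hom: "(\<lambda>a\<in>carrier A. cls a) \<in> Hom_Gr A RA SS"
proof -
  have "(\<lambda>a\<in>carrier RA. cls a) \<in> Hom_Gr A RA SS"
    by (rule HomI[OF RA_gm cls_lin]) (simp add: SS_simps)
  thus ?thesis by simp
qed

lemma SS_radical: "\<lbrakk>a \<in> Jr; s \<in> carrier SS\<rbrakk> \<Longrightarrow> a \<odot>\<^bsub>SS\<^esub> s = \<zero>\<^sub>S"
  by (erule SS_cases) (simp add: cls_smult Jr_closed cls_zero_iff Jr_right SS_simps(2))

section \<open>The submodules J X and the ideal J^2\<close>

abbreviation "JX X N \<equiv> act_prod X Jr N"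
abbreviation "JJ \<equiv> set_prod A Jr Jr"

lemma to_SS_radical:
  assumes X: "graded_module A X" and f: "lin A X SS f" and x: "x \<in> JX X (carrier X)"
  shows "f x = \<zero>\<^sub>S"
proof -
  interpret X: graded_module A X by (rule X)
  interpret SS: graded_module A SS by (rule SS_gm)
  show ?thesis using x
  proof (induction rule: X.act_prod_induct[OF Jr_sub subset_refl, consumes 1, case_names zero step])
    case zero
    show ?case by (rule lin_zero[OF f gm_group[OF X] SS_group])
  next
    case (step a x y)
    have "f (a \<odot>\<^bsub>X\<^esub> x) = \<zero>\<^sub>S" using step lin_smult[OF f] SS_radical[OF step(1)] lin_closed[OF f] by simp
    thus ?case using step lin_add[OF f] by simp
  qed
qed

text \<open>The two products differ only in the record that carries the addition; this makes the
  lemmas on \<open>act_prod\<close> available for J^2.\<close>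

lemma JJ_act: "JJ = JX RA Jr"
proof -
  have "finprod (add_monoid RA) s D = finprod (add_monoid A) s D" for s :: "nat \<Rightarrow> 'a" and D
    unfolding finprod_def graded_reg_module_def by simp
  thus ?thesis unfolding set_prod_def act_prod_def finite_sums_def by simp
qed

lemma JJ_sub_Jr: "JJ \<subseteq> Jr"
proof
  fix x assume "x \<in> JJ"
  hence "x \<in> JX RA Jr" unfolding JJ_act .
  have c: "Jr \<subseteq> carrier RA" using Jr_sub by simp
  from \<open>x \<in> JX RA Jr\<close> show "x \<in> Jr"
  proof (induction rule: RA.act_prod_induct[OF Jr_sub c, consumes 1, case_names zero step])
    case zero
    show ?case using Jr_zero by simp
  next
    case (step a x y)
    thus ?case using Jr_add Jr_left by simp
  qed
qed

lemma JJ_sub: "JJ \<subseteq> carrier A"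
  using JJ_sub_Jr Jr_sub by blast

text \<open>A product of a graded ideal and a graded submodule is graded: the scalar is expanded
  into components, each still in \<open>I\<close>, and a homogeneous scalar merely shifts
  components.\<close>

lemma act_prod_cp:
  assumes X: "graded_module A X" and I: "I \<subseteq> carrier A" and N: "N \<subseteq> carrier X"
    and Icp: "\<And>a i. a \<in> I \<Longrightarrow> cp RA i a \<in> I" and Ncp: "\<And>x i. x \<in> N \<Longrightarrow> cp X i x \<in> N"
    and x: "x \<in> act_prod X I N"
  shows "cp X i x \<in> act_prod X I N"
proof -
  interpret X: graded_module A X by (rule X)
  show ?thesis using x
  proof (induction rule: X.act_prod_induct[OF I N, consumes 1, case_names zero step])
    case zero
    show ?case using X.act_prod_zero[OF I N] by simp
  next
    case (step a x y)
    have P: "b \<in> carrier A \<Longrightarrow> (\<And>j. cp RA j b \<in> I) \<Longrightarrow> cp X i (b \<odot>\<^bsub>X\<^esub> x) \<in> act_prod X I N" for b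
    proof -
      assume b: "b \<in> carrier A" and bI: "\<And>j. cp RA j b \<in> I"
      let ?D = "{j. cp RA j b \<noteq> \<zero>}"
      have fin: "finite ?D" using RA.hcomp_spec(2)[of b] b by simp
      have bs: "b = (\<Oplus>\<^bsub>RA\<^esub>j\<in>?D. cp RA j b)" using RA.hcomp_spec(3)[of b] b by simp
      \<comment> \<open>The action on \<open>x\<close> is additive in the scalar; the empty scalar
        set makes \<open>lin_finsum\<close> applicable.\<close>
      have ls: "lin (A\<lparr>carrier := {}\<rparr>) RA X (\<lambda>b. b \<odot>\<^bsub>X\<^esub> x)"
        using step(4) X.smult_l_distr by (simp add: lin_def)
      have "b \<odot>\<^bsub>X\<^esub> x = (\<Oplus>\<^bsub>RA\<^esub>j\<in>?D. cp RA j b) \<odot>\<^bsub>X\<^esub> x" using bs by (rule arg_cong)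
      also have "\<dots> = (\<Oplus>\<^bsub>X\<^esub>j\<in>?D. cp RA j b \<odot>\<^bsub>X\<^esub> x)"
        by (rule lin_finsum[OF ls RA_group gm_group[OF X] fin]) (use b in simp)
      finally have "cp X i (b \<odot>\<^bsub>X\<^esub> x) = cp X i (\<Oplus>\<^bsub>X\<^esub>j\<in>?D. cp RA j b \<odot>\<^bsub>X\<^esub> x)" by simp
      also have "\<dots> = (\<Oplus>\<^bsub>X\<^esub>j\<in>?D. cp X i (cp RA j b \<odot>\<^bsub>X\<^esub> x))"
        by (rule X.hcomp_finsum[OF fin]) (use b step(4) in simp)
      also have "\<dots> = (\<Oplus>\<^bsub>X\<^esub>j\<in>?D. cp RA j b \<odot>\<^bsub>X\<^esub> cp X (i - j) x)"
        by (rule X.M.finsum_cong') (use b step(4) cp_smult[OF X cp_RA_in[OF b] step(4)] X.hcomp_closed in auto)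
      also have "\<dots> \<in> act_prod X I N" using fin
      proof (induction rule: finite_induct)
        case empty
        show ?case using X.act_prod_zero[OF I N] by simp
      next
        case (insert j D)
        have "(\<Oplus>\<^bsub>X\<^esub>j\<in>insert j D. cp RA j b \<odot>\<^bsub>X\<^esub> cp X (i - j) x) = cp RA j b \<odot>\<^bsub>X\<^esub> cp X (i - j) x \<oplus>\<^bsub>X\<^esub> (\<Oplus>\<^bsub>X\<^esub>j\<in>D. cp RA j b \<odot>\<^bsub>X\<^esub> cp X (i - j) x)"
          by (rule X.M.finsum_insert[OF insert(1,2)]) (use b step(4) X.hcomp_closed in auto)
        thus ?case
          using X.act_prod_add[OF I N X.act_prod_prod[OF I N bI Ncp[OF step(2)]] insert(3)] by simp
      qed
      finally show ?thesis .
    qed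
    have "cp X i (a \<odot>\<^bsub>X\<^esub> x) \<in> act_prod X I N" using P[OF step(3)] Icp[OF step(1)] by blast
    thus ?case using step(3-7) X.act_prod_add[OF I N] by (simp add: X.hcomp_add)
  qed
qed

lemma JJ_cp: "x \<in> JJ \<Longrightarrow> cp RA i x \<in> JJ"
  unfolding JJ_act by (rule act_prod_cp[OF RA_gm Jr_sub]) (simp_all add: Jr_sub Jr_cp)

end

section \<open>Finitely generated modules over the degree-zero part\<close>

context gsp begin

text \<open>Submodules over A_0, typically contained in one degree; \<open>gsub\<close> is kept for
  graded submodules over A.\<close>

definition sub0 :: "('a, 'm) graded_module \<Rightarrow> 'm set \<Rightarrow> bool"
  where "sub0 X U \<longleftrightarrow> U \<subseteq> carrier X \<and> \<zero>\<^bsub>X\<^esub> \<in> U \<and> (\<forall>x\<in>U. \<forall>y\<in>U. x \<oplus>\<^bsub>X\<^esub> y \<in> U) \<and> (\<forall>r\<in>A0. \<forall>x\<in>U. r \<odot>\<^bsub>X\<^esub> x \<in> U)"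

definition adj :: "('a, 'm) graded_module \<Rightarrow> 'm set \<Rightarrow> 'm \<Rightarrow> 'm set"
  where "adj X U v = {u \<oplus>\<^bsub>X\<^esub> r \<odot>\<^bsub>X\<^esub> v | u r. u \<in> U \<and> r \<in> A0}"

text \<open>The submodule generated by \<open>U\<close> and the list, with the head adjoined last.
  Lists allow induction on the number of generators over a fixed base \<open>U\<close>.\<close>

definition spanl :: "('a, 'm) graded_module \<Rightarrow> 'm set \<Rightarrow> 'm list \<Rightarrow> 'm set"
  where "spanl X U vs = foldr (\<lambda>v W. adj X W v) vs U"

lemma spanl_simps [simp]: "spanl X U [] = U" "spanl X U (v # vs) = adj X (spanl X U vs) v"
  "spanl X U (xs @ ys) = spanl X (spanl X U ys) xs"
  unfolding spanl_def by simp_all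

lemma sub0_closed: "sub0 X U \<Longrightarrow> x \<in> U \<Longrightarrow> x \<in> carrier X"
  and sub0_zero: "sub0 X U \<Longrightarrow> \<zero>\<^bsub>X\<^esub> \<in> U"
  and sub0_add: "sub0 X U \<Longrightarrow> x \<in> U \<Longrightarrow> y \<in> U \<Longrightarrow> x \<oplus>\<^bsub>X\<^esub> y \<in> U"
  and sub0_smult: "sub0 X U \<Longrightarrow> r \<in> A0 \<Longrightarrow> x \<in> U \<Longrightarrow> r \<odot>\<^bsub>X\<^esub> x \<in> U"
  and sub0_sub: "sub0 X U \<Longrightarrow> U \<subseteq> carrier X"
  unfolding sub0_def by auto

lemma sub0I: "\<lbrakk>U \<subseteq> carrier X; \<zero>\<^bsub>X\<^esub> \<in> U; \<And>x y. \<lbrakk>x \<in> U; y \<in> U\<rbrakk> \<Longrightarrow> x \<oplus>\<^bsub>X\<^esub> y \<in> U; \<And>r x. \<lbrakk>r \<in> A0; x \<in> U\<rbrakk> \<Longrightarrow> r \<odot>\<^bsub>X\<^esub> x \<in> U\<rbrakk> \<Longrightarrow> sub0 X U"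
  unfolding sub0_def by simp

lemma sub0_Int: "\<lbrakk>sub0 X U; sub0 X W\<rbrakk> \<Longrightarrow> sub0 X (U \<inter> W)"
  unfolding sub0_def by auto

lemma A0_neg_one: "\<ominus> \<one> \<in> A0" by (rule A0_neg[OF A0_one])

context
  fixes X :: "('a, 'm) graded_module"
  assumes X: "gm X"
begin

abbreviation (input) add_X (infixl "+." 65) where "x +. y \<equiv> x \<oplus>\<^bsub>X\<^esub> y"
abbreviation (input) act_X (infixl "*." 70) where "a *. x \<equiv> a \<odot>\<^bsub>X\<^esub> x"

interpretation X: graded_module A X by (rule X)

lemma X_smult_one: "x \<in> carrier X \<Longrightarrow> \<one> *. x = x"
  by (rule X.smult_one)

lemma sub0_neg: "sub0 X U \<Longrightarrow> x \<in> U \<Longrightarrow> \<ominus>\<^bsub>X\<^esub> x \<in> U"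
  using sub0_smult[OF _ A0_neg_one, of X U x] sub0_closed[of X U x] X.smult_neg_left[of \<one> x] by (simp add: X_smult_one)

lemma sub0_diff: "sub0 X U \<Longrightarrow> x +. y \<in> U \<Longrightarrow> x \<in> U \<Longrightarrow> x \<in> carrier X \<Longrightarrow> y \<in> carrier X \<Longrightarrow> y \<in> U"
  using sub0_add[of X U "\<ominus>\<^bsub>X\<^esub> x" "x +. y"] sub0_neg[of U x] by (simp add: X.M.a_assoc[symmetric] X.M.l_neg)

lemma sub0_null: "sub0 X {\<zero>\<^bsub>X\<^esub>}"
  by (rule sub0I) (simp_all add: A0_closed)

lemma sub0_mdeg: "sub0 X (mdeg X i)"
  by (rule sub0I) (use X.V_closed X.V_zero X.V_add smult_degree'[OF X, of _ 0] in auto)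

lemma gsub_sub0: "gsub X N \<Longrightarrow> sub0 X N"
  unfolding gsub_def sub0_def by (simp add: A0_closed)

lemma sub0_act: "N \<subseteq> carrier X \<Longrightarrow> sub0 X (JX X N)"
proof (rule sub0I)
  assume N: "N \<subseteq> carrier X"
  show "JX X N \<subseteq> carrier X" by (rule X.act_prod_closed[OF Jr_sub N])
  show "\<zero>\<^bsub>X\<^esub> \<in> JX X N" by (rule X.act_prod_zero[OF Jr_sub N])
  show "x +. y \<in> JX X N" if "x \<in> JX X N" "y \<in> JX X N" for x y by (rule X.act_prod_add[OF Jr_sub N that])
  show "r *. x \<in> JX X N" if "r \<in> A0" "x \<in> JX X N" for r x
    by (rule X.act_prod_smult[OF Jr_sub N _ A0_closed[OF that(1)] that(2)]) (rule Jr_left)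
qed

lemma sub0_sum:
  assumes W: "sub0 X W" and U: "sub0 X U"
  shows "sub0 X {w +. u | w u. w \<in> W \<and> u \<in> U}" "W \<subseteq> {w +. u | w u. w \<in> W \<and> u \<in> U}"
    "U \<subseteq> {w +. u | w u. w \<in> W \<and> u \<in> U}" (is "_ \<subseteq> ?W")
proof -
  note wc = sub0_closed[OF W] and uc = sub0_closed[OF U]
  show WW: "W \<subseteq> ?W"
  proof
    fix w assume w: "w \<in> W"
    hence "w = w +. \<zero>\<^bsub>X\<^esub>" using wc by simp
    thus "w \<in> ?W" using w sub0_zero[OF U] by blast
  qed
  show "U \<subseteq> ?W"
  proof
    fix u assume u: "u \<in> U"
    hence "u = \<zero>\<^bsub>X\<^esub> +. u" using uc by simp
    thus "u \<in> ?W" using u sub0_zero[OF W] by blast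
  qed
  show "sub0 X ?W"
  proof (rule sub0I)
    show "?W \<subseteq> carrier X" using wc uc by auto
    show "\<zero>\<^bsub>X\<^esub> \<in> ?W" using WW sub0_zero[OF W] by blast
  next
    fix x y assume "x \<in> ?W" "y \<in> ?W"
    then obtain w u w' u' where *: "x = w +. u" "y = w' +. u'" "w \<in> W" "u \<in> U" "w' \<in> W" "u' \<in> U" by blast
    have "x +. y = (w +. w') +. (u +. u')"
      unfolding *(1,2) using *(3-) wc uc by (simp add: X.M.a_ac)
    thus "x +. y \<in> ?W" using sub0_add[OF W *(3,5)] sub0_add[OF U *(4,6)] by blast
  next
    fix r x assume r: "r \<in> A0" and "x \<in> ?W"
    then obtain w u where *: "x = w +. u" "w \<in> W" "u \<in> U" by blast
    have "r *. x = r *. w +. r *. u" unfolding *(1) using X.smult_r_distr[OF A0_closed[OF r] wc[OF *(2)] uc[OF *(3)]] .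
    thus "r *. x \<in> ?W" using sub0_smult[OF W r *(2)] sub0_smult[OF U r *(3)] by blast
  qed
qed

lemma sub0_finsum: "\<lbrakk>sub0 X U; finite D; \<And>k. k \<in> D \<Longrightarrow> f k \<in> U\<rbrakk> \<Longrightarrow> finsum X f D \<in> U"
proof (rotate_tac 1, induction D rule: finite_induct)
  case empty
  thus ?case by (simp add: sub0_zero)
next
  case (insert k D)
  have "f \<in> D \<rightarrow> carrier X" "f k \<in> carrier X" using insert.prems(1) sub0_closed[OF insert.prems(2)] by simp_all
  hence "finsum X f (insert k D) = f k +. finsum X f D" using insert(1,2) by (intro X.M.finsum_insert) auto
  thus ?case using insert by (simp add: sub0_add)
qed

lemma adj_sub0:
  assumes U: "sub0 X U" and v: "v \<in> carrier X"
  shows "sub0 X (adj X U v)" "U \<subseteq> adj X U v" "v \<in> adj X U v"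
proof -
  note uc = sub0_closed[OF U]
  show "U \<subseteq> adj X U v"
  proof
    fix u assume "u \<in> U"
    moreover have "u = u +. \<zero> *. v" using uc[OF \<open>u \<in> U\<close>] v by simp
    ultimately show "u \<in> adj X U v" unfolding adj_def using A0_zero by blast
  qed
  have "v = \<zero>\<^bsub>X\<^esub> +. \<one> *. v" using v by (simp add: X_smult_one)
  thus "v \<in> adj X U v" unfolding adj_def using A0_one sub0_zero[OF U] by blast
  show "sub0 X (adj X U v)"
  proof (rule sub0I)
    show "adj X U v \<subseteq> carrier X" unfolding adj_def using uc v A0_closed by auto
    show "\<zero>\<^bsub>X\<^esub> \<in> adj X U v" using \<open>U \<subseteq> adj X U v\<close> sub0_zero[OF U] by blast
  next
    fix x y assume "x \<in> adj X U v" "y \<in> adj X U v"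
    then obtain u r u' r' where *: "x = u +. r *. v" "u \<in> U" "r \<in> A0" "y = u' +. r' *. v" "u' \<in> U" "r' \<in> A0"
      unfolding adj_def by blast
    have "x +. y = (u +. u') +. (r \<oplus> r') *. v"
      using * uc v A0_closed by (simp add: X.smult_l_distr X.M.a_ac)
    thus "x +. y \<in> adj X U v" unfolding adj_def using sub0_add[OF U *(2,5)] A0_add[OF *(3,6)] by blast
  next
    fix s x assume s: "s \<in> A0" and "x \<in> adj X U v"
    then obtain u r where *: "x = u +. r *. v" "u \<in> U" "r \<in> A0" unfolding adj_def by blast
    have "s *. x = s *. u +. (s \<otimes> r) *. v"
      using * uc v A0_closed s by (simp add: X.smult_r_distr X.smult_assoc)
    thus "s *. x \<in> adj X U v" unfolding adj_def using sub0_smult[OF U s *(2)] A0_mult[OF s *(3)] by blast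
  qed
qed

lemma adj_least: "\<lbrakk>sub0 X T; U \<subseteq> T; v \<in> T\<rbrakk> \<Longrightarrow> adj X U v \<subseteq> T"
  unfolding adj_def using sub0_add[of X T] sub0_smult[of X T] by auto

lemma spanl_sub0:
  assumes U: "sub0 X U" and vs: "set vs \<subseteq> carrier X"
  shows "sub0 X (spanl X U vs)" "U \<subseteq> spanl X U vs" "set vs \<subseteq> spanl X U vs"
proof -
  have "sub0 X (spanl X U vs) \<and> U \<subseteq> spanl X U vs \<and> set vs \<subseteq> spanl X U vs" using vs
  proof (induction vs)
    case Nil
    thus ?case using U by simp
  next
    case (Cons v vs)
    hence IH: "sub0 X (spanl X U vs)" "U \<subseteq> spanl X U vs" "set vs \<subseteq> spanl X U vs" and v: "v \<in> carrier X" by simp_all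
    show ?case using adj_sub0[OF IH(1) v] IH(2,3) by auto
  qed
  thus "sub0 X (spanl X U vs)" "U \<subseteq> spanl X U vs" "set vs \<subseteq> spanl X U vs" by blast+
qed

lemma spanl_least: "\<lbrakk>sub0 X T; U \<subseteq> T; set vs \<subseteq> T\<rbrakk> \<Longrightarrow> spanl X U vs \<subseteq> T"
proof (induction vs)
  case (Cons v vs)
  thus ?case using adj_least[of T "spanl X U vs" v] by simp
qed simp

definition fg :: "'m set \<Rightarrow> bool"
  where "fg N \<longleftrightarrow> (\<exists>vs. set vs \<subseteq> carrier X \<and> N = spanl X {\<zero>\<^bsub>X\<^esub>} vs)"

lemma spanl_extend:
  assumes "sub0 X V" "sub0 X U" "U \<subseteq> V" "V = spanl X {\<zero>\<^bsub>X\<^esub>} vs" "set vs \<subseteq> carrier X"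
  shows "V = spanl X U vs"
proof
  note z = spanl_sub0[OF sub0_null assms(5)] and u = spanl_sub0[OF assms(2,5)]
  show "V \<subseteq> spanl X U vs" unfolding assms(4) by (rule spanl_least[OF u(1) _ u(3)]) (use sub0_zero[OF u(1)] in blast)
  show "spanl X U vs \<subseteq> V" by (rule spanl_least[OF assms(1,3)]) (use z(3) assms(4) in blast)
qed

text \<open>Passes from generation as an intersection of submodules to lists of generators.
  \<open>M'\<close> has the operations of \<open>X\<close> but possibly another carrier and record
  type, so that one lemma serves graded modules, the ring A and its left ideals in degree 0.\<close>

lemma fin_gen_spanl:
  fixes M' :: "('a, 'm, 'c) module_scheme"
  assumes M': "sub0 X (carrier M')" "\<zero>\<^bsub>M'\<^esub> = \<zero>\<^bsub>X\<^esub>" "\<And>x y. x \<oplus>\<^bsub>M'\<^esub> y = x +. y" "\<And>a x. a \<odot>\<^bsub>M'\<^esub> x = a *. x"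
    and N: "sub0 X N" "N \<subseteq> carrier M'" and fgN: "fin_gen_submodule R0 M' N"
  shows "\<exists>vs. set vs \<subseteq> N \<and> N = spanl X {\<zero>\<^bsub>X\<^esub>} vs"
proof -
  obtain G where G: "finite G" "G \<subseteq> N" "N = \<Inter>{K. submodule K R0 M' \<and> G \<subseteq> K}" using fgN unfolding fin_gen_submodule_def by blast
  obtain vs where vs: "set vs = G" using finite_list[OF G(1)] by blast
  have vc: "set vs \<subseteq> carrier X" using vs G(2) sub0_sub[OF N(1)] by blast
  note sp = spanl_sub0[OF sub0_null vc]
  let ?T = "spanl X {\<zero>\<^bsub>X\<^esub>} vs"
  have TN: "?T \<subseteq> N" by (rule spanl_least[OF N(1)]) (use sub0_zero[OF N(1)] vs G(2) in auto)
  have "submodule ?T R0 M'"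
  proof (intro submodule.intro subgroup.intro submodule_axioms.intro)
    show "?T \<subseteq> carrier (add_monoid M')" using TN N(2) by simp
    show "x \<otimes>\<^bsub>add_monoid M'\<^esub> y \<in> ?T" if "x \<in> ?T" "y \<in> ?T" for x y using sub0_add[OF sp(1) that] by (simp add: M')
    show "\<one>\<^bsub>add_monoid M'\<^esub> \<in> ?T" using sub0_zero[OF sp(1)] by (simp add: M')
    show "a \<odot>\<^bsub>M'\<^esub> x \<in> ?T" if "a \<in> carrier R0" "x \<in> ?T" for a x using sub0_smult[OF sp(1), of a x] that by (simp add: M')
    \<comment> \<open>The inverse is a definite description over the carrier of \<open>M'\<close>;
      it is identified with the negative in \<open>X\<close>, whose carrier contains that of
      \<open>M'\<close>.\<close>
    show "inv\<^bsub>add_monoid M'\<^esub> x \<in> ?T" if x: "x \<in> ?T" for x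
    proof -
      have xc: "x \<in> carrier X" by (rule sub0_closed[OF sp(1) x])
      have nx: "\<ominus>\<^bsub>X\<^esub> x \<in> ?T" by (rule sub0_neg[OF sp(1) x])
      have "inv\<^bsub>add_monoid M'\<^esub> x = \<ominus>\<^bsub>X\<^esub> x"
        unfolding m_inv_def
      proof (rule the_equality)
        show "\<ominus>\<^bsub>X\<^esub> x \<in> carrier (add_monoid M') \<and> x \<otimes>\<^bsub>add_monoid M'\<^esub> \<ominus>\<^bsub>X\<^esub> x = \<one>\<^bsub>add_monoid M'\<^esub> \<and> \<ominus>\<^bsub>X\<^esub> x \<otimes>\<^bsub>add_monoid M'\<^esub> x = \<one>\<^bsub>add_monoid M'\<^esub>"
          using nx TN N(2) xc by (auto simp: M' X.M.r_neg X.M.l_neg)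
        fix y assume y: "y \<in> carrier (add_monoid M') \<and> x \<otimes>\<^bsub>add_monoid M'\<^esub> y = \<one>\<^bsub>add_monoid M'\<^esub> \<and> y \<otimes>\<^bsub>add_monoid M'\<^esub> x = \<one>\<^bsub>add_monoid M'\<^esub>"
        hence "y \<in> carrier X" "y +. x = \<zero>\<^bsub>X\<^esub>" using sub0_closed[OF M'(1), of y] by (auto simp: M')
        thus "y = \<ominus>\<^bsub>X\<^esub> x" using X.M.minus_equality xc by metis
      qed
      thus ?thesis using nx by simp
    qed
  qed
  hence "N \<subseteq> ?T" using G(3) vs sp(3) by blast
  thus ?thesis using TN vs G(2) by blast
qed

text \<open>Nakayama with \<open>V\<close> fixed: the generators over \<open>U\<close> are removed
  one by one. For the head of the list, v = z + j v with z in the span of the others and j in the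
  radical, and 1 - j has a left inverse.\<close>

lemma nakayama0:
  assumes U: "sub0 X U" and vs: "set vs \<subseteq> carrier X" and V: "V = spanl X U vs"
    and dec: "\<And>x. x \<in> V \<Longrightarrow> \<exists>u\<in>U. \<exists>w\<in>act_prod X J0 V. x = u +. w"
  shows "V = U"
  using vs V
proof (induction vs)
  case Nil
  thus ?case by simp
next
  case (Cons v vs)
  have v: "v \<in> carrier X" and vs: "set vs \<subseteq> carrier X" using Cons.prems by simp_all
  let ?W = "spanl X U vs"
  note W = spanl_sub0[OF U vs]
  have Vadj: "V = adj X ?W v" using Cons.prems by simp
  note V = adj_sub0[OF W(1) v, folded Vadj]
  have J0s: "J0 \<subseteq> carrier A" using J0_closed by blast
  \<comment> \<open>Since the radical is also a right ideal, multiplying u + r v by one of its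
    elements keeps the coefficient of \<open>v\<close> in it.\<close>
  have form: "\<exists>w\<in>?W. \<exists>j\<in>J0. x = w +. j *. v" if "x \<in> act_prod X J0 V" for x
    using that
  proof (induction rule: X.act_prod_induct[OF J0s sub0_sub[OF V(1)], consumes 1, case_names zero step])
    case zero
    have "\<zero>\<^bsub>X\<^esub> = \<zero>\<^bsub>X\<^esub> +. \<zero> *. v" using v by simp
    thus ?case using sub0_zero[OF W(1)] J0_zero by blast
  next
    case (step a x y)
    obtain w j where wj: "w \<in> ?W" "j \<in> J0" "y = w +. j *. v" using step(7) by blast
    obtain u r where ur: "x = u +. r *. v" "u \<in> ?W" "r \<in> A0" using step(2) unfolding Vadj adj_def by blast
    have c: "w \<in> carrier X" "u \<in> carrier X" "j \<in> carrier A" "r \<in> carrier A" "a \<in> carrier A"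
      using sub0_closed[OF W(1)] wj ur J0_closed A0_closed step(3) by blast+
    have "a *. x +. y = (a *. u +. w) +. (a \<otimes> r \<oplus> j) *. v"
      unfolding ur(1) wj(3) using c v by (simp add: X.smult_l_distr X.smult_r_distr X.smult_assoc X.M.a_ac)
    moreover have "a *. u +. w \<in> ?W" using sub0_add[OF W(1) sub0_smult[OF W(1) J0_A0[OF step(1)] ur(2)] wj(1)] .
    moreover have "a \<otimes> r \<oplus> j \<in> J0" using J0_add[OF J0_right[OF ur(3) step(1)] wj(2)] .
    ultimately show ?case by blast
  qed
  obtain u w where uw: "u \<in> U" "w \<in> act_prod X J0 V" "v = u +. w" using dec[OF V(3)] by blast
  obtain w' j where wj: "w' \<in> ?W" "j \<in> J0" "w = w' +. j *. v" using form[OF uw(2)] by blast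
  let ?z = "u +. w'"
  have z: "?z \<in> ?W" using sub0_add[OF W(1) subsetD[OF W(2) uw(1)] wj(1)] .
  have c: "u \<in> carrier X" "w' \<in> carrier X" "j \<in> carrier A" "?z \<in> carrier X"
    using sub0_closed[OF W(1)] wj(1) subsetD[OF W(2) uw(1)] J0_closed[OF wj(2)] z by blast+
  have vz: "v = ?z +. j *. v" using uw(3) wj(3) c v by (simp add: X.M.a_assoc)
  have "(\<one> \<ominus> j) *. v = v +. \<ominus>\<^bsub>X\<^esub> (j *. v)"
    using c v by (simp add: a_minus_def X.smult_l_distr X.smult_neg_left X_smult_one)
  also have "\<dots> = ?z +. j *. v +. \<ominus>\<^bsub>X\<^esub> (j *. v)" using vz by simp
  also have "\<dots> = ?z" using c v by (simp add: X.M.a_assoc X.M.r_neg)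
  finally have jz: "(\<one> \<ominus> j) *. v = ?z" .
  obtain t where t: "t \<in> A0" "t \<otimes> (\<one> \<ominus> j) = \<one>" by (rule J0_unit[OF wj(2)])
  have "v = (t \<otimes> (\<one> \<ominus> j)) *. v" using t v by (simp add: X_smult_one)
  also have "\<dots> = t *. ?z" using jz X.smult_assoc[OF A0_closed[OF t(1)], of "\<one> \<ominus> j" v] c v by simp
  also have "\<dots> \<in> ?W" by (rule sub0_smult[OF W(1) t(1) z])
  finally have "v \<in> ?W" .
  hence "V \<subseteq> ?W" unfolding Vadj by (intro adj_least[OF W(1)]) auto
  hence "V = ?W" using V(2) by blast
  thus ?case using Cons.IH[OF vs] by blast
qed

end

section \<open>Submodules of finitely generated modules over A_0\<close>

lemma noetherian_left_ideal:
  assumes I: "sub0 RA I" "I \<subseteq> A0"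
  shows "\<exists>as. set as \<subseteq> I \<and> I = spanl RA {\<zero>} as"
proof -
  have "left_ideal I R0"
    unfolding ring.left_ideal_iff[OF R0_ring] using I(2) sub0_zero[OF I(1)] sub0_add[OF I(1)] sub0_smult[OF I(1)] by (intro conjI ballI) auto
  hence fgI: "fin_gen_submodule R0 (reg_module R0) I" using noeth unfolding left_noetherian_def by blast
  have "sub0 RA (carrier (reg_module R0))" using sub0_mdeg[OF RA_gm, of 0] by (simp add: reg_module_def)
  from fin_gen_spanl[OF RA_gm this _ _ _ I(1) _ fgI] show ?thesis using I(2) by (simp add: reg_module_def)
qed

context
  fixes X :: "('a, 'm) graded_module"
  assumes X: "gm X"
begin

abbreviation (input) add_X' (infixl "+." 65) where "x +. y \<equiv> x \<oplus>\<^bsub>X\<^esub> y"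
abbreviation (input) act_X' (infixl "*." 70) where "a *. x \<equiv> a \<odot>\<^bsub>X\<^esub> x"

interpretation X: graded_module A X by (rule X)

text \<open>These are the coefficients that \<open>v\<close> takes in elements of \<open>T\<close>
  modulo \<open>N\<close>; below, the ideal of a submodule is compared with that of its candidate
  span.\<close>

lemma sub0_colon:
  assumes N: "sub0 X N" and T: "sub0 X T" and v: "v \<in> carrier X"
  shows "sub0 RA {r \<in> A0. \<exists>u\<in>N. u +. r *. v \<in> T}" (is "sub0 RA ?I")
proof (rule sub0I)
  show "?I \<subseteq> carrier RA" using A0_closed by auto
  show "\<zero>\<^bsub>RA\<^esub> \<in> ?I" using A0_zero sub0_zero[OF N] sub0_zero[OF T] v by (auto intro!: bexI[of _ "\<zero>\<^bsub>X\<^esub>"])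
next
  fix r s assume "r \<in> ?I" "s \<in> ?I"
  then obtain u t where *: "r \<in> A0" "s \<in> A0" "u \<in> N" "t \<in> N" "u +. r *. v \<in> T" "t +. s *. v \<in> T" by blast
  have "(u +. r *. v) +. (t +. s *. v) = (u +. t) +. (r \<oplus> s) *. v"
    using *(1,2) A0_closed sub0_closed[OF N *(3)] sub0_closed[OF N *(4)] v by (simp add: X.smult_l_distr X.M.a_ac)
  thus "r \<oplus>\<^bsub>RA\<^esub> s \<in> ?I" using sub0_add[OF T *(5,6)] sub0_add[OF N *(3,4)] A0_add[OF *(1,2)] by auto
next
  fix s r assume s: "s \<in> A0" and "r \<in> ?I"
  then obtain u where *: "r \<in> A0" "u \<in> N" "u +. r *. v \<in> T" by blast
  have "s *. (u +. r *. v) = s *. u +. (s \<otimes> r) *. v"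
    using *(1) s A0_closed sub0_closed[OF N *(2)] v by (simp add: X.smult_r_distr X.smult_assoc)
  thus "s \<odot>\<^bsub>RA\<^esub> r \<in> ?I" using sub0_smult[OF T s *(3)] sub0_smult[OF N s *(2)] A0_mult[OF s *(1)] by auto
qed

text \<open>Induction on the generators of the ambient module. With N the span of all generators but
  \<open>v\<close>, the submodule \<open>W\<close> is generated by generators of its intersection
  with N and by elements of \<open>W\<close> whose coefficients at \<open>v\<close> generate the
  ideal of all such coefficients.\<close>

lemma noetherian0:
  assumes "set vs \<subseteq> carrier X" "sub0 X W" "W \<subseteq> spanl X {\<zero>\<^bsub>X\<^esub>} vs"
  shows "\<exists>ws. set ws \<subseteq> W \<and> W = spanl X {\<zero>\<^bsub>X\<^esub>} ws"
  using assms
proof (induction vs arbitrary: W)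
  case Nil
  hence "W = spanl X {\<zero>\<^bsub>X\<^esub>} []" using sub0_zero[of X W] by auto
  thus ?case by (intro exI[of _ "[]"]) simp
next
  case (Cons v vs)
  let ?N = "spanl X {\<zero>\<^bsub>X\<^esub>} vs"
  have v: "v \<in> carrier X" and vs: "set vs \<subseteq> carrier X" using Cons.prems by simp_all
  note N = spanl_sub0[OF X sub0_null[OF X] vs]
  note W = Cons.prems(2)
  obtain ws' where ws': "set ws' \<subseteq> W \<inter> ?N" "W \<inter> ?N = spanl X {\<zero>\<^bsub>X\<^esub>} ws'"
    using Cons.IH[OF vs sub0_Int[OF W N(1)]] by blast
  let ?I = "{r \<in> A0. \<exists>u\<in>?N. u +. r *. v \<in> W}"
  have "\<exists>as. set as \<subseteq> ?I \<and> ?I = spanl RA {\<zero>} as"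
    by (rule noetherian_left_ideal[OF sub0_colon[OF N(1) W v]]) blast
  then obtain as where as: "set as \<subseteq> ?I" "?I = spanl RA {\<zero>} as" by blast
  have "\<forall>a. \<exists>u. a \<in> ?I \<longrightarrow> u \<in> ?N \<and> u +. a *. v \<in> W" by blast
  from choice[OF this] obtain t where t: "\<And>a. a \<in> ?I \<Longrightarrow> t a \<in> ?N \<and> t a +. a *. v \<in> W" by blast
  let ?w = "\<lambda>a. t a +. a *. v"
  let ?ws = "map ?w as @ ws'"
  have "?w a \<in> W" if "a \<in> set as" for a using t subsetD[OF as(1) that] by blast
  hence wsW: "set ?ws \<subseteq> W" using ws'(1) by auto
  have wsc: "set ?ws \<subseteq> carrier X" using wsW sub0_sub[OF W] by blast
  let ?T = "spanl X {\<zero>\<^bsub>X\<^esub>} ?ws"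
  note T = spanl_sub0[OF X sub0_null[OF X] wsc]
  have TW: "?T \<subseteq> W" by (rule spanl_least[OF X W _ wsW]) (use sub0_zero[OF W] in blast)
  have WNT: "W \<inter> ?N \<subseteq> ?T"
    unfolding ws'(2) by (rule spanl_least[OF X T(1)]) (use T(3) sub0_zero[OF T(1)] in auto)
  have "spanl RA {\<zero>} as \<subseteq> {r \<in> A0. \<exists>u\<in>?N. u +. r *. v \<in> ?T}"
  proof (rule spanl_least[OF RA_gm sub0_colon[OF N(1) T(1) v]])
    show "{\<zero>} \<subseteq> {r \<in> A0. \<exists>u\<in>?N. u +. r *. v \<in> ?T}"
      using sub0_zero[OF sub0_colon[OF N(1) T(1) v]] by simp
    show "set as \<subseteq> {r \<in> A0. \<exists>u\<in>?N. u +. r *. v \<in> ?T}"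
    proof
      fix a assume a: "a \<in> set as"
      hence aI: "a \<in> ?I" using as(1) by blast
      have "?w a \<in> ?T" using T(3) a by auto
      thus "a \<in> {r \<in> A0. \<exists>u\<in>?N. u +. r *. v \<in> ?T}" using aI t[OF aI] by blast
    qed
  qed
  \<comment> \<open>Every coefficient that occurs in \<open>W\<close> occurs in \<open>?T\<close>
    already, so an element of \<open>W\<close> differs from one of \<open>?T\<close> by an element
    of \<open>W \<inter> ?N\<close>.\<close>
  hence lift: "\<exists>u\<in>?N. u +. r *. v \<in> ?T" if "r \<in> ?I" for r using that as(2) by blast
  have "W \<subseteq> ?T"
  proof
    fix w assume w: "w \<in> W"
    hence "w \<in> adj X ?N v" using Cons.prems(3) by auto
    then obtain u r where ur: "w = u +. r *. v" "u \<in> ?N" "r \<in> A0" unfolding adj_def by blast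
    then obtain u' where u': "u' \<in> ?N" "u' +. r *. v \<in> ?T" using lift[of r] w by blast
    let ?w' = "u' +. r *. v"
    have c: "u \<in> carrier X" "u' \<in> carrier X" "r \<in> carrier A" using sub0_closed[OF N(1)] ur u' A0_closed by blast+
    have eq: "w = ?w' +. (u +. \<ominus>\<^bsub>X\<^esub> u')"
    proof -
      have "?w' +. (u +. \<ominus>\<^bsub>X\<^esub> u') = (u +. r *. v) +. (u' +. \<ominus>\<^bsub>X\<^esub> u')" using c v by (simp add: X.M.a_ac)
      thus ?thesis using ur(1) c v by (simp add: X.M.r_neg)
    qed
    have uN: "u +. \<ominus>\<^bsub>X\<^esub> u' \<in> ?N" using sub0_add[OF N(1) ur(2) sub0_neg[OF X N(1) u'(1)]] .
    have "?w' \<in> W" using u'(2) TW by blast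
    hence "u +. \<ominus>\<^bsub>X\<^esub> u' \<in> W"
      using sub0_diff[OF X W, of ?w' "u +. \<ominus>\<^bsub>X\<^esub> u'"] w c v unfolding eq[symmetric] by simp
    hence "u +. \<ominus>\<^bsub>X\<^esub> u' \<in> ?T" using uN WNT by blast
    thus "w \<in> ?T" unfolding eq using sub0_add[OF T(1) u'(2)] by blast
  qed
  hence "W = ?T" using TW by blast
  thus ?case using wsW by blast
qed

section \<open>Extension and separation of A_0-linear maps into A/J\<close>

abbreviation "res V \<equiv> X\<lparr>carrier := V\<rparr>"

lemma lin0_zero: "sub0 X V \<Longrightarrow> lin R0 (res V) SS f \<Longrightarrow> f \<zero>\<^bsub>X\<^esub> = \<zero>\<^sub>S"
proof -
  interpret SS: graded_module A SS by (rule SS_gm)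
  assume V: "sub0 X V" and f: "lin R0 (res V) SS f"
  show ?thesis using lin_add[OF f, of "\<zero>\<^bsub>X\<^esub>" "\<zero>\<^bsub>X\<^esub>"] lin_closed[OF f, of "\<zero>\<^bsub>X\<^esub>"] sub0_zero[OF V] by simp
qed

text \<open>An equation w + p y = w' + p y' places p (y - y') in \<open>W\<close>, so agreement of
  \<open>f\<close> and \<open>k\<close> on such elements makes the common extension well defined,
  also for a noninjective \<open>p\<close>. It serves to adjoin one element, with \<open>Y\<close> =
  A_0, and to impose the value zero on a submodule.\<close>

lemma glue_lin:
  assumes W: "sub0 X W" and f: "lin R0 (res W) SS f" and V: "gm V" and Y: "sub0 V Y"
    and p: "lin R0 (V\<lparr>carrier := Y\<rparr>) X p" and k: "lin R0 (V\<lparr>carrier := Y\<rparr>) SS k"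
    and agree: "\<And>y. \<lbrakk>y \<in> Y; p y \<in> W\<rbrakk> \<Longrightarrow> f (p y) = k y"
  shows "\<exists>h. lin R0 (res {w +. p y | w y. w \<in> W \<and> y \<in> Y}) SS h \<and> (\<forall>w\<in>W. h w = f w) \<and> (\<forall>y\<in>Y. h (p y) = k y)"
proof -
  interpret SS: graded_module A SS by (rule SS_gm)
  interpret V: graded_module A V by (rule V)
  note wc = sub0_closed[OF W] and yc = sub0_closed[OF Y]
  have fc: "f w \<in> carrier SS" if "w \<in> W" for w using lin_closed[OF f] that by simp
  have fa: "f (w +. w') = f w \<oplus>\<^bsub>SS\<^esub> f w'" if "w \<in> W" "w' \<in> W" for w w' using lin_add[OF f] that by simp
  have pc: "p y \<in> carrier X" "k y \<in> carrier SS" if "y \<in> Y" for y using lin_closed[OF p] lin_closed[OF k] that by simp_all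
  have pa: "p (y \<oplus>\<^bsub>V\<^esub> z) = p y +. p z" "k (y \<oplus>\<^bsub>V\<^esub> z) = k y \<oplus>\<^bsub>SS\<^esub> k z" if "y \<in> Y" "z \<in> Y" for y z
    using lin_add[OF p] lin_add[OF k] that by simp_all
  let ?D = "{w +. p y | w y. w \<in> W \<and> y \<in> Y}"
  define h where "h x = (SOME z. \<exists>w y. w \<in> W \<and> y \<in> Y \<and> x = w +. p y \<and> z = f w \<oplus>\<^bsub>SS\<^esub> k y)" for x
  have wd: "f w \<oplus>\<^bsub>SS\<^esub> k y = f w' \<oplus>\<^bsub>SS\<^esub> k y'"
    if w: "w \<in> W" "y \<in> Y" and w': "w' \<in> W" "y' \<in> Y" and eq: "w +. p y = w' +. p y'" for w y w' y'
  proof -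
    define t where "t = y \<oplus>\<^bsub>V\<^esub> \<ominus>\<^bsub>V\<^esub> y'"
    have t: "t \<in> Y" unfolding t_def by (rule sub0_add[OF Y w(2) sub0_neg[OF V Y w'(2)]])
    have y: "t \<oplus>\<^bsub>V\<^esub> y' = y" unfolding t_def using yc[OF w(2)] yc[OF w'(2)] by (simp add: V.M.a_assoc V.M.l_neg)
    note py = pa[OF t w'(2), unfolded y]
    note cc = wc[OF w(1)] wc[OF w'(1)] pc[OF t] pc[OF w'(2)] fc[OF w(1)]
    have "(w +. p t) +. p y' = w' +. p y'" using eq cc unfolding py by (simp add: X.M.a_assoc)
    hence wt: "w +. p t = w'" using cc by simp
    have "p t \<in> W" by (rule sub0_diff[OF X W _ w(1)]) (use wt w'(1) cc in simp_all)
    hence "f w' = f w \<oplus>\<^bsub>SS\<^esub> k t" using fa[OF w(1)] agree[OF t] wt by metis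
    thus ?thesis unfolding py using cc by (simp add: SS.M.a_assoc)
  qed
  have heq: "h (w +. p y) = f w \<oplus>\<^bsub>SS\<^esub> k y" if w: "w \<in> W" "y \<in> Y" for w y
    unfolding h_def
  proof (rule some_equality)
    show "\<exists>w' y'. w' \<in> W \<and> y' \<in> Y \<and> w +. p y = w' +. p y' \<and> f w \<oplus>\<^bsub>SS\<^esub> k y = f w' \<oplus>\<^bsub>SS\<^esub> k y'"
      using w by (intro exI[of _ w] exI[of _ y]) simp
  qed (elim exE conjE, simp only: wd[OF w])
  have h: "lin R0 (res ?D) SS h"
  proof (rule linI)
    fix x assume "x \<in> carrier (res ?D)"
    then obtain w y where x: "x = w +. p y" "w \<in> W" "y \<in> Y" by auto
    note cx = wc[OF x(2)] pc[OF x(3)] fc[OF x(2)]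
    show "h x \<in> carrier SS" unfolding x(1) heq[OF x(2,3)] using cx by simp
    fix x' assume "x' \<in> carrier (res ?D)"
    then obtain w' y' where x': "x' = w' +. p y'" "w' \<in> W" "y' \<in> Y" by auto
    note cx' = wc[OF x'(2)] pc[OF x'(3)] fc[OF x'(2)]
    have "x +. x' = (w +. w') +. p (y \<oplus>\<^bsub>V\<^esub> y')"
      unfolding x(1) x'(1) pa[OF x(3) x'(3)] using cx cx' by (simp add: X.M.a_ac)
    thus "h (x \<oplus>\<^bsub>res ?D\<^esub> x') = h x \<oplus>\<^bsub>SS\<^esub> h x'"
      using heq[OF sub0_add[OF W x(2) x'(2)] sub0_add[OF Y x(3) x'(3)]] cx cx'
      unfolding x(1) x'(1) heq[OF x(2,3)] heq[OF x'(2,3)] fa[OF x(2) x'(2)] pa[OF x(3) x'(3)] by (simp add: SS.M.a_ac)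
  next
    fix r x assume "r \<in> carrier R0" "x \<in> carrier (res ?D)"
    then obtain w y where r: "r \<in> A0" and x: "x = w +. p y" "w \<in> W" "y \<in> Y" by auto
    note cx = wc[OF x(2)] pc[OF x(3)] fc[OF x(2)] A0_closed[OF r]
    have "r *. x = r *. w +. p (r \<odot>\<^bsub>V\<^esub> y)"
      unfolding x(1) using cx lin_smult[OF p, of r y] r x(3) by (simp add: X.smult_r_distr)
    thus "h (r \<odot>\<^bsub>res ?D\<^esub> x) = r \<odot>\<^bsub>SS\<^esub> h x"
      using heq[OF sub0_smult[OF W r x(2)] sub0_smult[OF Y r x(3)]] lin_smult[OF f, of r w] lin_smult[OF k, of r y] r x(2,3) cx
      unfolding x(1) heq[OF x(2,3)] by (simp add: SS.smult_r_distr)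
  qed
  have k0: "p \<zero>\<^bsub>V\<^esub> = \<zero>\<^bsub>X\<^esub>" "k \<zero>\<^bsub>V\<^esub> = \<zero>\<^sub>S"
    using pa[OF sub0_zero[OF Y] sub0_zero[OF Y]] pc[OF sub0_zero[OF Y]] by simp_all
  have "h w = f w" if w: "w \<in> W" for w using heq[OF w sub0_zero[OF Y]] k0 wc[OF w] fc[OF w] by simp
  moreover have "h (p y) = k y" if y: "y \<in> Y" for y
    using heq[OF sub0_zero[OF W] y] pc[OF y] lin0_zero[OF W f] by simp
  ultimately show ?thesis using h by blast
qed

text \<open>The value \<open>c\<close> at \<open>v\<close> only has to respect the relations that
  put a v into \<open>U\<close>, since these describe the overlap of \<open>U\<close> with A_0
  v.\<close>

lemma adj_extend:
  assumes U: "sub0 X U" and f: "lin R0 (res U) SS f" and v: "v \<in> carrier X" and c: "c \<in> carrier SS"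
    and comp: "\<And>a. \<lbrakk>a \<in> A0; a *. v \<in> U\<rbrakk> \<Longrightarrow> f (a *. v) = a \<odot>\<^bsub>SS\<^esub> c"
  shows "\<exists>g. lin R0 (res (adj X U v)) SS g \<and> (\<forall>x\<in>U. g x = f x) \<and> g v = c"
proof -
  interpret SS: graded_module A SS by (rule SS_gm)
  have "\<exists>h. lin R0 (res (adj X U v)) SS h \<and> (\<forall>w\<in>U. h w = f w) \<and> (\<forall>r\<in>A0. h (r *. v) = r \<odot>\<^bsub>SS\<^esub> c)"
    unfolding adj_def
  proof (rule glue_lin[OF U f RA_gm sub0_mdeg[OF RA_gm] _ _ comp])
    show "lin R0 (RA\<lparr>carrier := A0\<rparr>) X (\<lambda>r. r *. v)"
      by (rule linI) (simp_all add: A0_closed v X.smult_l_distr X.smult_assoc)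
    show "lin R0 (RA\<lparr>carrier := A0\<rparr>) SS (\<lambda>r. r \<odot>\<^bsub>SS\<^esub> c)"
      by (rule linI) (simp_all add: A0_closed c SS.smult_l_distr SS.smult_assoc)
  qed
  thus ?thesis using A0_one X_smult_one[OF X v] SS.smult_one[OF c] by metis
qed

text \<open>The crux is one new generator \<open>v\<close>. The ideal of all a with a v in the
  domain contains the radical. If i retracts A_0 onto this ideal modulo the radical, the value g (i
  v) at \<open>v\<close> is consistent: for a in the ideal, a v and a i v differ by an element of
  J(A_0) v, where \<open>g\<close> vanishes.\<close>

lemma spanl_extend_lin:
  assumes W: "sub0 X W" and U: "U \<subseteq> W" and vs: "set vs \<subseteq> carrier X"
    and JU: "\<And>j v. \<lbrakk>j \<in> J0; v \<in> set vs\<rbrakk> \<Longrightarrow> j *. v \<in> U"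
    and f: "lin R0 (res W) SS f" and f0: "\<And>x. x \<in> U \<Longrightarrow> f x = \<zero>\<^sub>S"
  shows "\<exists>g. lin R0 (res (spanl X W vs)) SS g \<and> (\<forall>x\<in>W. g x = f x)"
  using vs JU
proof (induction vs)
  case Nil
  thus ?case using f by auto
next
  case (Cons v vs)
  interpret SS: graded_module A SS by (rule SS_gm)
  have v: "v \<in> carrier X" and vs: "set vs \<subseteq> carrier X" using Cons.prems by simp_all
  let ?V = "spanl X W vs"
  note V = spanl_sub0[OF X W vs]
  obtain g where g: "lin R0 (res ?V) SS g" "\<forall>x\<in>W. g x = f x" using Cons.IH[OF vs] Cons.prems(2) by auto
  let ?I = "{a \<in> A0. a *. v \<in> ?V}"
  have jv: "j *. v \<in> U" if "j \<in> J0" for j using Cons.prems(2) that by simp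
  have Iadd: "x \<oplus> y \<in> ?I" if "x \<in> ?I" "y \<in> ?I" for x y
    using that A0_add[of x y] sub0_add[OF V(1), of "x *. v" "y *. v"] A0_closed v by (simp add: X.smult_l_distr)
  have Ismult: "r \<otimes> x \<in> ?I" if "r \<in> A0" "x \<in> ?I" for r x
    using that A0_mult[of r x] sub0_smult[OF V(1) that(1), of "x *. v"] A0_closed v by (simp add: X.smult_assoc)
  have JI: "J0 \<subseteq> ?I" using jv U V(2) J0_A0 by blast
  obtain i where i: "i \<in> ?I" "\<And>a. a \<in> ?I \<Longrightarrow> a \<ominus> a \<otimes> i \<in> J0"
    by (rule retract0[of ?I, OF _ JI], blast, erule (1) Iadd, erule (1) Ismult, rule that)
  have iA: "i \<in> A0" and iv: "i *. v \<in> ?V" using i(1) by auto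
  have gc: "g (i *. v) \<in> carrier SS" using lin_closed[OF g(1)] iv by simp
  have "\<exists>h. lin R0 (res (adj X ?V v)) SS h \<and> (\<forall>x\<in>?V. h x = g x) \<and> h v = g (i *. v)"
  proof (rule adj_extend[OF V(1) g(1) v gc])
    fix a assume a: "a \<in> A0" and av: "a *. v \<in> ?V"
    have b: "a \<ominus> a \<otimes> i \<in> J0" using i(2) a av by simp
    note cc = A0_closed[OF a] A0_closed[OF iA] J0_closed[OF b]
    have "(a \<ominus> a \<otimes> i) \<oplus> a \<otimes> i = a" using cc by (simp add: a_minus_def a_assoc l_neg)
    hence "a *. v = (a \<ominus> a \<otimes> i) *. v +. a *. (i *. v)"
      using X.smult_l_distr[of "a \<ominus> a \<otimes> i" "a \<otimes> i" v] X.smult_assoc[of a i v] cc v by simp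
    moreover have 1: "(a \<ominus> a \<otimes> i) *. v \<in> U" by (rule jv[OF b])
    moreover have 2: "(a \<ominus> a \<otimes> i) *. v \<in> ?V" using 1 U V(2) by blast
    moreover have "g ((a \<ominus> a \<otimes> i) *. v) = \<zero>\<^sub>S" using 1 U g(2) f0 by auto
    ultimately show "g (a *. v) = a \<odot>\<^bsub>SS\<^esub> g (i *. v)"
      using lin_add[OF g(1), of "(a \<ominus> a \<otimes> i) *. v" "a *. (i *. v)"] sub0_smult[OF V(1) a iv]
        lin_smult[OF g(1), of a "i *. v"] a iv gc cc by simp
  qed
  then obtain h where h: "lin R0 (res (adj X ?V v)) SS h" "\<forall>x\<in>?V. h x = g x" by blast
  have "\<forall>x\<in>W. h x = f x" using h(2) g(2) V(2) by auto
  thus ?case using h(1) by auto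
qed

text \<open>Injectivity of A/J with respect to finitely generated modules V/U killed by the radical.
  Imposing the value zero on \<open>U\<close> first lets the extension start from a domain that
  contains J(A_0) V.\<close>

lemma extend_lin0:
  assumes W: "sub0 X W" and V: "sub0 X V" and U: "sub0 X U" and WV: "W \<subseteq> V" and UV: "U \<subseteq> V"
    and vs: "V = spanl X {\<zero>\<^bsub>X\<^esub>} vs" "set vs \<subseteq> carrier X"
    and JU: "\<And>j v. \<lbrakk>j \<in> J0; v \<in> V\<rbrakk> \<Longrightarrow> j *. v \<in> U"
    and f: "lin R0 (res W) SS f" and f0: "\<And>x. \<lbrakk>x \<in> W; x \<in> U\<rbrakk> \<Longrightarrow> f x = \<zero>\<^sub>S"
  shows "\<exists>g. lin R0 (res V) SS g \<and> (\<forall>x\<in>W. g x = f x) \<and> (\<forall>x\<in>U. g x = \<zero>\<^sub>S)"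
proof -
  interpret SS: graded_module A SS by (rule SS_gm)
  let ?W = "{w +. u | w u. w \<in> W \<and> u \<in> U}"
  note W' = sub0_sum[OF X W U]
  have "\<exists>h. lin R0 (res ?W) SS h \<and> (\<forall>w\<in>W. h w = f w) \<and> (\<forall>u\<in>U. h u = \<zero>\<^sub>S)"
  proof (rule glue_lin[OF W f X U])
    show "lin R0 (res U) X (\<lambda>u. u)" by (rule linI) (simp_all add: sub0_closed[OF U])
    show "lin R0 (res U) SS (\<lambda>_. \<zero>\<^sub>S)" by (rule linI) (simp_all add: A0_closed)
  qed (rule f0)
  then obtain h where h: "lin R0 (res ?W) SS h" "\<forall>w\<in>W. h w = f w" "\<forall>u\<in>U. h u = \<zero>\<^sub>S" by blast
  have WV': "?W \<subseteq> V" using sub0_add[OF V] WV UV by blast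
  have vsV: "set vs \<subseteq> V" using spanl_sub0(3)[OF X sub0_null[OF X] vs(2)] vs(1) by blast
  have "\<exists>g. lin R0 (res (spanl X ?W vs)) SS g \<and> (\<forall>x\<in>?W. g x = h x)"
    by (rule spanl_extend_lin[OF W'(1,3) vs(2) _ h(1) bspec[OF h(3)]]) (use JU vsV in blast)
  then obtain g where g: "lin R0 (res (spanl X ?W vs)) SS g" "\<forall>x\<in>?W. g x = h x" by blast
  have "V = spanl X ?W vs" by (rule spanl_extend[OF X V W'(1) WV' vs])
  hence "lin R0 (res V) SS g" using g(1) by simp
  moreover have "\<forall>x\<in>W. g x = f x"
  proof
    fix x assume x: "x \<in> W"
    show "g x = f x" using bspec[OF g(2) subsetD[OF W'(2) x]] bspec[OF h(2) x] by simp
  qed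
  moreover have "\<forall>x\<in>U. g x = \<zero>\<^sub>S"
  proof
    fix x assume x: "x \<in> U"
    show "g x = \<zero>\<^sub>S" using bspec[OF g(2) subsetD[OF W'(3) x]] bspec[OF h(3) x] by simp
  qed
  ultimately show ?thesis by blast
qed

text \<open>A/J as a cogenerator: with i a retraction onto the ideal of all a with a x in
  \<open>U\<close>, sending \<open>x\<close> to the class of 1 - i is consistent, and this class is
  nonzero since otherwise 1 would belong to the ideal.\<close>

lemma separate0:
  assumes V: "sub0 X V" and U: "sub0 X U" and UV: "U \<subseteq> V"
    and vs: "V = spanl X {\<zero>\<^bsub>X\<^esub>} vs" "set vs \<subseteq> carrier X"
    and JU: "\<And>j v. \<lbrakk>j \<in> J0; v \<in> V\<rbrakk> \<Longrightarrow> j *. v \<in> U"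
    and x: "x \<in> V" "x \<notin> U"
  shows "\<exists>g. lin R0 (res V) SS g \<and> (\<forall>y\<in>U. g y = \<zero>\<^sub>S) \<and> g x \<noteq> \<zero>\<^sub>S"
proof -
  interpret SS: graded_module A SS by (rule SS_gm)
  have xc: "x \<in> carrier X" by (rule sub0_closed[OF V x(1)])
  let ?I = "{a \<in> A0. a *. x \<in> U}"
  have Iadd: "a \<oplus> b \<in> ?I" if "a \<in> ?I" "b \<in> ?I" for a b
    using that A0_add[of a b] sub0_add[OF U, of "a *. x" "b *. x"] A0_closed xc by (simp add: X.smult_l_distr)
  have Ismult: "r \<otimes> a \<in> ?I" if "r \<in> A0" "a \<in> ?I" for r a
    using that A0_mult[of r a] sub0_smult[OF U that(1), of "a *. x"] A0_closed xc by (simp add: X.smult_assoc)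
  have JI: "J0 \<subseteq> ?I" using JU x(1) J0_A0 by blast
  obtain i where i: "i \<in> ?I" "\<And>a. a \<in> ?I \<Longrightarrow> a \<ominus> a \<otimes> i \<in> J0"
    by (rule retract0[of ?I, OF _ JI], blast, erule (1) Iadd, erule (1) Ismult, rule that)
  have iA: "i \<in> A0" using i(1) by blast
  note ic = A0_closed[OF iA]
  let ?c = "cls (\<one> \<ominus> i)"
  have c: "?c \<in> carrier SS" using cls_closed ic by simp
  have z: "lin R0 (res U) SS (\<lambda>_. \<zero>\<^sub>S)" by (rule linI) (simp_all add: A0_closed)
  have "\<exists>h. lin R0 (res (adj X U x)) SS h \<and> (\<forall>y\<in>U. h y = \<zero>\<^sub>S) \<and> h x = ?c"
  proof (rule adj_extend[OF U z xc c])
    fix a assume a: "a \<in> A0" "a *. x \<in> U"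
    note ac = A0_closed[OF a(1)]
    have "a \<otimes> (\<one> \<ominus> i) = a \<ominus> a \<otimes> i" using ac ic by (simp add: a_minus_def r_distr r_minus)
    moreover have "a \<ominus> a \<otimes> i \<in> J0" using i(2) a by simp
    ultimately have "a \<otimes> (\<one> \<ominus> i) \<in> Jr" using Jr_A0 J0_A0 by simp
    thus "\<zero>\<^sub>S = a \<odot>\<^bsub>SS\<^esub> ?c" using cls_smult[OF ac, of "\<one> \<ominus> i"] cls_zero_iff[of "a \<otimes> (\<one> \<ominus> i)"] ac ic by (simp add: SS_simps(2))
  qed
  then obtain h where h: "lin R0 (res (adj X U x)) SS h" "\<forall>y\<in>U. h y = \<zero>\<^sub>S" "h x = ?c" by blast
  note W = adj_sub0[OF X U xc]
  have WV: "adj X U x \<subseteq> V" by (rule adj_least[OF X V UV x(1)])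
  obtain g where g: "lin R0 (res V) SS g" "\<forall>y\<in>adj X U x. g y = h y" "\<forall>y\<in>U. g y = \<zero>\<^sub>S"
    using extend_lin0[OF W(1) V U WV UV vs JU h(1)] h(2) by blast
  have "?c \<noteq> \<zero>\<^sub>S"
  proof
    assume "?c = \<zero>\<^sub>S"
    hence "\<one> \<ominus> i \<in> Jr" using cls_zero_iff[of "\<one> \<ominus> i"] ic by (simp add: SS_simps(2))
    hence "\<one> \<ominus> i \<in> J0" using Jr_A0[OF A0_minus[OF A0_one iA]] by simp
    hence "(\<one> \<ominus> i) \<oplus> i \<in> ?I" using JI i(1) Iadd by blast
    moreover have "(\<one> \<ominus> i) \<oplus> i = \<one>" using ic by (simp add: a_minus_def a_assoc l_neg)
    ultimately show False using x(2) X_smult_one[OF X xc] by simp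
  qed
  hence "g x \<noteq> \<zero>\<^sub>S" using g(2) W(3) h(3) by simp
  thus ?thesis using g(1,3) by blast
qed

end

end

section \<open>Projective covers and minimal resolutions\<close>

context graded_ring begin

lemma ker_gsub:
  assumes X: "gm X" and Y: "gm Y" and f: "f \<in> Hom_Gr A X Y"
  shows "gsub X {x \<in> carrier X. f x = \<zero>\<^bsub>Y\<^esub>}"
proof -
  interpret X: graded_module A X by (rule X)
  interpret Y: graded_module A Y by (rule Y)
  note l = Hom_lin[OF f]
  show ?thesis
    unfolding gsub_def
    using lin_zero[OF l gm_group[OF X] gm_group[OF Y]] X.hcomp_closed Hom_cp[OF X Y f]
    by (auto simp: lin_add[OF l] lin_smult[OF l] simp flip: Hom_cp[OF X Y f])
qed

end

context gsp begin

lemma left_finite_fg: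
  assumes M: "gm M" and "left_finite A M" shows "fg M (mdeg M i)"
proof -
  have "fin_gen_submodule R0 M (mdeg M i)" using assms(2) unfolding left_finite_def by blast
  moreover have "mdeg M i \<subseteq> carrier M" using sub0_sub[OF sub0_mdeg[OF M]] .
  ultimately have "\<exists>vs. set vs \<subseteq> mdeg M i \<and> mdeg M i = spanl M {\<zero>\<^bsub>M\<^esub>} vs"
    using fin_gen_spanl[OF M gsub_sub0[OF M gsub_carrier[OF M]] refl refl refl sub0_mdeg[OF M]] by blast
  thus ?thesis unfolding fg_def[OF M] using \<open>mdeg M i \<subseteq> carrier M\<close> by blast
qed

lemma RA_fg: "fg RA (mdeg RA i)"
proof (cases "i < 0")
  case True
  thus ?thesis unfolding fg_def[OF RA_gm] by (intro exI[of _ "[]"]) (simp add: RA_mdeg)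
next
  case False
  have m: "mdeg RA i = rdeg A (nat i)" using False by (simp add: RA_mdeg)
  have f: "fin_gen_submodule R0 (reg_module A) (mdeg RA i)" using lfin m unfolding left_finite_ring_def by simp
  have c: "mdeg RA i \<subseteq> carrier (reg_module A)" using RA_closed by (auto simp: reg_module_def)
  have s: "sub0 RA (carrier (reg_module A))" using gsub_sub0[OF RA_gm gsub_carrier[OF RA_gm]] by (simp add: reg_module_def)
  from fin_gen_spanl[OF RA_gm s _ _ _ sub0_mdeg[OF RA_gm] c f]
  show ?thesis unfolding fg_def[OF RA_gm] using RA_closed by (auto simp: reg_module_def)
qed

text \<open>The projective cover in a single degree, one generator at a time. For the ideal of all a
  with a v in the span W so far, \<open>idempotent0\<close> gives f such that f v generates the same
  as \<open>v\<close> over W, and such that a f lies in the radical whenever a f v is in W. The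
  lists are reversed because \<open>spanl\<close> adjoins the head last.\<close>

lemma degree_cover:
  assumes N: "gm N" and V: "sub0 N V" and U: "sub0 N U" and UV: "U \<subseteq> V"
    and JU: "\<And>j v. \<lbrakk>j \<in> J0; v \<in> V\<rbrakk> \<Longrightarrow> j \<odot>\<^bsub>N\<^esub> v \<in> U" and vs: "set vs \<subseteq> V"
  shows "\<exists>(m::nat) e w. (\<forall>j<m. e j \<in> A0 \<and> e j \<otimes> e j = e j \<and> w j \<in> V \<and> e j \<odot>\<^bsub>N\<^esub> w j = w j \<and>
      (\<forall>a\<in>A0. (a \<otimes> e j) \<odot>\<^bsub>N\<^esub> w j \<in> spanl N U (rev (map w [0..<j])) \<longrightarrow> a \<otimes> e j \<in> J0)) \<and>
      spanl N U vs = spanl N U (rev (map w [0..<m]))"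
  using vs
proof (induction vs)
  case Nil
  show ?case by (rule exI[of _ 0]) simp
next
  case (Cons v vs)
  interpret N: graded_module A N by (rule N)
  obtain m :: nat and e w where IH: "\<And>j. j < m \<Longrightarrow> e j \<in> A0 \<and> e j \<otimes> e j = e j \<and> w j \<in> V \<and> e j \<odot>\<^bsub>N\<^esub> w j = w j \<and>
      (\<forall>a\<in>A0. (a \<otimes> e j) \<odot>\<^bsub>N\<^esub> w j \<in> spanl N U (rev (map w [0..<j])) \<longrightarrow> a \<otimes> e j \<in> J0)"
      "spanl N U vs = spanl N U (rev (map w [0..<m]))" using Cons by auto
  let ?W = "spanl N U vs"
  have v: "v \<in> V" "v \<in> carrier N" using Cons.prems sub0_closed[OF V] by auto
  have vsc: "set vs \<subseteq> carrier N" using Cons.prems sub0_sub[OF V] by auto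
  note W = spanl_sub0[OF N U vsc]
  let ?I = "{a \<in> A0. a \<odot>\<^bsub>N\<^esub> v \<in> ?W}"
  have Iadd: "x \<oplus> y \<in> ?I" if "x \<in> ?I" "y \<in> ?I" for x y
    using that A0_add[of x y] sub0_add[OF W(1), of "x \<odot>\<^bsub>N\<^esub> v" "y \<odot>\<^bsub>N\<^esub> v"] A0_closed v by (simp add: N.smult_l_distr)
  have Ismult: "r \<otimes> x \<in> ?I" if "r \<in> A0" "x \<in> ?I" for r x
    using that A0_mult[of r x] sub0_smult[OF W(1) that(1), of "x \<odot>\<^bsub>N\<^esub> v"] A0_closed v by (simp add: N.smult_assoc)
  have JI: "J0 \<subseteq> ?I" using JU v(1) W(2) J0_A0 by blast
  obtain f where f: "f \<in> A0" "f \<otimes> f = f" "\<one> \<ominus> f \<in> ?I" "\<And>a. \<lbrakk>a \<in> A0; a \<otimes> f \<in> ?I\<rbrakk> \<Longrightarrow> a \<otimes> f \<in> J0"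
    by (rule idempotent0[of ?I, OF _ JI], blast, erule (1) Iadd, erule (1) Ismult, rule that)
  note fc = A0_closed[OF f(1)]
  let ?fv = "f \<odot>\<^bsub>N\<^esub> v"
  have fvV: "?fv \<in> V" by (rule sub0_smult[OF V f(1) v(1)])
  have fvc: "?fv \<in> carrier N" by (rule sub0_closed[OF V fvV])
  have af: "(a \<otimes> f) \<odot>\<^bsub>N\<^esub> ?fv = (a \<otimes> f) \<odot>\<^bsub>N\<^esub> v" if "a \<in> A0" for a
    using N.smult_assoc[of "a \<otimes> f" f v] A0_closed[OF that] fc v f(2) by (simp add: m_assoc)
  note adv = adj_sub0[OF N W(1) v(2)] and adf = adj_sub0[OF N W(1) fvc]
  have "v = (\<one> \<ominus> f) \<odot>\<^bsub>N\<^esub> v \<oplus>\<^bsub>N\<^esub> ?fv"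
  proof -
    have "(\<one> \<ominus> f) \<oplus> f = \<one>" using fc by (simp add: a_minus_def a_assoc l_neg)
    thus ?thesis using N.smult_l_distr[of "\<one> \<ominus> f" f v] fc v N.smult_one by simp
  qed
  moreover have "(\<one> \<ominus> f) \<odot>\<^bsub>N\<^esub> v \<oplus>\<^bsub>N\<^esub> ?fv \<in> adj N ?W ?fv"
    using sub0_add[OF adf(1)] f(3) adf(2,3) by blast
  ultimately have "v \<in> adj N ?W ?fv" by simp
  hence "adj N ?W v \<subseteq> adj N ?W ?fv" by (intro adj_least[OF N adf(1) adf(2)])
  moreover have "adj N ?W ?fv \<subseteq> adj N ?W v"
    by (intro adj_least[OF N adv(1) adv(2)] sub0_smult[OF adv(1) f(1) adv(3)])
  ultimately have adeq: "adj N ?W v = adj N ?W ?fv" by blast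
  let ?e = "e(m := f)" and ?w = "w(m := ?fv)"
  have mp: "map ?w [0..<j] = map w [0..<j]" if "j \<le> m" for j using that by auto
  have "?e j \<in> A0 \<and> ?e j \<otimes> ?e j = ?e j \<and> ?w j \<in> V \<and> ?e j \<odot>\<^bsub>N\<^esub> ?w j = ?w j \<and>
      (\<forall>a\<in>A0. (a \<otimes> ?e j) \<odot>\<^bsub>N\<^esub> ?w j \<in> spanl N U (rev (map ?w [0..<j])) \<longrightarrow> a \<otimes> ?e j \<in> J0)" if j: "j < Suc m" for j
  proof (cases "j = m")
    case True
    have "f \<odot>\<^bsub>N\<^esub> ?fv = ?fv" using N.smult_assoc[of f f v] fc v f(2) by simp
    moreover have "a \<otimes> f \<in> J0" if a: "a \<in> A0" "(a \<otimes> f) \<odot>\<^bsub>N\<^esub> ?fv \<in> spanl N U (rev (map w [0..<m]))" for a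
      using f(4)[OF a(1)] a A0_mult[OF a(1) f(1)] af[OF a(1)] IH(2) by simp
    ultimately show ?thesis using True f(1,2) fvV mp[of m] by simp
  next
    case False
    hence "j < m" using j by simp
    thus ?thesis using IH(1)[of j] mp[of j] by simp
  qed
  moreover have "spanl N U (v # vs) = spanl N U (rev (map ?w [0..<Suc m]))"
    using adeq IH(2) mp[of m] by simp
  ultimately show ?case by blast
qed

lemma degree_independent:
  fixes N :: "('a, 'n) graded_module"
  assumes N: "gm N" and V: "sub0 N V" and U: "sub0 N U" and UV: "U \<subseteq> V"
    and JU: "\<And>j v. \<lbrakk>j \<in> J0; v \<in> V\<rbrakk> \<Longrightarrow> j \<odot>\<^bsub>N\<^esub> v \<in> U"
    and cov: "\<And>j. j < (m::nat) \<Longrightarrow> e j \<in> A0 \<and> w j \<in> V \<and>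
      (\<forall>a\<in>A0. (a \<otimes> e j) \<odot>\<^bsub>N\<^esub> w j \<in> spanl N U (rev (map w [0..<j])) \<longrightarrow> a \<otimes> e j \<in> J0)"
    and a: "\<And>j. j < m \<Longrightarrow> a j \<in> A0 \<and> a j \<otimes> e j = a j"
    and l: "l \<le> m" and sum: "(\<Oplus>\<^bsub>N\<^esub>j\<in>{..<l}. a j \<odot>\<^bsub>N\<^esub> w j) \<in> U"
  shows "\<forall>j<l. a j \<in> J0"
  using l sum
proof (induction l)
  case 0
  thus ?case by simp
next
  case (Suc l)
  interpret N: graded_module A N by (rule N)
  have lm: "l < m" using Suc.prems by simp
  have wc: "w j \<in> carrier N" if "j < m" for j using sub0_closed[OF V] cov[OF that] by blast
  have awc: "a j \<odot>\<^bsub>N\<^esub> w j \<in> carrier N" if "j < m" for j using wc[OF that] a[OF that] A0_closed by simp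
  have sc: "set (rev (map w [0..<l])) \<subseteq> carrier N" using wc lm by auto
  note W = spanl_sub0[OF N U sc]
  let ?s = "\<Oplus>\<^bsub>N\<^esub>j\<in>{..<l}. a j \<odot>\<^bsub>N\<^esub> w j"
  have sW: "?s \<in> spanl N U (rev (map w [0..<l]))"
  proof (rule sub0_finsum[OF N W(1) finite_lessThan])
    fix j assume j: "j \<in> {..<l}"
    hence "w j \<in> spanl N U (rev (map w [0..<l]))" using W(3) by auto
    thus "a j \<odot>\<^bsub>N\<^esub> w j \<in> spanl N U (rev (map w [0..<l]))" using sub0_smult[OF W(1)] a[of j] j lm by simp
  qed
  have sC: "?s \<in> carrier N" by (rule sub0_closed[OF W(1) sW])
  have "(\<Oplus>\<^bsub>N\<^esub>j\<in>{..<Suc l}. a j \<odot>\<^bsub>N\<^esub> w j) = a l \<odot>\<^bsub>N\<^esub> w l \<oplus>\<^bsub>N\<^esub> ?s"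
    unfolding lessThan_Suc by (rule N.M.finsum_insert) (use awc lm in auto)
  hence eq: "?s \<oplus>\<^bsub>N\<^esub> a l \<odot>\<^bsub>N\<^esub> w l \<in> U" using Suc.prems(2) sC awc[OF lm] by (simp add: N.M.a_comm)
  hence "a l \<odot>\<^bsub>N\<^esub> w l \<in> spanl N U (rev (map w [0..<l]))"
    using sub0_diff[OF N W(1) _ sW sC awc[OF lm]] W(2) by blast
  hence al: "a l \<in> J0" using cov[OF lm] a[OF lm] by metis
  hence "a l \<odot>\<^bsub>N\<^esub> w l \<in> U" using JU cov[OF lm] by blast
  hence "?s \<in> U" using sub0_diff[OF N U, of "a l \<odot>\<^bsub>N\<^esub> w l" ?s] eq sC awc[OF lm] by (simp add: N.M.a_comm)
  hence "\<forall>j<l. a j \<in> J0" using Suc.IH lm by simp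
  thus ?case using al less_Suc_eq by auto
qed

text \<open>Conditions under which the sum of the modules A e_k is projective, left finite and
  bounded below; see \<open>fmod_projective\<close> and \<open>basis_nice\<close>.\<close>

definition basis_data :: "'k set \<Rightarrow> ('k \<Rightarrow> 'a) \<Rightarrow> ('k \<Rightarrow> int) \<Rightarrow> bool"
  where "basis_data K e d \<longleftrightarrow> (\<forall>k\<in>K. e k \<in> A0 \<and> e k \<otimes> e k = e k) \<and> (\<forall>i. finite {k \<in> K. d k \<le> i}) \<and> (\<exists>b. \<forall>k\<in>K. b \<le> d k)"

definition nice :: "('a, 'n) graded_module \<Rightarrow> bool"
  where "nice N \<longleftrightarrow> gm N \<and> (\<forall>i. fg N (mdeg N i)) \<and> (\<exists>b. \<forall>i<b. mdeg N i = {\<zero>\<^bsub>N\<^esub>})"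

definition cover :: "('a, 'n) graded_module \<Rightarrow> 'k set \<Rightarrow> ('k \<Rightarrow> 'a) \<Rightarrow> ('k \<Rightarrow> int) \<Rightarrow> ('k \<Rightarrow> 'n) \<Rightarrow> bool"
  where "cover N K e d p \<longleftrightarrow> basis_data K e d \<and> (\<forall>k\<in>K. p k \<in> mdeg N (d k)) \<and>
    lincomb A N p ` carrier (fmod A K e d) = carrier N \<and>
    (\<forall>f\<in>carrier (fmod A K e d). lincomb A N p f = \<zero>\<^bsub>N\<^esub> \<longrightarrow> f \<in> JX (fmod A K e d) (carrier (fmod A K e d)))"

lemma basis_e: "basis_data K e d \<Longrightarrow> k \<in> K \<Longrightarrow> e k \<in> A0"
  and basis_idem: "basis_data K e d \<Longrightarrow> k \<in> K \<Longrightarrow> e k \<otimes> e k = e k"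
  and basis_fin: "basis_data K e d \<Longrightarrow> finite {k \<in> K. d k \<le> i}"
  unfolding basis_data_def by blast+

lemma basis_gm: "basis_data K e d \<Longrightarrow> gm (fmod A K e d)"
  by (rule fmod_gm_cp(1)) (rule basis_e)

context
  fixes K :: "'k set" and e d
  assumes bd: "basis_data K e d"
begin

lemma basis_single: "\<lbrakk>k \<in> K; a \<in> carrier A; a \<otimes> e k = a\<rbrakk> \<Longrightarrow> single A k a \<in> carrier (fmod A K e d)"
  by (rule single_in) (auto intro: basis_e[OF bd])

lemma basis_single_deg: "\<lbrakk>k \<in> K; a \<in> mdeg RA i; a \<otimes> e k = a\<rbrakk> \<Longrightarrow> single A k a \<in> mdeg (fmod A K e d) (i + d k)"
  by (rule single_deg) (auto intro: basis_e[OF bd])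

lemma basis_gen: "k \<in> K \<Longrightarrow> single A k (e k) \<in> carrier (fmod A K e d)"
  using basis_single A0_closed[OF basis_e[OF bd]] basis_idem[OF bd] by simp

lemma basis_mdeg: "f \<in> mdeg (fmod A K e d) i \<longleftrightarrow> f \<in> carrier (fmod A K e d) \<and> (\<forall>k. f k \<in> mdeg RA (i - d k))"
  by (rule fmod_mdeg) (rule basis_e[OF bd])

lemma basis_coeff: "f \<in> carrier (fmod A K e d) \<Longrightarrow> f k \<in> carrier A"
  by (rule fmodD) (auto intro: basis_e[OF bd])

lemma basis_coeff_e: "f \<in> carrier (fmod A K e d) \<Longrightarrow> k \<in> K \<Longrightarrow> f k \<otimes> e k = f k"
  by (rule fmod_e) (auto intro: basis_e[OF bd])

lemma basis_support: "f \<in> carrier (fmod A K e d) \<Longrightarrow> finite {k. f k \<noteq> \<zero>}"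
  by (rule fmod_fin) (auto intro: basis_e[OF bd])

lemma basis_out: "f \<in> carrier (fmod A K e d) \<Longrightarrow> k \<notin> K \<Longrightarrow> f k = \<zero>"
  by (rule fmod_out) (auto intro: basis_e[OF bd])

lemma basis_expand: "f \<in> carrier (fmod A K e d) \<Longrightarrow> lincomb A (fmod A K e d) (\<lambda>k. single A k (e k)) f = f"
  by (rule lincomb_basis) (auto intro: basis_e[OF bd] basis_idem[OF bd])

lemma basis_cp: "f \<in> carrier (fmod A K e d) \<Longrightarrow> cp (fmod A K e d) i f = (\<lambda>k. cp RA (i - d k) (f k))"
  by (rule fmod_gm_cp(2)) (auto intro: basis_e[OF bd])

lemma basis_simps : "\<zero>\<^bsub>fmod A K e d\<^esub> = (\<lambda>_. \<zero>)" "x \<oplus>\<^bsub>fmod A K e d\<^esub> y = (\<lambda>k. x k \<oplus> y k)"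
  "a \<odot>\<^bsub>fmod A K e d\<^esub> x = (\<lambda>k. a \<otimes> x k)"
  unfolding fmod_def Let_def by auto

end

lemma basis_lin: "basis_data K e d \<Longrightarrow> gm N \<Longrightarrow> (\<And>k. k \<in> K \<Longrightarrow> p k \<in> carrier N) \<Longrightarrow> lin A (fmod A K e d) N (lincomb A N p)"
  by (rule lincomb_lin) (rule basis_e)

lemma basis_lincomb_Jr:
  assumes K: "basis_data K e d" and N: "gm N" and p: "\<And>k. k \<in> K \<Longrightarrow> p k \<in> carrier N"
    and f: "f \<in> carrier (fmod A K e d)" and fJ: "\<And>k. k \<in> K \<Longrightarrow> f k \<in> Jr"
  shows "lincomb A N p f \<in> JX N (carrier N)"
  unfolding lincomb_def
proof (rule sub0_finsum[OF N sub0_act[OF N subset_refl]])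
  interpret N: graded_module A N by (rule N)
  show "finite {k. f k \<noteq> \<zero>}" by (rule basis_support[OF K f])
  fix k assume "k \<in> {k. f k \<noteq> \<zero>}"
  hence "k \<in> K" using basis_out[OF K f] by blast
  thus "f k \<odot>\<^bsub>N\<^esub> p k \<in> JX N (carrier N)" by (intro N.act_prod_prod[OF Jr_sub subset_refl] fJ p)
qed

text \<open>Expanding \<open>f\<close> in the generators shows that it suffices to have the
  coordinates in \<open>Jr\<close>.\<close>

lemma basis_Jr:
  assumes K: "basis_data K e d" and f: "f \<in> carrier (fmod A K e d)" and fJ: "\<And>k. k \<in> K \<Longrightarrow> f k \<in> Jr"
  shows "f \<in> JX (fmod A K e d) (carrier (fmod A K e d))"
proof -
  have s: "single A k (e k) \<in> carrier (fmod A K e d)" if "k \<in> K" for k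
    by (rule basis_gen[OF K that])
  have "lincomb A (fmod A K e d) (\<lambda>k. single A k (e k)) f \<in> JX (fmod A K e d) (carrier (fmod A K e d))"
    by (rule basis_lincomb_Jr[OF K basis_gm[OF K] s f fJ])
  moreover have "lincomb A (fmod A K e d) (\<lambda>k. single A k (e k)) f = f"
    by (rule basis_expand[OF K f])
  ultimately show ?thesis by simp
qed

lemma spanl_hsub: "spanl (hsub X K) U vs = spanl X U vs"
  unfolding spanl_def adj_def by simp

text \<open>In degree \<open>i\<close> the generators are the elements a e_k with
  \<open>d k \<le> i\<close> and a among the generators of A in degree \<open>i - d k\<close>:
  finitely many by \<open>basis_fin\<close> and left finiteness of A.\<close>

lemma basis_fg:
  assumes K: "basis_data K e d" shows "fg (fmod A K e d) (mdeg (fmod A K e d) i)"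
proof -
  let ?F = "fmod A K e d"
  note F = basis_gm[OF K]
  interpret F: graded_module A ?F by (rule F)
  note ek = basis_e[OF K] and idem = basis_idem[OF K]
  have "\<forall>j. \<exists>as. set as \<subseteq> carrier A \<and> mdeg RA j = spanl RA {\<zero>} as"
    using RA_fg unfolding fg_def[OF RA_gm] by simp
  from choice[OF this] obtain as where as: "\<And>j. set (as j) \<subseteq> carrier A" "\<And>j. mdeg RA j = spanl RA {\<zero>} (as j)" by blast
  have asd: "a \<in> mdeg RA j" if "a \<in> set (as j)" for a j
    using spanl_sub0(3)[OF RA_gm sub0_null[OF RA_gm], of "as j"] as[of j] that by auto
  obtain ks where ks: "set ks = {k \<in> K. d k \<le> i}" using finite_list[OF basis_fin[OF K]] by blast
  let ?vs = "concat (map (\<lambda>k. map (\<lambda>a. single A k (a \<otimes> e k)) (as (i - d k))) ks)"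
  have ae: "a \<otimes> e k \<otimes> e k = a \<otimes> e k" if "a \<in> carrier A" "k \<in> K" for a k
    using that idem[OF that(2)] A0_closed[OF ek[OF that(2)]] by (simp add: m_assoc)
  have sd: "single A k (a \<otimes> e k) \<in> mdeg ?F i" if "k \<in> K" "a \<in> mdeg RA (i - d k)" for a k
  proof -
    have "a \<otimes> e k \<in> mdeg RA (i - d k)" using RA_mult[OF that(2) ek[OF that(1)]] by simp
    from basis_single_deg[OF K that(1) this ae[OF RA_closed[OF that(2)] that(1)]]
    show ?thesis by simp
  qed
  have vsd: "set ?vs \<subseteq> mdeg ?F i" using ks asd sd by auto
  have vsc: "set ?vs \<subseteq> carrier ?F" using vsd F.V_closed by blast
  let ?T = "spanl ?F {\<zero>\<^bsub>?F\<^esub>} ?vs"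
  note T = spanl_sub0[OF F sub0_null[OF F] vsc]
  have sT: "single A k (a \<otimes> e k) \<in> ?T" if k: "k \<in> K" and a: "a \<in> mdeg RA (i - d k)" for a k
  proof (cases "d k \<le> i")
    case False
    hence "a = \<zero>" using a by (simp add: RA_mdeg)
    hence "single A k (a \<otimes> e k) = \<zero>\<^bsub>?F\<^esub>" using A0_closed[OF ek[OF k]] by (simp add: single_def fun_eq_iff basis_simps[OF K])
    thus ?thesis using sub0_zero[OF T(1)] by simp
  next
    case True
    let ?B = "{a \<in> carrier A. single A k (a \<otimes> e k) \<in> ?T}"
    note ec = A0_closed[OF ek[OF k]]
    have "mdeg RA (i - d k) \<subseteq> ?B"
      unfolding as(2)
    proof (rule spanl_least[OF RA_gm])
      show "sub0 RA ?B"
      proof (rule sub0I)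
        have "single A k (\<zero> \<otimes> e k) = \<zero>\<^bsub>?F\<^esub>" using ec by (simp add: single_def fun_eq_iff basis_simps[OF K])
        thus "\<zero>\<^bsub>RA\<^esub> \<in> ?B" using sub0_zero[OF T(1)] by simp
      next
        fix x y assume xy: "x \<in> ?B" "y \<in> ?B"
        have "single A k ((x \<oplus> y) \<otimes> e k) = single A k (x \<otimes> e k) \<oplus>\<^bsub>?F\<^esub> single A k (y \<otimes> e k)"
          using xy ec by (auto simp: single_def fun_eq_iff basis_simps[OF K] l_distr)
        thus "x \<oplus>\<^bsub>RA\<^esub> y \<in> ?B" using xy sub0_add[OF T(1)] by simp
      next
        fix r x assume r: "r \<in> A0" and x: "x \<in> ?B"
        have "single A k ((r \<otimes> x) \<otimes> e k) = r \<odot>\<^bsub>?F\<^esub> single A k (x \<otimes> e k)"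
          using x r ec A0_closed by (auto simp: single_def fun_eq_iff basis_simps[OF K] m_assoc)
        thus "r \<odot>\<^bsub>RA\<^esub> x \<in> ?B" using x r A0_closed sub0_smult[OF T(1)] by simp
      qed auto
      have "single A k (\<zero> \<otimes> e k) = \<zero>\<^bsub>?F\<^esub>" using ec by (simp add: single_def fun_eq_iff basis_simps[OF K])
      thus "{\<zero>} \<subseteq> ?B" using sub0_zero[OF T(1)] by simp
      show "set (as (i - d k)) \<subseteq> ?B"
      proof
        fix b assume b: "b \<in> set (as (i - d k))"
        have "k \<in> set ks" using ks k True by simp
        hence "single A k (b \<otimes> e k) \<in> set ?vs" using b by auto
        thus "b \<in> ?B" using T(3) b as(1) by blast
      qed
    qed
    thus ?thesis using a by blast
  qed
  have "mdeg ?F i \<subseteq> ?T"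
  proof
    fix f assume f: "f \<in> mdeg ?F i"
    have fc: "f \<in> carrier ?F" and fd: "\<And>k. f k \<in> mdeg RA (i - d k)" using f basis_mdeg[OF K] by blast+
    have "lincomb A ?F (\<lambda>k. single A k (e k)) f \<in> ?T"
      unfolding lincomb_def
    proof (rule sub0_finsum[OF F T(1)])
      show "finite {k. f k \<noteq> \<zero>}" using basis_support[OF K fc] .
      fix k assume "k \<in> {k. f k \<noteq> \<zero>}"
      hence k: "k \<in> K" using basis_out[OF K fc] by blast
      have "f k \<odot>\<^bsub>?F\<^esub> single A k (e k) = single A k (f k \<otimes> e k)"
        using basis_coeff[OF K fc] by (auto simp: single_def fun_eq_iff basis_simps[OF K])
      thus "f k \<odot>\<^bsub>?F\<^esub> single A k (e k) \<in> ?T" using sT[OF k fd] by simp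
    qed
    thus "f \<in> ?T" using basis_expand[OF K fc] by simp
  qed
  moreover have "?T \<subseteq> mdeg ?F i"
    by (rule spanl_least[OF F sub0_mdeg[OF F] _ vsd]) (use F.V_zero in simp)
  ultimately have "mdeg ?F i = ?T" by blast
  thus ?thesis unfolding fg_def[OF F] using vsc by blast
qed

lemma basis_nice: assumes "basis_data K e d" shows "nice (fmod A K e d)"
proof -
  let ?F = "fmod A K e d"
  interpret F: graded_module A ?F by (rule basis_gm[OF assms])
  obtain b where b: "\<forall>k\<in>K. b \<le> d k" using assms unfolding basis_data_def by blast
  have "mdeg ?F i = {\<zero>\<^bsub>?F\<^esub>}" if i: "i < b" for i
  proof -
    have "f = \<zero>\<^bsub>?F\<^esub>" if f: "f \<in> mdeg ?F i" for f
    proof -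
      have fc: "f \<in> carrier ?F" and fd: "\<And>k. f k \<in> mdeg RA (i - d k)" using f basis_mdeg[OF assms] by blast+
      have "f k = \<zero>" for k
      proof (cases "k \<in> K")
        case True
        hence "b \<le> d k" using b by blast
        thus ?thesis using fd[of k] i by (simp add: RA_mdeg)
      next
        case False
        thus ?thesis using basis_out[OF assms fc] by blast
      qed
      thus ?thesis by (simp add: fun_eq_iff basis_simps[OF assms])
    qed
    thus ?thesis using F.V_zero by blast
  qed
  thus ?thesis unfolding nice_def using basis_gm[OF assms] basis_fg[OF assms] by blast
qed

text \<open>Kernels of covers stay left finite because A_0 is noetherian; this keeps the
  construction of a resolution going.\<close>

lemma sub_nice:
  assumes X: "nice X" and K: "gsub X K" shows "nice (hsub X K)"
proof -
  have gm: "gm X" using X unfolding nice_def by blast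
  interpret X: graded_module A X by (rule gm)
  have fgF: "fg X (mdeg X i)" for i using X unfolding nice_def by blast
  obtain b where b: "\<And>i. i < b \<Longrightarrow> mdeg X i = {\<zero>\<^bsub>X\<^esub>}" using X unfolding nice_def by blast
  note H = hsub_gm(1)[OF gm K]
  have "fg (hsub X K) (mdeg (hsub X K) i)" for i
  proof -
    obtain vs where vs: "set vs \<subseteq> carrier X" "mdeg X i = spanl X {\<zero>\<^bsub>X\<^esub>} vs" using fgF[of i] unfolding fg_def[OF gm] by blast
    have "sub0 X (mdeg X i \<inter> K)" by (rule sub0_Int[OF sub0_mdeg[OF gm] gsub_sub0[OF gm K]])
    from noetherian0[OF gm vs(1) this] obtain ws where "set ws \<subseteq> mdeg X i \<inter> K" "mdeg X i \<inter> K = spanl X {\<zero>\<^bsub>X\<^esub>} ws"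
      using vs(2) by auto
    thus ?thesis unfolding fg_def[OF H] spanl_hsub by (intro exI[of _ ws]) auto
  qed
  moreover have "mdeg (hsub X K) i = {\<zero>\<^bsub>hsub X K\<^esub>}" if "i < b" for i
    using b[OF that] K unfolding gsub_def by auto
  ultimately show ?thesis unfolding nice_def using H by blast
qed

text \<open>In degree \<open>i\<close>, an element of J N collects terms from J(A_0) N_i and terms
  in which scalars of positive degree act on lower degrees. If the latter are known to lie in
  \<open>T\<close>, Nakayama over A_0 applies in degree \<open>i\<close>.\<close>

lemma JX_component:
  assumes N: "gm N" and N': "sub0 N T"
    and low: "\<And>j y. \<lbrakk>j < i; y \<in> mdeg N j\<rbrakk> \<Longrightarrow> y \<in> T" and Tsm: "\<And>a x. \<lbrakk>a \<in> carrier A; x \<in> T\<rbrakk> \<Longrightarrow> a \<odot>\<^bsub>N\<^esub> x \<in> T"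
    and x: "x \<in> JX N (carrier N)"
  shows "\<exists>u\<in>T \<inter> mdeg N i. \<exists>w\<in>act_prod N J0 (mdeg N i). cp N i x = u \<oplus>\<^bsub>N\<^esub> w"
proof -
  interpret N: graded_module A N by (rule N)
  have J0s: "J0 \<subseteq> carrier A" using J0_closed by blast
  have Ns: "mdeg N i \<subseteq> carrier N" using N.V_closed by blast
  let ?U = "T \<inter> mdeg N i" and ?W = "act_prod N J0 (mdeg N i)"
  have U: "sub0 N ?U" by (rule sub0_Int[OF N' sub0_mdeg[OF N]])
  note Wz = N.act_prod_zero[OF J0s Ns] and Wa = N.act_prod_add[OF J0s Ns] and Wc = N.act_prod_closed[OF J0s Ns]
  have W: "sub0 N ?W"
  proof (rule sub0I[OF Wc Wz Wa])
    fix r w assume r: "r \<in> A0" and w: "w \<in> ?W"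
    show "r \<odot>\<^bsub>N\<^esub> w \<in> ?W" using w
    proof (induction rule: N.act_prod_induct[OF J0s Ns, consumes 1, case_names zero step])
      case zero
      show ?case using A0_closed[OF r] Wz by simp
    next
      case (step a x y)
      have "r \<odot>\<^bsub>N\<^esub> (a \<odot>\<^bsub>N\<^esub> x \<oplus>\<^bsub>N\<^esub> y) = (r \<otimes> a) \<odot>\<^bsub>N\<^esub> x \<oplus>\<^bsub>N\<^esub> r \<odot>\<^bsub>N\<^esub> y"
        using step A0_closed[OF r] by (simp add: N.smult_r_distr N.smult_assoc)
      thus ?case using Wa[OF N.act_prod_prod[OF J0s Ns J0_left[OF r step(1)] step(2)] step(7)] by simp
    qed
  qed
  define G where "G = {u \<oplus>\<^bsub>N\<^esub> w | u w. u \<in> ?U \<and> w \<in> ?W}"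
  note S = sub0_sum[OF N U W, folded G_def]
  note Gadd = sub0_add[OF S(1)] and GU = subsetD[OF S(2)] and GW = subsetD[OF S(3)]
  have "cp N i x \<in> G" using x
  proof (induction rule: N.act_prod_induct[OF Jr_sub subset_refl, consumes 1, case_names zero step])
    case zero
    show ?case using GU[OF sub0_zero[OF U]] by simp
  next
    case (step a x y)
    have "cp N i (b \<odot>\<^bsub>N\<^esub> x) \<in> G" if b: "b \<in> carrier RA" and bJ: "\<And>j. cp RA j b \<in> Jr" for b
      using b
    proof (induction rule: RA.homogeneous_induct)
      case zero
      show ?case using GU[OF sub0_zero[OF U]] step(4) by simp
    next
      case (step j h z)
      have hA: "h \<in> carrier A" "z \<in> carrier A" using step(2,3) by simp_all
      have hJ: "h \<in> Jr" using step(4) bJ by simp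
      have eq: "cp N i (h \<odot>\<^bsub>N\<^esub> x) = h \<odot>\<^bsub>N\<^esub> cp N (i - j) x" by (rule cp_smult[OF N step(1) \<open>x \<in> carrier N\<close>])
      have cpx: "cp N (i - j) x \<in> mdeg N (i - j)" by (rule N.hcomp_spec(1)[OF \<open>x \<in> carrier N\<close>])
      have "h \<odot>\<^bsub>N\<^esub> cp N (i - j) x \<in> G"
      proof (cases "j = 0")
        case True
        hence "h \<in> J0" using hJ step(1) Jr_A0 by simp
        thus ?thesis using cpx True by (intro GW N.act_prod_prod[OF J0s Ns]) simp_all
      next
        case False
        show ?thesis
        proof (cases "j < 0")
          case True
          hence "h = \<zero>" using step(1) by (simp add: RA_mdeg)
          thus ?thesis using GU[OF sub0_zero[OF U]] N.V_closed[OF cpx] by simp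
        next
          case False
          hence "cp N (i - j) x \<in> T" using low[OF _ cpx] \<open>j \<noteq> 0\<close> by simp
          hence "h \<odot>\<^bsub>N\<^esub> cp N (i - j) x \<in> T" using Tsm[OF hA(1)] by simp
          moreover have "h \<odot>\<^bsub>N\<^esub> cp N (i - j) x \<in> mdeg N i" using smult_degree'[OF N step(1) cpx] by simp
          ultimately show ?thesis by (intro GU) simp
        qed
      qed
      hence 1: "cp N i (h \<odot>\<^bsub>N\<^esub> x) \<in> G" using eq by simp
      show ?case using Gadd[OF 1 step(5)] hA \<open>x \<in> carrier N\<close> by (simp add: N.smult_l_distr N.hcomp_add)
    qed
    hence "cp N i (a \<odot>\<^bsub>N\<^esub> x) \<in> G" using step(3) Jr_cp[OF step(1)] by simp
    thus ?case using Gadd step(3,4,6,7) by (simp add: N.hcomp_add)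
  qed
  thus ?thesis unfolding G_def by blast
qed

text \<open>\<open>degree_cover\<close> is applied in each degree i modulo (J N)_i. Surjectivity is
  a graded Nakayama argument, by induction on the degree from the lower bound on; the kernel is
  controlled by \<open>degree_independent\<close>. The injection \<open>enc\<close> places the
  generators, numbered by degree and position, in a prescribed index type.\<close>

lemma nice_cover:
  fixes N :: "('a, 'n) graded_module" and enc :: "int \<times> nat \<Rightarrow> 'k"
  assumes nN: "nice N" and inj: "inj enc"
  shows "\<exists>K (e :: 'k \<Rightarrow> 'a) d p. cover N K e d p"
proof -
  have N: "gm N" using nN unfolding nice_def by blast
  interpret N: graded_module A N by (rule N)
  obtain b where b: "\<And>i. i < b \<Longrightarrow> mdeg N i = {\<zero>\<^bsub>N\<^esub>}" using nN unfolding nice_def by blast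
  have "\<forall>i. \<exists>vs. set vs \<subseteq> carrier N \<and> mdeg N i = spanl N {\<zero>\<^bsub>N\<^esub>} vs" using nN unfolding nice_def fg_def[OF N] by blast
  from choice[OF this] obtain vs where vs: "\<And>i. set (vs i) \<subseteq> carrier N" "\<And>i. mdeg N i = spanl N {\<zero>\<^bsub>N\<^esub>} (vs i)" by blast
  define U where "U i = JX N (carrier N) \<inter> mdeg N i" for i
  have V: "sub0 N (mdeg N i)" for i by (rule sub0_mdeg[OF N])
  have JXs: "sub0 N (JX N (carrier N))" by (rule sub0_act[OF N subset_refl])
  have U: "sub0 N (U i)" for i unfolding U_def by (rule sub0_Int[OF JXs V])
  have UV: "U i \<subseteq> mdeg N i" for i unfolding U_def by blast
  have JU: "j \<odot>\<^bsub>N\<^esub> v \<in> U i" if j: "j \<in> J0" and v: "v \<in> mdeg N i" for i j v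
  proof -
    have "j \<in> Jr" using j Jr_A0 J0_A0 by blast
    hence "j \<odot>\<^bsub>N\<^esub> v \<in> JX N (carrier N)" using N.V_closed[OF v] by (intro N.act_prod_prod[OF Jr_sub subset_refl])
    moreover have "j \<odot>\<^bsub>N\<^esub> v \<in> mdeg N i" using smult_degree'[OF N J0_A0[OF j] v] by simp
    ultimately show ?thesis unfolding U_def by blast
  qed
  have vsV: "set (vs i) \<subseteq> mdeg N i" for i using spanl_sub0(3)[OF N sub0_null[OF N] vs(1)] vs(2) by blast
  define \<Phi> where "\<Phi> i m e w \<longleftrightarrow> (\<forall>j<m. e j \<in> A0 \<and> e j \<otimes> e j = e j \<and> w j \<in> mdeg N i \<and> e j \<odot>\<^bsub>N\<^esub> w j = w j \<and>
      (\<forall>a\<in>A0. (a \<otimes> e j) \<odot>\<^bsub>N\<^esub> w j \<in> spanl N (U i) (rev (map w [0..<j])) \<longrightarrow> a \<otimes> e j \<in> J0)) \<and>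
      spanl N (U i) (vs i) = spanl N (U i) (rev (map w [0..<m]))" for i and m :: nat and e w
  have "\<exists>m e w. \<Phi> i m e w" for i unfolding \<Phi>_def by (rule degree_cover[OF N V U UV JU vsV])
  then obtain m e w where \<Phi>: "\<And>i. \<Phi> i (m i) (e i) (w i)" by metis
  have ew: "e i j \<in> A0" "e i j \<otimes> e i j = e i j" "w i j \<in> mdeg N i" "e i j \<odot>\<^bsub>N\<^esub> w i j = w i j"
      "\<And>a. \<lbrakk>a \<in> A0; (a \<otimes> e i j) \<odot>\<^bsub>N\<^esub> w i j \<in> spanl N (U i) (rev (map (w i) [0..<j]))\<rbrakk> \<Longrightarrow> a \<otimes> e i j \<in> J0"
    if "j < m i" for i j using \<Phi>[of i] that unfolding \<Phi>_def by simp_all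
  have span: "mdeg N i = spanl N (U i) (rev (map (w i) [0..<m i]))" for i
    using spanl_extend[OF N V U UV vs(2,1)] \<Phi>[of i] unfolding \<Phi>_def by simp
  \<comment> \<open>Degrees below \<open>b\<close> get no generators, which gives the lower bound in
    \<open>basis_data\<close>.\<close>
  define K where "K = enc ` {(i, j). b \<le> i \<and> j < m i}"
  define dec where "dec = the_inv enc"
  define d where "d k = fst (dec k)" for k
  define ee where "ee k = e (fst (dec k)) (snd (dec k))" for k
  define p where "p k = w (fst (dec k)) (snd (dec k))" for k
  have dec: "dec (enc x) = x" for x unfolding dec_def by (rule the_inv_f_f[OF inj])
  have enc_simps: "d (enc (i, j)) = i" "ee (enc (i, j)) = e i j" "p (enc (i, j)) = w i j" for i j
    unfolding d_def ee_def p_def dec by simp_all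
  have Kcase: "\<exists>i j. k = enc (i, j) \<and> b \<le> i \<and> j < m i" if "k \<in> K" for k using that unfolding K_def by auto
  have eeA: "ee k \<in> A0" "ee k \<otimes> ee k = ee k" "p k \<in> mdeg N (d k)" "ee k \<odot>\<^bsub>N\<^esub> p k = p k" "b \<le> d k" if "k \<in> K" for k
    using Kcase[OF that] ew by (auto simp: enc_simps)
  have bd: "basis_data K ee d"
    unfolding basis_data_def
  proof (intro conjI ballI allI)
    show "finite {k \<in> K. d k \<le> i}" for i
    proof (rule finite_subset)
      show "{k \<in> K. d k \<le> i} \<subseteq> enc ` (SIGMA l:{b..i}. {..<m l})"
      proof
        fix k assume "k \<in> {k \<in> K. d k \<le> i}"
        hence k: "k \<in> K" "d k \<le> i" by simp_all
        obtain l j where lj: "k = enc (l, j)" "b \<le> l" "j < m l" using Kcase[OF k(1)] by blast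
        thus "k \<in> enc ` (SIGMA l:{b..i}. {..<m l})" using k(2) enc_simps by auto
      qed
      show "finite (enc ` (SIGMA l:{b..i}. {..<m l}))" by (intro finite_imageI finite_SigmaI) auto
    qed
    show "\<exists>b. \<forall>k\<in>K. b \<le> d k" using eeA(5) by blast
  qed (use eeA in auto)
  let ?F = "fmod A K ee d" and ?L = "lincomb A N p"
  note F = basis_gm[OF bd]
  interpret F: graded_module A ?F by (rule F)
  have pc: "p k \<in> carrier N" if "k \<in> K" for k using N.V_closed[OF eeA(3)[OF that]] .
  have L: "lin A ?F N ?L" by (rule basis_lin[OF bd N pc])
  have Ldeg: "?L f \<in> mdeg N i" if "f \<in> mdeg ?F i" for f i
  proof -
    have "?L f \<in> mdeg N (i + 0)"
      by (rule lincomb_deg[where K=K and e=ee and d=d and n=0, OF _ N]) (use eeA pc that in auto)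
    thus ?thesis by simp
  qed
  have LH: "(\<lambda>f\<in>carrier ?F. ?L f) \<in> Hom_Gr A ?F N" by (rule HomI[OF F L Ldeg])
  let ?T = "?L ` carrier ?F"
  have T: "sub0 N ?T" and Tsm: "\<And>a x. \<lbrakk>a \<in> carrier A; x \<in> ?T\<rbrakk> \<Longrightarrow> a \<odot>\<^bsub>N\<^esub> x \<in> ?T"
  proof -
    show sm: "a \<odot>\<^bsub>N\<^esub> x \<in> ?T" if a: "a \<in> carrier A" and x: "x \<in> ?T" for a x
    proof -
      obtain f where f: "x = ?L f" "f \<in> carrier ?F" using x by (rule imageE)
      show ?thesis unfolding f(1) lin_smult[OF L a f(2), symmetric] by (rule imageI[OF F.smult_closed[OF a f(2)]])
    qed
    show "sub0 N ?T"
    proof (rule sub0I)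
      show "?T \<subseteq> carrier N" using lin_closed[OF L] by (rule image_subsetI)
      show "\<zero>\<^bsub>N\<^esub> \<in> ?T" using lin_zero[OF L gm_group[OF F] gm_group[OF N], symmetric] F.M.zero_closed by (rule image_eqI)
      show "x \<oplus>\<^bsub>N\<^esub> y \<in> ?T" if x: "x \<in> ?T" and y: "y \<in> ?T" for x y
      proof -
        obtain f where f: "x = ?L f" "f \<in> carrier ?F" using x by (rule imageE)
        obtain g where g: "y = ?L g" "g \<in> carrier ?F" using y by (rule imageE)
        show ?thesis unfolding f(1) g(1) lin_add[OF L f(2) g(2), symmetric] by (rule imageI[OF F.M.a_closed[OF f(2) g(2)]])
      qed
    qed (use sm A0_closed in blast)
  qed
  have pT: "p k \<in> ?T" if k: "k \<in> K" for k
  proof -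
    have "?L (single A k (ee k)) = p k"
      using lincomb_single[of K ee N p k "ee k"] eeA k A0_closed N pc by simp
    thus ?thesis using basis_gen[OF bd k] by (metis imageI)
  qed
  \<comment> \<open>Graded Nakayama: N_i is the sum of (J N)_i and the image in degree i, and by
    \<open>JX_component\<close> (J N)_i lies in the image plus J(A_0) N_i.\<close>
  have step: "mdeg N i \<subseteq> ?T" if i: "b \<le> i" and low: "\<And>j. j < i \<Longrightarrow> mdeg N j \<subseteq> ?T" for i
  proof -
    let ?U = "?T \<inter> mdeg N i"
    have sU: "sub0 N ?U" by (rule sub0_Int[OF T V])
    have ws: "set (rev (map (w i) [0..<m i])) \<subseteq> ?U"
    proof
      fix x assume "x \<in> set (rev (map (w i) [0..<m i]))"
      then obtain j where j: "j < m i" "x = w i j" by auto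
      hence "enc (i, j) \<in> K" using i unfolding K_def by auto
      hence "w i j \<in> ?T" using pT[of "enc (i, j)"] enc_simps by simp
      thus "x \<in> ?U" using j ew(3) by simp
    qed
    have sum: "mdeg N i \<subseteq> {x \<oplus>\<^bsub>N\<^esub> u | x u. x \<in> U i \<and> u \<in> ?U}" (is "_ \<subseteq> ?S")
    proof -
      note S = sub0_sum[OF N U sU]
      have "spanl N (U i) (rev (map (w i) [0..<m i])) \<subseteq> ?S"
        by (rule spanl_least[OF N S(1,2) subset_trans[OF ws S(3)]])
      thus ?thesis unfolding span[symmetric] .
    qed
    have "mdeg N i = ?U"
    proof (rule nakayama0[OF N sU vs(1)])
      show "mdeg N i = spanl N ?U (vs i)" by (rule spanl_extend[OF N V sU _ vs(2,1)]) blast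
      fix x assume x: "x \<in> mdeg N i"
      obtain y t where yt: "x = y \<oplus>\<^bsub>N\<^esub> t" "y \<in> U i" "t \<in> ?U" using subsetD[OF sum x] by blast
      have y: "y \<in> JX N (carrier N)" "y \<in> mdeg N i" using yt(2) unfolding U_def by blast+
      have "\<exists>u\<in>?T \<inter> mdeg N i. \<exists>w\<in>act_prod N J0 (mdeg N i). cp N i y = u \<oplus>\<^bsub>N\<^esub> w"
        by (rule JX_component[OF N T _ Tsm y(1)]) (use low in blast)
      then obtain u w where uw: "u \<in> ?U" "w \<in> act_prod N J0 (mdeg N i)" "cp N i y = u \<oplus>\<^bsub>N\<^esub> w" by blast
      have yy: "y = u \<oplus>\<^bsub>N\<^esub> w" using N.hcomp_hom[OF y(2), of i] uw(3) by simp
      have wc: "w \<in> carrier N"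
      proof -
        have "J0 \<subseteq> carrier A" "mdeg N i \<subseteq> carrier N" using J0_closed N.V_closed by blast+
        thus ?thesis using N.act_prod_closed uw(2) by blast
      qed
      have "x = (u \<oplus>\<^bsub>N\<^esub> t) \<oplus>\<^bsub>N\<^esub> w"
        unfolding yt(1) yy using sub0_closed[OF sU uw(1)] sub0_closed[OF sU yt(3)] wc by (simp add: N.M.a_ac)
      thus "\<exists>u\<in>?U. \<exists>w\<in>act_prod N J0 (mdeg N i). x = u \<oplus>\<^bsub>N\<^esub> w"
        using sub0_add[OF sU uw(1) yt(3)] uw(2) by blast
    qed
    thus ?thesis by blast
  qed
  have all0: "mdeg N i \<subseteq> ?T" if "i < b" for i using b[OF that] sub0_zero[OF T] by simp
  have all1: "mdeg N (b + int n) \<subseteq> ?T" for n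
  proof (induction n rule: less_induct)
    case (less n)
    show ?case
    proof (rule step)
      fix j assume j: "j < b + int n"
      show "mdeg N j \<subseteq> ?T"
      proof (cases "j < b")
        case False
        hence "j = b + int (nat (j - b))" "nat (j - b) < n" using j by auto
        thus ?thesis using less.IH[of "nat (j - b)"] by metis
      qed (rule all0)
    qed simp
  qed
  have all: "mdeg N i \<subseteq> ?T" for i
  proof (cases "i < b")
    case False
    hence "i = b + int (nat (i - b))" by auto
    thus ?thesis using all1[of "nat (i - b)"] by metis
  qed (rule all0)
  have sur: "?T = carrier N"
  proof
    show "?T \<subseteq> carrier N" by (rule sub0_sub[OF T])
    show "carrier N \<subseteq> ?T"
    proof
      fix x assume "x \<in> carrier N"
      thus "x \<in> ?T"
      proof (induction rule: N.homogeneous_induct)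
        case zero
        show ?case by (rule sub0_zero[OF T])
      next
        case (step i h y)
        show ?case using sub0_add[OF T subsetD[OF all step(1)] step(5)] .
      qed
    qed
  qed
  \<comment> \<open>The coordinate \<open>f k\<close> is in J as soon as its degree 0 component is
    in J(A_0). That component is the coordinate at \<open>k\<close> of the part of \<open>f\<close>
    in degree \<open>d k\<close>, where generators of other degrees contribute only terms with
    coefficients in J.\<close>
  have ker: "f \<in> JX ?F (carrier ?F)" if f: "f \<in> carrier ?F" and Lf: "?L f = \<zero>\<^bsub>N\<^esub>" for f
  proof (rule basis_Jr[OF bd f])
    fix k assume k: "k \<in> K"
    let ?i = "d k"
    have bi: "b \<le> ?i" by (rule eeA(5)[OF k])
    define g where "g = cp ?F ?i f"
    have g: "g \<in> mdeg ?F ?i" unfolding g_def by (rule F.hcomp_spec(1)[OF f])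
    have gc: "g \<in> carrier ?F" by (rule F.V_closed[OF g])
    have gd: "g k' \<in> mdeg RA (?i - d k')" for k' using g basis_mdeg[OF bd] by blast
    have Lg: "?L g = \<zero>\<^bsub>N\<^esub>" using Hom_cp[OF F N LH f, of ?i] Lf gc f unfolding g_def by simp
    define g1 where "g1 = (\<lambda>k. if d k = ?i then g k else \<zero>)"
    define g2 where "g2 = (\<lambda>k. if d k \<noteq> ?i then g k else \<zero>)"
    have mem: "(\<lambda>k. if P k then g k else \<zero>) \<in> carrier ?F" for P
    proof -
      have "finite {k. (if P k then g k else \<zero>) \<noteq> \<zero>}" by (rule finite_subset[OF _ basis_support[OF bd gc]]) auto
      thus ?thesis
        using basis_coeff[OF bd gc] basis_out[OF bd gc] basis_coeff_e[OF bd gc] A0_closed[OF eeA(1)]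
        unfolding fmod_def Let_def by simp
    qed
    have g1c: "g1 \<in> carrier ?F" unfolding g1_def by (rule mem)
    have g2c: "g2 \<in> carrier ?F" unfolding g2_def by (rule mem)
    have gsum: "g = g1 \<oplus>\<^bsub>?F\<^esub> g2" using basis_coeff[OF bd gc] unfolding g1_def g2_def basis_simps[OF bd] by auto
    have L2: "?L g2 \<in> U ?i"
    proof -
      have "g2 k' \<in> Jr" for k'
        using Jr_pos[OF gd[of k']] Jr_zero unfolding g2_def by auto
      hence "?L g2 \<in> JX N (carrier N)" by (intro basis_lincomb_Jr[OF bd N pc g2c])
      moreover have "g2 \<in> mdeg ?F ?i"
        unfolding basis_mdeg[OF bd] using g2c gd RA.V_zero unfolding g2_def by simp
      ultimately show ?thesis unfolding U_def using Ldeg by blast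
    qed
    have L12: "?L g1 \<oplus>\<^bsub>N\<^esub> ?L g2 = \<zero>\<^bsub>N\<^esub>" using Lg lin_add[OF L g1c g2c] gsum by simp
    have L1: "?L g1 \<in> U ?i"
      by (rule sub0_diff[OF N U _ L2]) (use L12 sub0_zero[OF U] lin_closed[OF L g1c] lin_closed[OF L g2c] in \<open>simp_all add: N.M.a_comm\<close>)
    let ?D = "(\<lambda>j. enc (?i, j)) ` {..<m ?i}"
    have DK: "?D \<subseteq> K" using bi unfolding K_def by auto
    have supp: "{k. g1 k \<noteq> \<zero>} \<subseteq> ?D"
    proof
      fix k' assume "k' \<in> {k. g1 k \<noteq> \<zero>}"
      hence k': "d k' = ?i" "g k' \<noteq> \<zero>" unfolding g1_def by (auto split: if_splits)
      hence "k' \<in> K" using basis_out[OF bd gc] by blast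
      then obtain l j where "k' = enc (l, j)" "j < m l" using Kcase by blast
      thus "k' \<in> ?D" using k'(1) enc_simps by auto
    qed
    have "?L g1 = (\<Oplus>\<^bsub>N\<^esub>k\<in>?D. g1 k \<odot>\<^bsub>N\<^esub> p k)"
      by (rule lincomb_superset[where K=K and e=ee and d=d, OF _ N _ g1c _ supp DK]) (use eeA pc in auto)
    also have "\<dots> = (\<Oplus>\<^bsub>N\<^esub>j\<in>{..<m ?i}. g1 (enc (?i, j)) \<odot>\<^bsub>N\<^esub> p (enc (?i, j)))"
    proof (rule N.M.finsum_reindex)
      show "(\<lambda>k. g1 k \<odot>\<^bsub>N\<^esub> p k) \<in> ?D \<rightarrow> carrier N"
      proof
        fix k' assume "k' \<in> ?D"
        thus "g1 k' \<odot>\<^bsub>N\<^esub> p k' \<in> carrier N" using DK pc basis_coeff[OF bd g1c] by (intro N.smult_closed) auto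
      qed
      show "inj_on (\<lambda>j. enc (?i, j)) {..<m ?i}" using inj by (auto simp: inj_on_def)
    qed
    also have "\<dots> = (\<Oplus>\<^bsub>N\<^esub>j\<in>{..<m ?i}. g (enc (?i, j)) \<odot>\<^bsub>N\<^esub> w ?i j)"
      unfolding g1_def enc_simps by simp
    finally have S: "(\<Oplus>\<^bsub>N\<^esub>j\<in>{..<m ?i}. g (enc (?i, j)) \<odot>\<^bsub>N\<^esub> w ?i j) \<in> U ?i" using L1 by simp
    have ind: "\<forall>j<m ?i. g (enc (?i, j)) \<in> J0"
    proof (rule degree_independent[OF N V U UV JU _ _ le_refl S])
      show "e ?i j \<in> A0 \<and> w ?i j \<in> mdeg N ?i \<and> (\<forall>a\<in>A0. (a \<otimes> e ?i j) \<odot>\<^bsub>N\<^esub> w ?i j \<in> spanl N (U ?i) (rev (map (w ?i) [0..<j])) \<longrightarrow> a \<otimes> e ?i j \<in> J0)"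
        if "j < m ?i" for j using ew[OF that] by blast
      show "g (enc (?i, j)) \<in> A0 \<and> g (enc (?i, j)) \<otimes> e ?i j = g (enc (?i, j))" if "j < m ?i" for j
      proof -
        have "enc (?i, j) \<in> K" using DK that by blast
        thus ?thesis using basis_coeff_e[OF bd gc, of "enc (?i, j)"] gd[of "enc (?i, j)"] enc_simps by simp
      qed
    qed blast
    obtain l j where lj: "k = enc (l, j)" "j < m l" using Kcase[OF k] by blast
    have "g k \<in> J0" using ind lj enc_simps by auto
    moreover have "g k = cp RA 0 (f k)" unfolding g_def basis_cp[OF bd f] by simp
    ultimately show "f k \<in> Jr" unfolding Jr_iff using basis_coeff[OF bd f] by simp
  qed
  have "cover N K ee d p"
    unfolding cover_def using bd eeA(3) sur ker by blast
  thus ?thesis by blast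
qed

lemma cover_kernel:
  assumes N: "gm N" and c: "cover N K e d p"
  shows "(\<lambda>f\<in>carrier (fmod A K e d). lincomb A N p f) \<in> Hom_Gr A (fmod A K e d) N"
    "gsub (fmod A K e d) {f \<in> carrier (fmod A K e d). lincomb A N p f = \<zero>\<^bsub>N\<^esub>}"
proof -
  interpret N: graded_module A N by (rule N)
  let ?F = "fmod A K e d"
  have bd: "basis_data K e d" and p: "\<And>k. k \<in> K \<Longrightarrow> p k \<in> mdeg N (d k)" using c unfolding cover_def by blast+
  have pc: "p k \<in> carrier N" if "k \<in> K" for k using N.V_closed[OF p[OF that]] .
  show H: "(\<lambda>f\<in>carrier ?F. lincomb A N p f) \<in> Hom_Gr A ?F N"
  proof (rule HomI[OF basis_gm[OF bd] basis_lin[OF bd N pc]])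
    show "lincomb A N p f \<in> mdeg N i" if "f \<in> mdeg ?F i" for f i
    proof -
      have "lincomb A N p f \<in> mdeg N (i + 0)"
        by (rule lincomb_deg[where K=K and e=e and d=d and n=0, OF _ N]) (use basis_e[OF bd] p pc that in auto)
      thus ?thesis by simp
    qed
  qed
  have "{f \<in> carrier ?F. (\<lambda>f\<in>carrier ?F. lincomb A N p f) f = \<zero>\<^bsub>N\<^esub>} = {f \<in> carrier ?F. lincomb A N p f = \<zero>\<^bsub>N\<^esub>}" by auto
  thus "gsub ?F {f \<in> carrier ?F. lincomb A N p f = \<zero>\<^bsub>N\<^esub>}" using ker_gsub[OF basis_gm[OF bd] N H] by simp
qed

text \<open>Each kernel is again left finite and bounded below, so covers can be iterated.
  \<open>M\<close> and the kernels have different element types; the cover of \<open>M\<close> is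
  therefore chosen separately, and only the later ones are iterated by
  \<open>funpow\<close>.\<close>

lemma minimal_resolution_exists:
  fixes M :: "('a, 'm) graded_module"
  assumes M: "nice M"
  obtains P :: "('a, 'm, ('a, 'm) res_elem) resolution"
  where "minimal_resolution A M P" "\<And>n. \<exists>K e d. basis_data K e d \<and> res_mod P n = fmod A K e d"
proof -
  \<comment> \<open>The first two components of the index type are filled with an arbitrary value;
    degree and position are coded in the third.\<close>
  let ?enc = "\<lambda>x :: int \<times> nat. (undefined, undefined, to_nat x) :: 'm \<times> 'a \<times> nat"
  have inj: "inj ?enc" by (rule injI) simp
  have Mg: "gm M" using M unfolding nice_def by blast
  obtain K0 :: "('m \<times> 'a \<times> nat) set" and e0 d0 p0 where c0: "cover M K0 e0 d0 p0" using nice_cover[OF M inj] by blast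
  have bd0: "basis_data K0 e0 d0" using c0 unfolding cover_def by blast
  have "\<forall>N :: ('a, ('a, 'm) res_elem) graded_module. \<exists>K :: ('m \<times> 'a \<times> nat) set. \<exists>e d p. nice N \<longrightarrow> cover N K e d p"
    using nice_cover[OF _ inj] by blast
  then obtain K' :: "('a, ('a, 'm) res_elem) graded_module \<Rightarrow> ('m \<times> 'a \<times> nat) set" and e' d' p'
    where c: "\<And>N. nice N \<Longrightarrow> cover N (K' N) (e' N) (d' N) (p' N)" by metis
  define N0 where "N0 = hsub (fmod A K0 e0 d0) {f \<in> carrier (fmod A K0 e0 d0). lincomb A M p0 f = \<zero>\<^bsub>M\<^esub>}"
  define ker where "ker N = hsub (fmod A (K' N) (e' N) (d' N)) {f \<in> carrier (fmod A (K' N) (e' N) (d' N)). lincomb A N (p' N) f = \<zero>\<^bsub>N\<^esub>}" for N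
  define N where "N n = (ker ^^ n) N0" for n
  have nN: "nice (N n)" for n
  proof (induction n)
    case 0
    show ?case unfolding N_def N0_def funpow_0 by (rule sub_nice[OF basis_nice[OF bd0] cover_kernel(2)[OF Mg c0]])
  next
    case (Suc n)
    have "basis_data (K' (N n)) (e' (N n)) (d' (N n))" "gm (N n)" using c[OF Suc] Suc unfolding cover_def nice_def by blast+
    hence "nice (ker (N n))" unfolding ker_def by (intro sub_nice basis_nice cover_kernel(2)[OF _ c[OF Suc]])
    thus ?case unfolding N_def by simp
  qed
  define K e d p where "K n = K' (N n)" and "e n = e' (N n)" and "d n = d' (N n)" and "p n = p' (N n)" for n
  have inv: "nice (N n)" "cover (N n) (K n) (e n) (d n) (p n)" for n
    unfolding K_def e_def d_def p_def by (rule nN, rule c[OF nN])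
  have N_0: "N 0 = N0" unfolding N_def by simp
  have N_Suc: "N (Suc n) = hsub (fmod A (K n) (e n) (d n)) {f \<in> carrier (fmod A (K n) (e n) (d n)). lincomb A (N n) (p n) f = \<zero>\<^bsub>N n\<^esub>}" for n
    unfolding K_def e_def d_def p_def N_def by (simp add: ker_def)
  have gmN: "gm (N n)" for n using inv(1) unfolding nice_def by blast
  have bd: "basis_data (K n) (e n) (d n)" for n using inv(2) unfolding cover_def by blast
  let ?G = "fmod A K0 e0 d0" and ?F = "\<lambda>n. fmod A (K n) (e n) (d n)"
  define T where "T = (\<lambda>n. case n of 0 \<Rightarrow> ?G | Suc m \<Rightarrow> ?F m)"
  \<comment> \<open>The value at 0 is a dummy, since the map called d_0 is
    \<open>res_aug\<close>.\<close>
  define D where "D = (\<lambda>n. case n of 0 \<Rightarrow> (\<lambda>x. x) | Suc m \<Rightarrow> (\<lambda>f\<in>carrier (?F m). lincomb A (N m) (p m) f))"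
  define P where "P = \<lparr>res_mod = T, res_diff = D, res_aug = (\<lambda>f\<in>carrier ?G. lincomb A M p0 f)\<rparr>"
  have T: "\<exists>K e d. basis_data K e d \<and> T n = fmod A K e d" for n
    unfolding T_def using bd0 bd by (cases n) auto
  have Tgm: "gm (T n)" for n using T[of n] basis_gm by metis
  \<comment> \<open>The module covered at stage n is the n-th kernel, as a submodule of
    \<open>T n\<close>; this translates the recursion into statements about
    \<open>res_ker\<close>.\<close>
  have carN: "carrier (N n) = res_ker M P n \<and> N n = hsub (T n) (res_ker M P n) \<and> gsub (T n) (res_ker M P n)" for n
  proof (cases n)
    case 0
    have "res_ker M P 0 = {f \<in> carrier ?G. lincomb A M p0 f = \<zero>\<^bsub>M\<^esub>}"
      unfolding res_ker_0 P_def T_def by auto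
    thus ?thesis unfolding 0 N_0 N0_def T_def using cover_kernel(2)[OF Mg c0] by simp
  next
    case (Suc m)
    have z: "\<zero>\<^bsub>N m\<^esub> = \<zero>\<^bsub>T m\<^esub>"
    proof (cases m)
      case 0
      thus ?thesis unfolding 0 N_0 N0_def T_def by simp
    next
      case (Suc l)
      thus ?thesis unfolding Suc N_Suc T_def by simp
    qed
    have "res_ker M P (Suc m) = {f \<in> carrier (?F m). lincomb A (N m) (p m) f = \<zero>\<^bsub>N m\<^esub>}"
      unfolding res_ker_Suc P_def z by (auto simp: T_def D_def)
    thus ?thesis unfolding Suc N_Suc T_def using cover_kernel(2)[OF gmN inv(2)] by simp
  qed
  have DN: "D (Suc n) \<in> Hom_Gr A (T (Suc n)) (N n)" for n
    unfolding D_def T_def using cover_kernel(1)[OF gmN inv(2)] by simp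
  have DT: "D (Suc n) \<in> Hom_Gr A (T (Suc n)) (T n)" for n
  proof -
    have N: "N n = hsub (T n) (res_ker M P n)" and sub: "res_ker M P n \<subseteq> carrier (T n)" using carN[of n] unfolding gsub_def by blast+
    show ?thesis using DN[of n] sub unfolding Hom_Gr_iff N lin_def by auto
  qed
  have im: "res_im P (Suc n) = res_ker M P n" for n
  proof -
    have "lincomb A (N n) (p n) ` carrier (?F n) = carrier (N n)" using inv(2) unfolding cover_def by blast
    thus ?thesis using carN[of n] unfolding res_im_def P_def D_def T_def by simp
  qed
  have "graded_projective_resolution A M P"
    unfolding graded_projective_resolution_def
  proof (intro conjI allI)
    show "graded_projective A (res_mod P n)" for n
    proof -
      obtain K e d where *: "basis_data K e d" "T n = fmod A K e d" using T by metis
      show ?thesis unfolding P_def using fmod_projective[of K e d] basis_e[OF *(1)] basis_idem[OF *(1)] *(2) by simp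
    qed
    show "res_diff P (Suc n) \<in> Hom_Gr A (res_mod P (Suc n)) (res_mod P n)" for n unfolding P_def using DT by simp
    show "res_aug P \<in> Hom_Gr A (res_mod P 0) M" unfolding P_def T_def using cover_kernel(1)[OF Mg c0] by simp
    show "res_aug P ` carrier (res_mod P 0) = carrier M" unfolding P_def T_def using c0 unfolding cover_def by simp
    show "res_im P (Suc n) = res_ker M P n" for n by (rule im)
  qed
  moreover have "res_im P (Suc n) \<subseteq> act_prod (res_mod P n) (graded_radical A) (carrier (res_mod P n))" for n
  proof (cases n)
    case 0
    have "res_ker M P 0 \<subseteq> JX ?G (carrier ?G)"
      using c0 unfolding cover_def res_ker_0 P_def T_def by auto
    thus ?thesis unfolding im 0 by (simp add: P_def T_def)
  next
    case (Suc m)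
    have "res_ker M P (Suc m) \<subseteq> JX (?F m) (carrier (?F m))"
      using inv(2)[of m] carN[of "Suc m"] unfolding cover_def N_Suc by auto
    thus ?thesis unfolding im Suc by (simp add: P_def T_def)
  qed
  ultimately have "minimal_resolution A M P" unfolding minimal_resolution_def by blast
  moreover have "\<exists>K e d. basis_data K e d \<and> res_mod P n = fmod A K e d" for n using T unfolding P_def by simp
  ultimately show ?thesis by (rule that)
qed

end

section \<open>Maps into submodules and comparison of two resolutions\<close>

context graded_ring begin

lemma hsub_finsum:
  assumes X: "gm X" and N: "gsub X N" and "finite D" "\<And>k. k \<in> D \<Longrightarrow> f k \<in> N"
  shows "finsum (hsub X N) f D = finsum X f D"
proof -
  interpret X: graded_module A X by (rule X)
  interpret H: graded_module A "hsub X N" by (rule hsub_gm(1)[OF X N])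
  have sub: "N \<subseteq> carrier X" using N unfolding gsub_def by blast
  show ?thesis using assms(3,4)
  proof (induction D rule: finite_induct)
    case (insert k D)
    have "f \<in> D \<rightarrow> carrier (hsub X N)" "f k \<in> carrier (hsub X N)" "f \<in> D \<rightarrow> carrier X" "f k \<in> carrier X"
      using insert.prems sub by auto
    thus ?case using insert by simp
  qed simp
qed

text \<open>The homogeneous summands of \<open>f\<close> also take values in \<open>N\<close>,
  because \<open>N\<close> contains the components of its elements.\<close>

lemma uHom_restrict:
  assumes X: "gm X" and Y: "gm Y" and N: "gsub Y N" and f: "f \<in> uHom A X Y"
    and fN: "\<And>x. x \<in> carrier X \<Longrightarrow> f x \<in> N"
  shows "f \<in> uHom A X (hsub Y N)"
proof -
  interpret X: graded_module A X by (rule X)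
  obtain D h where D: "finite D" "\<And>n. n \<in> D \<Longrightarrow> h n \<in> homd X Y n" "f = (\<lambda>x\<in>carrier X. \<Oplus>\<^bsub>Y\<^esub> n\<in>D. h n x)"
    "\<And>n i x. \<lbrakk>n \<in> D; x \<in> mdeg X i\<rbrakk> \<Longrightarrow> h n x = cp Y (i + n) (f x)"
    by (rule uHom_decomp[OF X Y f]) (rule that)
  have hN: "h n x \<in> N" if n: "n \<in> D" and x: "x \<in> carrier X" for n x
  proof -
    note L = homd_lin[OF D(2)[OF n]]
    show ?thesis using x
    proof (induction rule: X.homogeneous_induct)
      case zero
      show ?case using lin_zero[OF L gm_group[OF X] gm_group[OF Y]] N unfolding gsub_def by simp
    next
      case (step i u y)
      have "h n u \<in> N" unfolding D(4)[OF n step(1)] using N fN[OF step(2)] unfolding gsub_def by blast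
      thus ?case unfolding lin_add[OF L step(2,3)] using step(5) N unfolding gsub_def by blast
    qed
  qed
  have "h n \<in> homd X (hsub Y N) n" if n: "n \<in> D" for n
    using D(2)[OF n] hN[OF n] X.V_closed unfolding Hom_shift_iff lin_def by auto
  moreover have "f = (\<lambda>x\<in>carrier X. \<Oplus>\<^bsub>hsub Y N\<^esub> n\<in>D. h n x)"
    unfolding D(3) using hsub_finsum[OF Y N D(1) hN] by (intro restrict_ext) simp
  ultimately show ?thesis unfolding uHom_def using D(1) by blast
qed

lemma Hom_lift:
  assumes proj: "graded_projective A P" and X: "gm X" and Y: "gm Y"
    and g: "g \<in> Hom_Gr A X Y" and sur: "g ` carrier X = carrier Y" and f: "f \<in> Hom_Gr A P Y"
  shows "\<exists>h\<in>Hom_Gr A P X. \<forall>x\<in>carrier P. g (h x) = f x"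
proof -
  note P = projective_gm[OF proj]
  interpret P: graded_module A P by (rule P)
  obtain d s where s: "s \<in> Hom_Gr A P (fmod A (homog P) (\<lambda>_. \<one>) d)" "\<And>p. p \<in> homog P \<Longrightarrow> p \<in> mdeg P (d p)"
    "\<And>x. x \<in> carrier P \<Longrightarrow> lincomb A P (\<lambda>p. p) (s x) = x"
    by (rule projective_section[OF proj]) (rule that)
  have "\<exists>h\<in>homd P X 0. \<forall>x\<in>carrier P. g (h x) = f x"
    by (rule lift_along[OF RA_one P X Y s(1,2) s(3) g])
      (use f sur lin_closed[OF Hom_lin[OF f]] P.V_closed[OF s(2)] in \<open>simp_all add: Hom_shift_zero\<close>)
  thus ?thesis unfolding Hom_shift_zero .
qed

end

lemma (in gp_resolution) ker_gsub': "gsub (T n) (res_ker M P n)"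
proof (cases n)
  case 0
  show ?thesis unfolding 0 res_ker_0 by (rule ker_gsub[OF T_gm M aug_Hom])
next
  case (Suc k)
  show ?thesis unfolding Suc res_ker_Suc by (rule ker_gsub[OF T_gm T_gm d_Hom])
qed

text \<open>Chain maps over the identity of \<open>M\<close> in both directions and a homotopy from
  \<psi> \<phi> to the identity. The homotopy is stated twice: on the kernels, where h d vanishes,
  in all degrees, and on whole terms in positive degrees.\<close>

lemma comparison:
  assumes "gp_resolution A M P" "gp_resolution A M Q"
  obtains \<phi> \<psi> h where "\<And>n. \<phi> n \<in> uHom A (res_mod P n) (res_mod Q n)" "\<And>n. \<psi> n \<in> uHom A (res_mod Q n) (res_mod P n)"
    "\<And>n x. x \<in> res_ker M P n \<Longrightarrow> \<phi> n x \<in> res_ker M Q n" "\<And>n x. x \<in> res_ker M Q n \<Longrightarrow> \<psi> n x \<in> res_ker M P n"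
    "\<And>n x. x \<in> carrier (res_mod P (Suc n)) \<Longrightarrow> res_diff Q (Suc n) (\<phi> (Suc n) x) = \<phi> n (res_diff P (Suc n) x)"
    "\<And>n x. x \<in> carrier (res_mod Q (Suc n)) \<Longrightarrow> res_diff P (Suc n) (\<psi> (Suc n) x) = \<psi> n (res_diff Q (Suc n) x)"
    "\<And>n. h n \<in> uHom A (res_mod P n) (res_mod P (Suc n))"
    "\<And>n x. x \<in> res_ker M P n \<Longrightarrow> \<psi> n (\<phi> n x) = x \<oplus>\<^bsub>res_mod P n\<^esub> res_diff P (Suc n) (h n x)"
    "\<And>n x. x \<in> carrier (res_mod P (Suc n)) \<Longrightarrow> \<psi> (Suc n) (\<phi> (Suc n) x) =
      x \<oplus>\<^bsub>res_mod P (Suc n)\<^esub> (res_diff P (Suc (Suc n)) (h (Suc n) x) \<oplus>\<^bsub>res_mod P (Suc n)\<^esub> h n (res_diff P (Suc n) x))"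
proof -
  interpret P: gp_resolution A M P by fact
  interpret Q: gp_resolution A M Q by fact
  interpret PQ: two_resolutions A M P M Q by (rule two_resolutions.intro[OF P.graded_ring_axioms assms])
  interpret QP: two_resolutions A M Q M P by (rule two_resolutions.intro[OF P.graded_ring_axioms assms(2,1)])
  interpret PP: two_resolutions A M P M P by (rule two_resolutions.intro[OF P.graded_ring_axioms assms(1,1)])
  have "\<exists>\<phi>. lifts A P Q 0 P.aug \<phi>" by (rule PQ.lifts_exist[OF P.aug_uHom P.aug_d])
  then obtain \<phi> where \<phi>: "lifts A P Q 0 P.aug \<phi>" by (rule exE)
  have "\<exists>\<psi>. lifts A Q P 0 Q.aug \<psi>" by (rule QP.lifts_exist[OF Q.aug_uHom Q.aug_d])
  then obtain \<psi> where \<psi>: "lifts A Q P 0 Q.aug \<psi>" by (rule exE)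
  note l = \<phi>[unfolded lifts_def add_0] \<psi>[unfolded lifts_def add_0]
  have u: "\<phi> n \<in> uHom A (P.T n) (Q.T n)" "\<psi> n \<in> uHom A (Q.T n) (P.T n)" for n using l by blast+
  have c: "\<phi> n x \<in> carrier (Q.T n)" if "x \<in> carrier (P.T n)" for n x using P.uHom_closed[OF P.T_gm Q.T_gm u(1) that] .
  have c': "\<psi> n x \<in> carrier (P.T n)" if "x \<in> carrier (Q.T n)" for n x using P.uHom_closed[OF Q.T_gm P.T_gm u(2) that] .
  have z: "\<phi> n \<zero>\<^bsub>P.T n\<^esub> = \<zero>\<^bsub>Q.T n\<^esub>" "\<psi> n \<zero>\<^bsub>Q.T n\<^esub> = \<zero>\<^bsub>P.T n\<^esub>" for n
    using P.uHom_0[OF P.T_gm Q.T_gm u(1)]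
      P.uHom_0[OF Q.T_gm P.T_gm u(2)] .
  have d: "Q.dif (Suc n) (\<phi> (Suc n) x) = \<phi> n (P.dif (Suc n) x)" if "x \<in> carrier (P.T (Suc n))" for n x using l(1) that by blast
  have d': "P.dif (Suc n) (\<psi> (Suc n) x) = \<psi> n (Q.dif (Suc n) x)" if "x \<in> carrier (Q.T (Suc n))" for n x using l(2) that by blast
  have k: "\<phi> n x \<in> res_ker M Q n" if x: "x \<in> res_ker M P n" for n x
  proof (cases n)
    case 0
    thus ?thesis using x l(1) c unfolding 0 res_ker_0 by auto
  next
    case (Suc m)
    thus ?thesis using x d c z unfolding Suc res_ker_Suc by auto
  qed
  have k': "\<psi> n x \<in> res_ker M P n" if x: "x \<in> res_ker M Q n" for n x
  proof (cases n)
    case 0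
    thus ?thesis using x l(2) c' unfolding 0 res_ker_0 by auto
  next
    case (Suc m)
    thus ?thesis using x d' c' z unfolding Suc res_ker_Suc by auto
  qed
  let ?\<chi> = "\<lambda>n. \<lambda>x\<in>carrier (P.T n). \<psi> n (\<phi> n x)"
  have \<chi>: "lifts A P P 0 P.aug ?\<chi>"
    unfolding lifts_def add_0
  proof (intro conjI allI ballI)
    show "?\<chi> n \<in> uHom A (P.T n) (P.T n)" for n by (rule P.uHom_comp[OF P.T_gm Q.T_gm P.T_gm u])
    show "P.aug (?\<chi> 0 x) = P.aug x" if x: "x \<in> carrier (P.T 0)" for x
      using l x c[OF x] by simp
    show "P.dif (Suc n) (?\<chi> (Suc n) x) = ?\<chi> n (P.dif (Suc n) x)" if x: "x \<in> carrier (P.T (Suc n))" for n x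
      using x d[OF x] d'[OF c[OF x]] by simp
  qed
  obtain h where h: "\<And>n. h n \<in> uHom A (P.T (0 + n)) (P.T (Suc n))"
    "\<And>x. x \<in> carrier (P.T 0) \<Longrightarrow> ?\<chi> 0 x = (\<lambda>x\<in>carrier (P.T 0). x) x \<oplus>\<^bsub>P.T 0\<^esub> P.dif (Suc 0) (h 0 x)"
    "\<And>n x. x \<in> carrier (P.T (Suc (0 + n))) \<Longrightarrow> ?\<chi> (Suc n) x = (\<lambda>x\<in>carrier (P.T (Suc n)). x) x
      \<oplus>\<^bsub>P.T (Suc n)\<^esub> (P.dif (Suc (Suc n)) (h (Suc n) x) \<oplus>\<^bsub>P.T (Suc n)\<^esub> h n (P.dif (Suc (0 + n)) x))"
    by (rule PP.lifts_homotopy[OF \<chi> P.lifts_id]) (rule that)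
  note hu = h(1)[unfolded add_0]
  have h0: "\<psi> 0 (\<phi> 0 x) = x \<oplus>\<^bsub>P.T 0\<^esub> P.dif (Suc 0) (h 0 x)" if x: "x \<in> carrier (P.T 0)" for x using h(2)[OF x] x by simp
  have hS: "\<psi> (Suc n) (\<phi> (Suc n) x) = x \<oplus>\<^bsub>P.T (Suc n)\<^esub> (P.dif (Suc (Suc n)) (h (Suc n) x) \<oplus>\<^bsub>P.T (Suc n)\<^esub> h n (P.dif (Suc n) x))"
    if x: "x \<in> carrier (P.T (Suc n))" for n x using h(3)[of x n] x by simp
  have hk: "\<psi> n (\<phi> n x) = x \<oplus>\<^bsub>P.T n\<^esub> P.dif (Suc n) (h n x)" if x: "x \<in> res_ker M P n" for n x
  proof (cases n)
    case 0
    thus ?thesis using h0 x unfolding 0 res_ker_0 by simp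
  next
    case (Suc m)
    interpret T: graded_module A "P.T (Suc m)" by (rule P.T_gm)
    have x': "x \<in> carrier (P.T (Suc m))" "P.dif (Suc m) x = \<zero>\<^bsub>P.T m\<^esub>" using x unfolding Suc res_ker_Suc by simp_all
    have hz: "h m \<zero>\<^bsub>P.T m\<^esub> = \<zero>\<^bsub>P.T (Suc m)\<^esub>"
      by (rule P.uHom_0[OF P.T_gm P.T_gm hu])
    have "P.dif (Suc (Suc m)) (h (Suc m) x) \<in> carrier (P.T (Suc m))"
      by (rule P.d_closed[OF P.uHom_closed[OF P.T_gm P.T_gm hu x'(1)]])
    thus ?thesis unfolding Suc hS[OF x'(1)] x'(2) hz by simp
  qed
  show ?thesis by (rule that[OF u k k' d d' hu hk hS])
qed

section \<open>Radical submodules in a resolution and functionals into A/J\<close>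

context gsp begin

lemma JX_gsub: assumes X: "gm X" and N: "gsub X N" shows "gsub X (JX X N)"
proof -
  interpret X: graded_module A X by (rule X)
  have sub: "N \<subseteq> carrier X" using N unfolding gsub_def by blast
  show ?thesis
    unfolding gsub_def
  proof (intro conjI ballI allI)
    show "cp X i x \<in> JX X N" if x: "x \<in> JX X N" for x i
      by (rule act_prod_cp[OF X Jr_sub sub Jr_cp _ x]) (use N in \<open>simp_all add: gsub_def\<close>)
  qed (use X.act_prod_closed[OF Jr_sub sub] X.act_prod_zero[OF Jr_sub sub] X.act_prod_add[OF Jr_sub sub]
      X.act_prod_smult[OF Jr_sub sub Jr_left] in auto)
qed

lemma JX_mono: "gm X \<Longrightarrow> N \<subseteq> N' \<Longrightarrow> N' \<subseteq> carrier X \<Longrightarrow> JX X N \<subseteq> JX X N'"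
  by (rule left_module.act_prod_mono[OF gm_left_module]) (use Jr_sub in auto)

lemma JX_sub: assumes X: "gm X" and N: "gsub X N" shows "JX X N \<subseteq> N"
proof
  interpret X: graded_module A X by (rule X)
  fix x assume x: "x \<in> JX X N"
  have N': "N \<subseteq> carrier X" "\<zero>\<^bsub>X\<^esub> \<in> N" "\<And>x y. \<lbrakk>x \<in> N; y \<in> N\<rbrakk> \<Longrightarrow> x \<oplus>\<^bsub>X\<^esub> y \<in> N" "\<And>a x. \<lbrakk>a \<in> carrier A; x \<in> N\<rbrakk> \<Longrightarrow> a \<odot>\<^bsub>X\<^esub> x \<in> N"
    using N unfolding gsub_def by blast+
  show "x \<in> N" by (rule X.act_prod_least[OF Jr_sub N'(1) _ N'(2,3) x]) (use N'(4) Jr_closed in blast)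
qed

text \<open>The definition of quasi-Koszul uses the ideal J^2, while preimages and values of maps
  are tracked through J (J X).\<close>

lemma JJX: assumes X: "gm X" shows "act_prod X JJ (carrier X) = JX X (JX X (carrier X))"
proof
  interpret X: graded_module A X by (rule X)
  have JXc: "JX X (carrier X) \<subseteq> carrier X" by (rule X.act_prod_closed[OF Jr_sub subset_refl])
  note add = X.act_prod_add[OF JJ_sub subset_refl] X.act_prod_add[OF Jr_sub JXc]
  note zr = X.act_prod_zero[OF JJ_sub subset_refl] X.act_prod_zero[OF Jr_sub JXc]
  show "act_prod X JJ (carrier X) \<subseteq> JX X (JX X (carrier X))"
  proof
    fix x assume x: "x \<in> act_prod X JJ (carrier X)"
    show "x \<in> JX X (JX X (carrier X))"
    proof (rule X.act_prod_least[OF JJ_sub subset_refl _ zr(2) add(2) x])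
      fix a y assume a: "a \<in> JJ" and y: "y \<in> carrier X"
      have Jr': "Jr \<subseteq> carrier RA" using Jr_sub by simp
      from a have "a \<in> act_prod RA Jr Jr" unfolding JJ_act .
      thus "a \<odot>\<^bsub>X\<^esub> y \<in> JX X (JX X (carrier X))"
      proof (induction rule: RA.act_prod_induct[OF Jr_sub Jr', consumes 1, case_names zero step])
        case zero
        thus ?case using y zr(2) by simp
      next
        case (step a b c)
        have "(a \<otimes> b \<oplus> c) \<odot>\<^bsub>X\<^esub> y = a \<odot>\<^bsub>X\<^esub> (b \<odot>\<^bsub>X\<^esub> y) \<oplus>\<^bsub>X\<^esub> c \<odot>\<^bsub>X\<^esub> y"
          using step y by (simp add: X.smult_l_distr X.smult_assoc)
        moreover have "a \<odot>\<^bsub>X\<^esub> (b \<odot>\<^bsub>X\<^esub> y) \<in> JX X (JX X (carrier X))"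
          by (intro X.act_prod_prod[OF Jr_sub JXc] X.act_prod_prod[OF Jr_sub subset_refl] step y)
        ultimately show ?case using add(2) step by simp
      qed
    qed
  qed
  show "JX X (JX X (carrier X)) \<subseteq> act_prod X JJ (carrier X)"
  proof
    fix x assume x: "x \<in> JX X (JX X (carrier X))"
    show "x \<in> act_prod X JJ (carrier X)"
    proof (rule X.act_prod_least[OF Jr_sub JXc _ zr(1) add(1) x])
      fix a y assume a: "a \<in> Jr" and y: "y \<in> JX X (carrier X)"
      show "a \<odot>\<^bsub>X\<^esub> y \<in> act_prod X JJ (carrier X)" using y
      proof (induction rule: X.act_prod_induct[OF Jr_sub subset_refl, consumes 1, case_names zero step])
        case zero
        thus ?case using Jr_closed[OF a] zr(1) by simp
      next
        case (step b x y)
        have ab: "a \<otimes> b \<in> JJ"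
          unfolding JJ_act using RA.act_prod_prod[of Jr Jr a b] a step(1) Jr_sub by simp
        have "a \<odot>\<^bsub>X\<^esub> (b \<odot>\<^bsub>X\<^esub> x \<oplus>\<^bsub>X\<^esub> y) = (a \<otimes> b) \<odot>\<^bsub>X\<^esub> x \<oplus>\<^bsub>X\<^esub> a \<odot>\<^bsub>X\<^esub> y"
          using step Jr_closed[OF a] by (simp add: X.smult_r_distr X.smult_assoc)
        thus ?case using add(1)[OF X.act_prod_prod[OF JJ_sub subset_refl ab step(2)] step(7)] by simp
      qed
    qed
  qed
qed

text \<open>Write the element as a sum of terms a d v and take the sum of the a v. Maps from P_(n+1)
  to A/J vanish on the preimage so found, which is how membership in J K_n is exploited.\<close>

lemma JX_lift:
  assumes P: "gp_resolution A M P" and z: "z \<in> JX (res_mod P n) (res_ker M P n)"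
  shows "\<exists>y\<in>JX (res_mod P (Suc n)) (carrier (res_mod P (Suc n))). res_diff P (Suc n) y = z"
proof -
  interpret P: gp_resolution A M P by (rule P)
  interpret T: graded_module A "P.T n" by (rule P.T_gm)
  interpret U: graded_module A "P.T (Suc n)" by (rule P.T_gm)
  note L = Hom_lin[OF P.d_Hom[of n]]
  show ?thesis using z
  proof (induction rule: T.act_prod_induct[OF Jr_sub res_ker_sub, consumes 1, case_names zero step])
    case zero
    show ?case using lin_zero[OF L P.T_group P.T_group] U.act_prod_zero[OF Jr_sub subset_refl] by blast
  next
    case (step a x y)
    obtain v where v: "v \<in> carrier (P.T (Suc n))" "P.dif (Suc n) v = x" using P.ker_d[OF step(2)] by blast
    obtain w where w: "w \<in> JX (P.T (Suc n)) (carrier (P.T (Suc n)))" "P.dif (Suc n) w = y" using step(7) by blast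
    have wc: "w \<in> carrier (P.T (Suc n))" using U.act_prod_closed[OF Jr_sub subset_refl] w(1) by blast
    have "a \<odot>\<^bsub>P.T (Suc n)\<^esub> v \<oplus>\<^bsub>P.T (Suc n)\<^esub> w \<in> JX (P.T (Suc n)) (carrier (P.T (Suc n)))"
      by (intro U.act_prod_add[OF Jr_sub subset_refl] U.act_prod_prod[OF Jr_sub subset_refl] step(1) v(1) w(1))
    moreover have "P.dif (Suc n) (a \<odot>\<^bsub>P.T (Suc n)\<^esub> v \<oplus>\<^bsub>P.T (Suc n)\<^esub> w) = a \<odot>\<^bsub>P.T n\<^esub> x \<oplus>\<^bsub>P.T n\<^esub> y"
      using lin_add[OF L U.smult_closed[OF step(3) v(1)] wc] lin_smult[OF L step(3) v(1)] v(2) w(2) by simp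
    ultimately show ?case by blast
  qed
qed

text \<open>The components of \<open>a y\<close> coming from \<open>a \<in> A\<^sub>i\<close> with \<open>i > 0\<close> lie in \<open>J N\<close>, so that linearity over
  \<open>A\<^sub>0\<close> is enough.\<close>

lemma graded_functional:
  assumes X: "gm X" and N: "gsub X N" and E: "lin R0 (X\<lparr>carrier := N \<inter> mdeg X d\<rparr>) SS E"
    and E0: "\<And>z. \<lbrakk>z \<in> JX X N; z \<in> mdeg X d\<rbrakk> \<Longrightarrow> E z = \<zero>\<^sub>S"
  shows "(\<lambda>y\<in>N. E (cp X d y)) \<in> homd (hsub X N) SS (- d)"
proof -
  interpret X: graded_module A X by (rule X)
  interpret SS: graded_module A SS by (rule SS_gm)
  have N': "N \<subseteq> carrier X" "\<zero>\<^bsub>X\<^esub> \<in> N" "\<And>x y. \<lbrakk>x \<in> N; y \<in> N\<rbrakk> \<Longrightarrow> x \<oplus>\<^bsub>X\<^esub> y \<in> N" "\<And>a x. \<lbrakk>a \<in> carrier A; x \<in> N\<rbrakk> \<Longrightarrow> a \<odot>\<^bsub>X\<^esub> x \<in> N"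
     "\<And>x i. x \<in> N \<Longrightarrow> cp X i x \<in> N"
    using N unfolding gsub_def by blast+
  let ?f = "\<lambda>y. E (cp X d y)"
  have cpN: "cp X d y \<in> N \<inter> mdeg X d" if "y \<in> N" for y using N'(5)[OF that] X.hcomp_spec(1) N'(1) that by blast
  have cl: "?f y \<in> carrier SS" if "y \<in> N" for y using lin_closed[OF E] cpN[OF that] by simp
  have Eadd: "E (u \<oplus>\<^bsub>X\<^esub> v) = E u \<oplus>\<^bsub>SS\<^esub> E v" if "u \<in> N \<inter> mdeg X d" "v \<in> N \<inter> mdeg X d" for u v
    using lin_add[OF E] that by simp
  have add: "?f (u \<oplus>\<^bsub>X\<^esub> v) = ?f u \<oplus>\<^bsub>SS\<^esub> ?f v" if uv: "u \<in> N" "v \<in> N" for u v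
    unfolding X.hcomp_add[OF subsetD[OF N'(1) uv(1)] subsetD[OF N'(1) uv(2)]] by (rule Eadd[OF cpN[OF uv(1)] cpN[OF uv(2)]])
  have z: "?f \<zero>\<^bsub>X\<^esub> = \<zero>\<^sub>S" using E0[of "\<zero>\<^bsub>X\<^esub>"] X.act_prod_zero[OF Jr_sub N'(1)] X.V_zero by simp
  have sm: "?f (a \<odot>\<^bsub>X\<^esub> y) = a \<odot>\<^bsub>SS\<^esub> ?f y" if a: "a \<in> carrier A" and y: "y \<in> N" for a y
  proof -
    have yc: "y \<in> carrier X" using y N'(1) by blast
    from a have "a \<in> carrier RA" by simp
    thus ?thesis
    proof (induction rule: RA.homogeneous_induct)
      case zero
      thus ?case using z cl[OF y] yc by simp
    next
      case (step i b c)
      have bc: "b \<in> carrier A" "c \<in> carrier A" using step(2,3) by simp_all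
      have b: "?f (b \<odot>\<^bsub>X\<^esub> y) = b \<odot>\<^bsub>SS\<^esub> ?f y"
      proof (cases "i = 0")
        case True
        hence "b \<in> A0" using step(1) by simp
        moreover have "cp X d (b \<odot>\<^bsub>X\<^esub> y) = b \<odot>\<^bsub>X\<^esub> cp X d y" using cp_smult[OF X step(1) yc, of d] True by simp
        ultimately show ?thesis using lin_smult[OF E, of b "cp X d y"] cpN[OF y] by simp
      next
        case False
        have bJ: "b \<in> Jr" by (rule Jr_pos[OF step(1) False])
        have "cp X d (b \<odot>\<^bsub>X\<^esub> y) = b \<odot>\<^bsub>X\<^esub> cp X (d - i) y" by (rule cp_smult[OF X step(1) yc])
        hence "cp X d (b \<odot>\<^bsub>X\<^esub> y) \<in> JX X N" using X.act_prod_prod[OF Jr_sub N'(1) bJ N'(5)[OF y]] by simp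
        moreover have "cp X d (b \<odot>\<^bsub>X\<^esub> y) \<in> mdeg X d" using X.hcomp_spec(1)[OF X.smult_closed[OF bc(1) yc]] .
        ultimately show ?thesis using E0 SS_radical[OF bJ cl[OF y]] by simp
      qed
      have "?f ((b \<oplus> c) \<odot>\<^bsub>X\<^esub> y) = ?f (b \<odot>\<^bsub>X\<^esub> y) \<oplus>\<^bsub>SS\<^esub> ?f (c \<odot>\<^bsub>X\<^esub> y)"
        using add[OF N'(4)[OF bc(1) y] N'(4)[OF bc(2) y]] X.smult_l_distr[OF bc yc] by simp
      thus ?case using b step(5) SS.smult_l_distr[OF bc cl[OF y]] by simp
    qed
  qed
  show ?thesis
  proof (rule homdI[where X = "hsub X N", unfolded hsub_simps])
    show "gm (hsub X N)" by (rule hsub_gm(1)[OF X N])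
    show "lin A (hsub X N) SS ?f" by (rule linI) (use cl add sm in simp_all)
    show "?f x \<in> mdeg SS (i + - d)" if x: "x \<in> mdeg X i \<inter> N" for i x
    proof (cases "i = d")
      case True
      thus ?thesis using cl x unfolding SS_deg by simp
    next
      case False
      hence "cp X d x = \<zero>\<^bsub>X\<^esub>" using X.hcomp_hom[of x i d] x by simp
      hence "?f x = \<zero>\<^sub>S" using z by simp
      thus ?thesis using SS.V_zero by simp
    qed
  qed
qed

text \<open>\<open>proj_res\<close> is a choice operator. That a resolution with terms of the
  prescribed type exists is seen from the minimal one, though the chosen one may be another.\<close>

lemma nice_ext_source:
  fixes M :: "('a, 'm) graded_module"
  assumes "nice M" shows "ext_source A M"
proof -
  have "\<exists>P :: ('a, 'm, ('a, 'm) res_elem) resolution. graded_projective_resolution A M P"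
    by (rule minimal_resolution_exists[OF assms]) (auto simp: minimal_resolution_def)
  hence "graded_projective_resolution A M (proj_res A M)" unfolding proj_res_def by (rule someI_ex)
  moreover have "gm M" using assms unfolding nice_def by blast
  ultimately show ?thesis
    by (intro ext_source.intro gp_resolution.intro gp_resolution_axioms.intro graded_ring_axioms)
qed

lemma nice_left_finite: "\<lbrakk>gm M; left_finite A M; bounded_below M\<rbrakk> \<Longrightarrow> nice M"
  unfolding nice_def bounded_below_def using left_finite_fg by blast

lemma SS_nice: "nice SS"
  unfolding nice_def
proof (intro conjI allI)
  interpret SS: graded_module A SS by (rule SS_gm)
  show "gm SS" by (rule SS_gm)
  show "\<exists>b. \<forall>i<b. mdeg SS i = {\<zero>\<^sub>S}" unfolding SS_deg by (rule exI[of _ 0]) simp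
  show "fg SS (mdeg SS i)" for i
  proof (cases "i = 0")
    case True
    have c1: "cls \<one> \<in> carrier SS" by (rule cls_closed) simp
    have "mdeg SS 0 = spanl SS {\<zero>\<^sub>S} [cls \<one>]"
    proof
      show "spanl SS {\<zero>\<^sub>S} [cls \<one>] \<subseteq> mdeg SS 0"
        by (rule spanl_least[OF SS_gm sub0_mdeg[OF SS_gm]]) (use c1 SS.V_zero in \<open>simp_all add: SS_deg\<close>)
      show "mdeg SS 0 \<subseteq> spanl SS {\<zero>\<^sub>S} [cls \<one>]"
      proof
        fix s assume "s \<in> mdeg SS 0"
        then obtain a where a: "s = cls a" "a \<in> mdeg RA 0" unfolding SS_simps(4) by (rule imageE)
        have "s = \<zero>\<^sub>S \<oplus>\<^bsub>SS\<^esub> a \<odot>\<^bsub>SS\<^esub> cls \<one>"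
          using a(1) cls_smult[OF A0_closed[OF a(2)] one_closed] cls_closed[OF A0_closed[OF a(2)]] A0_closed[OF a(2)] by simp
        thus "s \<in> spanl SS {\<zero>\<^sub>S} [cls \<one>]" using a(2) unfolding spanl_simps adj_def by blast
      qed
    qed
    thus ?thesis unfolding fg_def[OF SS_gm] True using c1 by (intro exI[of _ "[cls \<one>]"]) simp
  next
    case False
    thus ?thesis unfolding fg_def[OF SS_gm] by (intro exI[of _ "[]"]) (simp add: SS_deg)
  qed
qed

end

lemma (in ext_pair) cl_nul: "cl n (nul n) = \<one>\<^bsub>E n\<^esub>"
proof -
  interpret Y: graded_module A Y by (rule Y)
  interpret E: comm_group "E n" by (rule E_group)
  have "plus n (nul n) (nul n) = nul n" by (rule restrict_ext) simp
  hence "cl n (nul n) \<otimes>\<^bsub>E n\<^esub> cl n (nul n) = cl n (nul n)" using cl_plus[OF nul_Z nul_Z] by simp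
  thus ?thesis using cl_closed[OF nul_Z] by (simp add: E.l_cancel_one')
qed

text \<open>Passes from a pointwise sum of cocycles to the product of their classes, Ext being
  written multiplicatively.\<close>

lemma (in ext_pair) cl_finsum:
  assumes S: "S \<subseteq> carrier (E n)" and "finite D" "\<And>k. k \<in> D \<Longrightarrow> g k \<in> Z n" "\<And>k. k \<in> D \<Longrightarrow> cl n (g k) \<in> finite_sums (E n) S"
  shows "(\<lambda>x\<in>carrier (T n). \<Oplus>\<^bsub>Y\<^esub>k\<in>D. g k x) \<in> Z n \<and> cl n (\<lambda>x\<in>carrier (T n). \<Oplus>\<^bsub>Y\<^esub>k\<in>D. g k x) \<in> finite_sums (E n) S"
proof -
  interpret Y: graded_module A Y by (rule Y)
  interpret E: comm_group "E n" by (rule E_group)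
  show ?thesis using assms(2-4)
  proof (induction D rule: finite_induct)
    case empty
    have "(\<lambda>x\<in>carrier (T n). \<Oplus>\<^bsub>Y\<^esub>k\<in>{}. g k x) = nul n" by simp
    thus ?case using nul_Z[of n] cl_nul[of n] E.finite_sums_one by (simp only:)
  next
    case (insert k D)
    let ?s = "\<lambda>x\<in>carrier (T n). \<Oplus>\<^bsub>Y\<^esub>k\<in>D. g k x"
    have "?s \<in> Z n \<and> cl n ?s \<in> finite_sums (E n) S" by (rule insert.IH) (use insert.prems in blast)+
    hence IH: "?s \<in> Z n" "cl n ?s \<in> finite_sums (E n) S" by (rule conjunct1, rule conjunct2)
    have gk: "g k \<in> Z n" "cl n (g k) \<in> finite_sums (E n) S" using insert.prems by simp_all
    have "(\<lambda>x\<in>carrier (T n). \<Oplus>\<^bsub>Y\<^esub>k\<in>insert k D. g k x) = plus n (g k) ?s"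
    proof (rule restrict_ext)
      fix x assume x: "x \<in> carrier (T n)"
      have "(\<lambda>k. g k x) \<in> D \<rightarrow> carrier Y" "g k x \<in> carrier Y" using Z_closed[OF _ x] insert.prems by auto
      thus "(\<Oplus>\<^bsub>Y\<^esub>k\<in>insert k D. g k x) = g k x \<oplus>\<^bsub>Y\<^esub> ?s x" using insert.hyps x by simp
    qed
    thus ?case using plus_Z[OF gk(1) IH(1)] cl_plus[OF gk(1) IH(1)] E.finite_sums_mult[OF S gk(2) IH(2)] by (simp only:)
  qed
qed

context yon begin

lemma products_closed: "{yo j i \<alpha> \<beta> | \<alpha> \<beta>. \<alpha> \<in> carrier (YZ.E j) \<and> \<beta> \<in> carrier (XY.E i)} \<subseteq> carrier (XZ.E (i + j))"
  using yoneda_closed by blast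

lemma Ext_product_closed: "Ext_product A j i X Y Z \<subseteq> carrier (XZ.E (i + j))"
  unfolding Ext_product_def by (rule comm_monoid.finite_sums_closed[OF comm_group.axioms(1)[OF XZ.E_group] products_closed])

lemma Ext_product_yoneda: "\<lbrakk>\<alpha> \<in> carrier (YZ.E j); \<beta> \<in> carrier (XY.E i)\<rbrakk> \<Longrightarrow> yo j i \<alpha> \<beta> \<in> Ext_product A j i X Y Z"
  unfolding Ext_product_def
  by (rule comm_monoid.finite_sums_incl[OF comm_group.axioms(1)[OF XZ.E_group] products_closed]) blast

end

context gsp begin

section \<open>Independence of the resolution\<close>

text \<open>Only the inclusion that can fail is required: in this form the property does not depend on
  the resolution, minimal or not.\<close>

definition QK :: "('a, 'm) graded_module \<Rightarrow> ('a, 'm, 'p) resolution \<Rightarrow> bool"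
  where "QK M P \<longleftrightarrow>
    (\<forall>n. res_ker M P n \<inter> act_prod (res_mod P n) JJ (carrier (res_mod P n)) \<subseteq> JX (res_mod P n) (res_ker M P n))"

lemma uHom_act_prod:
  assumes X: "gm X" and Y: "gm Y" and f: "f \<in> uHom A X Y" and I: "I \<subseteq> carrier A"
    and N: "N \<subseteq> carrier X" and N': "N' \<subseteq> carrier Y" and fN: "\<And>x. x \<in> N \<Longrightarrow> f x \<in> N'" and x: "x \<in> act_prod X I N"
  shows "f x \<in> act_prod Y I N'"
  by (rule lin_act_prod[OF uHom_lin[OF X Y f] gm_left_module[OF X] gm_left_module[OF Y] I N x _ N']) (rule image_subsetI[OF fN])

text \<open>Write x = \<psi> \<phi> x - d h x. The first term comes from J ker in the other
  resolution by hypothesis; for the second, h preserves J^2 and d maps into the kernel.\<close>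

lemma QK_independent:
  assumes P: "gp_resolution A M P" and Q: "gp_resolution A M Q" and QK: "QK M Q"
  shows "QK M P"
proof -
  interpret P: gp_resolution A M P by (rule P)
  interpret Q: gp_resolution A M Q by (rule Q)
  obtain \<phi> \<psi> h where c: "\<And>n. \<phi> n \<in> uHom A (P.T n) (Q.T n)" "\<And>n. \<psi> n \<in> uHom A (Q.T n) (P.T n)"
    "\<And>n x. x \<in> res_ker M P n \<Longrightarrow> \<phi> n x \<in> res_ker M Q n" "\<And>n x. x \<in> res_ker M Q n \<Longrightarrow> \<psi> n x \<in> res_ker M P n"
    "\<And>n. h n \<in> uHom A (P.T n) (P.T (Suc n))"
    "\<And>n x. x \<in> res_ker M P n \<Longrightarrow> \<psi> n (\<phi> n x) = x \<oplus>\<^bsub>P.T n\<^esub> P.dif (Suc n) (h n x)"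
    by (rule comparison[OF P Q]) (rule that)
  show ?thesis
    unfolding QK_def
  proof (intro allI subsetI)
    fix n x assume "x \<in> res_ker M P n \<inter> act_prod (P.T n) JJ (carrier (P.T n))"
    hence x: "x \<in> res_ker M P n" "x \<in> act_prod (P.T n) JJ (carrier (P.T n))" by simp_all
    interpret T: graded_module A "P.T n" by (rule P.T_gm)
    note N = res_ker_sub[of M P n]
    have "\<phi> n x \<in> act_prod (Q.T n) JJ (carrier (Q.T n))"
      by (rule uHom_act_prod[OF P.T_gm Q.T_gm c(1) JJ_sub subset_refl subset_refl uHom_closed[OF P.T_gm Q.T_gm c(1)] x(2)])
    hence b0: "\<phi> n x \<in> JX (Q.T n) (res_ker M Q n)" using QK c(3)[OF x(1)] unfolding QK_def by blast
    have a: "\<psi> n (\<phi> n x) \<in> JX (P.T n) (res_ker M P n)"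
      by (rule uHom_act_prod[OF Q.T_gm P.T_gm c(2) Jr_sub res_ker_sub res_ker_sub c(4) b0])
    have c0: "h n x \<in> act_prod (P.T (Suc n)) JJ (carrier (P.T (Suc n)))"
      by (rule uHom_act_prod[OF P.T_gm P.T_gm c(5) JJ_sub subset_refl subset_refl uHom_closed[OF P.T_gm P.T_gm c(5)] x(2)])
    have "P.dif (Suc n) (h n x) \<in> act_prod (P.T n) JJ (res_ker M P n)"
      by (rule uHom_act_prod[OF P.T_gm P.T_gm P.d_uHom JJ_sub subset_refl res_ker_sub P.d_ker c0])
    hence b: "P.dif (Suc n) (h n x) \<in> JX (P.T n) (res_ker M P n)"
      using T.act_prod_mono[OF JJ_sub_Jr subset_refl Jr_sub N] by blast
    have b': "\<ominus>\<^bsub>P.T n\<^esub> P.dif (Suc n) (h n x) \<in> JX (P.T n) (res_ker M P n)"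
      by (rule gsub_neg[OF P.T_gm JX_gsub[OF P.T_gm P.ker_gsub'] b])
    have bc: "P.dif (Suc n) (h n x) \<in> carrier (P.T n)" using b T.act_prod_closed[OF Jr_sub N] by blast
    have xc: "x \<in> carrier (P.T n)" using x(1) N by blast
    have "x = \<psi> n (\<phi> n x) \<oplus>\<^bsub>P.T n\<^esub> \<ominus>\<^bsub>P.T n\<^esub> P.dif (Suc n) (h n x)"
      unfolding c(6)[OF x(1)] using xc bc by (simp add: T.M.a_assoc T.M.r_neg)
    thus "x \<in> JX (P.T n) (res_ker M P n)" using T.act_prod_add[OF Jr_sub N a b'] by simp
  qed
qed

section \<open>Cocycles as sums of products\<close>

lemma nice_sub_fg:
  assumes X: "nice X" and W: "sub0 X W" "W \<subseteq> mdeg X d"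
  shows "\<exists>ws. set ws \<subseteq> carrier X \<and> W = spanl X {\<zero>\<^bsub>X\<^esub>} ws"
proof -
  have Xg: "gm X" using X unfolding nice_def by blast
  obtain vs where vs: "set vs \<subseteq> carrier X" "mdeg X d = spanl X {\<zero>\<^bsub>X\<^esub>} vs" using X unfolding nice_def fg_def[OF Xg] by blast
  have "\<exists>ws. set ws \<subseteq> W \<and> W = spanl X {\<zero>\<^bsub>X\<^esub>} ws" by (rule noetherian0[OF Xg vs(1) W(1)]) (use W(2) vs(2) in simp)
  thus ?thesis using sub0_sub[OF W(1)] by blast
qed

text \<open>The map induced on K_n vanishes on the intersection with J^2 P_n for this reason: by
  hypothesis that intersection lies in J K_n, whose elements have preimages in J P_(n+1), and
  \<open>h\<close> is zero there. The extension itself takes place in one degree;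
  \<open>graded_functional\<close> makes it A-linear.\<close>

lemma cocycle_extension:
  assumes P: "gp_resolution A M P" and nice: "nice (res_mod P n)"
    and min: "res_ker M P n \<subseteq> JX (res_mod P n) (carrier (res_mod P n))"
    and QK: "res_ker M P n \<inter> act_prod (res_mod P n) JJ (carrier (res_mod P n)) \<subseteq> JX (res_mod P n) (res_ker M P n)"
    and h: "h \<in> homd (res_mod P (Suc n)) SS m"
    and hd: "\<And>x. x \<in> carrier (res_mod P (Suc (Suc n))) \<Longrightarrow> h (res_diff P (Suc (Suc n)) x) = \<zero>\<^sub>S"
  shows "\<exists>\<Phi>\<in>homd (hsub (res_mod P n) (JX (res_mod P n) (carrier (res_mod P n)))) SS m.
    \<forall>y\<in>carrier (res_mod P (Suc n)). \<Phi> (res_diff P (Suc n) y) = h y"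
proof -
  interpret P: gp_resolution A M P by (rule P)
  interpret T: graded_module A "P.T n" by (rule P.T_gm)
  interpret U: graded_module A "P.T (Suc n)" by (rule P.T_gm)
  interpret SS: graded_module A SS by (rule SS_gm)
  \<comment> \<open>A/J is concentrated in degree 0, so a map of degree m sees only degree
    -m.\<close>
  let ?d = "- m" and ?T = "P.T n" and ?U = "P.T (Suc n)" and ?K = "res_ker M P n"
  let ?N = "JX ?T (carrier ?T)"
  have N: "gsub ?T ?N" by (rule JX_gsub[OF P.T_gm gsub_carrier[OF P.T_gm]])
  have Nc: "?N \<subseteq> carrier ?T" by (rule T.act_prod_closed[OF Jr_sub subset_refl])
  define W V Q where "W = ?K \<inter> mdeg ?T ?d" and "V = ?N \<inter> mdeg ?T ?d" and "Q = JX ?T ?N \<inter> mdeg ?T ?d"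
  note deg = sub0_mdeg[OF P.T_gm]
  have W: "sub0 ?T W" unfolding W_def by (rule sub0_Int[OF gsub_sub0[OF P.T_gm P.ker_gsub'] deg])
  have V: "sub0 ?T V" unfolding V_def by (rule sub0_Int[OF gsub_sub0[OF P.T_gm N] deg])
  have Q: "sub0 ?T Q" unfolding Q_def by (rule sub0_Int[OF gsub_sub0[OF P.T_gm JX_gsub[OF P.T_gm N]] deg])
  have WV: "W \<subseteq> V" unfolding W_def V_def using min by blast
  have QV: "Q \<subseteq> V" unfolding Q_def V_def using JX_sub[OF P.T_gm N] by blast
  note hL = homd_lin[OF h] and dL = Hom_lin[OF P.d_Hom[of n]]
  have hc: "h y \<in> carrier SS" if "y \<in> carrier ?U" for y using lin_closed[OF hL that] .
  \<comment> \<open>The choice of the preimage does not matter: two preimages differ by a boundary,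
    and \<open>h\<close> kills boundaries.\<close>
  define f where "f z = h (SOME y. y \<in> carrier ?U \<and> P.dif (Suc n) y = z)" for z
  have fd: "f (P.dif (Suc n) y) = h y" if y: "y \<in> carrier ?U" for y
  proof -
    define y' where "y' = (SOME y'. y' \<in> carrier ?U \<and> P.dif (Suc n) y' = P.dif (Suc n) y)"
    have "y' \<in> carrier ?U \<and> P.dif (Suc n) y' = P.dif (Suc n) y" unfolding y'_def by (rule someI_ex) (use y in blast)
    hence y': "y' \<in> carrier ?U" "P.dif (Suc n) y' = P.dif (Suc n) y" by blast+
    have ny: "\<ominus>\<^bsub>?U\<^esub> y \<in> carrier ?U" using y by simp
    have "P.dif (Suc n) (y' \<oplus>\<^bsub>?U\<^esub> \<ominus>\<^bsub>?U\<^esub> y) = \<zero>\<^bsub>?T\<^esub>"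
      using lin_add[OF dL y'(1) ny] lin_neg[OF dL P.T_group P.T_group y] y'(2) P.d_closed[OF y] by (simp add: T.M.r_neg)
    hence "y' \<oplus>\<^bsub>?U\<^esub> \<ominus>\<^bsub>?U\<^esub> y \<in> res_ker M P (Suc n)" unfolding res_ker_Suc using y'(1) y by simp
    then obtain w where w: "w \<in> carrier (P.T (Suc (Suc n)))" "P.dif (Suc (Suc n)) w = y' \<oplus>\<^bsub>?U\<^esub> \<ominus>\<^bsub>?U\<^esub> y" using P.ker_d by blast
    have "h (y' \<oplus>\<^bsub>?U\<^esub> \<ominus>\<^bsub>?U\<^esub> y) = \<zero>\<^sub>S" using hd[OF w(1)] w(2) by simp
    moreover have "y' = (y' \<oplus>\<^bsub>?U\<^esub> \<ominus>\<^bsub>?U\<^esub> y) \<oplus>\<^bsub>?U\<^esub> y" using y y' by (simp add: U.M.a_assoc U.M.l_neg)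
    ultimately have "h y' = h y" using lin_add[OF hL _ y, of "y' \<oplus>\<^bsub>?U\<^esub> \<ominus>\<^bsub>?U\<^esub> y"] hc[OF y] y'(1) y by simp
    thus ?thesis unfolding f_def y'_def .
  qed
  have lift: "\<exists>y\<in>carrier ?U. P.dif (Suc n) y = z" if "z \<in> W" for z using P.ker_d that unfolding W_def by blast
  have f: "lin R0 (?T\<lparr>carrier := W\<rparr>) SS f"
  proof (rule linI)
    show "f z \<in> carrier SS" if z: "z \<in> carrier (?T\<lparr>carrier := W\<rparr>)" for z
    proof -
      from z have "z \<in> W" by simp
      then obtain y where "y \<in> carrier ?U" "P.dif (Suc n) y = z" using lift by blast
      thus ?thesis using fd hc by metis
    qed
    show "f (z \<oplus>\<^bsub>?T\<lparr>carrier := W\<rparr>\<^esub> z') = f z \<oplus>\<^bsub>SS\<^esub> f z'" if z: "z \<in> carrier (?T\<lparr>carrier := W\<rparr>)" "z' \<in> carrier (?T\<lparr>carrier := W\<rparr>)" for z z'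
    proof -
      from z have "z \<in> W" "z' \<in> W" by simp_all
      then obtain y y' where y: "y \<in> carrier ?U" "P.dif (Suc n) y = z" "y' \<in> carrier ?U" "P.dif (Suc n) y' = z'" using lift by blast
      have "z \<oplus>\<^bsub>?T\<^esub> z' = P.dif (Suc n) (y \<oplus>\<^bsub>?U\<^esub> y')" using lin_add[OF dL y(1,3)] y(2,4) by simp
      thus ?thesis using fd[of "y \<oplus>\<^bsub>?U\<^esub> y'"] fd[OF y(1)] fd[OF y(3)] y lin_add[OF hL y(1,3)] by simp
    qed
    show "f (a \<odot>\<^bsub>?T\<lparr>carrier := W\<rparr>\<^esub> z) = a \<odot>\<^bsub>SS\<^esub> f z" if a: "a \<in> carrier R0" and z: "z \<in> carrier (?T\<lparr>carrier := W\<rparr>)" for a z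
    proof -
      from a have a': "a \<in> carrier A" using A0_closed by simp
      from z have "z \<in> W" by simp
      then obtain y where y: "y \<in> carrier ?U" "P.dif (Suc n) y = z" using lift by blast
      have "a \<odot>\<^bsub>?T\<^esub> z = P.dif (Suc n) (a \<odot>\<^bsub>?U\<^esub> y)" using lin_smult[OF dL a' y(1)] y(2) by simp
      thus ?thesis using fd[of "a \<odot>\<^bsub>?U\<^esub> y"] fd[OF y(1)] y lin_smult[OF hL a' y(1)] a' by simp
    qed
  qed
  have f0: "f z = \<zero>\<^sub>S" if z: "z \<in> W" "z \<in> Q" for z
  proof -
    have "z \<in> JX ?T ?K" using z QK unfolding W_def Q_def JJX[OF P.T_gm] by blast
    then obtain y where y: "y \<in> JX ?U (carrier ?U)" "P.dif (Suc n) y = z" using JX_lift[OF P] by blast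
    have "y \<in> carrier ?U" using y(1) U.act_prod_closed[OF Jr_sub subset_refl] by blast
    thus ?thesis using fd[of y] y(2) to_SS_radical[OF P.T_gm hL y(1)] by simp
  qed
  have "\<exists>vs. set vs \<subseteq> carrier ?T \<and> V = spanl ?T {\<zero>\<^bsub>?T\<^esub>} vs" by (rule nice_sub_fg[OF nice V, where d = ?d]) (simp add: V_def)
  then obtain vs where vs: "set vs \<subseteq> carrier ?T" "V = spanl ?T {\<zero>\<^bsub>?T\<^esub>} vs" by blast
  have JQ: "j \<odot>\<^bsub>?T\<^esub> v \<in> Q" if j: "j \<in> J0" and v: "v \<in> V" for j v
  proof -
    have "j \<in> Jr" using j Jr_A0 J0_A0 by blast
    hence "j \<odot>\<^bsub>?T\<^esub> v \<in> JX ?T ?N" using v unfolding V_def by (intro T.act_prod_prod[OF Jr_sub Nc]) simp_all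
    moreover have "j \<odot>\<^bsub>?T\<^esub> v \<in> mdeg ?T ?d" using smult_degree'[OF P.T_gm[of n] J0_A0[OF j], of v ?d] v unfolding V_def by simp
    ultimately show ?thesis unfolding Q_def by blast
  qed
  have "\<exists>g. lin R0 (?T\<lparr>carrier := V\<rparr>) SS g \<and> (\<forall>x\<in>W. g x = f x) \<and> (\<forall>x\<in>Q. g x = \<zero>\<^sub>S)"
    by (rule extend_lin0[OF P.T_gm W V Q WV QV vs(2,1) JQ f f0])
  then obtain g where g: "lin R0 (?T\<lparr>carrier := V\<rparr>) SS g" "\<And>x. x \<in> W \<Longrightarrow> g x = f x" "\<And>x. x \<in> Q \<Longrightarrow> g x = \<zero>\<^sub>S" by blast
  let ?\<Phi> = "\<lambda>y\<in>?N. g (cp ?T ?d y)"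
  have "?\<Phi> \<in> homd (hsub ?T ?N) SS (- ?d)"
    by (rule graded_functional[OF P.T_gm N]) (use g(1,3) in \<open>simp_all add: V_def Q_def\<close>)
  hence "?\<Phi> \<in> homd (hsub ?T ?N) SS m" by simp
  \<comment> \<open>Both sides depend only on the component of \<open>y\<close> in degree -m, where
    \<open>g\<close> extends the map induced by \<open>h\<close>.\<close>
  moreover have "?\<Phi> (P.dif (Suc n) y) = h y" if y: "y \<in> carrier ?U" for y
  proof -
    have yd: "cp ?U ?d y \<in> carrier ?U" using y by (rule U.hcomp_closed)
    have dk: "P.dif (Suc n) y \<in> ?K" by (rule P.d_ker[OF y])
    hence "?\<Phi> (P.dif (Suc n) y) = g (cp ?T ?d (P.dif (Suc n) y))" using min by auto
    also have "cp ?T ?d (P.dif (Suc n) y) = P.dif (Suc n) (cp ?U ?d y)" by (rule Hom_cp[OF P.T_gm P.T_gm P.d_Hom y])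
    also have "P.dif (Suc n) (cp ?U ?d y) \<in> W"
      unfolding W_def using P.d_ker[OF yd] Hom_deg[OF P.d_Hom U.hcomp_spec(1)[OF y]] by blast
    hence "g (P.dif (Suc n) (cp ?U ?d y)) = h (cp ?U ?d y)" using g(2) fd[OF yd] by simp
    also have "\<dots> = cp SS 0 (h y)" using homd_cp[OF P.T_gm SS_gm h y, of 0] by simp
    also have "\<dots> = h y" using SS.hcomp_hom[of "h y" 0 0] hc[OF y] by (simp add: SS_deg)
    finally show ?thesis .
  qed
  ultimately show ?thesis by blast
qed

lemma JX_Jr: "f \<in> carrier RA \<Longrightarrow> f \<in> JX RA (carrier RA) \<Longrightarrow> f \<in> Jr"
  by (rule RA.act_prod_least[OF Jr_sub subset_refl]) (simp_all add: Jr_right Jr_zero Jr_add)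

text \<open>\<open>g\<close> represents the product of the class of \<open>q \<mapsto> \<Phi> (\<theta> (d q) p)\<close>, where \<open>\<theta>\<close> lifts the
  augmentation of \<open>A/J\<close> through \<open>A\<close>, and the class of \<open>\<pi> \<phi>\<close> modulo \<open>J\<close>; the two cocycles differ by the
  coboundary of \<open>u \<mapsto> \<Phi> ((\<theta> (\<lambda>\<^sub>0 u) - \<pi> (\<phi> u)) p)\<close>.\<close>

lemma coefficient_product:
  fixes M :: "('a, 'm) graded_module" and F :: "('a, 'f) graded_module"
  assumes M: "ext_source A M" and F: "gm F" and \<phi>: "\<phi> \<in> uHom A (res_term A M n) F"
    and \<phi>d: "\<And>x. x \<in> carrier (res_term A M (Suc n)) \<Longrightarrow> \<phi> (res_diff (proj_res A M) (Suc n) x) \<in> JX F (carrier F)"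
    and \<Phi>: "\<Phi> \<in> homd (hsub F (JX F (carrier F))) SS m" and \<pi>: "\<pi> \<in> homd F RA r" and p: "p \<in> mdeg F s"
  defines "g \<equiv> \<lambda>x\<in>carrier (res_term A M (Suc n)). \<Phi> (\<pi> (\<phi> (res_diff (proj_res A M) (Suc n) x)) \<odot>\<^bsub>F\<^esub> p)"
  shows "g \<in> cocycles A (Suc n) M SS" "ext_class A (Suc n) M SS g \<in> Ext_product A 1 n M SS SS"
proof -
  have S: "ext_source A SS" by (rule nice_ext_source[OF SS_nice])
  interpret X: ext_source A M by (rule M)
  interpret yon A M SS SS by (rule yonI[OF M S SS_gm])
  interpret F: graded_module A F by (rule F)
  interpret SS: graded_module A SS by (rule SS_gm)
  let ?N = "JX F (carrier F)"
  have N: "gsub F ?N" by (rule JX_gsub[OF F gsub_carrier[OF F]])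
  have NF: "gm (hsub F ?N)" by (rule hsub_gm(1)[OF F N])
  have JR: "gm (hsub RA Jr)" by (rule hsub_gm(1)[OF RA_gm Jr_gsub])
  have pc: "p \<in> carrier F" by (rule F.V_closed[OF p])
  note \<Phi>L = homd_lin[OF \<Phi>]
  have jp: "j \<odot>\<^bsub>F\<^esub> p \<in> ?N" if "j \<in> Jr" for j by (rule F.act_prod_prod[OF Jr_sub subset_refl that pc])
  \<comment> \<open>The restriction of \<open>\<Phi>\<close> to the multiples j p with j in J,
    regarded as a map on J itself; from here on the argument concerns maps with values in J.\<close>
  define \<Psi> where "\<Psi> = (\<lambda>j\<in>Jr. \<Phi> (j \<odot>\<^bsub>F\<^esub> p))"
  have \<Psi>: "\<Psi> \<in> homd (hsub RA Jr) SS (s + m)"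
    unfolding \<Psi>_def
  proof (rule homdI[where X = "hsub RA Jr", unfolded hsub_simps, OF JR])
    show "lin A (hsub RA Jr) SS (\<lambda>j. \<Phi> (j \<odot>\<^bsub>F\<^esub> p))"
    proof (rule linI)
      show "\<Phi> (j \<odot>\<^bsub>F\<^esub> p) \<in> carrier SS" if "j \<in> carrier (hsub RA Jr)" for j
        using lin_closed[OF \<Phi>L, of "j \<odot>\<^bsub>F\<^esub> p"] jp that by simp
      show "\<Phi> ((i \<oplus>\<^bsub>hsub RA Jr\<^esub> j) \<odot>\<^bsub>F\<^esub> p) = \<Phi> (i \<odot>\<^bsub>F\<^esub> p) \<oplus>\<^bsub>SS\<^esub> \<Phi> (j \<odot>\<^bsub>F\<^esub> p)"
        if "i \<in> carrier (hsub RA Jr)" "j \<in> carrier (hsub RA Jr)" for i j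
        using lin_add[OF \<Phi>L, of "i \<odot>\<^bsub>F\<^esub> p" "j \<odot>\<^bsub>F\<^esub> p"] jp that pc by (simp add: F.smult_l_distr Jr_closed)
      show "\<Phi> ((a \<odot>\<^bsub>hsub RA Jr\<^esub> j) \<odot>\<^bsub>F\<^esub> p) = a \<odot>\<^bsub>SS\<^esub> \<Phi> (j \<odot>\<^bsub>F\<^esub> p)"
        if "a \<in> carrier A" "j \<in> carrier (hsub RA Jr)" for a j
        using lin_smult[OF \<Phi>L, of a "j \<odot>\<^bsub>F\<^esub> p"] jp that pc by (simp add: F.smult_assoc Jr_closed)
    qed
    show "\<Phi> (j \<odot>\<^bsub>F\<^esub> p) \<in> mdeg SS (i + (s + m))" if "j \<in> mdeg RA i \<inter> Jr" for i j
    proof -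
      have "j \<odot>\<^bsub>F\<^esub> p \<in> mdeg (hsub F ?N) (i + s)" using smult_degree'[OF F _ p, of j i] that jp by simp
      from homd_deg[OF \<Phi> this] show ?thesis by (simp only: add.assoc)
    qed
  qed
  note \<Psi>u = homd_uHom[OF JR SS_gm \<Psi>]
  note \<Psi>L = homd_lin[OF \<Psi>]
  have \<Psi>0: "\<Psi> \<zero> = \<zero>\<^sub>S" using lin_zero[OF \<Psi>L gm_group[OF JR] SS_group] by simp
  have comp\<Psi>: "(\<lambda>x\<in>carrier V. \<Psi> (f x)) \<in> uHom A V SS"
    if V: "gm V" and f: "f \<in> uHom A V RA" and fJ: "\<And>x. x \<in> carrier V \<Longrightarrow> f x \<in> Jr" for V :: "('a, 'v) graded_module" and f
    by (rule uHom_comp[OF V JR SS_gm uHom_restrict[OF V RA_gm Jr_gsub f fJ] \<Psi>u])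
  obtain \<theta> where \<theta>: "\<theta> \<in> Hom_Gr A (Y.T 0) RA" "\<And>x. x \<in> carrier (Y.T 0) \<Longrightarrow> cls (\<theta> x) = Y.aug x"
  proof -
    have "(\<lambda>a\<in>carrier A. cls a) ` carrier RA = carrier SS" unfolding SS_simps by auto
    hence "\<exists>h\<in>Hom_Gr A (Y.T 0) RA. \<forall>x\<in>carrier (Y.T 0). (\<lambda>a\<in>carrier A. cls a) (h x) = Y.aug x"
      by (rule Hom_lift[OF Y.T_proj RA_gm SS_gm cls_Hom _ Y.aug_Hom])
    then obtain h where h: "h \<in> Hom_Gr A (Y.T 0) RA" "\<forall>x\<in>carrier (Y.T 0). (\<lambda>a\<in>carrier A. cls a) (h x) = Y.aug x" by (rule bexE)
    have "cls (h x) = Y.aug x" if x: "x \<in> carrier (Y.T 0)" for x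
      using bspec[OF h(2) x] lin_closed[OF Hom_lin[OF h(1)] x] by simp
    thus thesis using that h(1) by blast
  qed
  note \<theta>L = Hom_lin[OF \<theta>(1)] and \<theta>u = Hom_uHom[OF Y.T_gm RA_gm \<theta>(1)]
  have \<theta>c: "\<theta> x \<in> carrier A" if "x \<in> carrier (Y.T 0)" for x using lin_closed[OF \<theta>L that] by simp
  have \<pi>L: "lin A F RA \<pi>" by (rule homd_lin[OF \<pi>])
  have \<pi>c: "\<pi> f \<in> carrier A" if "f \<in> carrier F" for f using lin_closed[OF \<pi>L that] by simp
  have \<pi>J: "\<pi> f \<in> Jr" if f: "f \<in> ?N" for f
  proof -
    have "f \<in> carrier F" using f F.act_prod_closed[OF Jr_sub subset_refl] by blast
    moreover have "\<pi> f \<in> JX RA (carrier RA)"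
      by (rule lin_act_prod[OF \<pi>L gm_left_module[OF F] gm_left_module[OF RA_gm] Jr_sub subset_refl f _ subset_refl]) (rule image_subsetI[OF lin_closed[OF \<pi>L]])
    ultimately show ?thesis using JX_Jr lin_closed[OF \<pi>L] by blast
  qed
  have \<phi>c: "\<phi> x \<in> carrier F" if "x \<in> carrier (X.T n)" for x by (rule uHom_closed[OF X.T_gm F \<phi> that])
  let ?\<pi>\<phi> = "\<lambda>x\<in>carrier (X.T n). \<pi> (\<phi> x)"
  have \<pi>\<phi>: "?\<pi>\<phi> \<in> uHom A (X.T n) RA" by (rule uHom_comp[OF X.T_gm F RA_gm \<phi> homd_uHom[OF F RA_gm \<pi>]])
  have \<pi>\<phi>d: "(\<lambda>x\<in>carrier (X.T (Suc n)). ?\<pi>\<phi> (X.dif (Suc n) x)) \<in> uHom A (X.T (Suc n)) RA"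
    by (rule uHom_comp[OF X.T_gm X.T_gm RA_gm X.d_uHom \<pi>\<phi>])
  have gJ: "\<pi> (\<phi> (X.dif (Suc n) x)) \<in> Jr" if "x \<in> carrier (X.T (Suc n))" for x by (rule \<pi>J[OF \<phi>d[OF that]])
  have g_eq: "g x = \<Psi> (\<pi> (\<phi> (X.dif (Suc n) x)))" if "x \<in> carrier (X.T (Suc n))" for x
    using that gJ[OF that] unfolding g_def \<Psi>_def by simp
  have gu: "g \<in> uHom A (X.T (Suc n)) SS"
  proof -
    have "(\<lambda>x\<in>carrier (X.T (Suc n)). \<Psi> ((\<lambda>x\<in>carrier (X.T (Suc n)). ?\<pi>\<phi> (X.dif (Suc n) x)) x)) \<in> uHom A (X.T (Suc n)) SS"
      by (rule comp\<Psi>[OF X.T_gm \<pi>\<phi>d]) (use gJ in simp)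
    moreover have "g = (\<lambda>x\<in>carrier (X.T (Suc n)). \<Psi> ((\<lambda>x\<in>carrier (X.T (Suc n)). ?\<pi>\<phi> (X.dif (Suc n) x)) x))"
    proof
      show "g x = (\<lambda>x\<in>carrier (X.T (Suc n)). \<Psi> ((\<lambda>x\<in>carrier (X.T (Suc n)). ?\<pi>\<phi> (X.dif (Suc n) x)) x)) x" for x
        using g_eq[of x] unfolding g_def by (cases "x \<in> carrier (X.T (Suc n))") simp_all
    qed
    ultimately show ?thesis by simp
  qed
  have zz: "\<pi> (\<phi> \<zero>\<^bsub>X.T n\<^esub>) = \<zero>"
    using uHom_0[OF X.T_gm F \<phi>] lin_zero[OF \<pi>L gm_group[OF F] RA_group] by simp
  show gZ: "g \<in> XY.Z (Suc n)"
    unfolding XY.Z_iff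
  proof (intro conjI ballI gu)
    fix x assume x: "x \<in> carrier (X.T (Suc (Suc n)))"
    show "g (X.dif (Suc (Suc n)) x) = \<zero>\<^sub>S" using g_eq[OF X.d_closed[OF x]] X.dd[OF x] zz \<Psi>0 by simp
  qed
  \<comment> \<open>Reduction modulo J gives a cocycle: \<open>\<phi>\<close> maps boundaries into J
    F, and \<open>\<pi>\<close> maps J F into J.\<close>
  let ?b = "\<lambda>x\<in>carrier (X.T n). cls (\<pi> (\<phi> x))"
  have b: "?b \<in> XY.Z n"
    unfolding XY.Z_iff
  proof (intro conjI ballI)
    have "(\<lambda>x\<in>carrier (X.T n). (\<lambda>a\<in>carrier A. cls a) (?\<pi>\<phi> x)) \<in> uHom A (X.T n) SS"
      by (rule uHom_comp[OF X.T_gm RA_gm SS_gm \<pi>\<phi> Hom_uHom[OF RA_gm SS_gm cls_Hom]])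
    moreover have "(\<lambda>x\<in>carrier (X.T n). (\<lambda>a\<in>carrier A. cls a) (?\<pi>\<phi> x)) = ?b"
      by (rule restrict_ext) (simp add: \<pi>c \<phi>c)
    ultimately show "?b \<in> uHom A (X.T n) SS" by (simp only:)
    fix x assume x: "x \<in> carrier (X.T (Suc n))"
    show "?b (X.dif (Suc n) x) = \<zero>\<^sub>S" using x gJ[OF x] cls_zero_iff Jr_closed unfolding SS_simps by simp
  qed
  have "\<exists>l. lifts A (proj_res A M) (proj_res A SS) n ?b l" by (rule lift_cocycle[OF b])
  then obtain l where l: "lifts A (proj_res A M) (proj_res A SS) n ?b l" by (rule exE)
  note l0 = liftsD(1)[OF l, of 0, unfolded add_0_right]
  have l0c: "l 0 x \<in> carrier (Y.T 0)" if "x \<in> carrier (X.T n)" for x using liftsD(4)[OF l, of x 0] that by simp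
  have l1c: "l 1 x \<in> carrier (Y.T (Suc 0))" if "x \<in> carrier (X.T (Suc n))" for x using liftsD(4)[OF l, of x 1] that by simp
  have ld: "Y.dif (Suc 0) (l 1 x) = l 0 (X.dif (Suc n) x)" if "x \<in> carrier (X.T (Suc n))" for x using liftsD(3)[OF l, of x 0] that by simp
  have la: "Y.aug (l 0 x) = cls (\<pi> (\<phi> x))" if "x \<in> carrier (X.T n)" for x using liftsD(2)[OF l that] that by simp
  have \<theta>dJ: "\<theta> (Y.dif (Suc 0) q) \<in> Jr" if q: "q \<in> carrier (Y.T (Suc 0))" for q
    using \<theta>(2)[OF Y.d_closed[OF q]] Y.aug_d[OF q] cls_zero_iff[OF \<theta>c[OF Y.d_closed[OF q]]] unfolding SS_simps by simp
  let ?\<theta>d = "\<lambda>q\<in>carrier (Y.T (Suc 0)). \<theta> (Y.dif (Suc 0) q)"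
  let ?a = "\<lambda>q\<in>carrier (Y.T (Suc 0)). \<Psi> (?\<theta>d q)"
  have a: "?a \<in> YZ.Z 1"
    unfolding YZ.Z_iff One_nat_def
  proof (intro conjI ballI)
    show "?a \<in> uHom A (Y.T (Suc 0)) SS"
      by (rule comp\<Psi>[OF Y.T_gm uHom_comp[OF Y.T_gm Y.T_gm RA_gm Y.d_uHom \<theta>u]]) (use \<theta>dJ in simp)
    fix q assume q: "q \<in> carrier (Y.T (Suc (Suc 0)))"
    have "\<theta> \<zero>\<^bsub>Y.T 0\<^esub> = \<zero>" using lin_zero[OF \<theta>L Y.T_group RA_group] by simp
    thus "?a (Y.dif (Suc (Suc 0)) q) = \<zero>\<^sub>S" using Y.d_closed[OF q] Y.dd[OF q] \<Psi>0 by simp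
  qed
  let ?w = "comp n 1 ?a l"
  have prod: "yo 1 n (YZ.cl 1 ?a) (XY.cl n ?b) = XY.cl (n + 1) ?w" by (rule yoneda_cl[OF b a l])
  have wZ: "?w \<in> XY.Z (n + 1)" by (rule comp_Z[OF l a])
  let ?f = "\<lambda>u\<in>carrier (X.T n). \<theta> (l 0 u)" and ?f' = "\<lambda>u\<in>carrier (X.T n). \<ominus> ?\<pi>\<phi> u"
  \<comment> \<open>Both terms represent the same class modulo J, so the difference takes values in
    J and \<open>\<Psi>\<close> can be applied to it.\<close>
  let ?ff = "\<lambda>u\<in>carrier (X.T n). ?f u \<oplus>\<^bsub>RA\<^esub> ?f' u"
  let ?c = "\<lambda>u\<in>carrier (X.T n). \<Psi> (?ff u)"
  have ffJ: "?ff u \<in> Jr" if u: "u \<in> carrier (X.T n)" for u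
  proof -
    have "cls (\<theta> (l 0 u)) = cls (\<pi> (\<phi> u))" using \<theta>(2)[OF l0c[OF u]] la[OF u] by simp
    thus ?thesis using cls_eq_iff[OF \<theta>c[OF l0c[OF u]] \<pi>c[OF \<phi>c[OF u]]] u by (simp add: a_minus_def)
  qed
  have c: "?c \<in> uHom A (X.T n) SS"
  proof (rule comp\<Psi>[OF X.T_gm _ ffJ])
    show "?ff \<in> uHom A (X.T n) RA"
    proof (rule uHom_add[OF X.T_gm RA_gm uHom_comp[OF X.T_gm Y.T_gm RA_gm l0 \<theta>u]])
      show "?f' \<in> uHom A (X.T n) RA" using uHom_neg[OF X.T_gm RA_gm \<pi>\<phi>] unfolding RA_inv .
    qed
  qed
  have "XY.cl (Suc n) ?w = XY.cl (Suc n) g"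
  proof (rule XY.cl_eqI1[OF gZ _ c])
    show "?w \<in> XY.Z (Suc n)" using wZ unfolding Suc_eq_plus1 .
    fix x assume x: "x \<in> carrier (X.T (Suc n))"
    have dx: "X.dif (Suc n) x \<in> carrier (X.T n)" by (rule X.d_closed[OF x])
    have "?w x = \<Psi> (\<theta> (l 0 (X.dif (Suc n) x)))" using x l1c[OF x] ld[OF x] by simp
    also have "\<theta> (l 0 (X.dif (Suc n) x)) = ?ff (X.dif (Suc n) x) \<oplus> \<pi> (\<phi> (X.dif (Suc n) x))"
      using dx \<theta>c[OF l0c[OF dx]] \<pi>c[OF \<phi>c[OF dx]] by (simp add: a_assoc l_neg)
    also have "\<Psi> \<dots> = \<Psi> (?ff (X.dif (Suc n) x)) \<oplus>\<^bsub>SS\<^esub> \<Psi> (\<pi> (\<phi> (X.dif (Suc n) x)))"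
      using lin_add[OF \<Psi>L, of "?ff (X.dif (Suc n) x)" "\<pi> (\<phi> (X.dif (Suc n) x))"] ffJ[OF dx] gJ[OF x] by (simp only: hsub_simps RA_simps)
    also have "\<dots> = ?c (X.dif (Suc n) x) \<oplus>\<^bsub>SS\<^esub> g x" using dx g_eq[OF x] by simp
    finally show "?w x = ?c (X.dif (Suc n) x) \<oplus>\<^bsub>SS\<^esub> g x" .
  qed
  hence "yo 1 n (YZ.cl 1 ?a) (XY.cl n ?b) = XY.cl (Suc n) g" using prod unfolding Suc_eq_plus1 by (simp only:)
  thus "XY.cl (Suc n) g \<in> Ext_product A 1 n M SS SS"
    using Ext_product_yoneda[OF YZ.cl_closed[OF a] XY.cl_closed[OF b]] by (simp only:)
qed

text \<open>The finite index set is the same for all \<open>y\<close>, which turns an expansion of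
  elements into an expansion of maps. A generator of degree above -m contributes nothing, since its
  multiples have no component in degree -m and \<open>\<Phi>\<close> sees no other degree.\<close>

lemma functional_expand:
  fixes K :: "'k set"
  assumes bd: "basis_data K e \<delta>"
    and \<Phi>: "\<Phi> \<in> homd (hsub (fmod A K e \<delta>) (JX (fmod A K e \<delta>) (carrier (fmod A K e \<delta>)))) SS m"
    and y: "y \<in> JX (fmod A K e \<delta>) (carrier (fmod A K e \<delta>))"
  shows "\<Phi> y = (\<Oplus>\<^bsub>SS\<^esub>k\<in>{k \<in> K. \<delta> k \<le> - m}. \<Phi> (y k \<odot>\<^bsub>fmod A K e \<delta>\<^esub> single A k (e k)))"
proof -
  let ?X = "fmod A K e \<delta>"
  let ?N = "JX ?X (carrier ?X)"
  note X = basis_gm[OF bd]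
  interpret X: graded_module A ?X by (rule X)
  interpret SS: graded_module A SS by (rule SS_gm)
  have N: "gsub ?X ?N" by (rule JX_gsub[OF X gsub_carrier[OF X]])
  have NX: "gm (hsub ?X ?N)" by (rule hsub_gm(1)[OF X N])
  have yc: "y \<in> carrier ?X" using y X.act_prod_closed[OF Jr_sub subset_refl] by blast
  note L = homd_lin[OF \<Phi>]
  let ?p = "\<lambda>k. single A k (e k)"
  let ?D = "{k \<in> K. \<delta> k \<le> - m}"
  \<comment> \<open>The support of \<open>y\<close> is added in order to expand \<open>y\<close>;
    the surplus terms are then shown to vanish.\<close>
  define D' where "D' = ?D \<union> {k. y k \<noteq> \<zero>}"
  have D': "finite D'" "D' \<subseteq> K" "{k. y k \<noteq> \<zero>} \<subseteq> D'" "?D \<subseteq> D'"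
    unfolding D'_def using basis_fin[OF bd] basis_support[OF bd yc] basis_out[OF bd yc] by auto
  have ev: "lin A ?X RA (\<lambda>f. f k)" for k by (rule fmod_eval_lin) (rule basis_e[OF bd])
  have yJ: "y k \<in> Jr" for k
  proof (rule JX_Jr)
    show "y k \<in> carrier RA" using basis_coeff[OF bd yc] by simp
    show "y k \<in> JX RA (carrier RA)"
      by (rule lin_act_prod[OF ev gm_left_module[OF X] gm_left_module[OF RA_gm] Jr_sub subset_refl y _ subset_refl]) (rule image_subsetI[OF lin_closed[OF ev]])
  qed
  have tN: "y k \<odot>\<^bsub>?X\<^esub> ?p k \<in> ?N" if "k \<in> K" for k
    by (rule X.act_prod_prod[OF Jr_sub subset_refl yJ basis_gen[OF bd that]])
  have "y = lincomb A ?X ?p y" by (rule basis_expand[OF bd yc, symmetric])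
  also have "\<dots> = (\<Oplus>\<^bsub>?X\<^esub>k\<in>D'. y k \<odot>\<^bsub>?X\<^esub> ?p k)"
    by (rule lincomb_superset[where K=K and e=e and d=\<delta>, OF basis_e[OF bd] X basis_gen[OF bd] yc D'(1,3,2)])
  also have "\<dots> = (\<Oplus>\<^bsub>hsub ?X ?N\<^esub>k\<in>D'. y k \<odot>\<^bsub>?X\<^esub> ?p k)"
    by (rule hsub_finsum[OF X N D'(1), symmetric]) (use tN D'(2) in blast)
  finally have "\<Phi> y = \<Phi> (\<Oplus>\<^bsub>hsub ?X ?N\<^esub>k\<in>D'. y k \<odot>\<^bsub>?X\<^esub> ?p k)" by (rule arg_cong)
  also have "\<dots> = (\<Oplus>\<^bsub>SS\<^esub>k\<in>D'. \<Phi> (y k \<odot>\<^bsub>?X\<^esub> ?p k))"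
    by (rule lin_finsum[OF L gm_group[OF NX] SS_group D'(1)]) (use tN D'(2) in auto)
  also have "\<dots> = (\<Oplus>\<^bsub>SS\<^esub>k\<in>?D. \<Phi> (y k \<odot>\<^bsub>?X\<^esub> ?p k))"
  proof (rule SS.M.add.finprod_mono_neutral_cong_right[OF D'(1,4)])
    show "(\<lambda>k. \<Phi> (y k \<odot>\<^bsub>?X\<^esub> ?p k)) \<in> D' \<rightarrow> carrier SS" using lin_closed[OF L] tN D'(2) by auto
    fix k assume "k \<in> D' - ?D"
    hence k: "k \<in> K" "\<not> \<delta> k \<le> - m" using D'(2) by auto
    let ?t = "y k \<odot>\<^bsub>?X\<^esub> ?p k"
    have tc: "?t \<in> carrier ?X" using tN[OF k(1)] X.act_prod_closed[OF Jr_sub subset_refl] by blast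
    have "cp ?X (- m) ?t = \<zero>\<^bsub>?X\<^esub>"
      unfolding basis_cp[OF bd tc] unfolding basis_simps[OF bd]
    proof (rule ext)
      fix j
      show "cp RA (- m - \<delta> j) (y k \<otimes> single A k (e k) j) = \<zero>"
      proof (cases "j = k")
        case True
        have "cp RA (- m - \<delta> j) (y k \<otimes> single A k (e k) j) \<in> mdeg RA (- m - \<delta> j)"
          by (rule cp_RA_in) (use True basis_coeff[OF bd yc] A0_closed[OF basis_e[OF bd k(1)]] in \<open>simp add: single_def\<close>)
        thus ?thesis using k(2) True by (simp add: RA_mdeg)
      next
        case False
        thus ?thesis using basis_coeff[OF bd yc] by (simp add: single_def)
      qed
    qed
    moreover have "\<Phi> (cp ?X (- m) ?t) = cp SS 0 (\<Phi> ?t)"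
      using homd_cp[OF NX SS_gm \<Phi>, of ?t 0] hsub_gm(2)[OF X N tN[OF k(1)]] tN[OF k(1)] by simp
    moreover have "\<Phi> ?t \<in> carrier SS" using lin_closed[OF L] tN[OF k(1)] by simp
    hence "cp SS 0 (\<Phi> ?t) = \<Phi> ?t" using SS.hcomp_hom[of "\<Phi> ?t" 0 0] by (simp add: SS_deg)
    moreover have "\<Phi> \<zero>\<^bsub>?X\<^esub> = \<zero>\<^sub>S" using lin_zero[OF L gm_group[OF NX] SS_group] by simp
    ultimately show "\<Phi> ?t = \<zero>\<^sub>S" by simp
  qed simp
  finally show ?thesis .
qed

lemma Ext_product_sums: "Ext_product A 1 n M SS SS = finite_sums (Ext A (Suc n) M SS)
    {yoneda A 1 n M SS SS \<alpha> \<beta> | \<alpha> \<beta>. \<alpha> \<in> carrier (Ext A 1 SS SS) \<and> \<beta> \<in> carrier (Ext A n M SS)}"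
  unfolding Ext_product_def Suc_eq_plus1 by (rule refl)

lemma products_Ext:
  assumes "ext_source A M"
  shows "{yoneda A 1 n M SS SS \<alpha> \<beta> | \<alpha> \<beta>. \<alpha> \<in> carrier (Ext A 1 SS SS) \<and> \<beta> \<in> carrier (Ext A n M SS)} \<subseteq> carrier (Ext A (Suc n) M SS)"
proof -
  interpret yon A M SS SS by (rule yonI[OF assms nice_ext_source[OF SS_nice] SS_gm])
  show ?thesis using products_closed[where j = 1 and i = n] unfolding Suc_eq_plus1 .
qed

text \<open>The extension to J P_n exists on \<open>P\<close>, whereas Ext lives on
  \<open>proj_res\<close>; the pullback along \<phi> joins the two, and
  \<open>functional_expand\<close> leaves one term per generator for
  \<open>coefficient_product\<close>.\<close>

lemma homogeneous_cocycle_product: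
  fixes K :: "'k set" and M :: "('a, 'm) graded_module" and P :: "('a, 'm, 'k \<Rightarrow> 'a) resolution"
  assumes M: "ext_source A M" and P: "gp_resolution A M P"
    and bd: "basis_data K e \<delta>" and Tn: "res_mod P n = fmod A K e \<delta>"
    and min: "res_ker M P n \<subseteq> JX (res_mod P n) (carrier (res_mod P n))" and QK: "QK M P"
    and \<phi>: "\<And>n. \<phi> n \<in> uHom A (res_term A M n) (res_mod P n)"
    and d\<phi>: "\<And>x. x \<in> carrier (res_term A M (Suc n)) \<Longrightarrow> res_diff P (Suc n) (\<phi> (Suc n) x) = \<phi> n (res_diff (proj_res A M) (Suc n) x)"
    and h: "h \<in> homd (res_mod P (Suc n)) SS m"
    and hd: "\<And>x. x \<in> carrier (res_mod P (Suc (Suc n))) \<Longrightarrow> h (res_diff P (Suc (Suc n)) x) = \<zero>\<^sub>S"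
  shows "(\<lambda>x\<in>carrier (res_term A M (Suc n)). h (\<phi> (Suc n) x)) \<in> cocycles A (Suc n) M SS \<and>
    ext_class A (Suc n) M SS (\<lambda>x\<in>carrier (res_term A M (Suc n)). h (\<phi> (Suc n) x)) \<in> Ext_product A 1 n M SS SS"
proof -
  interpret X: ext_source A M by (rule M)
  interpret P: gp_resolution A M P by (rule P)
  interpret ext_pair A M SS by (rule ext_pairI[OF M SS_gm])
  let ?F = "fmod A K e \<delta>"
  let ?N = "JX ?F (carrier ?F)"
  note F = basis_gm[OF bd]
  have "\<exists>\<Phi>\<in>homd (hsub (P.T n) (JX (P.T n) (carrier (P.T n)))) SS m. \<forall>y\<in>carrier (P.T (Suc n)). \<Phi> (P.dif (Suc n) y) = h y"
  proof (rule cocycle_extension[where h = h, OF P _ min _ h hd])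
    show "nice (P.T n)" unfolding Tn by (rule basis_nice[OF bd])
    show "res_ker M P n \<inter> act_prod (P.T n) JJ (carrier (P.T n)) \<subseteq> JX (P.T n) (res_ker M P n)" using QK unfolding QK_def by blast
  qed
  then obtain \<Phi> where \<Phi>: "\<Phi> \<in> homd (hsub ?F ?N) SS m" "\<forall>y\<in>carrier (P.T (Suc n)). \<Phi> (P.dif (Suc n) y) = h y"
    unfolding Tn by (rule bexE)
  have \<phi>c: "\<phi> n x \<in> carrier (P.T n)" if "x \<in> carrier (X.T n)" for x n by (rule uHom_closed[OF X.T_gm P.T_gm \<phi> that])
  have \<phi>d: "\<phi> n (X.dif (Suc n) x) \<in> ?N" if x: "x \<in> carrier (X.T (Suc n))" for x
    using subsetD[OF min P.d_ker[OF \<phi>c[OF x]]] unfolding d\<phi>[OF x] Tn .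
  have \<phi>n: "\<phi> n \<in> uHom A (X.T n) ?F" using \<phi>[of n] unfolding Tn .
  let ?D = "{k \<in> K. \<delta> k \<le> - m}"
  define g where "g k = (\<lambda>x\<in>carrier (X.T (Suc n)). \<Phi> ((\<lambda>f\<in>carrier ?F. f k) (\<phi> n (X.dif (Suc n) x)) \<odot>\<^bsub>?F\<^esub> single A k (e k)))" for k
  have g: "g k \<in> Z (Suc n)" "cl (Suc n) (g k) \<in> Ext_product A 1 n M SS SS" if k: "k \<in> ?D" for k
  proof -
    have kK: "k \<in> K" using k by simp
    have \<pi>: "(\<lambda>f\<in>carrier ?F. f k) \<in> homd ?F RA (- \<delta> k)"
    proof (rule homdI[OF F])
      show "lin A ?F RA (\<lambda>f. f k)" by (rule fmod_eval_lin) (rule basis_e[OF bd])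
      show "f k \<in> mdeg RA (i + - \<delta> k)" if "f \<in> mdeg ?F i" for i f using that unfolding basis_mdeg[OF bd] by simp
    qed
    have p: "single A k (e k) \<in> mdeg ?F (0 + \<delta> k)" by (rule basis_single_deg[OF bd kK basis_e[OF bd kK] basis_idem[OF bd kK]])
    show "g k \<in> Z (Suc n)" "cl (Suc n) (g k) \<in> Ext_product A 1 n M SS SS"
      unfolding g_def by (rule coefficient_product[OF M F \<phi>n \<phi>d \<Phi>(1) \<pi> p], assumption)+
  qed
  have "(\<lambda>x\<in>carrier (X.T (Suc n)). \<Oplus>\<^bsub>SS\<^esub>k\<in>?D. g k x) \<in> Z (Suc n) \<and>
    cl (Suc n) (\<lambda>x\<in>carrier (X.T (Suc n)). \<Oplus>\<^bsub>SS\<^esub>k\<in>?D. g k x) \<in> Ext_product A 1 n M SS SS"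
    unfolding Ext_product_sums
    by (rule cl_finsum[OF products_Ext[OF M] basis_fin[OF bd] g(1) g(2)[unfolded Ext_product_sums]])
  moreover have "(\<lambda>x\<in>carrier (X.T (Suc n)). \<Oplus>\<^bsub>SS\<^esub>k\<in>?D. g k x) = (\<lambda>x\<in>carrier (X.T (Suc n)). h (\<phi> (Suc n) x))"
  proof (rule restrict_ext)
    fix x assume x: "x \<in> carrier (X.T (Suc n))"
    have c: "\<phi> n (X.dif (Suc n) x) \<in> carrier ?F" using \<phi>c[OF X.d_closed[OF x]] unfolding Tn .
    have "h (\<phi> (Suc n) x) = \<Phi> (\<phi> n (X.dif (Suc n) x))" using bspec[OF \<Phi>(2) \<phi>c[OF x]] unfolding d\<phi>[OF x] by simp
    also have "\<dots> = (\<Oplus>\<^bsub>SS\<^esub>k\<in>?D. \<Phi> (\<phi> n (X.dif (Suc n) x) k \<odot>\<^bsub>?F\<^esub> single A k (e k)))"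
      by (rule functional_expand[OF bd \<Phi>(1) \<phi>d[OF x]])
    also have "\<dots> = (\<Oplus>\<^bsub>SS\<^esub>k\<in>?D. g k x)" unfolding g_def using x c by simp
    finally show "(\<Oplus>\<^bsub>SS\<^esub>k\<in>?D. g k x) = h (\<phi> (Suc n) x)" by (rule sym)
  qed
  ultimately show ?thesis by (simp only:)
qed

text \<open>A cocycle \<gamma> on \<open>proj_res\<close> becomes \<gamma> \<psi> on
  \<open>P\<close>, is split into homogeneous parts there and comes back through \<phi>; \<gamma>
  \<psi> \<phi> and \<gamma> are cohomologous by the homotopy.\<close>

lemma QK_imp_products:
  fixes M :: "('a, 'm) graded_module" and P :: "('a, 'm, 'k \<Rightarrow> 'a) resolution"
  assumes M: "ext_source A M" and P: "gp_resolution A M P"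
    and bd: "\<exists>K e \<delta>. basis_data K e \<delta> \<and> res_mod P n = fmod A (K :: 'k set) e \<delta>"
    and min: "res_ker M P n \<subseteq> JX (res_mod P n) (carrier (res_mod P n))" and QK: "QK M P"
  shows "carrier (Ext A (Suc n) M SS) \<subseteq> Ext_product A 1 n M SS SS"
proof
  interpret X: ext_source A M by (rule M)
  interpret P: gp_resolution A M P by (rule P)
  interpret ext_pair A M SS by (rule ext_pairI[OF M SS_gm])
  interpret SS: graded_module A SS by (rule SS_gm)
  fix \<alpha> assume "\<alpha> \<in> carrier (E (Suc n))"
  then obtain \<gamma> where \<gamma>: "\<gamma> \<in> Z (Suc n)" "\<alpha> = cl (Suc n) \<gamma>" by (rule E_cases)
  obtain \<phi> \<psi> h where c: "\<And>n. \<phi> n \<in> uHom A (X.T n) (P.T n)" "\<And>n. \<psi> n \<in> uHom A (P.T n) (X.T n)"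
    "\<And>n x. x \<in> carrier (X.T (Suc n)) \<Longrightarrow> P.dif (Suc n) (\<phi> (Suc n) x) = \<phi> n (X.dif (Suc n) x)"
    "\<And>n x. x \<in> carrier (P.T (Suc n)) \<Longrightarrow> X.dif (Suc n) (\<psi> (Suc n) x) = \<psi> n (P.dif (Suc n) x)"
    "\<And>n. h n \<in> uHom A (X.T n) (X.T (Suc n))"
    "\<And>n x. x \<in> carrier (X.T (Suc n)) \<Longrightarrow> \<psi> (Suc n) (\<phi> (Suc n) x) =
      x \<oplus>\<^bsub>X.T (Suc n)\<^esub> (X.dif (Suc (Suc n)) (h (Suc n) x) \<oplus>\<^bsub>X.T (Suc n)\<^esub> h n (X.dif (Suc n) x))"
    by (rule comparison[OF X.gp_resolution_axioms P]) (rule that)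
  have \<phi>c: "\<phi> n x \<in> carrier (P.T n)" if "x \<in> carrier (X.T n)" for x n by (rule uHom_closed[OF X.T_gm P.T_gm c(1) that])
  have \<psi>c: "\<psi> n x \<in> carrier (X.T n)" if "x \<in> carrier (P.T n)" for x n by (rule uHom_closed[OF P.T_gm X.T_gm c(2) that])
  have hc: "h n x \<in> carrier (X.T (Suc n))" if "x \<in> carrier (X.T n)" for x n by (rule uHom_closed[OF X.T_gm X.T_gm c(5) that])
  note \<gamma>u = Z_uHom[OF \<gamma>(1)]
  note \<gamma>L = uHom_lin[OF X.T_gm SS_gm \<gamma>u]
  let ?g = "\<lambda>z\<in>carrier (P.T (Suc n)). \<gamma> (\<psi> (Suc n) z)"
  have gu: "?g \<in> uHom A (P.T (Suc n)) SS" by (rule uHom_comp[OF P.T_gm X.T_gm SS_gm c(2) \<gamma>u])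
  have gd: "?g (P.dif (Suc (Suc n)) x) = \<zero>\<^sub>S" if x: "x \<in> carrier (P.T (Suc (Suc n)))" for x
    using P.d_closed[OF x] c(4)[OF x] Z_d[OF \<gamma>(1) \<psi>c[OF x]] by simp
  obtain D k where D: "finite D" "\<And>m. m \<in> D \<Longrightarrow> k m \<in> homd (P.T (Suc n)) SS m" "?g = (\<lambda>x\<in>carrier (P.T (Suc n)). \<Oplus>\<^bsub>SS\<^esub> m\<in>D. k m x)"
    "\<And>m i x. \<lbrakk>m \<in> D; x \<in> mdeg (P.T (Suc n)) i\<rbrakk> \<Longrightarrow> k m x = cp SS (i + m) (?g x)"
    by (rule uHom_decomp[OF P.T_gm SS_gm gu]) (rule that)
  \<comment> \<open>Homogeneous parts of a cocycle are cocycles, because the differential preserves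
    degrees.\<close>
  have kd: "k m (P.dif (Suc (Suc n)) x) = \<zero>\<^sub>S" if m: "m \<in> D" and x: "x \<in> carrier (P.T (Suc (Suc n)))" for m x
  proof -
    interpret T: graded_module A "P.T (Suc (Suc n))" by (rule P.T_gm)
    note kL = homd_lin[OF D(2)[OF m]] and dL = Hom_lin[OF P.d_Hom[of "Suc n"]]
    show ?thesis using x
    proof (induction rule: T.homogeneous_induct)
      case zero
      show ?case using lin_zero[OF dL P.T_group P.T_group] lin_zero[OF kL P.T_group SS_group] by simp
    next
      case (step i u y)
      have "k m (P.dif (Suc (Suc n)) u) = \<zero>\<^sub>S"
        unfolding D(4)[OF m Hom_deg[OF P.d_Hom step(1)]] gd[OF step(2)] by simp
      thus ?case unfolding lin_add[OF dL step(2,3)] lin_add[OF kL P.d_closed[OF step(2)] P.d_closed[OF step(3)]] using step(5) by simp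
    qed
  qed
  let ?G = "\<lambda>m. \<lambda>x\<in>carrier (X.T (Suc n)). k m (\<phi> (Suc n) x)"
  obtain K e \<delta> where K: "basis_data K e \<delta>" "res_mod P n = fmod A (K :: 'k set) e \<delta>" using bd by blast
  have G: "?G m \<in> Z (Suc n) \<and> cl (Suc n) (?G m) \<in> Ext_product A 1 n M SS SS" if m: "m \<in> D" for m
    by (rule homogeneous_cocycle_product[OF M P K min QK c(1,3) D(2)[OF m] kd[OF m]])
  let ?\<Gamma> = "\<lambda>x\<in>carrier (X.T (Suc n)). \<Oplus>\<^bsub>SS\<^esub>m\<in>D. ?G m x"
  have \<Gamma>: "?\<Gamma> \<in> Z (Suc n) \<and> cl (Suc n) ?\<Gamma> \<in> Ext_product A 1 n M SS SS"
    unfolding Ext_product_sums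
    by (rule cl_finsum[OF products_Ext[OF M] D(1) conjunct1[OF G] conjunct2[OF G, unfolded Ext_product_sums]])
  let ?b = "\<lambda>u\<in>carrier (X.T n). \<gamma> (h n u)"
  have "cl (Suc n) ?\<Gamma> = cl (Suc n) \<gamma>"
  proof (rule cl_eqI1[OF \<gamma>(1) conjunct1[OF \<Gamma>] uHom_comp[OF X.T_gm X.T_gm SS_gm c(5) \<gamma>u]])
    fix x assume x: "x \<in> carrier (X.T (Suc n))"
    interpret T: graded_module A "X.T (Suc n)" by (rule X.T_gm)
    have dx: "X.dif (Suc n) x \<in> carrier (X.T n)" by (rule X.d_closed[OF x])
    let ?u = "X.dif (Suc (Suc n)) (h (Suc n) x)" and ?v = "h n (X.dif (Suc n) x)"
    have uv: "?u \<in> carrier (X.T (Suc n))" "?v \<in> carrier (X.T (Suc n))" by (rule X.d_closed[OF hc[OF x]], rule hc[OF dx])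
    have "?\<Gamma> x = ?g (\<phi> (Suc n) x)" unfolding D(3) using x \<phi>c[OF x] by simp
    also have "\<dots> = \<gamma> (x \<oplus>\<^bsub>X.T (Suc n)\<^esub> (?u \<oplus>\<^bsub>X.T (Suc n)\<^esub> ?v))" using \<phi>c[OF x] c(6)[OF x] by simp
    also have "\<dots> = \<gamma> x \<oplus>\<^bsub>SS\<^esub> (\<gamma> ?u \<oplus>\<^bsub>SS\<^esub> \<gamma> ?v)"
      unfolding lin_add[OF \<gamma>L x T.M.a_closed[OF uv]] lin_add[OF \<gamma>L uv] by (rule refl)
    also have "\<dots> = ?b (X.dif (Suc n) x) \<oplus>\<^bsub>SS\<^esub> \<gamma> x"
      using Z_d[OF \<gamma>(1) hc[OF x]] dx lin_closed[OF \<gamma>L x] lin_closed[OF \<gamma>L uv(2)] by (simp add: SS.M.a_comm)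
    finally show "?\<Gamma> x = ?b (X.dif (Suc n) x) \<oplus>\<^bsub>SS\<^esub> \<gamma> x" .
  qed
  thus "\<alpha> \<in> Ext_product A 1 n M SS SS" using conjunct2[OF \<Gamma>] unfolding \<gamma>(2) by (simp only:)
qed

section \<open>Products detect the quasi-Koszul property\<close>

text \<open>A product \<open>a \<lambda>\<^sub>1\<close> vanishes at \<open>y\<close> because \<open>\<lambda>\<^sub>0 (d y) \<in> J\<^sup>2 Q\<^sub>0 \<subseteq> J ker aug\<close> for the resolution
  \<open>Q\<close> of \<open>A/J\<close>, so that \<open>\<lambda>\<^sub>1 y \<in> J Q\<^sub>1 + im d\<^sub>2\<close>.\<close>

lemma products_vanish:
  assumes M: "ext_source A M" and \<alpha>: "\<alpha> \<in> Ext_product A 1 n M SS SS"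
    and \<gamma>: "\<gamma> \<in> cocycles A (Suc n) M SS" "\<alpha> = ext_class A (Suc n) M SS \<gamma>"
    and y: "y \<in> carrier (res_term A M (Suc n))"
    and dy: "res_diff (proj_res A M) (Suc n) y \<in> JX (res_term A M n) (JX (res_term A M n) (carrier (res_term A M n)))"
  shows "\<gamma> y = \<zero>\<^sub>S"
proof -
  have S: "ext_source A SS" by (rule nice_ext_source[OF SS_nice])
  interpret X: ext_source A M by (rule M)
  interpret yon A M SS SS by (rule yonI[OF M S SS_gm])
  interpret SS: graded_module A SS by (rule SS_gm)
  interpret T: graded_module A "X.T n" by (rule X.T_gm)
  interpret Q: graded_module A "Y.T 0" by (rule Y.T_gm)
  interpret Q1: graded_module A "Y.T (Suc 0)" by (rule Y.T_gm)
  interpret E: comm_group "XY.E (Suc n)" by (rule XY.E_group)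
  have dyc: "X.dif (Suc n) y \<in> carrier (X.T n)" by (rule X.d_closed[OF y])
  have JT: "JX (X.T n) (carrier (X.T n)) \<subseteq> carrier (X.T n)" by (rule T.act_prod_closed[OF Jr_sub subset_refl])
  have dyJ: "X.dif (Suc n) y \<in> JX (X.T n) (carrier (X.T n))" using dy JX_mono[OF X.T_gm JT subset_refl] by blast
  \<comment> \<open>The value at \<open>y\<close> depends only on the cohomology class: a coboundary
    b d takes the value b (d y), which is zero because d y lies in J times the module.\<close>
  have rep: "\<gamma>' y = \<zero>\<^sub>S" if r: "\<gamma>' \<in> XY.Z (Suc n)" "g \<in> XY.Z (Suc n)" "XY.cl (Suc n) \<gamma>' = XY.cl (Suc n) g" "g y = \<zero>\<^sub>S" for \<gamma>' g
  proof -
    obtain b where b: "b \<in> uHom A (X.T n) SS" "\<And>x. x \<in> carrier (X.T (Suc n)) \<Longrightarrow> \<gamma>' x = b (X.dif (Suc n) x) \<oplus>\<^bsub>SS\<^esub> g x"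
      by (rule XY.cl_eqD1[OF r(2,1,3)]) (rule that)
    have "b (X.dif (Suc n) y) = \<zero>\<^sub>S" by (rule to_SS_radical[OF X.T_gm uHom_lin[OF X.T_gm SS_gm b(1)] dyJ])
    thus ?thesis using b(2)[OF y] r(4) by simp
  qed
  have "\<forall>\<gamma>\<in>XY.Z (Suc n). \<alpha> = XY.cl (Suc n) \<gamma> \<longrightarrow> \<gamma> y = \<zero>\<^sub>S"
    using \<alpha> unfolding Ext_product_sums
  proof (induction rule: E.finite_sums_induct[OF _ products_Ext[OF M], consumes 1, case_names one step])
    case one
    show ?case
    proof (intro ballI impI)
      fix \<gamma> assume \<gamma>: "\<gamma> \<in> XY.Z (Suc n)" "\<one>\<^bsub>XY.E (Suc n)\<^esub> = XY.cl (Suc n) \<gamma>"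
      show "\<gamma> y = \<zero>\<^sub>S" by (rule rep[OF \<gamma>(1) XY.nul_Z]) (use \<gamma>(2) XY.cl_nul y in simp_all)
    qed
  next
    case (step s t)
    obtain \<alpha>' \<beta>' where s: "s = yo 1 n \<alpha>' \<beta>'" "\<alpha>' \<in> carrier (YZ.E 1)" "\<beta>' \<in> carrier (XY.E n)" using step(1) by blast
    obtain a where a: "a \<in> YZ.Z 1" "\<alpha>' = YZ.cl 1 a" using s(2) by (rule YZ.E_cases)
    obtain b where b: "b \<in> XY.Z n" "\<beta>' = XY.cl n b" using s(3) by (rule XY.E_cases)
    have "\<exists>l. lifts A (proj_res A M) (proj_res A SS) n b l" by (rule lift_cocycle[OF b(1)])
    then obtain l where l: "lifts A (proj_res A M) (proj_res A SS) n b l" by (rule exE)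
    let ?w = "comp n 1 a l"
    have sw: "s = XY.cl (Suc n) ?w" using yoneda_cl[OF b(1) a(1) l] unfolding s(1) a(2) b(2) Suc_eq_plus1 .
    have wZ: "?w \<in> XY.Z (Suc n)" using comp_Z[OF l a(1)] unfolding Suc_eq_plus1 .
    have au: "a \<in> uHom A (Y.T (Suc 0)) SS" "\<And>q. q \<in> carrier (Y.T (Suc (Suc 0))) \<Longrightarrow> a (Y.dif (Suc (Suc 0)) q) = \<zero>\<^sub>S"
      using a(1) unfolding YZ.Z_iff One_nat_def by simp_all
    note aL = uHom_lin[OF Y.T_gm SS_gm au(1)]
    have w0: "?w y = \<zero>\<^sub>S"
    proof -
      have l0: "l 0 \<in> uHom A (X.T n) (Y.T 0)" using liftsD(1)[OF l, of 0] by simp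
      have ly: "l 1 y \<in> carrier (Y.T (Suc 0))" using liftsD(4)[OF l, of y 1] y by simp
      have ld: "Y.dif (Suc 0) (l 1 y) = l 0 (X.dif (Suc n) y)" using liftsD(3)[OF l, of y 0] y by simp
      have "l 0 z \<in> JX (Y.T 0) (carrier (Y.T 0))" if z: "z \<in> JX (X.T n) (carrier (X.T n))" for z
        by (rule uHom_act_prod[OF X.T_gm Y.T_gm l0 Jr_sub subset_refl subset_refl uHom_closed[OF X.T_gm Y.T_gm l0] z])
      moreover have "JX (Y.T 0) (carrier (Y.T 0)) \<subseteq> res_ker SS (proj_res A SS) 0"
      proof
        fix q assume q: "q \<in> JX (Y.T 0) (carrier (Y.T 0))"
        thus "q \<in> res_ker SS (proj_res A SS) 0"
          unfolding res_ker_0 using Q.act_prod_closed[OF Jr_sub subset_refl] to_SS_radical[OF Y.T_gm Hom_lin[OF Y.aug_Hom] q] by auto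
      qed
      ultimately have lk: "l 0 z \<in> res_ker SS (proj_res A SS) 0" if "z \<in> JX (X.T n) (carrier (X.T n))" for z using that by blast
      have "l 0 (X.dif (Suc n) y) \<in> JX (Y.T 0) (res_ker SS (proj_res A SS) 0)"
        by (rule uHom_act_prod[OF X.T_gm Y.T_gm l0 Jr_sub JT res_ker_sub lk dy])
      hence "\<exists>q\<in>JX (Y.T (Suc 0)) (carrier (Y.T (Suc 0))). Y.dif (Suc 0) q = l 0 (X.dif (Suc n) y)" by (rule JX_lift[OF Y.gp_resolution_axioms])
      then obtain q where q: "q \<in> JX (Y.T (Suc 0)) (carrier (Y.T (Suc 0)))" "Y.dif (Suc 0) q = l 0 (X.dif (Suc n) y)" by (rule bexE)
      have qc: "q \<in> carrier (Y.T (Suc 0))" using q(1) Q1.act_prod_closed[OF Jr_sub subset_refl] by blast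
      note dL = Hom_lin[OF Y.d_Hom[of 0]]
      let ?z = "l 1 y \<oplus>\<^bsub>Y.T (Suc 0)\<^esub> \<ominus>\<^bsub>Y.T (Suc 0)\<^esub> q"
      have nq: "\<ominus>\<^bsub>Y.T (Suc 0)\<^esub> q \<in> carrier (Y.T (Suc 0))" using qc by simp
      have "Y.dif (Suc 0) ?z = \<zero>\<^bsub>Y.T 0\<^esub>"
        unfolding lin_add[OF dL ly nq] lin_neg[OF dL Y.T_group Y.T_group qc] q(2) ld[symmetric]
        using Y.d_closed[OF ly] by (rule Q.M.r_neg)
      hence "?z \<in> res_ker SS (proj_res A SS) (Suc 0)" unfolding res_ker_Suc using ly nq by simp
      hence "\<exists>v\<in>carrier (Y.T (Suc (Suc 0))). Y.dif (Suc (Suc 0)) v = ?z" by (rule Y.ker_d)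
      then obtain v where v: "v \<in> carrier (Y.T (Suc (Suc 0)))" "Y.dif (Suc (Suc 0)) v = ?z" by (rule bexE)
      have az: "a ?z = \<zero>\<^sub>S" using au(2)[OF v(1)] v(2) by simp
      have aq: "a q = \<zero>\<^sub>S" by (rule to_SS_radical[OF Y.T_gm aL q(1)])
      have "l 1 y = ?z \<oplus>\<^bsub>Y.T (Suc 0)\<^esub> q" using ly qc by (simp add: Q1.M.a_assoc Q1.M.l_neg)
      hence "a (l 1 y) = a ?z \<oplus>\<^bsub>SS\<^esub> a q" using lin_add[OF aL Q1.M.a_closed[OF ly nq] qc] by simp
      thus ?thesis using az aq y by simp
    qed
    show ?case
    proof (intro ballI impI)
      fix \<gamma> assume \<gamma>: "\<gamma> \<in> XY.Z (Suc n)" "s \<otimes>\<^bsub>XY.E (Suc n)\<^esub> t = XY.cl (Suc n) \<gamma>"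
      obtain f where f: "f \<in> XY.Z (Suc n)" "t = XY.cl (Suc n) f" using step(3) by (rule XY.E_cases)
      have f0: "f y = \<zero>\<^sub>S" using step(4) f by simp
      have "XY.cl (Suc n) \<gamma> = XY.cl (Suc n) (XY.plus (Suc n) ?w f)" using \<gamma>(2) XY.cl_plus[OF wZ f(1)] unfolding sw f(2) by (simp only:)
      thus "\<gamma> y = \<zero>\<^sub>S" by (rule rep[OF \<gamma>(1) XY.plus_Z[OF wZ f(1)]]) (simp only: restrict_apply' y w0 f0 SS.M.l_zero SS.M.zero_closed)
    qed
  qed
  thus ?thesis using \<gamma> by blast
qed

text \<open>By contradiction in one degree: a component z of \<open>x\<close> outside J K_n is
  separated from J K_n by a functional \<Phi> on K_n, and \<Phi> d is a cocycle on \<open>P\<close>.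
  Moved to \<open>proj_res\<close> and evaluated at y with d y = \<phi> z it vanishes, being
  cohomologous to a sum of products. This says that \<Phi> (\<psi> \<phi> z) = 0, and the homotopy
  turns it into \<Phi> z = 0.\<close>

lemma products_imp_QK:
  fixes M :: "('a, 'm) graded_module" and P :: "('a, 'm, 'p) resolution"
  assumes M: "ext_source A M" and P: "gp_resolution A M P" and nice: "\<And>n. nice (res_mod P n)"
    and prod: "\<And>n. carrier (Ext A (Suc n) M SS) \<subseteq> Ext_product A 1 n M SS SS"
  shows "QK M P"
  unfolding QK_def
proof (intro allI subsetI)
  interpret X: ext_source A M by (rule M)
  interpret P: gp_resolution A M P by (rule P)
  interpret ext_pair A M SS by (rule ext_pairI[OF M SS_gm])
  interpret SS: graded_module A SS by (rule SS_gm)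
  obtain \<phi> \<psi> h where c: "\<And>n. \<phi> n \<in> uHom A (P.T n) (X.T n)" "\<And>n. \<psi> n \<in> uHom A (X.T n) (P.T n)"
    "\<And>n x. x \<in> res_ker M P n \<Longrightarrow> \<phi> n x \<in> res_ker M (proj_res A M) n"
    "\<And>n x. x \<in> carrier (X.T (Suc n)) \<Longrightarrow> P.dif (Suc n) (\<psi> (Suc n) x) = \<psi> n (X.dif (Suc n) x)"
    "\<And>n. h n \<in> uHom A (P.T n) (P.T (Suc n))"
    "\<And>n x. x \<in> res_ker M P n \<Longrightarrow> \<psi> n (\<phi> n x) = x \<oplus>\<^bsub>P.T n\<^esub> P.dif (Suc n) (h n x)"
    by (rule comparison[OF P X.gp_resolution_axioms]) (rule that)
  fix n x assume "x \<in> res_ker M P n \<inter> act_prod (P.T n) JJ (carrier (P.T n))"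
  hence xK: "x \<in> res_ker M P n" and xJ: "x \<in> act_prod (P.T n) JJ (carrier (P.T n))" by simp_all
  let ?T = "P.T n" and ?U = "P.T (Suc n)" and ?K = "res_ker M P n"
  interpret T: graded_module A ?T by (rule P.T_gm)
  interpret U: graded_module A ?U by (rule P.T_gm)
  have Kg: "gsub ?T ?K" by (rule P.ker_gsub')
  have KJg: "gsub ?T (JX ?T ?K)" by (rule JX_gsub[OF P.T_gm Kg])
  have KJs: "JX ?T ?K \<subseteq> ?K" by (rule JX_sub[OF P.T_gm Kg])
  have KT: "gm (hsub ?T ?K)" by (rule hsub_gm(1)[OF P.T_gm Kg])
  have Kc: "?K \<subseteq> carrier ?T" by (rule res_ker_sub)
  \<comment> \<open>Separation works in a single degree, so \<open>x\<close> is treated one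
    component at a time.\<close>
  have comp_in: "cp ?T d x \<in> JX ?T ?K" for d
  proof (rule ccontr)
    assume not: "cp ?T d x \<notin> JX ?T ?K"
    define z where "z = cp ?T d x"
    have zK: "z \<in> ?K" unfolding z_def using Kg xK unfolding gsub_def by blast
    have zd: "z \<in> mdeg ?T d" unfolding z_def using T.hcomp_spec(1) xK Kc by blast
    have zJ: "z \<in> act_prod ?T JJ (carrier ?T)"
      unfolding z_def by (rule act_prod_cp[OF P.T_gm JJ_sub subset_refl JJ_cp T.hcomp_closed xJ])
    define V Q where "V = ?K \<inter> mdeg ?T d" and "Q = JX ?T ?K \<inter> mdeg ?T d"
    note deg = sub0_mdeg[OF P.T_gm[of n], of d]
    have V: "sub0 ?T V" unfolding V_def by (rule sub0_Int[OF gsub_sub0[OF P.T_gm Kg] deg])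
    have Q: "sub0 ?T Q" unfolding Q_def by (rule sub0_Int[OF gsub_sub0[OF P.T_gm KJg] deg])
    have QV: "Q \<subseteq> V" unfolding Q_def V_def using KJs by blast
    have "\<exists>vs. set vs \<subseteq> carrier ?T \<and> V = spanl ?T {\<zero>\<^bsub>?T\<^esub>} vs" by (rule nice_sub_fg[OF nice V, where d = d]) (simp add: V_def)
    then obtain vs where vs: "set vs \<subseteq> carrier ?T" "V = spanl ?T {\<zero>\<^bsub>?T\<^esub>} vs" by blast
    have JQ: "j \<odot>\<^bsub>?T\<^esub> v \<in> Q" if j: "j \<in> J0" and v: "v \<in> V" for j v
    proof -
      have "j \<in> Jr" using j Jr_A0 J0_A0 by blast
      hence "j \<odot>\<^bsub>?T\<^esub> v \<in> JX ?T ?K" using v unfolding V_def by (intro T.act_prod_prod[OF Jr_sub Kc]) simp_all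
      moreover have "j \<odot>\<^bsub>?T\<^esub> v \<in> mdeg ?T d" using smult_degree'[OF P.T_gm[of n] J0_A0[OF j], of v d] v unfolding V_def by simp
      ultimately show ?thesis unfolding Q_def by blast
    qed
    have zV: "z \<in> V" "z \<notin> Q" using zK zd not unfolding V_def Q_def z_def by simp_all
    have "\<exists>g. lin R0 (?T\<lparr>carrier := V\<rparr>) SS g \<and> (\<forall>y\<in>Q. g y = \<zero>\<^sub>S) \<and> g z \<noteq> \<zero>\<^sub>S"
      by (rule separate0[OF P.T_gm V Q QV vs(2,1) JQ zV])
    then obtain g where g: "lin R0 (?T\<lparr>carrier := V\<rparr>) SS g" "\<forall>y\<in>Q. g y = \<zero>\<^sub>S" "g z \<noteq> \<zero>\<^sub>S" by blast
    let ?\<Phi> = "\<lambda>y\<in>?K. g (cp ?T d y)"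
    have \<Phi>: "?\<Phi> \<in> homd (hsub ?T ?K) SS (- d)"
      by (rule graded_functional[OF P.T_gm Kg]) (use g(1,2) in \<open>simp_all add: V_def Q_def\<close>)
    note \<Phi>L = homd_lin[OF \<Phi>]
    have dK: "P.dif (Suc n) \<in> uHom A ?U (hsub ?T ?K)"
      by (rule uHom_restrict[OF P.T_gm P.T_gm Kg P.d_uHom P.d_ker])
    define \<gamma>' where "\<gamma>' = (\<lambda>y\<in>carrier ?U. ?\<Phi> (P.dif (Suc n) y))"
    have \<gamma>'u: "\<gamma>' \<in> uHom A ?U SS" unfolding \<gamma>'_def by (rule uHom_comp[OF P.T_gm KT SS_gm dK homd_uHom[OF KT SS_gm \<Phi>]])
    have \<Phi>0: "?\<Phi> \<zero>\<^bsub>?T\<^esub> = \<zero>\<^sub>S" using lin_zero[OF \<Phi>L gm_group[OF KT] SS_group] by (simp only: hsub_simps)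
    let ?\<gamma> = "\<lambda>y\<in>carrier (X.T (Suc n)). \<gamma>' (\<psi> (Suc n) y)"
    have \<psi>c: "\<psi> n u \<in> carrier (P.T n)" if "u \<in> carrier (X.T n)" for u n by (rule uHom_closed[OF X.T_gm P.T_gm c(2) that])
    have \<psi>0: "\<psi> n \<zero>\<^bsub>X.T n\<^esub> = \<zero>\<^bsub>P.T n\<^esub>" using uHom_0[OF X.T_gm P.T_gm c(2)] .
    have \<gamma>e: "?\<gamma> y = ?\<Phi> (\<psi> n (X.dif (Suc n) y))" if y: "y \<in> carrier (X.T (Suc n))" for y
      unfolding \<gamma>'_def restrict_apply'[OF y] restrict_apply'[OF \<psi>c[OF y]] c(4)[OF y] by (rule refl)
    have \<gamma>Z: "?\<gamma> \<in> Z (Suc n)"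
      unfolding Z_iff
    proof (intro conjI ballI)
      show "?\<gamma> \<in> uHom A (X.T (Suc n)) SS" by (rule uHom_comp[OF X.T_gm P.T_gm SS_gm c(2) \<gamma>'u])
      show "?\<gamma> (X.dif (Suc (Suc n)) y) = \<zero>\<^sub>S" if y: "y \<in> carrier (X.T (Suc (Suc n)))" for y
        unfolding \<gamma>e[OF X.d_closed[OF y]] X.dd[OF y] \<psi>0 by (rule \<Phi>0)
    qed
    have "cl (Suc n) ?\<gamma> \<in> Ext_product A 1 n M SS SS" using prod cl_closed[OF \<gamma>Z] by blast
    note van = products_vanish[OF M this \<gamma>Z refl]
    have zc: "z \<in> carrier ?T" using zK Kc by blast
    have "\<exists>y\<in>carrier (X.T (Suc n)). X.dif (Suc n) y = \<phi> n z" by (rule X.ker_d[OF c(3)[OF zK]])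
    then obtain y where y: "y \<in> carrier (X.T (Suc n))" "X.dif (Suc n) y = \<phi> n z" by (rule bexE)
    have "\<phi> n z \<in> act_prod (X.T n) JJ (carrier (X.T n))"
      by (rule uHom_act_prod[OF P.T_gm X.T_gm c(1) JJ_sub subset_refl subset_refl uHom_closed[OF P.T_gm X.T_gm c(1)] zJ])
    hence "?\<gamma> y = \<zero>\<^sub>S" using van[OF y(1)] unfolding y(2) JJX[OF X.T_gm] by blast
    hence 0: "?\<Phi> (\<psi> n (\<phi> n z)) = \<zero>\<^sub>S" unfolding \<gamma>e[OF y(1)] y(2) .
    let ?h = "h n z"
    have hJ: "?h \<in> act_prod ?U JJ (carrier ?U)"
      by (rule uHom_act_prod[OF P.T_gm P.T_gm c(5) JJ_sub subset_refl subset_refl uHom_closed[OF P.T_gm P.T_gm c(5)] zJ])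
    have hJ': "?h \<in> JX ?U (carrier ?U)" using hJ U.act_prod_mono[OF JJ_sub_Jr subset_refl Jr_sub subset_refl] by blast
    have hc: "?h \<in> carrier ?U" using hJ' U.act_prod_closed[OF Jr_sub subset_refl] by blast
    \<comment> \<open>The homotopy error d h z is harmless: h z lies in J P_(n+1), where every map
      to A/J vanishes.\<close>
    have "\<gamma>' ?h = \<zero>\<^sub>S" by (rule to_SS_radical[OF P.T_gm uHom_lin[OF P.T_gm SS_gm \<gamma>'u] hJ'])
    hence dh: "?\<Phi> (P.dif (Suc n) ?h) = \<zero>\<^sub>S" unfolding \<gamma>'_def restrict_apply'[OF hc] .
    have \<Phi>z: "?\<Phi> z = g z" using zK T.hcomp_hom[OF zd, of d] by simp
    have "?\<Phi> (z \<oplus>\<^bsub>?T\<^esub> P.dif (Suc n) ?h) = ?\<Phi> z \<oplus>\<^bsub>SS\<^esub> ?\<Phi> (P.dif (Suc n) ?h)"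
      using lin_add[OF \<Phi>L, of z "P.dif (Suc n) ?h"] zK P.d_ker[OF hc] by (simp only: hsub_simps)
    hence "\<zero>\<^sub>S = g z \<oplus>\<^bsub>SS\<^esub> \<zero>\<^sub>S" unfolding c(6)[OF zK, symmetric] 0 dh \<Phi>z .
    moreover have "g z \<in> carrier SS" using lin_closed[OF g(1)] zV(1) by simp
    ultimately have "g z = \<zero>\<^sub>S" by simp
    thus False using g(3) by blast
  qed
  have "x \<in> carrier ?T" using xK Kc by blast
  thus "x \<in> JX ?T ?K"
  proof (induction rule: T.homogeneous_induct)
    case zero
    show ?case by (rule T.act_prod_zero[OF Jr_sub Kc])
  next
    case (step i u y)
    show ?case using T.act_prod_add[OF Jr_sub Kc _ step(5)] comp_in[of i] unfolding step(4)[symmetric] by blast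
  qed
qed

section \<open>The equivalence for quasi-Koszul modules\<close>

lemma minimal_gp: "gm M \<Longrightarrow> minimal_resolution A M P \<Longrightarrow> gp_resolution A M P"
  unfolding minimal_resolution_def
  by (intro gp_resolution.intro gp_resolution_axioms.intro graded_ring_axioms) simp_all

text \<open>The inclusion by which the equality exceeds \<open>QK\<close> is automatic: K_n is
  contained in J P_n by minimality, so J K_n is contained in J (J P_n).\<close>

lemma minimal_quasi_Koszul_iff:
  assumes M: "gm M" and P: "minimal_resolution A M P"
  shows "(\<forall>n. JX (res_mod P n) (res_ker M P n) = res_ker M P n \<inter> act_prod (res_mod P n) JJ (carrier (res_mod P n))) \<longleftrightarrow> QK M P"
proof -
  interpret P: gp_resolution A M P by (rule minimal_gp[OF M P])
  have "JX (P.T n) (res_ker M P n) \<subseteq> res_ker M P n \<inter> act_prod (P.T n) JJ (carrier (P.T n))" for n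
  proof -
    interpret T: graded_module A "P.T n" by (rule P.T_gm)
    have "res_ker M P n \<subseteq> JX (P.T n) (carrier (P.T n))"
      using P P.im_ker[of n] unfolding minimal_resolution_def res_im_def by blast
    hence "JX (P.T n) (res_ker M P n) \<subseteq> JX (P.T n) (JX (P.T n) (carrier (P.T n)))"
      by (rule JX_mono[OF P.T_gm _ T.act_prod_closed[OF Jr_sub subset_refl]])
    thus ?thesis using JX_sub[OF P.T_gm P.ker_gsub'] unfolding JJX[OF P.T_gm] by blast
  qed
  thus ?thesis unfolding QK_def by blast
qed

text \<open>\<open>quasi_Koszul\<close> asks for some minimal resolution. By
  \<open>QK_independent\<close> the condition may be tested on the one built from covers, whose
  terms have the explicit form that the expansion into coordinates requires.\<close>

lemma quasi_Koszul_iff_products: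
  fixes M :: "('a, 'm) graded_module"
  assumes nice: "nice M"
  shows "quasi_Koszul A M \<longleftrightarrow> (\<forall>n>0. Ext_product A 1 (n - 1) M SS SS = carrier (Ext A n M SS))"
proof -
  have M: "gm M" using nice unfolding nice_def by blast
  have X: "ext_source A M" by (rule nice_ext_source[OF nice])
  obtain P :: "('a, 'm, ('a, 'm) res_elem) resolution"
    where P: "minimal_resolution A M P" "\<And>n. \<exists>K e d. basis_data K e d \<and> res_mod P n = fmod A K e d"
    by (rule minimal_resolution_exists[OF nice]) (rule that)
  have gP: "gp_resolution A M P" by (rule minimal_gp[OF M P(1)])
  have min: "res_ker M P n \<subseteq> JX (res_mod P n) (carrier (res_mod P n))" for n
    using P(1) gp_resolution.im_ker[OF gP, of n] unfolding minimal_resolution_def res_im_def by blast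
  have niceP: "nice (res_mod P n)" for n
  proof -
    obtain K :: "('m \<times> 'a \<times> nat) set" and e d where "basis_data K e d" "res_mod P n = fmod A K e d" using P(2)[of n] by blast
    thus ?thesis using basis_nice by simp
  qed
  interpret Y: yon A M SS SS by (rule yonI[OF X nice_ext_source[OF SS_nice] SS_gm])
  have sub: "Ext_product A 1 n M SS SS \<subseteq> carrier (Ext A (Suc n) M SS)" for n
    using Y.Ext_product_closed[where j = 1 and i = n] unfolding Suc_eq_plus1 .
  have "quasi_Koszul A M \<longleftrightarrow> QK M P"
  proof
    assume "QK M P"
    thus "quasi_Koszul A M" unfolding quasi_Koszul_def using P(1) minimal_quasi_Koszul_iff[OF M P(1)] by blast
  next
    assume "quasi_Koszul A M"
    then obtain P' :: "('a, 'm, ('a, 'm) res_elem) resolution" where P': "minimal_resolution A M P'" "QK M P'"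
      unfolding quasi_Koszul_def using minimal_quasi_Koszul_iff[OF M] by blast
    show "QK M P" by (rule QK_independent[OF gP minimal_gp[OF M P'(1)] P'(2)])
  qed
  also have "\<dots> \<longleftrightarrow> (\<forall>n. carrier (Ext A (Suc n) M SS) \<subseteq> Ext_product A 1 n M SS SS)"
    using QK_imp_products[OF X gP P(2) min] products_imp_QK[OF X gP niceP] by blast
  also have "\<dots> \<longleftrightarrow> (\<forall>n. Ext_product A 1 n M SS SS = carrier (Ext A (Suc n) M SS))" using sub by blast
  also have "\<dots> \<longleftrightarrow> (\<forall>n>0. Ext_product A 1 (n - 1) M SS SS = carrier (Ext A n M SS))"
    by (metis Suc_pred' diff_Suc_1 zero_less_Suc)
  finally show ?thesis .
qed

end

section \<open>The Ext ring\<close>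

lemma (in comm_monoid) finite_sums_finprod:
  assumes S: "S \<subseteq> carrier G" and "finite D" "\<And>k. k \<in> D \<Longrightarrow> f k \<in> finite_sums G S"
  shows "finprod G f D \<in> finite_sums G S"
  using assms(2,3)
proof (induction D rule: finite_induct)
  case (insert k D)
  have "f \<in> D \<rightarrow> carrier G" "f k \<in> carrier G" using insert.prems finite_sums_closed[OF S] by auto
  thus ?case using insert finite_sums_mult[OF S] by simp
qed (simp add: finite_sums_one)

lemma (in comm_group) finite_sums_inv:
  assumes S: "S \<subseteq> carrier G" and inv: "\<And>s. s \<in> S \<Longrightarrow> inv s \<in> S" and x: "x \<in> finite_sums G S"
  shows "inv x \<in> finite_sums G S"
  using x
proof (induction rule: finite_sums_induct[OF _ S, consumes 1, case_names one step])
  case (step s x)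
  hence "inv (s \<otimes> x) = inv s \<otimes> inv x" using S by (intro inv_mult) auto
  thus ?case using finite_sums_step[OF S inv[OF step(1)] step(4)] by simp
qed (simp add: finite_sums_one)

context ext_source begin

abbreviation "EG n \<equiv> Ext A n X X"
abbreviation one_EG ("\<one>\<^sub>E _" [1000] 1000) where "\<one>\<^sub>E n \<equiv> \<one>\<^bsub>EG n\<^esub>"
abbreviation "yn j i \<equiv> yoneda A j i X X X"
abbreviation "pr n \<equiv> {yn 1 n \<alpha> \<beta> | \<alpha> \<beta>. \<alpha> \<in> carrier (EG 1) \<and> \<beta> \<in> carrier (EG n)}"
abbreviation "EP n \<equiv> Ext_product A 1 n X X X"
abbreviation "XR \<equiv> Ext_ring A X"
abbreviation "ind n \<equiv> in_degree A X n"

interpretation EX: ext_pair A X X by (rule ext_pairI[OF ext_source_axioms M])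
interpretation I: yon A X X X by (rule yonI[OF ext_source_axioms ext_source_axioms M])

lemma Ex_group: "comm_group (EG n)" by (rule EX.E_group)

lemma Ex_one: "\<one>\<^sub>E n \<in> carrier (EG n)"
  using comm_group.axioms(1)[OF Ex_group, of n] by (simp add: comm_monoid_def monoid.one_closed)

lemma yo_closed: "\<lbrakk>\<alpha> \<in> carrier (EG j); \<beta> \<in> carrier (EG i); n = i + j\<rbrakk> \<Longrightarrow> yn j i \<alpha> \<beta> \<in> carrier (EG n)"
  using I.yoneda_closed by simp

lemma pr_closed: "pr n \<subseteq> carrier (EG (Suc n))"
  using yo_closed by force

lemma EP_sums: "EP n = finite_sums (EG (Suc n)) (pr n)"
  unfolding Ext_product_def Suc_eq_plus1 by (rule refl)

lemma EP_closed: "EP n \<subseteq> carrier (EG (Suc n))"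
  unfolding EP_sums by (rule comm_monoid.finite_sums_closed[OF comm_group.axioms(1)[OF Ex_group] pr_closed])

lemma EP_incl: "\<lbrakk>\<alpha> \<in> carrier (EG 1); \<beta> \<in> carrier (EG n)\<rbrakk> \<Longrightarrow> yn 1 n \<alpha> \<beta> \<in> EP n"
  unfolding EP_sums by (rule comm_monoid.finite_sums_incl[OF comm_group.axioms(1)[OF Ex_group] pr_closed]) blast

lemma EP_one: "\<one>\<^sub>E (Suc n) \<in> EP n"
  unfolding EP_sums by (rule comm_monoid.finite_sums_one[OF comm_group.axioms(1)[OF Ex_group]])

lemma EP_mult: "\<lbrakk>x \<in> EP n; y \<in> EP n\<rbrakk> \<Longrightarrow> x \<otimes>\<^bsub>EG (Suc n)\<^esub> y \<in> EP n"
  unfolding EP_sums by (rule comm_monoid.finite_sums_mult[OF comm_group.axioms(1)[OF Ex_group] pr_closed])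

lemma yo_inv:
  assumes "\<alpha> \<in> carrier (EG j)" "\<beta> \<in> carrier (EG i)"
  shows "yn j i (inv\<^bsub>EG j\<^esub> \<alpha>) \<beta> = inv\<^bsub>EG (i + j)\<^esub> yn j i \<alpha> \<beta>"
proof -
  interpret Ej: comm_group "EG j" by (rule Ex_group)
  interpret E: comm_group "EG (i + j)" by (rule Ex_group)
  have "yn j i (inv\<^bsub>EG j\<^esub> \<alpha>) \<beta> \<otimes>\<^bsub>EG (i + j)\<^esub> yn j i \<alpha> \<beta> = \<one>\<^sub>E (i + j)"
    using I.yoneda_add_left[of "inv\<^bsub>EG j\<^esub> \<alpha>" j \<alpha> \<beta> i] I.yoneda_zero_left[OF assms(2), of j] assms by simp
  thus ?thesis using E.inv_equality[symmetric] I.yoneda_closed assms by simp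
qed

lemma EP_inv: "x \<in> EP n \<Longrightarrow> inv\<^bsub>EG (Suc n)\<^esub> x \<in> EP n"
  unfolding EP_sums
proof (rule comm_group.finite_sums_inv[OF Ex_group pr_closed])
  interpret E1: comm_group "EG 1" by (rule Ex_group)
  fix s assume "s \<in> pr n"
  then obtain \<alpha> \<beta> where s: "s = yn 1 n \<alpha> \<beta>" "\<alpha> \<in> carrier (EG 1)" "\<beta> \<in> carrier (EG n)" by blast
  have "inv\<^bsub>EG (Suc n)\<^esub> s = yn 1 n (inv\<^bsub>EG 1\<^esub> \<alpha>) \<beta>" using yo_inv[OF s(2,3)] s(1) by simp
  thus "inv\<^bsub>EG (Suc n)\<^esub> s \<in> pr n" using E1.inv_closed[OF s(2)] s(3) by blast
qed

text \<open>By associativity a class of degree 0 is absorbed into the left factor of degree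
  1.\<close>

lemma EP_left:
  assumes \<alpha>: "\<alpha> \<in> carrier (EG 0)" and x: "x \<in> EP n"
  shows "yn 0 (Suc n) \<alpha> x \<in> EP n"
proof -
  interpret E: comm_group "EG (Suc n)" by (rule Ex_group)
  show ?thesis using x unfolding EP_sums
  proof (induction rule: E.finite_sums_induct[OF _ pr_closed, consumes 1, case_names one step])
    case one
    show ?case using I.yoneda_zero_right[OF \<alpha>, of "Suc n"] E.finite_sums_one by simp
  next
    case (step s x)
    obtain a b where s: "s = yn 1 n a b" "a \<in> carrier (EG 1)" "b \<in> carrier (EG n)" using step(1) by blast
    have sc: "s \<in> carrier (EG (Suc n))" using step(1) pr_closed by blast
    have "yn 0 (Suc n) \<alpha> s = yn 1 n (yn 0 1 \<alpha> a) b"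
      using yoneda_assoc[OF ext_source_axioms ext_source_axioms ext_source_axioms M \<alpha> s(2,3)] s(1) by simp
    moreover have "yn 0 1 \<alpha> a \<in> carrier (EG 1)" by (rule yo_closed[OF \<alpha> s(2)]) simp
    ultimately have sp: "yn 0 (Suc n) \<alpha> s \<in> pr n" using s(3) by blast
    have "yn 0 (Suc n) \<alpha> (s \<otimes>\<^bsub>EG (Suc n)\<^esub> x) = yn 0 (Suc n) \<alpha> s \<otimes>\<^bsub>EG (Suc n)\<^esub> yn 0 (Suc n) \<alpha> x"
      using I.yoneda_add_right[OF \<alpha> sc step(3)] by simp
    thus ?case using E.finite_sums_step[OF pr_closed sp step(4)] by simp
  qed
qed

text \<open>By associativity the class multiplied from the right is absorbed into the right factor,
  and the left factor of degree 1 stays.\<close>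

lemma EP_right:
  assumes \<beta>: "\<beta> \<in> carrier (EG i)" and x: "x \<in> EP m"
  shows "yn (Suc m) i x \<beta> \<in> EP (i + m)"
proof -
  interpret E: comm_group "EG (Suc m)" by (rule Ex_group)
  interpret E': comm_group "EG (Suc (i + m))" by (rule Ex_group)
  show ?thesis using x unfolding EP_sums
  proof (induction rule: E.finite_sums_induct[OF _ pr_closed, consumes 1, case_names one step])
    case one
    show ?case using I.yoneda_zero_left[OF \<beta>, of "Suc m"] E'.finite_sums_one by simp
  next
    case (step s x)
    obtain a b where s: "s = yn 1 m a b" "a \<in> carrier (EG 1)" "b \<in> carrier (EG m)" using step(1) by blast
    have sc: "s \<in> carrier (EG (Suc m))" using step(1) pr_closed by blast
    have "yn (Suc m) i s \<beta> = yn 1 (i + m) a (yn m i b \<beta>)"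
      using yoneda_assoc[OF ext_source_axioms ext_source_axioms ext_source_axioms M s(2,3) \<beta>] s(1) by simp
    moreover have "yn m i b \<beta> \<in> carrier (EG (i + m))" by (rule yo_closed[OF s(3) \<beta>]) simp
    ultimately have sp: "yn (Suc m) i s \<beta> \<in> pr (i + m)" using s(2) by blast
    have "yn (Suc m) i (s \<otimes>\<^bsub>EG (Suc m)\<^esub> x) \<beta> = yn (Suc m) i s \<beta> \<otimes>\<^bsub>EG (Suc (i + m))\<^esub> yn (Suc m) i x \<beta>"
      using I.yoneda_add_left[OF sc step(3) \<beta>] by simp
    thus ?case using E'.finite_sums_step[OF pr_closed sp step(4)] by simp
  qed
qed

lemma XR_carrier: "u \<in> carrier XR \<longleftrightarrow> (\<forall>n. u n \<in> carrier (EG n)) \<and> finite {n. u n \<noteq> \<one>\<^sub>E n}"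
  unfolding Ext_ring_def by simp

lemma XR_mult: "(u \<otimes>\<^bsub>XR\<^esub> v) n = finprod (EG n) (\<lambda>j. yn j (n - j) (u j) (v (n - j))) {..n}"
  unfolding Ext_ring_def by simp

lemma XR_add: "u \<oplus>\<^bsub>XR\<^esub> v = (\<lambda>n. u n \<otimes>\<^bsub>EG n\<^esub> v n)" and XR_zero: "\<zero>\<^bsub>XR\<^esub> = (\<lambda>n. \<one>\<^sub>E n)"
  unfolding Ext_ring_def by simp_all

lemma XR_one: "\<one>\<^bsub>XR\<^esub> n = (if n = 0 then ext_class A 0 X X aug else \<one>\<^sub>E n)"
  unfolding Ext_ring_def by simp

text \<open>\<open>generate_ring\<close> uses the negation of the record, a definite description; it
  is computed here directly from the group laws in each degree.\<close>

lemma XR_neg: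
  assumes u: "u \<in> carrier XR" shows "\<ominus>\<^bsub>XR\<^esub> u = (\<lambda>n. inv\<^bsub>EG n\<^esub> u n)" "(\<lambda>n. inv\<^bsub>EG n\<^esub> u n) \<in> carrier XR"
proof -
  have uc: "u n \<in> carrier (EG n)" for n using u unfolding XR_carrier by blast
  have gr: "group (EG n)" for n using Ex_group[of n] by (rule comm_group.axioms(2))
  have ic: "inv\<^bsub>EG n\<^esub> u n \<in> carrier (EG n)" for n by (rule group.inv_closed[OF gr uc])
  have "{n. inv\<^bsub>EG n\<^esub> u n \<noteq> \<one>\<^sub>E n} \<subseteq> {n. u n \<noteq> \<one>\<^sub>E n}"
    using group.is_monoid[OF gr] by (auto simp: monoid.inv_one)
  thus c: "(\<lambda>n. inv\<^bsub>EG n\<^esub> u n) \<in> carrier XR"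
    using u ic unfolding XR_carrier by (auto intro: finite_subset)
  have l: "u n \<otimes>\<^bsub>EG n\<^esub> inv\<^bsub>EG n\<^esub> u n = \<one>\<^sub>E n" "inv\<^bsub>EG n\<^esub> u n \<otimes>\<^bsub>EG n\<^esub> u n = \<one>\<^sub>E n" for n
    using group.r_inv[OF gr uc] group.l_inv[OF gr uc] .
  define w where "w = (\<lambda>n. inv\<^bsub>EG n\<^esub> u n)"
  have "\<ominus>\<^bsub>XR\<^esub> u = w"
    unfolding a_inv_def m_inv_def
  proof (rule the_equality)
    show "w \<in> carrier (add_monoid XR) \<and> u \<otimes>\<^bsub>add_monoid XR\<^esub> w = \<one>\<^bsub>add_monoid XR\<^esub> \<and>
      w \<otimes>\<^bsub>add_monoid XR\<^esub> u = \<one>\<^bsub>add_monoid XR\<^esub>"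
      using c by (simp add: XR_add XR_zero l w_def)
    fix y assume "y \<in> carrier (add_monoid XR) \<and> u \<otimes>\<^bsub>add_monoid XR\<^esub> y = \<one>\<^bsub>add_monoid XR\<^esub> \<and> y \<otimes>\<^bsub>add_monoid XR\<^esub> u = \<one>\<^bsub>add_monoid XR\<^esub>"
    hence y: "y \<in> carrier XR" "y \<oplus>\<^bsub>XR\<^esub> u = \<zero>\<^bsub>XR\<^esub>" by simp_all
    show "y = w"
    proof (rule ext)
      fix n
      have "y n \<otimes>\<^bsub>EG n\<^esub> u n = \<one>\<^sub>E n" using fun_cong[OF y(2), of n] unfolding XR_add XR_zero .
      moreover have "y n \<in> carrier (EG n)" using y(1) unfolding XR_carrier by blast
      ultimately show "y n = w n" unfolding w_def using group.inv_equality[OF gr _ uc] by metis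
    qed
  qed
  thus "\<ominus>\<^bsub>XR\<^esub> u = (\<lambda>n. inv\<^bsub>EG n\<^esub> u n)" unfolding w_def .
qed

lemma XR_term:
  assumes "u \<in> carrier XR" "v \<in> carrier XR" "j \<le> n"
  shows "yn j (n - j) (u j) (v (n - j)) \<in> carrier (EG n)"
  by (rule yo_closed) (use assms in \<open>simp_all add: XR_carrier\<close>)

lemma XR_closed:
  assumes u: "u \<in> carrier XR" and v: "v \<in> carrier XR"
  shows "u \<oplus>\<^bsub>XR\<^esub> v \<in> carrier XR" "u \<otimes>\<^bsub>XR\<^esub> v \<in> carrier XR"
proof -
  have uv: "u n \<in> carrier (EG n)" "v n \<in> carrier (EG n)" for n using u v unfolding XR_carrier by blast+
  have fin: "finite {n. u n \<noteq> \<one>\<^sub>E n}" "finite {n. v n \<noteq> \<one>\<^sub>E n}" using u v unfolding XR_carrier by blast+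
  have mo: "comm_monoid (EG n)" for n using Ex_group[of n] by (rule comm_group.axioms(1))
  note mo' = comm_monoid.axioms(1)[OF mo]
  show "u \<oplus>\<^bsub>XR\<^esub> v \<in> carrier XR"
    unfolding XR_carrier XR_add
  proof (intro conjI allI)
    show "u n \<otimes>\<^bsub>EG n\<^esub> v n \<in> carrier (EG n)" for n by (rule monoid.m_closed[OF mo' uv])
    have "{n. u n \<otimes>\<^bsub>EG n\<^esub> v n \<noteq> \<one>\<^sub>E n} \<subseteq> {n. u n \<noteq> \<one>\<^sub>E n} \<union> {n. v n \<noteq> \<one>\<^sub>E n}"
      using monoid.l_one[OF mo' Ex_one] by auto
    thus "finite {n. u n \<otimes>\<^bsub>EG n\<^esub> v n \<noteq> \<one>\<^sub>E n}" using fin by (auto intro: finite_subset)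
  qed
  \<comment> \<open>If the supports lie below \<open>a\<close> and \<open>b\<close>, then in degrees
    from \<open>a + b\<close> on one factor of every term is trivial.\<close>
  obtain a where a: "\<And>n. u n \<noteq> \<one>\<^sub>E n \<Longrightarrow> n < a" using fin(1) unfolding finite_nat_set_iff_bounded by blast
  obtain b where b: "\<And>n. v n \<noteq> \<one>\<^sub>E n \<Longrightarrow> n < b" using fin(2) unfolding finite_nat_set_iff_bounded by blast
  show "u \<otimes>\<^bsub>XR\<^esub> v \<in> carrier XR"
    unfolding XR_carrier
  proof (intro conjI allI)
    show "(u \<otimes>\<^bsub>XR\<^esub> v) n \<in> carrier (EG n)" for n
      unfolding XR_mult by (rule comm_monoid.finprod_closed[OF mo]) (use XR_term[OF u v] in auto)
    have "(u \<otimes>\<^bsub>XR\<^esub> v) n = \<one>\<^sub>E n" if n: "a + b \<le> n" for n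
      unfolding XR_mult
    proof (rule comm_monoid.finprod_one_eqI[OF mo])
      fix j assume "j \<in> {..n}"
      hence j: "n - j + j = n" by simp
      show "yn j (n - j) (u j) (v (n - j)) = \<one>\<^sub>E n"
      proof (cases "j < a")
        case True
        hence "\<not> n - j < b" using n by simp
        hence "v (n - j) = \<one>\<^sub>E (n - j)" using b by blast
        thus ?thesis using I.yoneda_zero_right[OF uv(1)[of j], of "n - j"] j by simp
      next
        case False
        hence "u j = \<one>\<^sub>E j" using a by blast
        thus ?thesis using I.yoneda_zero_left[OF uv(2)[of "n - j"], of j] j by simp
      qed
    qed
    hence "{n. (u \<otimes>\<^bsub>XR\<^esub> v) n \<noteq> \<one>\<^sub>E n} \<subseteq> {..<a + b}" by (auto simp: not_le[symmetric])
    thus "finite {n. (u \<otimes>\<^bsub>XR\<^esub> v) n \<noteq> \<one>\<^sub>E n}" by (rule finite_subset) simp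
  qed
qed

lemma deg_simps: "ind n \<alpha> n = \<alpha>" "m \<noteq> n \<Longrightarrow> ind n \<alpha> m = \<one>\<^sub>E m"
  unfolding in_degree_def by simp_all

lemma deg_XR: "\<alpha> \<in> carrier (EG n) \<Longrightarrow> ind n \<alpha> \<in> carrier XR"
  unfolding XR_carrier using Ex_one by (auto simp: in_degree_def intro: finite_subset[of _ "{n}"])

lemma deg_one: "ind n \<one>\<^sub>E n = \<zero>\<^bsub>XR\<^esub>"
  unfolding XR_zero in_degree_def by (rule ext) simp

lemma deg_add: "ind n (\<alpha> \<otimes>\<^bsub>EG n\<^esub> \<beta>) = ind n \<alpha> \<oplus>\<^bsub>XR\<^esub> ind n \<beta>"
proof (rule ext)
  fix m
  interpret E: comm_group "EG m" by (rule Ex_group)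
  show "ind n (\<alpha> \<otimes>\<^bsub>EG n\<^esub> \<beta>) m = (ind n \<alpha> \<oplus>\<^bsub>XR\<^esub> ind n \<beta>) m" unfolding XR_add in_degree_def by simp
qed

lemma deg_mult:
  assumes \<alpha>: "\<alpha> \<in> carrier (EG a)" and \<beta>: "\<beta> \<in> carrier (EG b)"
  shows "ind a \<alpha> \<otimes>\<^bsub>XR\<^esub> ind b \<beta> = ind (b + a) (yn a b \<alpha> \<beta>)"
proof (rule ext)
  fix n
  interpret E: comm_group "EG n" by (rule Ex_group)
  note XR = deg_XR[OF \<alpha>] deg_XR[OF \<beta>]
  have c: "ind m \<gamma> k \<in> carrier (EG k)" if "\<gamma> \<in> carrier (EG m)" for m k \<gamma> using deg_XR[OF that] unfolding XR_carrier by blast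
  let ?f = "\<lambda>j. yn j (n - j) (ind a \<alpha> j) (ind b \<beta> (n - j))"
  have one: "?f j = \<one>\<^sub>E n" if j: "j \<le> n" and ne: "\<not> (j = a \<and> n = b + a)" for j
  proof (cases "j = a")
    case True
    hence "ind b \<beta> (n - j) = \<one>\<^sub>E (n - j)" using ne j by (intro deg_simps(2)) auto
    thus ?thesis using I.yoneda_zero_right[OF c[OF \<alpha>, of j], where i = "n - j"] j by simp
  next
    case False
    thus ?thesis using I.yoneda_zero_left[OF c[OF \<beta>, of "n - j"], where j = j] j deg_simps(2)[OF False] by simp
  qed
  show "(ind a \<alpha> \<otimes>\<^bsub>XR\<^esub> ind b \<beta>) n = ind (b + a) (yn a b \<alpha> \<beta>) n"
  proof (cases "n = b + a")
    case True
    have aa: "?f a \<in> carrier (EG n)" using XR_term[OF XR, of a "b + a"] True by simp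
    have "finprod (EG n) ?f {..n} = finprod (EG n) ?f {a}"
      by (rule E.finprod_mono_neutral_cong_right) (use True one XR_term[OF XR] in auto)
    also have "finprod (EG n) ?f {a} = ?f a" using E.finprod_insert[of "{}" a ?f] aa by simp
    also have "\<dots> = yn a b \<alpha> \<beta>" using True deg_simps by simp
    finally show ?thesis unfolding XR_mult using True deg_simps by simp
  next
    case False
    thus ?thesis unfolding XR_mult deg_simps(2)[OF False] by (intro E.finprod_one_eqI one) auto
  qed
qed

abbreviation "XG \<equiv> hom_to_Ext A X ` uHom A X X \<union> ind 1 ` carrier (EG 1)"

lemma hom_class: "h \<in> uHom A X X \<Longrightarrow> ext_class A 0 X X (compose (carrier (T 0)) h aug) \<in> carrier (EG 0)"
proof (rule EX.cl_closed)
  assume h: "h \<in> uHom A X X"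
  interpret X: graded_module A X by (rule M)
  show "compose (carrier (T 0)) h aug \<in> EX.Z 0"
    unfolding EX.Z_iff compose_def
  proof (intro conjI ballI)
    show "(\<lambda>x\<in>carrier (T 0). h (aug x)) \<in> uHom A (T 0) X" by (rule uHom_comp[OF T_gm M M aug_uHom h])
    show "(\<lambda>x\<in>carrier (T 0). h (aug x)) (dif (Suc 0) x) = \<zero>\<^bsub>X\<^esub>" if x: "x \<in> carrier (T (Suc 0))" for x
      using d_closed[OF x] aug_d[OF x] uHom_0[OF M M h] by simp
  qed
qed

text \<open>The invariant kept by all ring operations: components of positive degree are sums of
  products with a left factor of degree 1. In a product, the term with \<open>j = 0\<close> is
  covered by \<open>EP_left\<close>, all others by \<open>EP_right\<close>.\<close>

lemma generated_products:
  assumes u: "u \<in> generate_ring XR XG"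
  shows "u \<in> carrier XR \<and> (\<forall>n. u (Suc n) \<in> EP n)"
  using u
proof (induction rule: generate_ring.induct)
  case one
  have "ext_class A 0 X X aug \<in> carrier (EG 0)" by (rule EX.cl_closed[OF aug_cocycle])
  thus ?case unfolding XR_carrier XR_one using Ex_one EP_one by (auto intro: finite_subset[of _ "{0}"])
next
  case (incl h)
  thus ?case
  proof
    assume "h \<in> hom_to_Ext A X ` uHom A X X"
    then obtain f where f: "h = hom_to_Ext A X f" "f \<in> uHom A X X" by (rule imageE)
    show ?thesis unfolding f(1) hom_to_Ext_def using deg_XR[OF hom_class[OF f(2)]] EP_one deg_simps(2)[of "Suc _" 0] by simp
  next
    assume "h \<in> ind 1 ` carrier (EG 1)"
    then obtain \<alpha> where \<alpha>: "h = ind 1 \<alpha>" "\<alpha> \<in> carrier (EG 1)" by (rule imageE)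
    \<comment> \<open>A class of degree 1 is itself such a product, with the identity class on the
      right.\<close>
    have "yn 1 0 \<alpha> (ext_class A 0 X X aug) = \<alpha>" by (rule yoneda_one_right[OF ext_source_axioms M \<alpha>(2)])
    hence "\<alpha> \<in> EP 0" using EP_incl[OF \<alpha>(2) EX.cl_closed[OF aug_cocycle]] by simp
    hence "ind 1 \<alpha> (Suc n) \<in> EP n" for n
      using EP_one[of n] by (cases n) (simp_all add: in_degree_def)
    thus ?thesis unfolding \<alpha>(1) using deg_XR[OF \<alpha>(2)] by blast
  qed
next
  case (a_inv h)
  thus ?case using XR_neg EP_inv by simp
next
  case (eng_add u v)
  thus ?case using XR_closed(1) EP_mult by (simp add: XR_add)
next
  case (eng_mult u v)
  have uc: "u \<in> carrier XR" and vc: "v \<in> carrier XR" and uE: "\<And>n. u (Suc n) \<in> EP n" and vE: "\<And>n. v (Suc n) \<in> EP n"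
    using eng_mult.IH by blast+
  have "(u \<otimes>\<^bsub>XR\<^esub> v) (Suc n) \<in> EP n" for n
    unfolding XR_mult EP_sums
  proof (rule comm_monoid.finite_sums_finprod[OF comm_group.axioms(1)[OF Ex_group] pr_closed])
    fix j assume j: "j \<in> {..Suc n}"
    show "yn j (Suc n - j) (u j) (v (Suc n - j)) \<in> finite_sums (EG (Suc n)) (pr n)"
    proof (cases j)
      case 0
      have "u 0 \<in> carrier (EG 0)" using uc unfolding XR_carrier by blast
      thus ?thesis using EP_left[OF _ vE, of "u 0" n] unfolding 0 EP_sums by simp
    next
      case (Suc m)
      have v': "v (n - m) \<in> carrier (EG (n - m))" using vc unfolding XR_carrier by blast
      have "n - m + m = n" "Suc n - Suc m = n - m" using j Suc by auto
      thus ?thesis using EP_right[OF v' uE, of m] unfolding Suc EP_sums by simp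
    qed
  qed simp
  thus ?case using XR_closed(2)[OF uc vc] by blast
qed

text \<open>A cocycle of degree \<open>0\<close> kills the kernel of the augmentation, hence factors through it; to see
  that the factor lies in \<^const>\<open>uHom\<close>, this is done for one homogeneous component at a time.\<close>

lemma cocycle_0_factor:
  assumes f: "f \<in> cocycles A 0 X X"
  shows "\<exists>h\<in>uHom A X X. compose (carrier (T 0)) h aug = f"
proof -
  interpret X: graded_module A X by (rule M)
  interpret T: graded_module A "T 0" by (rule T_gm)
  note fu = EX.Z_uHom[OF f]
  obtain D k where D: "finite D" "\<And>m. m \<in> D \<Longrightarrow> k m \<in> homd (T 0) X m" "f = (\<lambda>x\<in>carrier (T 0). \<Oplus>\<^bsub>X\<^esub> m\<in>D. k m x)"
    "\<And>m i x. \<lbrakk>m \<in> D; x \<in> mdeg (T 0) i\<rbrakk> \<Longrightarrow> k m x = cp X (i + m) (f x)"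
    by (rule uHom_decomp[OF T_gm M fu]) (rule that)
  note aL = Hom_lin[OF aug_Hom]
  \<comment> \<open>A set-theoretic section of the augmentation. Each \<open>k m\<close> kills the
    kernel, so its value at the chosen preimage does not depend on the choice.\<close>
  define s where "s y = (SOME x. x \<in> carrier (T 0) \<and> aug x = y)" for y
  have s: "s y \<in> carrier (T 0)" "aug (s y) = y" if y: "y \<in> carrier X" for y
  proof -
    have "\<exists>x. x \<in> carrier (T 0) \<and> aug x = y" using y unfolding aug_sur[symmetric] by blast
    hence "s y \<in> carrier (T 0) \<and> aug (s y) = y" unfolding s_def by (rule someI_ex)
    thus "s y \<in> carrier (T 0)" "aug (s y) = y" by blast+
  qed
  have k0: "k m x = \<zero>\<^bsub>X\<^esub>" if m: "m \<in> D" and x: "x \<in> carrier (T 0)" "aug x = \<zero>\<^bsub>X\<^esub>" for m x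
  proof -
    have gx: "aug (cp (T 0) i x) = \<zero>\<^bsub>X\<^esub>" for i using Hom_cp[OF T_gm M aug_Hom x(1), of i] x(2) by simp
    have fz: "f (cp (T 0) i x) = \<zero>\<^bsub>X\<^esub>" for i
    proof -
      have "cp (T 0) i x \<in> res_ker X (proj_res A X) 0" unfolding res_ker_0 using gx T.hcomp_closed[OF x(1)] by simp
      then obtain y where "y \<in> carrier (T (Suc 0))" "dif (Suc 0) y = cp (T 0) i x" using ker_d by blast
      thus ?thesis using EX.Z_d[OF f] by metis
    qed
    have "k m (cp (T 0) i x) = \<zero>\<^bsub>X\<^esub>" for i using D(4)[OF m T.hcomp_spec(1)[OF x(1)]] fz by simp
    hence "cp X j (k m x) = \<zero>\<^bsub>X\<^esub>" for j using homd_cp[OF T_gm M D(2)[OF m] x(1)] by simp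
    thus ?thesis by (rule X.hcomp_eq_zero[OF lin_closed[OF homd_lin[OF D(2)[OF m]] x(1)]])
  qed
  have ks: "k m (s (aug x)) = k m x" if m: "m \<in> D" and x: "x \<in> carrier (T 0)" for m x
  proof -
    note sx = s[OF aug_closed[OF x]]
    note kL = homd_lin[OF D(2)[OF m]]
    have nx: "\<ominus>\<^bsub>T 0\<^esub> x \<in> carrier (T 0)" using x by simp
    have "aug (s (aug x) \<oplus>\<^bsub>T 0\<^esub> \<ominus>\<^bsub>T 0\<^esub> x) = \<zero>\<^bsub>X\<^esub>"
      unfolding lin_add[OF aL sx(1) nx] lin_neg[OF aL T_group gm_group[OF M] x] sx(2) by (rule X.M.r_neg[OF aug_closed[OF x]])
    hence "k m (s (aug x) \<oplus>\<^bsub>T 0\<^esub> \<ominus>\<^bsub>T 0\<^esub> x) = \<zero>\<^bsub>X\<^esub>" using k0[OF m] sx(1) nx by simp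
    moreover have "s (aug x) = (s (aug x) \<oplus>\<^bsub>T 0\<^esub> \<ominus>\<^bsub>T 0\<^esub> x) \<oplus>\<^bsub>T 0\<^esub> x" using sx(1) x by (simp add: T.M.a_assoc T.M.l_neg)
    ultimately show ?thesis using lin_add[OF kL T.M.a_closed[OF sx(1) nx] x] lin_closed[OF kL x] by simp
  qed
  have h: "(\<lambda>y\<in>carrier X. k m (s y)) \<in> homd X X m" if m: "m \<in> D" for m
  proof (rule homdI[OF M])
    note kL = homd_lin[OF D(2)[OF m]]
    show "lin A X X (\<lambda>y. k m (s y))"
    proof (rule linI)
      show "k m (s y) \<in> carrier X" if "y \<in> carrier X" for y by (rule lin_closed[OF kL s(1)[OF that]])
      show "k m (s (y \<oplus>\<^bsub>X\<^esub> z)) = k m (s y) \<oplus>\<^bsub>X\<^esub> k m (s z)" if y: "y \<in> carrier X" and z: "z \<in> carrier X" for y z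
        using ks[OF m T.M.a_closed[OF s(1)[OF y] s(1)[OF z]]] lin_add[OF aL s(1)[OF y] s(1)[OF z]] lin_add[OF kL s(1)[OF y] s(1)[OF z]] s(2)[OF y] s(2)[OF z] by simp
      show "k m (s (a \<odot>\<^bsub>X\<^esub> y)) = a \<odot>\<^bsub>X\<^esub> k m (s y)" if a: "a \<in> carrier A" and y: "y \<in> carrier X" for a y
        using ks[OF m T.smult_closed[OF a s(1)[OF y]]] lin_smult[OF aL a s(1)[OF y]] lin_smult[OF kL a s(1)[OF y]] s(2)[OF y] by simp
    qed
    show "k m (s y) \<in> mdeg X (i + m)" if y: "y \<in> mdeg X i" for i y
    proof -
      have yc: "y \<in> carrier X" by (rule X.V_closed[OF y])
      have "aug (cp (T 0) i (s y)) = y" using Hom_cp[OF T_gm M aug_Hom s(1)[OF yc], of i] X.hcomp_hom[OF y, of i] s(2)[OF yc] by simp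
      hence "k m (s y) = k m (cp (T 0) i (s y))" using ks[OF m T.hcomp_closed[OF s(1)[OF yc], of i]] by simp
      thus ?thesis using homd_deg[OF D(2)[OF m] T.hcomp_spec(1)[OF s(1)[OF yc]]] by simp
    qed
  qed
  let ?H = "\<lambda>m. \<lambda>y\<in>carrier X. k m (s y)"
  let ?h = "\<lambda>y\<in>carrier X. \<Oplus>\<^bsub>X\<^esub>m\<in>D. ?H m y"
  have "?h \<in> uHom A X X"
    unfolding uHom_def
  proof (rule CollectI, rule exI[of _ D], rule exI[of _ ?H], intro conjI ballI)
    show "?H m \<in> homd X X m" if "m \<in> D" for m by (rule h[OF that])
  qed (rule D(1), rule refl)
  moreover have "compose (carrier (T 0)) ?h aug = f"
    unfolding compose_def
  proof (subst D(3), rule restrict_ext)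
    fix x assume x: "x \<in> carrier (T 0)"
    have "?h (aug x) = (\<Oplus>\<^bsub>X\<^esub>m\<in>D. k m (s (aug x)))" using aug_closed[OF x] by simp
    also have "\<dots> = (\<Oplus>\<^bsub>X\<^esub>m\<in>D. k m x)"
      by (rule X.M.finsum_cong') (use ks[OF _ x] lin_closed[OF homd_lin[OF D(2)] x] in auto)
    finally show "?h (aug x) = (\<Oplus>\<^bsub>X\<^esub>m\<in>D. k m x)" .
  qed
  ultimately show ?thesis by blast
qed

text \<open>Homogeneous elements are generated by induction on the degree, those of degree 0 being
  endomorphisms of \<open>X\<close> by \<open>cocycle_0_factor\<close>; an arbitrary element is the
  sum of its finitely many components.\<close>

lemma products_generated:
  assumes EP: "\<And>n. carrier (EG (Suc n)) \<subseteq> EP n"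
  shows "carrier XR \<subseteq> generate_ring XR XG"
proof -
  let ?G = "generate_ring XR XG"
  have g1: "ind 1 \<alpha> \<in> ?G" if "\<alpha> \<in> carrier (EG 1)" for \<alpha> using that by (intro generate_ring.incl) blast
  \<comment> \<open>Zero is obtained as the trivial class placed in degree 1, since
    \<open>generate_ring\<close> is not closed under it by definition.\<close>
  have zero: "\<zero>\<^bsub>XR\<^esub> \<in> ?G" using g1[OF Ex_one] unfolding deg_one .
  have g: "\<forall>\<alpha>\<in>carrier (EG n). ind n \<alpha> \<in> ?G" for n
  proof (induction n)
    case 0
    show ?case
    proof
      fix \<alpha> assume "\<alpha> \<in> carrier (EG 0)"
      then obtain f where f: "f \<in> EX.Z 0" "\<alpha> = EX.cl 0 f" by (rule EX.E_cases)
      obtain h where h: "h \<in> uHom A X X" "compose (carrier (T 0)) h aug = f" using cocycle_0_factor[OF f(1)] by (rule bexE)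
      have "ind 0 \<alpha> = hom_to_Ext A X h" unfolding hom_to_Ext_def h(2) f(2) by (rule refl)
      thus "ind 0 \<alpha> \<in> ?G" using h(1) by (intro generate_ring.incl) simp
    qed
  next
    case (Suc n)
    show ?case
    proof
      interpret E: comm_group "EG (Suc n)" by (rule Ex_group)
      fix \<alpha> assume "\<alpha> \<in> carrier (EG (Suc n))"
      hence "\<alpha> \<in> finite_sums (EG (Suc n)) (pr n)" using EP[of n] unfolding EP_sums by blast
      thus "ind (Suc n) \<alpha> \<in> ?G"
      proof (induction rule: E.finite_sums_induct[OF _ pr_closed, consumes 1, case_names one step])
        case one
        show ?case unfolding deg_one by (rule zero)
      next
        case (step s x)
        obtain a b where s: "s = yn 1 n a b" "a \<in> carrier (EG 1)" "b \<in> carrier (EG n)" using step(1) by blast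
        have "ind (Suc n) s = ind 1 a \<otimes>\<^bsub>XR\<^esub> ind n b" using deg_mult[OF s(2,3)] s(1) by simp
        hence "ind (Suc n) s \<in> ?G" using generate_ring.eng_mult[OF g1[OF s(2)]] Suc s(3) by simp
        thus ?case unfolding deg_add using step(4) by (rule generate_ring.eng_add)
      qed
    qed
  qed
  \<comment> \<open>Induction on a bound for the support, splitting off the top component
    \<open>u N\<close>.\<close>
  have "\<forall>u\<in>carrier XR. (\<forall>n\<ge>N. u n = \<one>\<^sub>E n) \<longrightarrow> u \<in> ?G" for N
  proof (induction N)
    case 0
    have "u = \<zero>\<^bsub>XR\<^esub>" if "\<forall>n\<ge>0. u n = \<one>\<^sub>E n" for u using that unfolding XR_zero by auto
    thus ?case using zero by blast
  next
    case (Suc N)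
    show ?case
    proof (intro ballI impI)
      fix u assume u: "u \<in> carrier XR" and N: "\<forall>n\<ge>Suc N. u n = \<one>\<^sub>E n"
      have uc: "u n \<in> carrier (EG n)" for n using u unfolding XR_carrier by blast
      let ?v = "u(N := \<one>\<^bsub>EG N\<^esub>)"
      have "?v \<in> carrier XR"
        unfolding XR_carrier
      proof (intro conjI allI)
        show "?v n \<in> carrier (EG n)" for n using uc Ex_one by simp
        have "{n. ?v n \<noteq> \<one>\<^sub>E n} \<subseteq> {n. u n \<noteq> \<one>\<^sub>E n}" by auto
        thus "finite {n. ?v n \<noteq> \<one>\<^sub>E n}" by (rule finite_subset) (use u in \<open>simp add: XR_carrier\<close>)
      qed
      moreover have "\<forall>n\<ge>N. ?v n = \<one>\<^sub>E n" 
      proof (intro allI impI)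
        show "?v n = \<one>\<^sub>E n" if "N \<le> n" for n using N that by (cases "n = N") simp_all
      qed
      ultimately have vG: "?v \<in> ?G" using Suc by blast
      have "u = ind N (u N) \<oplus>\<^bsub>XR\<^esub> ?v"
      proof (rule ext)
        fix n
        interpret E: comm_group "EG n" by (rule Ex_group)
        show "u n = (ind N (u N) \<oplus>\<^bsub>XR\<^esub> ?v) n"
          using E.r_one[OF uc] E.l_one[OF uc] unfolding XR_add by (cases "n = N") (simp_all add: deg_simps)
      qed
      thus "u \<in> ?G" using generate_ring.eng_add[OF bspec[OF g uc] vG] by metis
    qed
  qed
  hence *: "u \<in> ?G" if "u \<in> carrier XR" "\<And>n. n \<ge> N \<Longrightarrow> u n = \<one>\<^sub>E n" for u N using that by blast
  show ?thesis
  proof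
    fix u assume u: "u \<in> carrier XR"
    then obtain N where "\<And>n. u n \<noteq> \<one>\<^sub>E n \<Longrightarrow> n < N" unfolding XR_carrier finite_nat_set_iff_bounded by blast
    thus "u \<in> ?G" using *[OF u, of N] by (meson not_le)
  qed
qed

lemma Ext_generated_iff_products:
  "Ext_generated_in_degree_one A X \<longleftrightarrow> (\<forall>n>0. EP (n - 1) = carrier (EG n))"
proof -
  have "Ext_generated_in_degree_one A X \<longleftrightarrow> carrier XR \<subseteq> generate_ring XR XG"
    unfolding Ext_generated_in_degree_one_def using generated_products by blast
  also have "\<dots> \<longleftrightarrow> (\<forall>n. carrier (EG (Suc n)) \<subseteq> EP n)"
  proof (intro iffI allI subsetI)
    fix n \<alpha> assume G: "carrier XR \<subseteq> generate_ring XR XG" and \<alpha>: "\<alpha> \<in> carrier (EG (Suc n))"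
    have "ind (Suc n) \<alpha> (Suc n) \<in> EP n" using generated_products subsetD[OF G deg_XR[OF \<alpha>]] by blast
    thus "\<alpha> \<in> EP n" unfolding deg_simps(1) .
  qed (use products_generated in blast)
  also have "\<dots> \<longleftrightarrow> (\<forall>n>0. EP (n - 1) = carrier (EG n))"
    using EP_closed by (metis Suc_pred' diff_Suc_1 subset_antisym subset_refl zero_less_Suc)
  finally show ?thesis .
qed

end

theorem theorem1p1:
  fixes A :: "'a graded_ring"
  assumes "graded_ring A"
    and "left_finite_ring A"
    and "generated_in_degree_one A"
    and "left_noetherian (degree_zero A)"
    and "semiperfect_ring (degree_zero A)"
  shows "(\<forall>M :: ('a, 'm) graded_module.
           graded_module A M \<and> left_finite A M \<and> bounded_below M \<longrightarrow>
           (quasi_Koszul A M \<longleftrightarrow>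
             (\<forall>n>0. Ext_product A 1 (n - 1) M (mod_radical A) (mod_radical A) =
               carrier (Ext A n M (mod_radical A)))))
       \<and> (quasi_Koszul_ring A \<longleftrightarrow> Ext_generated_in_degree_one A (mod_radical A))"
proof -
  interpret gsp A by (intro gsp.intro gsp_axioms.intro assms)
  show ?thesis
  proof (intro conjI allI impI)
    fix M :: "('a, 'm) graded_module"
    assume M: "graded_module A M \<and> left_finite A M \<and> bounded_below M"
    have "nice M" by (rule nice_left_finite) (use M in blast)+
    thus "quasi_Koszul A M \<longleftrightarrow> (\<forall>n>0. Ext_product A 1 (n - 1) M SS SS = carrier (Ext A n M SS))"
      by (rule quasi_Koszul_iff_products)
  next
    show "quasi_Koszul_ring A \<longleftrightarrow> Ext_generated_in_degree_one A SS"
      unfolding quasi_Koszul_ring_def quasi_Koszul_iff_products[OF SS_nice]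
        ext_source.Ext_generated_iff_products[OF nice_ext_source[OF SS_nice]] by (rule refl)
  qed
qed

end
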